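(* Let $G$ be one of $\mathrm{GL}_n$, $\mathrm{SO}_{2n}$, $\mathrm{SO}_{2n+1}$, $\mathrm{Sp}_{2n}$ over an algebraically closed field of characteristic $p\ge 0$, excluding $\mathrm{SO}_{2n+1}$ when $p=2$. Let $P$ be a parabolic subgroup of $G$ with Levi partition $\Lambda$, and let $\lambda$ be the partition of Jordan block sizes (on the natural module) of the Richardson class of $P$. Then $\lambda=\psi(\Lambda)^*$.
   Context: Richardson class: for a parabolic subgroup $P$ of a connected reductive group $G$ with unipotent radical $Q$, there is a unique unipotent $G$-class $C$ with $C\cap Q$ open and dense in $Q$; $C$ is the Richardson class of $P$, and $C\cap Q$ (a single $P$-class) is the Richardson orbit in $Q$. Partitions: weakly decreasing sequences of positive integers (padded with zeros); $(1^{c(1)},2^{c(2)},\dots)$ denotes the partition in which $x$ occurs $c(x)$ times. The dual $\lambda^*$ of $\lambda$ has parts $\lambda^*_i=\#\{j:\lambda_j\ge i\}$. Levi partition: for $G\in\{\mathrm{SO}_{2n},\mathrm{SO}_{2n+1},\mathrm{Sp}_{2n}\}$ fix a base $\Delta=\{\alpha_1,\dots,\alpha_n\}$ labelled as in Bourbaki, and let $P$ be conjugate to the standard parabolic for $J\subseteq\Delta$. If $\alpha_n\in J$, let $m$ be the largest integer with $\alpha_{n-m+1},\dots,\alpha_n\in J$; then a Levi factor is $L=\mathrm{GL}_{n_1}\cdots\mathrm{GL}_{n_s}\mathrm{Cl}_m$ with $\mathrm{Cl}_m$ the classical group of the same type of rank $m$. If $\alpha_n\notin J$, or $G=\mathrm{GL}_n$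 (where $L=\mathrm{GL}_{n_1}\cdots\mathrm{GL}_{n_s}$), put $m=0$. Then $n=n_1+\dots+n_s+m$ and the Levi partition is $\Lambda=(n_1,\dots,n_s)\oplus m=(1^{c(1)},2^{c(2)},\dots)\oplus m$, where $c(x)$ is the number of $i$ with $n_i=x$. The map $\psi$: $\psi(\Lambda)$ is the partition formed by the union of the parts of $\psi(m)$ and of $\psi(j^{c(j)})$ over all $j$ with $c(j)\ge1$ (zero parts discarded), where: - $G=\mathrm{GL}_n$: $\psi(\Lambda)=(n_1,\dots,n_s)$. - $G=\mathrm{SO}_{2n}$, $p\ne2$: $\psi(m)=2m$; $\psi(j^{c})=j^{2c}$ if $j$ is even or $j\le 2m$; $\psi(j^c)=(j+1,j^{2c-2},j-1)$ if $j$ is odd and $j>2m$. - $G=\mathrm{SO}_{2n}$, $p=2$: $\psi(m)=2m$; $\psi(j^c)=j^{2c}$ if $j$ even; $(j+1,j^{2c-2},j-1)$ if $j$ odd and $j\le 2m$; $(j+1,j-1)$ if $j$ odd, $j>2m$, $c=1$; $((j+1)^2,j^{2c-4},(j-1)^2)$ if $j$ odd, $j>2m$, $c\ge2$. - $G=\mathrm{SO}_{2n+1}$, $p\ne2$: $\psi(m)=2m+1$; $\psi(j^c)=j^{2c}$ if $j$ is odd or $j\le 2m+1$; $(j+1,j^{2c-2},j-1)$ if $j$ even and $j>2m+1$. - $G=\mathrm{Sp}_{2n}$: $\psi(m)=2m$; $\psi(j^c)=j^{2c}$ if $j$ is even or $j\ge 2m$; $(j+1,j^{2c-2},j-1)$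 if $j$ odd and $j<2m$.
   Formalization: For SO_{2n} with α_n in J and α_{n-1} not in J, the Levi partition is computed after replacing α_n by α_{n-1} in J (the literal recipe fails, e.g. n=2, J={α_2} gives (3,1) instead of (2,2)); SO_{2n} is taken with n≥2, and all groups with n≥1. *)

theory Defs
  imports "Jordan_Normal_Form.Jordan_Normal_Form" "Jordan_Normal_Form.DL_Rank"
    "HOL-Library.Multiset" "HOL-Computational_Algebra.Polynomial"
begin

datatype cgroup = GLt | SOeven | SOodd | Spt

fun dimN :: "cgroup \<Rightarrow> nat \<Rightarrow> nat" where
  "dimN GLt n = n"
| "dimN SOeven n = 2*n"
| "dimN SOodd n = 2*n+1"
| "dimN Spt n = 2*n"

text \<open>Bourbaki index set of the simple roots: GL_n has alpha_1..alpha_(n-1), the others alpha_1..alpha_n.\<close>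
fun simple_roots :: "cgroup \<Rightarrow> nat \<Rightarrow> nat set" where
  "simple_roots GLt n = {1..<n}"
| "simple_roots _ n = {1..n}"

text \<open>Admissible ranks (Bourbaki labelling of D_n needs n >= 2).\<close>
fun valid_rank :: "cgroup \<Rightarrow> nat \<Rightarrow> bool" where
  "valid_rank SOeven n = (2 \<le> n)"
| "valid_rank _ n = (1 \<le> n)"

definition qform :: "nat \<Rightarrow> 'a::field vec \<Rightarrow> 'a" where
  "qform N x = (\<Sum>i<N div 2. x $ i * x $ (N - 1 - i)) + (if odd N then (x $ (N div 2))^2 else 0)"

definition Jsp :: "nat \<Rightarrow> 'a::field mat" where
  "Jsp N = mat N N (\<lambda>(i,j). if j = N - 1 - i then (if i < N div 2 then 1 else -1) else 0)"

definition orth_group :: "nat \<Rightarrow> 'a::field mat set" where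
  "orth_group N = {g \<in> carrier_mat N N. det g \<noteq> 0 \<and> (\<forall>x \<in> carrier_vec N. qform N (g *\<^sub>v x) = qform N x)}"

text \<open>Special orthogonal group: determinant 1, except in characteristic 2 and even dimension,
  where it is the kernel of the Dickson invariant g \<mapsto> rank (g - 1) mod 2.\<close>
definition grp :: "cgroup \<Rightarrow> nat \<Rightarrow> 'a::field mat set" where
  "grp ty n = (let N = dimN ty n in case ty of
      GLt \<Rightarrow> {g \<in> carrier_mat N N. det g \<noteq> 0}
    | Spt \<Rightarrow> {g \<in> carrier_mat N N. transpose_mat g * Jsp N * g = Jsp N}
    | SOodd \<Rightarrow> {g \<in> orth_group N. det g = 1}
    | SOeven \<Rightarrow> {g \<in> orth_group N.
         if CHAR('a) = 2 then even (vec_space.rank N (g - 1\<^sub>m N)) else det g = 1})"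

definition unipotent :: "nat \<Rightarrow> 'a::field mat \<Rightarrow> bool" where
  "unipotent N u \<longleftrightarrow> (u - 1\<^sub>m N) ^\<^sub>m N = 0\<^sub>m N N"

definition gclass :: "cgroup \<Rightarrow> nat \<Rightarrow> 'a::field mat \<Rightarrow> 'a mat set" where
  "gclass ty n u = {v \<in> carrier_mat (dimN ty n) (dimN ty n). \<exists>h \<in> grp ty n. h * u = v * h}"

text \<open>Pairing of the weight of the i-th standard basis vector (0-based) with a cocharacter
  lambda_J satisfying <alpha,lambda_J> = 0 for alpha in J and > 0 for simple alpha not in J.\<close>
definition coch_a :: "cgroup \<Rightarrow> nat \<Rightarrow> nat set \<Rightarrow> nat \<Rightarrow> int" where
  "coch_a ty n J k = (case ty of
      SOeven \<Rightarrow> (let x = (if n - 1 \<notin> J then 1 else 0); y = (if n \<notin> J then 1 else 0) in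
         if k = n then y - x
         else x + y + int (card {j \<in> {1..n-2} - J. k \<le> j}))
    | _ \<Rightarrow> int (card {j \<in> simple_roots ty n - J. k \<le> j}))"

definition wt :: "cgroup \<Rightarrow> nat \<Rightarrow> nat set \<Rightarrow> nat \<Rightarrow> int" where
  "wt ty n J i = (if ty = GLt then coch_a ty n J (i+1)
     else if i < n then coch_a ty n J (i+1)
     else if dimN ty n - n \<le> i then - coch_a ty n J (dimN ty n - i)
     else 0)"

definition std_parabolic :: "cgroup \<Rightarrow> nat \<Rightarrow> nat set \<Rightarrow> 'a::field mat set" where
  "std_parabolic ty n J = {g \<in> grp ty n. \<forall>i < dimN ty n. \<forall>j < dimN ty n.
      wt ty n J i < wt ty n J j \<longrightarrow> g $$ (i,j) = 0}"

definition std_unip_radical :: "cgroup \<Rightarrow> nat \<Rightarrow> nat set \<Rightarrow> 'a::field mat set" where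
  "std_unip_radical ty n J = {g \<in> grp ty n. \<forall>i < dimN ty n. \<forall>j < dimN ty n.
      wt ty n J i \<le> wt ty n J j \<longrightarrow> g $$ (i,j) = (if i = j then 1 else 0)}"

definition conj_set :: "'a::field mat \<Rightarrow> 'a mat set \<Rightarrow> 'a mat set" where
  "conj_set g S = {x \<in> carrier_mat (dim_row g) (dim_row g). \<exists>s \<in> S. x * g = g * s}"

inductive_set polyfun :: "nat \<Rightarrow> ('a::field mat \<Rightarrow> 'a) set" for N where
  const: "(\<lambda>_. c) \<in> polyfun N"
| coord: "i < N \<Longrightarrow> j < N \<Longrightarrow> (\<lambda>A. A $$ (i,j)) \<in> polyfun N"
| add: "f \<in> polyfun N \<Longrightarrow> g \<in> polyfun N \<Longrightarrow> (\<lambda>A. f A + g A) \<in> polyfun N"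
| mult: "f \<in> polyfun N \<Longrightarrow> g \<in> polyfun N \<Longrightarrow> (\<lambda>A. f A * g A) \<in> polyfun N"

definition zclosed_in :: "nat \<Rightarrow> 'a::field mat set \<Rightarrow> 'a mat set \<Rightarrow> bool" where
  "zclosed_in N X S \<longleftrightarrow> (\<exists>F \<subseteq> polyfun N. S = {A \<in> X. \<forall>f \<in> F. f A = 0})"

definition zopen_in :: "nat \<Rightarrow> 'a::field mat set \<Rightarrow> 'a mat set \<Rightarrow> bool" where
  "zopen_in N X S \<longleftrightarrow> S \<subseteq> X \<and> zclosed_in N X (X - S)"

definition zdense_in :: "nat \<Rightarrow> 'a::field mat set \<Rightarrow> 'a mat set \<Rightarrow> bool" where
  "zdense_in N X S \<longleftrightarrow> S \<subseteq> X \<and> (\<forall>T. zclosed_in N X T \<and> S \<subseteq> T \<longrightarrow> T = X)"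

definition richardson_class :: "cgroup \<Rightarrow> nat \<Rightarrow> 'a::field mat set \<Rightarrow> 'a mat set \<Rightarrow> bool" where
  "richardson_class ty n Q C \<longleftrightarrow>
     (\<exists>u \<in> grp ty n. unipotent (dimN ty n) u \<and> C = gclass ty n u) \<and>
     zopen_in (dimN ty n) Q (C \<inter> Q) \<and> zdense_in (dimN ty n) Q (C \<inter> Q)"

definition jordan_type :: "'a::field mat \<Rightarrow> nat multiset \<Rightarrow> bool" where
  "jordan_type u lam \<longleftrightarrow> (\<exists>n_as. jordan_nf u n_as \<and> mset (map fst n_as) = lam)"

definition normJ :: "cgroup \<Rightarrow> nat \<Rightarrow> nat set \<Rightarrow> nat set" where
  "normJ ty n J = (if ty = SOeven \<and> n \<in> J \<and> n - 1 \<notin> J then (J - {n}) \<union> {n - 1} else J)"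

definition levi_m :: "cgroup \<Rightarrow> nat \<Rightarrow> nat set \<Rightarrow> nat" where
  "levi_m ty n J = (let J' = normJ ty n J in
     if ty = GLt \<or> n \<notin> J' then 0 else (GREATEST m. m \<le> n \<and> {n - m + 1..n} \<subseteq> J'))"

definition levi_gl_parts :: "cgroup \<Rightarrow> nat \<Rightarrow> nat set \<Rightarrow> nat multiset" where
  "levi_gl_parts ty n J = (let J' = normJ ty n J; r = n - levi_m ty n J;
      endb = (\<lambda>s. LEAST t. s \<le> t \<and> (t = r \<or> t \<notin> J')) in
     image_mset (\<lambda>s. endb s - s + 1) (mset_set {s \<in> {1..r}. s = 1 \<or> s - 1 \<notin> J'}))"

definition hook :: "nat \<Rightarrow> nat \<Rightarrow> nat multiset" where
  "hook j c = {#j+1#} + replicate_mset (2*c - 2) j + {#j - 1#}"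

definition psi_j :: "cgroup \<Rightarrow> nat \<Rightarrow> nat \<Rightarrow> nat \<Rightarrow> nat \<Rightarrow> nat multiset" where
  "psi_j ty p m j c = (case ty of
      GLt \<Rightarrow> replicate_mset c j
    | SOeven \<Rightarrow> (if p \<noteq> 2 then
          (if even j \<or> j \<le> 2*m then replicate_mset (2*c) j else hook j c)
        else
          (if even j then replicate_mset (2*c) j
           else if j \<le> 2*m then hook j c
           else if c = 1 then {#j+1, j-1#}
           else replicate_mset 2 (j+1) + replicate_mset (2*c - 4) j + replicate_mset 2 (j-1)))
    | SOodd \<Rightarrow> (if odd j \<or> j \<le> 2*m+1 then replicate_mset (2*c) j else hook j c)
    | Spt \<Rightarrow> (if even j \<or> 2*m \<le> j then replicate_mset (2*c) j else hook j c))"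

definition psi_m :: "cgroup \<Rightarrow> nat \<Rightarrow> nat multiset" where
  "psi_m ty m = (case ty of GLt \<Rightarrow> {#} | SOodd \<Rightarrow> {#2*m+1#} | _ \<Rightarrow> {#2*m#})"

definition psi :: "cgroup \<Rightarrow> nat \<Rightarrow> nat \<Rightarrow> nat multiset \<Rightarrow> nat multiset" where
  "psi ty p m parts = filter_mset (\<lambda>x. 0 < x)
     (psi_m ty m + (\<Sum>j \<in> set_mset parts. psi_j ty p m j (count parts j)))"

definition dual_part :: "nat multiset \<Rightarrow> nat multiset" where
  "dual_part M = filter_mset (\<lambda>x. 0 < x)
     (mset (map (\<lambda>i. size (filter_mset (\<lambda>x. i \<le> x) M)) [1..<Suc (sum_mset M)]))"

end

theory Submission
  imports Defs "Jordan_Normal_Form.Jordan_Normal_Form_Existence" "Jordan_Normal_Form.Jordan_Normal_Form_Uniqueness"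
begin

text \<open>
  Let \<open>x = v - 1\<close> for \<open>v\<close> in the unipotent radical \<open>Q\<close>. A rank condition on \<open>x\<^sup>k\<close> of the form
  ``at least \<open>r\<close>'' is Zariski open, so by density the ranks of the powers on the Richardson class are
  the maxima over \<open>Q\<close>, and these ranks determine the Jordan type.

  Let \<open>d\<^sub>t\<close> be the sizes of the weight blocks and \<open>c\<^sub>i\<close> the number of blocks of size at least \<open>i\<close>.
  Since \<open>x\<close> raises weights, \<open>x\<^sup>k\<close> has corank at least the sum of the \<open>k\<close> largest \<open>d\<^sub>t\<close>; this gives the
  parts \<open>d\<^sub>t\<close> for \<open>GL\<^sub>n\<close>. In the other groups the rank of \<open>x\<^sup>k\<close> is in addition even for suitable \<open>k\<close>, because
  it is the rank of an alternating form built from \<open>x\<close>, and concavity of \<open>k \<mapsto> rank x\<^sup>k\<close> spreads this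
  defect over the whole interval \<open>c\<^sub>j\<^sub>+\<^sub>1 < k < c\<^sub>j\<close>. This is exactly the effect of replacing \<open>j\<^sup>2\<^sup>c\<close> by
  \<open>(j+1, j\<^sup>2\<^sup>c\<^sup>-\<^sup>2, j-1)\<close> in \<open>\<psi>\<close>. For \<open>p = 2\<close> and \<open>SO\<^sub>2\<^sub>n\<close> the quadratic form costs one more dimension.

  For the converse, at most \<open>t\<close> basis vectors of each block receive labels below \<open>t\<close>, and \<open>x\<close> moves each of
  them to the next vector with the same label; an isometry of this kind is \<open>(1 + Y) (1 + Y\<^sup>*)\<^sup>-\<^sup>1 (1 + S)\<close>, where \<open>Y\<close>
  follows the arrows inside a totally singular subspace, \<open>Y\<^sup>*\<close> is its adjoint and \<open>S\<close> links the two
  halves of self-dual chains. One more label, forming a column whose two central links are both present in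
  \<open>S\<close>, attains the parity defect.
\<close>


section \<open>Rank\<close>

text \<open>The maximum of the rank of \<open>x^k\<close> is found for each \<open>k\<close>
  separately: the explicit witness may depend on \<open>k\<close>, since a dense class attains all
  these maxima at once. Between \<open>c_(j+1)\<close> and \<open>c_j\<close> the sum of the
  \<open>k\<close> largest blocks is a line of slope \<open>j\<close>, and the corank predicted by
  \<open>psi\<close> exceeds it by the minimum of a constant (0, 1 or 2) and the distances from
  \<open>k\<close> to both ends. This is a minimum of three lines, each attained by its own
  construction: those of slopes \<open>j + 1\<close> and \<open>j - 1\<close> by that many labels, a
  number that suits the form; the one of slope \<open>j\<close> by \<open>j\<close> labels, with one
  place of the middle block lost in the symplectic case, or by \<open>j - 1\<close> labels and the
  extra column in the orthogonal case. In characteristic 2 the polar form of an even-dimensional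
  quadratic form is alternating, so parity concerns even powers instead of odd ones; for
  \<open>j\<close> beyond the middle block the first unit of the defect then comes from the
  quadratic form and parity doubles it. In type D the chosen cocharacter vanishes on the last
  coordinate if the last two roots both lie outside \<open>J\<close>. The weights then see
  \<open>SO_2\<close> where the Levi partition has \<open>GL_1\<close>, and \<open>psi\<close>
  agrees on both.\<close>

abbreviation rk :: "nat \<Rightarrow> 'a::field mat \<Rightarrow> nat" where
  "rk n A \<equiv> vec_space.rank n A"

definition pr :: "nat \<Rightarrow> nat set \<Rightarrow> 'a::field mat" where
  "pr n S = mat n n (\<lambda>(i,j). if i = j \<and> i \<in> S then 1 else 0)"

lemma pr_carrier [simp]: "pr n S \<in> carrier_mat n n"
  by (simp add: pr_def)

lemma pr_dim [simp]: "dim_row (pr n S) = n" "dim_col (pr n S) = n"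
  by (simp_all add: pr_def)

lemma mat_assoc:
  "dim_col A = dim_row B \<Longrightarrow> dim_col B = dim_row C \<Longrightarrow> A * B * C = A * (B * (C :: 'a::semiring_0 mat))"
  by (rule assoc_mult_mat[of A "dim_row A" "dim_col A" B "dim_col B" C "dim_col C"]) auto

lemma mat_cancel:
  "P * Q = 1\<^sub>m n \<Longrightarrow> dim_col P = dim_row Q \<Longrightarrow> dim_col Q = dim_row A \<Longrightarrow> dim_row A = n \<Longrightarrow> P * (Q * A) = (A :: 'a::semiring_1 mat)"
  by (subst mat_assoc[symmetric]) auto

lemma mat_add_distrib:
  fixes A B C :: "'a::ring_1 mat"
  shows "dim_col A = dim_row B \<Longrightarrow> dim_row C = dim_row B \<Longrightarrow> dim_col C = dim_col B \<Longrightarrow> A * (B + C) = A * B + A * C"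
    and "dim_col B = dim_row A \<Longrightarrow> dim_row C = dim_row B \<Longrightarrow> dim_col C = dim_col B \<Longrightarrow> (B + C) * A = B * A + C * A"
    and "dim_col A = dim_row B \<Longrightarrow> dim_row C = dim_row B \<Longrightarrow> dim_col C = dim_col B \<Longrightarrow> A * (B - C) = A * B - A * C"
    and "dim_col B = dim_row A \<Longrightarrow> dim_row C = dim_row B \<Longrightarrow> dim_col C = dim_col B \<Longrightarrow> (B - C) * A = B * A - C * A"
  by (auto intro!: mult_add_distrib_mat add_mult_distrib_mat mult_minus_distrib_mat minus_mult_distrib_mat carrier_matI)

lemma pr_mult_left_index:
  assumes "A \<in> carrier_mat n m" "i < n" "j < m"
  shows "(pr n S * A) $$ (i,j) = (if i \<in> S then A $$ (i,j) else 0)"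
proof -
  have "(pr n S * A) $$ (i,j) = (\<Sum>k<n. (if i = k \<and> i \<in> S then 1 else 0) * A $$ (k,j))"
    using assms by (simp add: pr_def scalar_prod_def lessThan_atLeast0)
  also have "\<dots> = (\<Sum>k<n. if k = i then (if i \<in> S then A $$ (i,j) else 0) else 0)"
    by (intro sum.cong) auto
  finally show ?thesis using assms by simp
qed

lemma pr_mult_right_index:
  assumes "A \<in> carrier_mat m n" "i < m" "j < n"
  shows "(A * pr n S) $$ (i,j) = (if j \<in> S then A $$ (i,j) else 0)"
proof -
  have "(A * pr n S) $$ (i,j) = (\<Sum>k<n. A $$ (i,k) * (if k = j \<and> k \<in> S then 1 else 0))"
    using assms by (simp add: pr_def scalar_prod_def lessThan_atLeast0)
  also have "\<dots> = (\<Sum>k<n. if k = j then (if j \<in> S then A $$ (i,j) else 0) else 0)"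
    by (intro sum.cong) auto
  finally show ?thesis using assms by simp
qed

lemma rk_prod_le_left:
  assumes B: "B \<in> carrier_mat n r" and C: "C \<in> carrier_mat r m"
  shows "rk n (B * C) \<le> rk n B"
proof -
  interpret vec_space "TYPE('a)" n .
  have BC: "B * C \<in> carrier_mat n m" using B C by simp
  have car: "set (cols B) \<subseteq> carrier_vec n" using B cols_dim by blast
  have sub: "set (cols (B * C)) \<subseteq> span (set (cols B))"
  proof
    fix v assume "v \<in> set (cols (B * C))"
    then obtain j where j: "j < m" and v: "v = col (B * C) j"
      using BC by (metis carrier_matD(2) cols_length cols_nth in_set_conv_nth)
    have "v = B *\<^sub>v col C j" unfolding v by (rule col_mult2[OF B C j])
    also have "\<dots> = lincomb_list (\<lambda>i. col C j $ i) (cols B)"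
    proof -
      have "mat_of_cols n (cols B) = B" using B by auto
      moreover have "vec (length (cols B)) (\<lambda>i. col C j $ i) = col C j" using B C j by auto
      moreover have "\<forall>w \<in> set (cols B). dim_vec w = n" using car by auto
      ultimately show ?thesis by (simp add: lincomb_list_as_mat_mult)
    qed
    also have "\<dots> \<in> span (set (cols B))"
      unfolding span_list_as_span[OF car, symmetric] by (rule in_span_listI) auto
    finally show "v \<in> span (set (cols B))" .
  qed
  have s1: "subspace class_ring (span (set (cols B))) V" using car span_is_subspace by blast
  have s2: "subspace class_ring (span (set (cols (B * C)))) V"
    using BC cols_dim span_is_subspace by (metis carrier_matD(1))
  have "span (set (cols (B * C))) \<subseteq> span (set (cols B))"
    using sub car by (metis span_is_submodule span_is_subset)
  then have "subspace class_ring (span (set (cols (B * C)))) (vs (span (set (cols B))))"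
    using nested_subspaces[OF s1 s2] by simp
  then show ?thesis unfolding rank_def
    using vectorspace.subspace_dim[OF subspace_is_vs[OF s1]]
      fin_dim_span_cols[OF B] fin_dim_span_cols[OF BC] by auto
qed

lemma rk_le_nc:
  assumes "A \<in> carrier_mat n nc"
  shows "rk n A \<le> nc"
  by (rule vec_space.rank_le_nc[OF assms])

lemma rk_one: "rk n (1\<^sub>m n :: 'a::field mat) = n"
  using vec_space.det_rank_iff[of "1\<^sub>m n :: 'a mat" n] by simp

definition inc :: "nat \<Rightarrow> nat \<Rightarrow> 'a::field mat" where
  "inc n t = mat n t (\<lambda>(i,j). if i = j then 1 else 0)"

lemma inc_carrier [simp]: "inc n t \<in> carrier_mat n t"
  by (simp add: inc_def)

lemma inc_mult_transpose: "inc n t * inc t n = (pr n {..<t} :: 'a::field mat)"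
proof (rule eq_matI)
  fix i j assume "i < dim_row (pr n {..<t} :: 'a mat)" "j < dim_col (pr n {..<t} :: 'a mat)"
  then have ij: "i < n" "j < n" by auto
  have "(inc n t * inc t n) $$ (i,j) = (\<Sum>k<t. (if i = k then 1 else 0) * (if k = j then 1 else 0 :: 'a))"
    using ij by (simp add: inc_def scalar_prod_def lessThan_atLeast0)
  also have "\<dots> = (\<Sum>k<t. if k = i then (if i = j then 1 else 0) else 0)"
    by (intro sum.cong) auto
  also have "\<dots> = pr n {..<t} $$ (i,j)" using ij by (simp add: pr_def)
  finally show "(inc n t * inc t n) $$ (i,j) = (pr n {..<t} $$ (i,j) :: 'a)" .
qed (auto simp: inc_def)

lemma inc_transpose_mult: "t \<le> n \<Longrightarrow> inc t n * inc n t = 1\<^sub>m t"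
  unfolding inc_mult_transpose by (rule eq_matI) (auto simp: pr_def)

text \<open>Gauss-Jordan elimination recorded as matrix identities: \<open>R\<close> picks out the
  pivot columns, which in the reduced form are the first \<open>t\<close> unit vectors.\<close>

lemma echelon_obtain:
  fixes A :: "'a::field mat"
  assumes A: "A \<in> carrier_mat nr nc"
  obtains P P' R t where "P \<in> carrier_mat nr nr" "P' \<in> carrier_mat nr nr" "P * P' = 1\<^sub>m nr" "P' * P = 1\<^sub>m nr"
    "t \<le> nr" "R \<in> carrier_mat nc t" "pr nr {..<t} * (P * A) = P * A" "(P * A) * R = inc nr t"
proof -
  define C where "C = gauss_jordan_single A"
  note gj = gauss_jordan_single[OF A C_def[symmetric]]
  obtain P P' where P: "C = P * A" "P \<in> carrier_mat nr nr" "P' \<in> carrier_mat nr nr" "P * P' = 1\<^sub>m nr" "P' * P = 1\<^sub>m nr"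
    using gj(4) by auto
  have C: "C \<in> carrier_mat nr nc" using gj(2) .
  obtain f where f: "pivot_fun C f nc" using gj(3) C unfolding row_echelon_form_def by auto
  have dC: "dim_row C = nr" using C by simp
  note pf = pivot_funD[OF dC f]
  \<comment> \<open>The pivot function takes the value \<open>nc\<close> exactly on the zero rows,
    which come last, so \<open>t\<close> counts the nonzero rows.\<close>
  define t where "t = (LEAST i. i \<ge> nr \<or> f i = nc)"
  have t: "t \<ge> nr \<or> f t = nc" unfolding t_def by (rule LeastI[of _ nr]) simp
  have tnr: "t \<le> nr" unfolding t_def by (rule Least_le) simp
  have lt: "i < nr \<and> f i < nc" if "i < t" for i
    using not_less_Least[of i "\<lambda>i. i \<ge> nr \<or> f i = nc"] that pf(1)[of i] unfolding t_def[symmetric] by auto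
  have ge: "f i = nc" if "t \<le> i" "i < nr" for i
    using that
  proof (induction i rule: dec_induct)
    case base then show ?case using t by auto
  next
    case (step k)
    then have "f k = nc" by auto
    with pf(3)[of k] pf(1)[of "Suc k"] step show ?case by auto
  qed
  define R :: "'a mat" where "R = mat nc t (\<lambda>(i,j). if i = f j then 1 else 0)"
  have R: "R \<in> carrier_mat nc t" by (simp add: R_def)
  have 1: "pr nr {..<t} * C = C"
  proof (rule eq_matI)
    fix i j assume "i < dim_row C" "j < dim_col C"
    then have ij: "i < nr" "j < nc" using C by auto
    show "(pr nr {..<t} * C) $$ (i,j) = C $$ (i,j)"
      using pr_mult_left_index[OF C ij, of "{..<t}"] ge[of i] pf(2)[of i j] ij by (auto split: if_splits)
  qed (use C in auto)
  have 2: "C * R = inc nr t"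
  proof (rule eq_matI)
    fix i j assume "i < dim_row (inc nr t :: 'a mat)" "j < dim_col (inc nr t :: 'a mat)"
    then have ij: "i < nr" "j < t" by (auto simp: inc_def)
    have "(C * R) $$ (i,j) = (\<Sum>k<nc. C $$ (i,k) * (if k = f j then 1 else 0))"
      using ij C R by (simp add: R_def scalar_prod_def lessThan_atLeast0)
    also have "\<dots> = (\<Sum>k<nc. if k = f j then C $$ (i, f j) else 0)"
      by (intro sum.cong) auto
    also have "\<dots> = C $$ (i, f j)" using lt[OF ij(2)] by simp
    also have "\<dots> = (if i = j then 1 else 0)"
      using pf(4)[of j] pf(5)[of j i] lt[OF ij(2)] ij by auto
    finally show "(C * R) $$ (i,j) = inc nr t $$ (i,j)" using ij by (simp add: inc_def)
  qed (use C R in \<open>auto simp: inc_def\<close>)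
  show thesis by (rule that[OF P(2-5) tnr R]) (use 1 2 P(1) in simp_all)
qed

lemma rk_left_invertible:
  fixes L :: "'a::field mat"
  assumes L: "L \<in> carrier_mat n r" and L': "L' \<in> carrier_mat r n" and e: "L' * L = 1\<^sub>m r"
  shows "rk n L = r"
proof -
  interpret vec_space "TYPE('a)" n .
  have inj: "v = 0\<^sub>v r" if "v \<in> carrier_vec r" "L *\<^sub>v v = 0\<^sub>v n" for v
  proof -
    have "v = (L' * L) *\<^sub>v v" using that e by simp
    also have "\<dots> = L' *\<^sub>v (L *\<^sub>v v)" using L L' that by (simp add: assoc_mult_mat_vec)
    also have "\<dots> = 0\<^sub>v r" using that(2) L' by (intro eq_vecI) (auto simp: scalar_prod_def)
    finally show ?thesis .
  qed
  have d: "distinct (cols L)"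
  proof (rule ccontr)
    assume "\<not> distinct (cols L)"
    then obtain i j where ij: "i < r" "j < r" "i \<noteq> j" "col L i = col L j"
      using L by (auto simp: distinct_conv_nth)
    have "L *\<^sub>v (unit_vec r i - unit_vec r j) = L *\<^sub>v unit_vec r i - L *\<^sub>v unit_vec r j"
      using L by (intro mult_minus_distrib_mat_vec) auto
    also have "\<dots> = 0\<^sub>v n" 
    proof -
      have "L *\<^sub>v unit_vec r k = col L k" if "k < r" for k
        using L that by (intro eq_vecI) auto
      then show ?thesis using ij L by (auto intro!: eq_vecI)
    qed
    finally have "unit_vec r i - unit_vec r j = (0\<^sub>v r :: 'a vec)" using inj by auto
    then have "(unit_vec r i - unit_vec r j) $ i = (0\<^sub>v r :: 'a vec) $ i" by simp
    with ij show False by simp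
  qed
  have "lin_indpt (set (cols L))"
    using lin_depE[OF L _ d] inj by metis
  then show ?thesis using lin_indpt_full_rank[OF L d] by simp
qed

text \<open>The map factors through a space of dimension equal to its rank; the one-sided inverses
  of both factors carry ranks through products.\<close>

lemma rank_factorization:
  fixes A :: "'a::field mat"
  assumes A: "A \<in> carrier_mat nr nc"
  obtains L R L' R' where "A = L * R" "L \<in> carrier_mat nr (rk nr A)" "R \<in> carrier_mat (rk nr A) nc"
    "L' \<in> carrier_mat (rk nr A) nr" "R' \<in> carrier_mat nc (rk nr A)"
    "L' * L = 1\<^sub>m (rk nr A)" "R * R' = 1\<^sub>m (rk nr A)"
proof -
  obtain P P' Q t where P: "P \<in> carrier_mat nr nr" "P' \<in> carrier_mat nr nr" "P * P' = 1\<^sub>m nr" "P' * P = 1\<^sub>m nr"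
    and t: "t \<le> nr" and Q: "Q \<in> carrier_mat nc t" and e: "pr nr {..<t} * (P * A) = P * A" "(P * A) * Q = inc nr t"
    by (rule echelon_obtain[OF A])
  define L where "L = P' * inc nr t"
  define R where "R = inc t nr * (P * A)"
  define L' where "L' = inc t nr * P"
  note [simp] = carrier_matD[OF A] carrier_matD[OF P(1)] carrier_matD[OF P(2)] carrier_matD[OF Q]
  have [simp]: "dim_row (inc a b :: 'a mat) = a" "dim_col (inc a b :: 'a mat) = b" for a b by (auto simp: inc_def)
  have LR: "L \<in> carrier_mat nr t" "R \<in> carrier_mat t nc" "L' \<in> carrier_mat t nr"
    by (auto simp: L_def R_def L'_def intro!: carrier_matI)
  have "L * R = P' * ((inc nr t * inc t nr) * (P * A))"
    unfolding L_def R_def by (simp add: mat_assoc)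
  also have "\<dots> = A"
    by (simp add: inc_mult_transpose e(1) mat_cancel[OF P(4)])
  finally have 1: "A = L * R" by simp
  have "L' * L = inc t nr * (P * (P' * inc nr t))"
    unfolding L_def L'_def by (simp add: mat_assoc)
  then have 2: "L' * L = 1\<^sub>m t" using t by (simp add: inc_transpose_mult mat_cancel[OF P(3)])
  have "R * Q = inc t nr * (P * A * Q)" unfolding R_def by (simp add: mat_assoc)
  then have 3: "R * Q = 1\<^sub>m t" using t by (simp only: e(2) inc_transpose_mult)
  have "rk nr L = t" by (rule rk_left_invertible[OF LR(1,3) 2])
  moreover have "rk nr A \<le> rk nr L" unfolding 1 by (rule rk_prod_le_left[OF LR(1,2)])
  moreover have "rk nr L \<le> rk nr A"
  proof -
    have "L = A * Q" unfolding 1 using LR Q 3 by (simp add: assoc_mult_mat[of _ nr t _ nc])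
    then show ?thesis using rk_prod_le_left[OF A Q] by simp
  qed
  ultimately have "rk nr A = t" by simp
  then show thesis using that[OF 1] LR Q 2 3 by simp
qed

lemma rk_prod_le_right:
  assumes B: "B \<in> carrier_mat n r" and C: "C \<in> carrier_mat r m"
  shows "rk n (B * C) \<le> rk r C"
proof -
  obtain L R where LR: "C = L * R" "L \<in> carrier_mat r (rk r C)" "R \<in> carrier_mat (rk r C) m"
    by (rule rank_factorization[OF C])
  have "B * C = (B * L) * R" by (subst LR(1)) (use B LR(2,3) in \<open>simp add: assoc_mult_mat[of _ n r _ "rk r C"]\<close>)
  then have "rk n (B * C) \<le> rk n (B * L)" using B LR(2,3) rk_prod_le_left[of "B * L" n "rk r C" R m] by simp
  also have "\<dots> \<le> rk r C" using B LR(2) by (intro rk_le_nc) auto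
  finally show ?thesis .
qed

lemma rk_le_nr:
  assumes A: "A \<in> carrier_mat n m" shows "rk n A \<le> n"
  using rk_prod_le_left[of "1\<^sub>m n" n n A m] A by (simp add: rk_one)

lemma rk_transpose:
  assumes A: "A \<in> carrier_mat n m"
  shows "rk m (transpose_mat A) = rk n A"
proof -
  have le: "rk m (transpose_mat A) \<le> rk n A" if A: "A \<in> carrier_mat n m" for A :: "'a mat" and n m
  proof -
    obtain L R where LR: "A = L * R" "L \<in> carrier_mat n (rk n A)" "R \<in> carrier_mat (rk n A) m"
      by (rule rank_factorization[OF A])
    have "transpose_mat A = transpose_mat R * transpose_mat L"
      by (subst LR(1)) (rule transpose_mult[OF LR(2,3)])
    then have "rk m (transpose_mat A) \<le> rk m (transpose_mat R)"
      using rk_prod_le_left[of "transpose_mat R" m "rk n A" "transpose_mat L" n] LR(2,3) by simp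
    also have "\<dots> \<le> rk n A" using LR(3) by (intro rk_le_nc) auto
    finally show ?thesis .
  qed
  have "rk n A \<le> rk m (transpose_mat A)" using le[of "transpose_mat A" m n] A by simp
  with le[OF A] show ?thesis by simp
qed

lemma rk_mult_inv_left:
  assumes "P \<in> carrier_mat n n" "P' \<in> carrier_mat n n" "P' * P = 1\<^sub>m n" "A \<in> carrier_mat n m"
  shows "rk n (P * A) = rk n A"
proof (rule antisym)
  show "rk n (P * A) \<le> rk n A" by (rule rk_prod_le_right[OF assms(1,4)])
  have "A = P' * (P * A)" using assms by (simp add: assoc_mult_mat[of P' n n P n A m, symmetric])
  then show "rk n A \<le> rk n (P * A)" using rk_prod_le_right[of P' n n "P * A" m] assms by simp
qed

lemma rk_mult_inv_right:
  assumes "P \<in> carrier_mat m m" "P' \<in> carrier_mat m m" "P * P' = 1\<^sub>m m" "A \<in> carrier_mat n m"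
  shows "rk n (A * P) = rk n A"
proof (rule antisym)
  show "rk n (A * P) \<le> rk n A" by (rule rk_prod_le_left[OF assms(4,1)])
  have "A = (A * P) * P'" using assms by (simp add: assoc_mult_mat[of A n m P m P' m])
  then show "rk n A \<le> rk n (A * P)" using rk_prod_le_left[of "A * P" n m P' m] assms by simp
qed

lemma rk_add:
  assumes "A \<in> carrier_mat n m" "B \<in> carrier_mat n m"
  shows "rk n (A + B) \<le> rk n A + rk n B"
  by (rule vec_space.rank_subadditive[OF assms])

lemma pr_split: "pr n S + pr n (- S) = 1\<^sub>m n"
  by (rule eq_matI) (auto simp: pr_def)

lemma pr_UNIV: "pr n UNIV = 1\<^sub>m n" "{..<n} \<subseteq> S \<Longrightarrow> pr n S = 1\<^sub>m n"
  by (rule eq_matI; auto simp: pr_def)+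

lemma pr_mult: "pr n S * pr n T = (pr n (S \<inter> T) :: 'a::field mat)"
proof (rule eq_matI)
  fix i j assume "i < dim_row (pr n (S \<inter> T) :: 'a mat)" "j < dim_col (pr n (S \<inter> T) :: 'a mat)"
  then show "(pr n S * pr n T) $$ (i,j) = (pr n (S \<inter> T) $$ (i,j) :: 'a)"
    by (subst pr_mult_left_index[OF pr_carrier]) (auto simp: pr_def)
qed auto

lemma pr_disjoint_add: "S \<inter> T = {} \<Longrightarrow> pr n (S \<union> T) = pr n S + pr n T"
  by (rule eq_matI) (auto simp: pr_def)

lemma rk_zero: "rk n (0\<^sub>m n m :: 'a::field mat) = 0"
  by (rule vec_space.rank_0I)

lemma rk_pr_le: "rk n (pr n S :: 'a::field mat) \<le> card (S \<inter> {..<n})"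
proof -
  have "rk n (pr n T :: 'a mat) \<le> card T" if "finite T" "T \<subseteq> {..<n}" for T
    using that
  proof (induction T rule: finite_induct)
    case empty
    have "pr n {} = (0\<^sub>m n n :: 'a mat)" by (rule eq_matI) (auto simp: pr_def)
    then show ?case by (simp add: rk_zero)
  next
    case (insert x T)
    have "pr n (insert x T) = pr n {x} + (pr n T :: 'a mat)"
      using insert pr_disjoint_add[of "{x}" T n] by simp
    moreover have "rk n (pr n {x} :: 'a mat) \<le> 1"
      by (rule vec_space.rank_le_1_product_entries[OF pr_carrier, of _ _ "\<lambda>i. if i = x then 1 else 0" "\<lambda>i. if i = x then 1 else 0"])
        (auto simp: pr_def)
    ultimately show ?case using insert rk_add[of "pr n {x} :: 'a mat" n n "pr n T"] by simp
  qed
  from this[of "S \<inter> {..<n}"] have "rk n (pr n (S \<inter> {..<n}) :: 'a mat) \<le> card (S \<inter> {..<n})" by simp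
  moreover have "pr n (S \<inter> {..<n}) = (pr n S :: 'a mat)" by (rule eq_matI) (auto simp: pr_def)
  ultimately show ?thesis by simp
qed

lemma rk_pr: "rk n (pr n S :: 'a::field mat) = card (S \<inter> {..<n})"
proof -
  have "n = rk n (pr n S + pr n (- S) :: 'a mat)" by (simp add: pr_split rk_one)
  also have "\<dots> \<le> rk n (pr n S :: 'a mat) + rk n (pr n (- S) :: 'a mat)" by (rule rk_add) auto
  also have "\<dots> \<le> rk n (pr n S :: 'a mat) + card (- S \<inter> {..<n})" using rk_pr_le by (rule add_left_mono)
  finally have "n \<le> rk n (pr n S :: 'a mat) + card (- S \<inter> {..<n})" .
  moreover have "card (S \<inter> {..<n}) + card (- S \<inter> {..<n}) = n"
    by (subst card_Un_disjoint[symmetric]) (auto simp: Int_Un_distrib2[symmetric])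
  ultimately show ?thesis using rk_pr_le[of n S] by (metis add_le_cancel_right antisym)
qed

text \<open>After row reduction of \<open>Y\<close> only its first \<open>t\<close> rows are
  nonzero. The first \<open>t\<close> columns of \<open>X * P'\<close> can be recovered from
  \<open>X * Y\<close>, and the other \<open>r - t\<close> columns add at most \<open>r - t\<close>
  to the rank.\<close>

lemma sylvester_rank:
  assumes X: "X \<in> carrier_mat n r" and Y: "Y \<in> carrier_mat r m"
  shows "rk n X + rk r Y \<le> r + rk n (X * Y)"
proof -
  obtain P P' Q t where P: "P \<in> carrier_mat r r" "P' \<in> carrier_mat r r" "P * P' = 1\<^sub>m r" "P' * P = 1\<^sub>m r"
    and t: "t \<le> r" and Q: "Q \<in> carrier_mat m t" and e: "pr r {..<t} * (P * Y) = P * Y" "(P * Y) * Q = inc r t"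
    by (rule echelon_obtain[OF Y])
  have rY: "rk r Y \<le> t"
  proof -
    have "rk r Y = rk r (P * Y)" by (rule rk_mult_inv_left[symmetric, OF P(1,2,4) Y])
    also have "\<dots> = rk r (pr r {..<t} * (P * Y))" using e(1) by simp
    also have "\<dots> \<le> rk r (pr r {..<t} :: 'a mat)" by (rule rk_prod_le_left[of _ r r _ m]) (use P Y in auto)
    also have "\<dots> \<le> t" using t card_mono[of "{..<t}" "{..<t} \<inter> {..<r}"] by (simp add: rk_pr)
  finally show ?thesis .
  qed
  define Z where "Z = X * P'"
  have Z: "Z \<in> carrier_mat n r" using X P by (simp add: Z_def)
  have "rk n X = rk n Z" unfolding Z_def by (rule rk_mult_inv_right[symmetric, OF P(2,1,4) X])
  also have "Z = Z * pr r {..<t} + Z * pr r (- {..<t})"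
    using Z by (subst mult_add_distrib_mat[symmetric, of _ n r]) (use Z in \<open>auto simp only: pr_split right_mult_one_mat intro: pr_carrier\<close>)
  also have "rk n \<dots> \<le> rk n (Z * pr r {..<t}) + rk n (Z * pr r (- {..<t}))"
    using Z by (intro rk_add[of _ n r]) auto
  also have "rk n (Z * pr r (- {..<t})) \<le> rk r (pr r (- {..<t}) :: 'a mat)"
    by (rule rk_prod_le_right[OF Z]) auto
  also have "rk r (pr r (- {..<t}) :: 'a mat) = r - t"
  proof -
    have "- {..<t} \<inter> {..<r} = {t..<r}" by auto
    then show ?thesis by (simp add: rk_pr)
  qed
  also have "rk n (Z * pr r {..<t}) \<le> rk n (X * Y)"
  proof -
    note [simp] = carrier_matD[OF X] carrier_matD[OF Y] carrier_matD[OF P(1)] carrier_matD[OF P(2)] carrier_matD[OF Q]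
    have [simp]: "dim_row (inc a b :: 'a mat) = a" "dim_col (inc a b :: 'a mat) = b" for a b by (auto simp: inc_def)
    have "X * Y * (Q * inc t r) = Z * (P * Y * Q) * inc t r"
      unfolding Z_def by (simp add: mat_assoc mat_cancel[OF P(4)])
    also have "\<dots> = Z * (inc r t * inc t r)" unfolding e(2) by (simp add: mat_assoc Z_def)
    finally have eq: "Z * pr r {..<t} = X * Y * (Q * inc t r)" by (simp add: inc_mult_transpose)
    show ?thesis unfolding eq by (rule rk_prod_le_left[of _ n m _ r]) (use X Y Q in auto)
  qed
  finally have "rk n X \<le> rk n (X * Y) + (r - t)" by simp
  then show ?thesis using rY t by simp
qed

text \<open>Sylvester's inequality for \<open>A * L\<close> and \<open>R * C\<close>, where
  \<open>B = L * R\<close> is a full-rank factorization. The later inequalities between ranks of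
  powers and of compressions come from this one.\<close>

lemma frobenius_rank:
  assumes A: "A \<in> carrier_mat n p" and B: "B \<in> carrier_mat p q" and C: "C \<in> carrier_mat q m"
  shows "rk n (A * B) + rk p (B * C) \<le> rk p B + rk n (A * B * C)"
proof -
  let ?r = "rk p B"
  obtain L R L' R' where LR: "B = L * R" "L \<in> carrier_mat p ?r" "R \<in> carrier_mat ?r q"
    by (rule rank_factorization[OF B])
  have AL: "A * L \<in> carrier_mat n ?r" and RC: "R * C \<in> carrier_mat ?r m" using A C LR by auto
  have "A * B = A * L * R" by (subst LR(1)) (use A LR(2,3) in \<open>simp add: assoc_mult_mat[of A n p]\<close>)
  then have 1: "rk n (A * B) \<le> rk n (A * L)" using rk_prod_le_left[OF AL LR(3)] by simp
  have "B * C = L * (R * C)" by (subst LR(1)) (use C LR(2,3) in \<open>simp add: assoc_mult_mat[of L p]\<close>)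
  then have 2: "rk p (B * C) \<le> rk ?r (R * C)" using rk_prod_le_right[OF LR(2) RC] by simp
  have "A * B * C = A * L * (R * C)"
    by (subst LR(1)) (simp add: mat_assoc carrier_matD[OF A] carrier_matD[OF C] carrier_matD[OF LR(2)] carrier_matD[OF LR(3)])
  then show ?thesis using sylvester_rank[OF AL RC] 1 2 by simp
qed

lemma rk_factor_le:
  assumes "A \<in> carrier_mat n p" "B \<in> carrier_mat p q" "C \<in> carrier_mat q m"
  shows "rk n (A * B * C) \<le> rk p B"
  using rk_prod_le_left[of "A * B" n q C m] rk_prod_le_right[of A n p B q] assms by simp

lemma rk_eq_0:
  assumes A: "A \<in> carrier_mat n m" and "rk n A = 0"
  shows "A = 0\<^sub>m n m"
proof -
  obtain L R where "A = L * R" "L \<in> carrier_mat n (rk n A)" "R \<in> carrier_mat (rk n A) m"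
    by (rule rank_factorization[OF A])
  with assms(2) show ?thesis by (intro eq_matI) (auto simp: scalar_prod_def)
qed

text \<open>Both sides are read off the reduced echelon form. This connects ranks with the
  generalized eigenspaces that determine the Jordan block sizes.\<close>

lemma kernel_dim_eq_rk:
  fixes A :: "'a::field mat"
  assumes A: "A \<in> carrier_mat n n"
  shows "kernel_dim A = n - rk n A"
proof -
  define C where "C = gauss_jordan_single A"
  note gj = gauss_jordan_single[OF A C_def[symmetric]]
  obtain f where f: "pivot_fun C f n" using gj(2,3) unfolding row_echelon_form_def by auto
  obtain P P' where P: "C = P * A" "P \<in> carrier_mat n n" "P' \<in> carrier_mat n n" "P * P' = 1\<^sub>m n" "P' * P = 1\<^sub>m n"
    using gj(4) by auto
  have C: "C \<in> carrier_mat n n" by (rule gj(2))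
  let ?S = "{i. i < n \<and> f i \<noteq> n}"
  have fle: "f i \<le> n" if "i < n" for i using pivot_funD(1)[OF _ f, of n i] C that by auto
  have len: "length (pivot_positions C) = card ?S"
  proof -
    have "?S = {i. i < n \<and> row C i \<noteq> 0\<^sub>v n}"
      using pivot_fun_zero_row_iff[OF f C] by auto
    then show ?thesis using pivot_positions(4)[OF C f] by simp
  qed
  have row0: "C $$ (i,j) = 0" if "i < n" "j < n" "i \<notin> ?S" for i j
    using pivot_funD(2)[OF _ f, of n i j] C that by auto
  have "rk n A = rk n C" unfolding P(1) by (rule rk_mult_inv_left[symmetric, OF P(2,3,5) A])
  also have "rk n C = card ?S"
  proof (rule antisym)
    have "C = pr n ?S * C"
    proof (rule eq_matI)
      fix i j assume "i < dim_row (pr n ?S * C)" "j < dim_col (pr n ?S * C)"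
      then have "i < n" "j < n" using C by auto
      then show "C $$ (i,j) = (pr n ?S * C) $$ (i,j)"
        unfolding pr_mult_left_index[OF C \<open>i < n\<close> \<open>j < n\<close>] using row0 by auto
    qed (use C in auto)
    then have "rk n C \<le> rk n (pr n ?S :: 'a mat)" using rk_prod_le_left[OF pr_carrier C] by metis
    also have "\<dots> \<le> card ?S" by (simp add: rk_pr card_mono)
    finally show "rk n C \<le> card ?S" .
    define R :: "'a mat" where "R = mat n n (\<lambda>(k,i). if i \<in> ?S \<and> k = f i then 1 else 0)"
    have R: "R \<in> carrier_mat n n" by (simp add: R_def)
    have "C * R = pr n ?S"
    proof (rule eq_matI)
      fix i j assume "i < dim_row (pr n ?S :: 'a mat)" "j < dim_col (pr n ?S :: 'a mat)"
      then have ij: "i < n" "j < n" by auto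
      have "(C * R) $$ (i,j) = (\<Sum>k<n. C $$ (i,k) * (if j \<in> ?S \<and> k = f j then 1 else 0))"
        using ij C R by (simp add: R_def scalar_prod_def lessThan_atLeast0)
      also have "\<dots> = (\<Sum>k<n. if k = f j then (if j \<in> ?S then C $$ (i, f j) else 0) else 0)"
        by (intro sum.cong) auto
      also have "\<dots> = (if j \<in> ?S then C $$ (i, f j) else 0)" using fle[OF ij(2)] by auto
      also have "\<dots> = (if i = j \<and> i \<in> ?S then 1 else 0)"
        using pivot_funD(4)[OF _ f, of n j] pivot_funD(5)[OF _ f, of n j i] C ij fle[OF ij(2)] by auto
      finally show "(C * R) $$ (i,j) = pr n ?S $$ (i,j)" using ij by (simp add: pr_def)
    qed (use C R in auto)
    then have "rk n (pr n ?S :: 'a mat) \<le> rk n C" using rk_prod_le_left[OF C R] by simp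
    moreover have "?S \<inter> {..<n} = ?S" by auto
    ultimately show "card ?S \<le> rk n C" by (simp add: rk_pr)
  qed
  finally have r: "rk n A = card ?S" .
  interpret K: kernel n n C by unfold_locales (rule C)
  have "kernel_dim A = K.dim" unfolding kernel_dim_def
    using mat_kernel_mult_eq[OF A P(2,3,5), folded P(1)] A by simp
  also have "\<dots> = n - card ?S" using find_base_vectors(5,6)[OF gj(3) C] len by simp
  finally show ?thesis using r by simp
qed

section \<open>Ranks of powers\<close>

lemma pow_mat_add:
  assumes "x \<in> carrier_mat n n"
  shows "x ^\<^sub>m (a + b) = x ^\<^sub>m a * (x ^\<^sub>m b :: 'a::semiring_1 mat)"
proof (induction b)
  case 0 then show ?case using assms pow_carrier_mat[OF assms, of a] by simp
next
  case (Suc b)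
  then show ?case using assms by (simp add: mat_assoc carrier_matD[OF assms])
qed

lemma pow_mat_Suc_left:
  assumes "x \<in> carrier_mat n n"
  shows "x ^\<^sub>m Suc k = x * (x ^\<^sub>m k :: 'a::semiring_1 mat)"
  using pow_mat_add[OF assms, of 1 k] assms by simp

lemma rk_pow_mono:
  assumes x: "x \<in> carrier_mat n n" and "a \<le> b"
  shows "rk n (x ^\<^sub>m b) \<le> rk n (x ^\<^sub>m a)"
proof -
  have "x ^\<^sub>m b = x ^\<^sub>m a * x ^\<^sub>m (b - a)" using pow_mat_add[OF x, of a "b - a"] assms by simp
  then show ?thesis using rk_prod_le_left[of "x ^\<^sub>m a" n n "x ^\<^sub>m (b - a)" n] x by simp
qed

text \<open>Frobenius' inequality for \<open>x * x^k * x\<close>. The successive drops of the rank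
  weakly decrease; equivalently the corank is concave in \<open>k\<close>.\<close>

lemma rk_pow_concave:
  assumes x: "x \<in> carrier_mat n n"
  shows "2 * rk n (x ^\<^sub>m Suc k) \<le> rk n (x ^\<^sub>m k) + rk n (x ^\<^sub>m Suc (Suc k))"
  using frobenius_rank[of x n n "x ^\<^sub>m k" n x n] x pow_mat_Suc_left[OF x, of k] pow_mat_Suc_left[OF x, of "Suc k"]
  by (simp add: mat_assoc carrier_matD[OF x])

text \<open>The ranks of the powers of a nilpotent matrix drop strictly until they reach 0, and a
  nonzero \<open>x^r\<close> leaves room for \<open>r + 1\<close> such drops.\<close>

lemma rk_pow_nilpotent:
  assumes x: "x \<in> carrier_mat n n" and nil: "x ^\<^sub>m K = 0\<^sub>m n n" and nz: "x ^\<^sub>m r \<noteq> 0\<^sub>m n n"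
  shows "r + 1 \<le> rk n (x ^\<^sub>m i) + i"
proof -
  have dec: "rk n (x ^\<^sub>m Suc i) < rk n (x ^\<^sub>m i)" if "i \<le> r" for i
  proof (rule ccontr)
    assume "\<not> ?thesis"
    with rk_pow_mono[OF x, of i "Suc i"] have eq: "rk n (x ^\<^sub>m Suc i) = rk n (x ^\<^sub>m i)" by simp
    \<comment> \<open>As the drops weakly decrease, one vanishing drop makes all later ranks equal,
      which nilpotency allows only at rank 0.\<close>
    have const: "rk n (x ^\<^sub>m (i + j)) = rk n (x ^\<^sub>m i) \<and> rk n (x ^\<^sub>m Suc (i + j)) = rk n (x ^\<^sub>m i)" for j
    proof (induction j)
      case (Suc j)
      then show ?case using rk_pow_concave[OF x, of "i + j"] rk_pow_mono[OF x, of "Suc (i+j)" "Suc (Suc (i + j))"] by simp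
    qed (use eq in simp)
    have "x ^\<^sub>m (i + K) = 0\<^sub>m n n" using pow_mat_add[OF x, of i K] nil x by simp
    then have "rk n (x ^\<^sub>m i) = 0" using const[of K] by (simp add: rk_zero)
    then have "rk n (x ^\<^sub>m r) = 0" using rk_pow_mono[OF x that] by simp
    then show False using nz rk_eq_0[of "x ^\<^sub>m r" n n] x by simp
  qed
  show ?thesis
  proof (induction i)
    case 0
    have "r + 1 - j \<le> rk n (x ^\<^sub>m j)" if "j \<le> r + 1" for j
      using that
    proof (induction j rule: inc_induct)
      case (step m) then show ?case using dec[of m] by simp
    qed simp
    from this[of 0] show ?case by simp
  next
    case (Suc i)
    show ?case
    proof (cases "Suc i \<le> r + 1")
      case True
      have "r + 1 - j \<le> rk n (x ^\<^sub>m j)" if "j \<le> r + 1" for j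
        using that
      proof (induction j rule: inc_induct)
        case (step m) then show ?case using dec[of m] by simp
      qed simp
      from this[OF True] show ?thesis by simp
    qed simp
  qed
qed

text \<open>On the image of the projection \<open>e\<close> the kernel of \<open>x^k\<close> has at
  most \<open>k\<close> times the dimension of the kernel of \<open>x\<close>.\<close>

lemma rk_compress_pow:
  assumes x: "x \<in> carrier_mat n n" and e: "e \<in> carrier_mat n n" and ee: "e * e = e" and ex: "e * x = x * e"
  shows "rk n e + k * rk n (e * x) \<le> rk n (e * x ^\<^sub>m k) + k * rk n e"
proof (induction k)
  case 0 then show ?case using e x by simp
next
  case (Suc k)
  have comm: "x ^\<^sub>m j * e = e * x ^\<^sub>m j" for j
  proof (induction j)
    case (Suc j)
    have "x ^\<^sub>m Suc j * e = x ^\<^sub>m j * (e * x)" using x e ex by (simp add: mat_assoc)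
    also have "\<dots> = e * x ^\<^sub>m Suc j"
      using x e Suc by (simp add: mat_assoc[symmetric])
    finally show ?case .
  qed (use x e in simp)
  have "rk n (x ^\<^sub>m k * e) + rk n (e * x) \<le> rk n e + rk n (x ^\<^sub>m k * e * x)"
    by (rule frobenius_rank) (use x e in auto)
  moreover have "x ^\<^sub>m k * e * x = e * x ^\<^sub>m Suc k" unfolding comm using x e by (simp add: mat_assoc)
  ultimately have "rk n (e * x ^\<^sub>m k) + rk n (e * x) \<le> rk n e + rk n (e * x ^\<^sub>m Suc k)"
    using comm[of k] by simp
  then show ?case using Suc by simp
qed

text \<open>Frobenius' inequality with \<open>M\<close> in the middle, the triple product being 0:
  ranks on disjoint coordinate blocks add up below the rank of \<open>M\<close>.\<close>

lemma rk_ge_blocks: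
  assumes M: "M \<in> carrier_mat n n" and ST: "S \<inter> T = {}"
    and comm: "pr n S * M = M * pr n S" 
  shows "rk n (pr n S * M) + rk n (M * pr n T) \<le> rk n M"
proof -
  have "pr n S * M * pr n T = M * (pr n S * pr n T)" using M by (simp add: comm mat_assoc)
  also have "\<dots> = 0\<^sub>m n n"
  proof -
    have "pr n (S \<inter> T) = (0\<^sub>m n n :: 'a mat)" using ST by (intro eq_matI) (auto simp: pr_def)
    then show ?thesis using M by (simp add: pr_mult)
  qed
  finally have "pr n S * M * pr n T = 0\<^sub>m n n" .
  then show ?thesis using frobenius_rank[of "pr n S" n n M n "pr n T" n] M by (simp add: rk_zero)
qed

section \<open>Alternating matrices\<close>

text \<open>The zero diagonal is a separate requirement because skew symmetry does not give it in
  characteristic 2.\<close>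

definition alt_mat :: "nat \<Rightarrow> 'a::field mat \<Rightarrow> bool" where
  "alt_mat n A \<longleftrightarrow> A \<in> carrier_mat n n \<and> (\<forall>i<n. A $$ (i,i) = 0) \<and> (\<forall>i<n. \<forall>j<n. A $$ (i,j) = - A $$ (j,i))"

lemma alt_matD:
  assumes "alt_mat n A"
  shows "A \<in> carrier_mat n n" "i < n \<Longrightarrow> A $$ (i,i) = 0" "i < n \<Longrightarrow> j < n \<Longrightarrow> A $$ (i,j) = - A $$ (j,i)"
  using assms unfolding alt_mat_def by blast+

text \<open>Removing the last row together with the last column cancels them against each other,
  without dividing by 2.\<close>

lemma sum_antisym_eq_0:
  fixes f :: "nat \<Rightarrow> nat \<Rightarrow> 'a::ab_group_add"
  assumes "\<And>i. i < n \<Longrightarrow> f i i = 0" "\<And>i j. i < n \<Longrightarrow> j < n \<Longrightarrow> f i j = - f j i"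
  shows "(\<Sum>i<n. \<Sum>j<n. f i j) = 0"
  using assms
proof (induction n)
  case (Suc n)
  have 1: "(\<Sum>i<Suc n. \<Sum>j<Suc n. f i j) = (\<Sum>i<n. \<Sum>j<n. f i j) + ((\<Sum>j<n. f n j) + ((\<Sum>i<n. f i n) + f n n))"
    by (simp only: sum.lessThan_Suc sum.distrib add.assoc)
  have 2: "(\<Sum>i<n. f i n) = - (\<Sum>j<n. f n j)"
    unfolding sum_negf[symmetric] by (rule sum.cong[OF refl], rule Suc.prems(2)) auto
  have 3: "(\<Sum>i<n. \<Sum>j<n. f i j) = 0"
  proof (rule Suc.IH)
    fix i j assume "i < n" "j < n"
    then show "f i j = - f j i" by (intro Suc.prems(2)) auto
  next
    fix i assume "i < n"
    then show "f i i = 0" by (intro Suc.prems(1)) auto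
  qed
  have 4: "f n n = 0" by (rule Suc.prems(1)) simp
  show ?case unfolding 1 2 3 4 by simp
next
  case 0
  show ?case by (simp only: lessThan_0 sum.empty)
qed

lemma quad_expand:
  assumes "A \<in> carrier_mat n n" "a \<in> carrier_vec n" "b \<in> carrier_vec n"
  shows "a \<bullet> (A *\<^sub>v b) = (\<Sum>i<n. \<Sum>j<n. a $ i * A $$ (i,j) * (b $ j :: 'a::field))"
  using assms by (auto simp: scalar_prod_def lessThan_atLeast0 sum_distrib_left mult.assoc intro!: sum.cong)

lemma alt_mat_quad:
  assumes "alt_mat n A" "a \<in> carrier_vec n"
  shows "a \<bullet> (A *\<^sub>v a) = 0"
proof -
  have A: "A \<in> carrier_mat n n" by (rule alt_matD[OF assms(1)])
  show ?thesis unfolding quad_expand[OF A assms(2,2)]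
  proof (rule sum_antisym_eq_0)
    fix i j assume "i < n" "j < n"
    then have "A $$ (i,j) = - A $$ (j,i)" by (rule alt_matD[OF assms(1)])
    then show "a $ i * A $$ (i, j) * a $ j = - (a $ j * A $$ (j, i) * a $ i)" by (simp only:) simp
  qed (simp add: alt_matD(2)[OF assms(1)])
qed

text \<open>Polarization: the quadratic form is evaluated at \<open>e_k\<close> and at
  \<open>e_k + e_l\<close>.\<close>

lemma alt_matI:
  assumes A: "A \<in> carrier_mat n n" and q: "\<And>a. a \<in> carrier_vec n \<Longrightarrow> a \<bullet> (A *\<^sub>v a) = 0"
  shows "alt_mat n (A :: 'a::field mat)"
proof -
  have e: "(\<Sum>i<n. \<Sum>j<n. (f i * A $$ (i,j)) * f j) = 0" for f
    using q[of "vec n f"] quad_expand[OF A, of "vec n f" "vec n f"] by simp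
  have ee: "(\<Sum>i<n. \<Sum>j<n. (if i = k then 1 else 0) * A $$ (i,j) * (if j = l then 1 else 0)) = A $$ (k,l)" if "k < n" "l < n" for k l
  proof -
    have "(\<Sum>i<n. \<Sum>j<n. (if i = k then 1 else 0) * A $$ (i,j) * (if j = l then 1 else 0))
      = (\<Sum>i<n. \<Sum>j<n. if j = l then (if i = k then A $$ (i,j) else 0) else 0)"
      by (intro sum.cong) auto
    also have "\<dots> = A $$ (k,l)" using that by simp
    finally show ?thesis .
  qed
  have d: "A $$ (i,i) = 0" if "i < n" for i
    using e[of "\<lambda>j. if j = i then 1 else 0"] ee[OF that that] by simp
  moreover have "A $$ (k,l) = - A $$ (l,k)" if kl: "k < n" "l < n" for k l
  proof (cases "k = l")
    case True then show ?thesis using d kl by simp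
  next
    case False
    let ?f = "\<lambda>j. (if j = k then 1 else 0) + (if j = l then 1 else (0::'a))"
    define t where "t = (\<lambda>k l i j. (if i = k then 1 else 0) * A $$ (i,j) * (if j = l then 1 else 0 :: 'a))"
    have t: "(\<Sum>i<n. \<Sum>j<n. t k l i j) = A $$ (k,l)" if "k < n" "l < n" for k l
      using ee[OF that] by (simp add: t_def)
    have "0 = (\<Sum>i<n. \<Sum>j<n. (?f i * A $$ (i,j)) * ?f j)" using e[of ?f] by simp
    also have "\<dots> = (\<Sum>i<n. \<Sum>j<n. (t k k i j + t l k i j) + (t k l i j + t l l i j))"
      unfolding t_def by (simp only: distrib_left distrib_right)
    also have "\<dots> = (A $$ (k,k) + A $$ (l,k)) + (A $$ (k,l) + A $$ (l,l))"
      by (simp only: sum.distrib t kl)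
    finally show ?thesis using d kl by (simp add: eq_neg_iff_add_eq_0 add.commute)
  qed
  ultimately show ?thesis using A unfolding alt_mat_def by blast
qed

lemma alt_mat_congruence:
  assumes A: "alt_mat n A" and B: "B \<in> carrier_mat n m"
  shows "alt_mat m (transpose_mat B * A * B)"
proof (rule alt_matI)
  note A' = alt_matD(1)[OF A]
  then show "transpose_mat B * A * B \<in> carrier_mat m m" using B by auto
  fix a :: "'a vec" assume a: "a \<in> carrier_vec m"
  have "a \<bullet> (transpose_mat B * A * B *\<^sub>v a) = a \<bullet> (transpose_mat B *\<^sub>v (A *\<^sub>v (B *\<^sub>v a)))"
    using A' B a by (simp add: assoc_mult_mat_vec[of _ m n _ m] assoc_mult_mat_vec[of _ m n _ n] assoc_mult_mat_vec[of _ n n _ m])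
  also have "\<dots> = (A *\<^sub>v (B *\<^sub>v a)) \<bullet> (B *\<^sub>v a)"
  proof -
    have "(transpose_mat B *\<^sub>v c) \<bullet> a = c \<bullet> (B *\<^sub>v a)" if "c \<in> carrier_vec n" for c
    proof -
      have "(\<Sum>i<m. (\<Sum>k<n. B $$ (k,i) * c $ k) * a $ i) = (\<Sum>k<n. c $ k * (\<Sum>i<m. B $$ (k,i) * a $ i))"
        unfolding sum_distrib_right sum_distrib_left by (subst sum.swap) (simp add: mult_ac)
      then show ?thesis using that a B by (simp add: scalar_prod_def lessThan_atLeast0)
    qed
    then show ?thesis using A' B a by (subst comm_scalar_prod[of _ m]) auto
  qed
  also have "\<dots> = (B *\<^sub>v a) \<bullet> (A *\<^sub>v (B *\<^sub>v a))" by (rule comm_scalar_prod[of _ n]) (use A' B a in auto)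
  finally show "a \<bullet> (transpose_mat B * A * B *\<^sub>v a) = 0" using alt_mat_quad[OF A, of "B *\<^sub>v a"] B a by simp
qed

text \<open>Fixed points have to contribute 0 by themselves, so the cancellation works in
  characteristic 2 as well.\<close>

lemma sum_involution_eq_0:
  fixes f :: "'b \<Rightarrow> 'a::ab_group_add"
  assumes "finite A" "\<And>x. x \<in> A \<Longrightarrow> \<phi> x \<in> A" "\<And>x. x \<in> A \<Longrightarrow> \<phi> (\<phi> x) = x"
    "\<And>x. x \<in> A \<Longrightarrow> f (\<phi> x) = - f x" "\<And>x. x \<in> A \<Longrightarrow> \<phi> x = x \<Longrightarrow> f x = 0"
  shows "sum f A = 0"
  using assms
proof (induction A rule: finite_psubset_induct)
  case (psubset A)
  show ?case
  proof (cases "A = {}")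
    case False
    then obtain x where x: "x \<in> A" by auto
    let ?B = "A - {x, \<phi> x}"
    have "\<phi> y \<in> ?B" if "y \<in> ?B" for y
      using that psubset.prems(1,2) x by (metis Diff_iff insert_iff empty_iff)
    then have "sum f ?B = 0" using psubset.prems x by (intro psubset.IH) auto
    moreover have "sum f {x, \<phi> x} = 0"
      using psubset.prems(3)[OF x] psubset.prems(4)[OF x] by (cases "\<phi> x = x") auto
    moreover have "sum f A = sum f ?B + sum f {x, \<phi> x}"
      using x psubset.prems(1)[OF x] psubset.hyps by (intro sum.subset_diff) auto
    ultimately show ?thesis by simp
  qed simp
qed

lemma even_card_involution:
  assumes "finite A" "\<And>x. x \<in> A \<Longrightarrow> \<phi> x \<in> A" "\<And>x. x \<in> A \<Longrightarrow> \<phi> (\<phi> x) = x" "\<And>x. x \<in> A \<Longrightarrow> \<phi> x \<noteq> x"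
  shows "even (card A)"
  using assms
proof (induction A rule: finite_psubset_induct)
  case (psubset A)
  show ?case
  proof (cases "A = {}")
    case False
    then obtain x where x: "x \<in> A" by auto
    let ?B = "A - {x, \<phi> x}"
    have "\<phi> y \<in> ?B" if "y \<in> ?B" for y
      using that psubset.prems(1,2) x by (metis Diff_iff insert_iff empty_iff)
    then have "even (card ?B)" using psubset.prems x by (intro psubset.IH) auto
    moreover have "card A = card ?B + card {x, \<phi> x}"
      using x psubset.prems(1)[OF x] psubset.hyps card_Un_disjoint[of ?B "{x, \<phi> x}"]
      by (metis Diff_disjoint Diff_partition Int_commute empty_subsetI finite.emptyI finite.insertI finite_Diff insert_subset sup_commute)
    moreover have "card {x, \<phi> x} = 2" using psubset.prems(3)[OF x] by auto
    ultimately show ?thesis by simp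
  qed simp
qed

text \<open>In the Leibniz formula the terms of \<open>p\<close> and of its inverse cancel because
  \<open>n\<close> is odd. A self-inverse \<open>p\<close> on an odd set has a fixed point, and its
  term then contains a diagonal entry, which is 0.\<close>

lemma det_alt_odd:
  fixes A :: "'a::field mat"
  assumes A: "alt_mat n A" and "odd n"
  shows "det A = 0"
proof -
  note A' = alt_matD(1)[OF A]
  show ?thesis unfolding det_def'[OF A']
  proof (rule sum_involution_eq_0[where \<phi> = Hilbert_Choice.inv])
    show "finite {p. p permutes {0..<n}}" by (simp add: finite_permutations)
    fix p :: "nat \<Rightarrow> nat" assume "p \<in> {p. p permutes {0..<n}}"
    then have p: "p permutes {0..<n}" by simp
    show "Hilbert_Choice.inv p \<in> {p. p permutes {0..<n}}" using p by (simp add: permutes_inv)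
    show "Hilbert_Choice.inv (Hilbert_Choice.inv p) = p" using p by (simp add: permutes_inv_inv)
    have pl: "p i < n" if "i < n" for i using p that by (metis atLeastLessThan_iff permutes_in_image zero_le)
    have "(\<Prod>i = 0..<n. A $$ (i, Hilbert_Choice.inv p i)) = (\<Prod>i = 0..<n. A $$ (p i, Hilbert_Choice.inv p (p i)))"
      by (rule prod.reindex_bij_betw[symmetric]) (rule permutes_imp_bij[OF p])
    also have "\<dots> = (\<Prod>i = 0..<n. - A $$ (i, p i))"
    proof (rule prod.cong[OF refl])
      fix i assume "i \<in> {0..<n}"
      then show "A $$ (p i, Hilbert_Choice.inv p (p i)) = - A $$ (i, p i)"
        using alt_matD(3)[OF A, of "p i" i] pl[of i] permutes_inverses(2)[OF p, of i] by auto
    qed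
    also have "\<dots> = - (\<Prod>i = 0..<n. A $$ (i, p i))" using \<open>odd n\<close> by (simp add: prod_uminus)
    finally show "signof (Hilbert_Choice.inv p) * (\<Prod>i = 0..<n. A $$ (i, Hilbert_Choice.inv p i)) = - (signof p * (\<Prod>i = 0..<n. A $$ (i, p i)))"
      using sign_inverse[OF permutes_imp_permutation[OF _ p]] by simp
    assume ip: "Hilbert_Choice.inv p = p"
    have "\<exists>i<n. p i = i"
    proof (rule ccontr)
      assume "\<not> ?thesis"
      then have "even (card {0..<n})"
        using pl permutes_inverses(1)[OF p] ip by (intro even_card_involution[where \<phi> = p]) auto
      with \<open>odd n\<close> show False by simp
    qed
    then obtain i where "i < n" "p i = i" by auto
    then have "(\<Prod>i = 0..<n. A $$ (i, p i)) = 0"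
      using alt_matD(2)[OF A, of i] by (intro prod_zero) (auto intro!: bexI[of _ i])
    then show "signof p * (\<Prod>i = 0..<n. A $$ (i, p i)) = 0" by simp
  qed
qed

text \<open>Congruence by the row reduction \<open>P\<close> confines the matrix to its leading
  \<open>t\<close> by \<open>t\<close> block. That block is alternating and invertible, and
  \<open>t\<close> is the rank.\<close>

theorem even_rk_alt:
  fixes A :: "'a::field mat"
  assumes A: "alt_mat n A"
  shows "even (rk n A)"
proof -
  note A' = alt_matD(1)[OF A]
  obtain P P' R t where P: "P \<in> carrier_mat n n" "P' \<in> carrier_mat n n" "P * P' = 1\<^sub>m n" "P' * P = 1\<^sub>m n"
    and t: "t \<le> n" and R: "R \<in> carrier_mat n t" and e: "pr n {..<t} * (P * A) = P * A" "(P * A) * R = inc n t"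
    by (rule echelon_obtain[OF A'])
  note [simp] = carrier_matD[OF A'] carrier_matD[OF P(1)] carrier_matD[OF P(2)] carrier_matD[OF R]
  have [simp]: "dim_row (inc a b :: 'a mat) = a" "dim_col (inc a b :: 'a mat) = b" for a b by (auto simp: inc_def)
  define B where "B = P * A * transpose_mat P"
  have B: "alt_mat n B" unfolding B_def using alt_mat_congruence[OF A, of "transpose_mat P" n] P by simp
  note B' = alt_matD(1)[OF B]
  have "rk n A = rk n (P * A)" by (rule rk_mult_inv_left[symmetric, OF P(1,2,4) A'])
  moreover have "transpose_mat P * transpose_mat P' = 1\<^sub>m n"
    using transpose_mult[OF P(2,1)] unfolding P(4) by simp
  then have "rk n B = rk n (P * A)" unfolding B_def
    by (rule rk_mult_inv_right[OF _ _ _ mult_carrier_mat[OF P(1) A'], rotated -1]) (simp_all add: P(1,2))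
  ultimately have rAB: "rk n A = rk n B" by (simp only:)
  have "pr n {..<t} * B = pr n {..<t} * (P * A) * transpose_mat P" unfolding B_def by (simp add: mat_assoc)
  then have "pr n {..<t} * B = B" unfolding e(1) B_def .
  then have B0: "B $$ (i,j) = 0" if "i < n" "j < n" "i \<ge> t" for i j
    using pr_mult_left_index[OF B' that(1,2), of "{..<t}"] that by simp
  then have B1: "B $$ (i,j) = 0" if "i < n" "j < n" "j \<ge> t" for i j
    using B0[of j i] alt_matD(3)[OF B, of i j] that by auto
  define D where "D = inc t n * B * inc n t"
  have D: "D \<in> carrier_mat t t" unfolding D_def using B' by auto
  have "alt_mat t D"
  proof -
    have "transpose_mat (inc n t) = (inc t n :: 'a mat)" by (rule eq_matI) (auto simp: inc_def)
    then show ?thesis using alt_mat_congruence[OF B, of "inc n t" t] by (simp add: D_def)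
  qed
  moreover have "det D \<noteq> 0"
  proof -
    have "inc n t * D * inc t n = pr n {..<t} * B * pr n {..<t}"
      unfolding D_def inc_mult_transpose[symmetric] using B' by (simp add: mat_assoc)
    also have "\<dots> = B"
    proof (rule eq_matI)
      fix i j assume "i < dim_row B" "j < dim_col B"
      then have ij: "i < n" "j < n" using B' by auto
      have c: "pr n {..<t} * B \<in> carrier_mat n n" using B' by auto
      show "(pr n {..<t} * B * pr n {..<t}) $$ (i,j) = B $$ (i,j)"
        unfolding pr_mult_right_index[OF c ij] pr_mult_left_index[OF B' ij] using B0[OF ij] B1[OF ij] by auto
    qed (use B' in auto)
    finally have "rk n B \<le> rk t D" using rk_factor_le[OF inc_carrier D inc_carrier, of n n] by simp
    moreover have "t \<le> rk n A"
    proof -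
      have "rk n (inc n t :: 'a mat) = t"
        by (rule rk_left_invertible[of _ _ _ "inc t n"]) (auto simp: inc_transpose_mult t)
      then show ?thesis using rk_factor_le[OF P(1) A' R] e(2) by simp
    qed
    ultimately have "rk t D = t" using rAB rk_le_nc[OF D] by simp
    then show ?thesis using vec_space.det_rank_iff[OF D] by simp
  qed
  ultimately have "even t" using det_alt_odd by blast
  moreover have "rk n A = t"
  proof (rule antisym)
    have "rk n (P * A) \<le> rk n (pr n {..<t} :: 'a mat)" using rk_prod_le_left[OF pr_carrier, of "P * A" n n "{..<t}"] e(1) P A' by simp
    also have "\<dots> \<le> t" using card_mono[of "{..<t}" "{..<t} \<inter> {..<n}"] by (simp add: rk_pr)
    finally show "rk n A \<le> t" using rk_mult_inv_left[OF P(1,2,4) A'] by simp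
    have "rk n (inc n t :: 'a mat) = t"
      by (rule rk_left_invertible[of _ _ _ "inc t n"]) (auto simp: inc_transpose_mult t)
    then show "t \<le> rk n A" using rk_factor_le[OF P(1) A' R] e(2) by simp
  qed
  ultimately show ?thesis by simp
qed

section \<open>Matrices raising a weight\<close>

text \<open>The row index is the target: a nonzero entry at \<open>(i,j)\<close> sends
  \<open>e_j\<close> towards the strictly heavier \<open>e_i\<close>. The companion
  \<open>wunip\<close> is the condition that cuts the unipotent radical out of the group.\<close>

definition raises :: "nat \<Rightarrow> (nat \<Rightarrow> int) \<Rightarrow> 'a::field mat \<Rightarrow> bool" where
  "raises n w X \<longleftrightarrow> X \<in> carrier_mat n n \<and> (\<forall>i<n. \<forall>j<n. w i \<le> w j \<longrightarrow> X $$ (i,j) = 0)"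

definition wunip :: "nat \<Rightarrow> (nat \<Rightarrow> int) \<Rightarrow> 'a::field mat \<Rightarrow> bool" where
  "wunip n w A \<longleftrightarrow> A \<in> carrier_mat n n \<and> (\<forall>i<n. \<forall>j<n. w i \<le> w j \<longrightarrow> A $$ (i,j) = (if i = j then 1 else 0))"

lemma raisesD: "raises n w X \<Longrightarrow> X \<in> carrier_mat n n" "raises n w X \<Longrightarrow> i < n \<Longrightarrow> j < n \<Longrightarrow> w i \<le> w j \<Longrightarrow> X $$ (i,j) = 0"
  by (auto simp: raises_def)

lemma mat_mult_index:
  assumes "A \<in> carrier_mat n m" "B \<in> carrier_mat m p" "i < n" "j < p"
  shows "(A * B) $$ (i,j) = (\<Sum>k<m. A $$ (i,k) * B $$ (k,j))"
  using assms by (simp add: scalar_prod_def lessThan_atLeast0)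

lemma wunip_iff: "A \<in> carrier_mat n n \<Longrightarrow> wunip n w A \<longleftrightarrow> raises n w (A - 1\<^sub>m n)"
  unfolding wunip_def raises_def by (auto split: if_splits)

lemma raises_add: "raises n w X \<Longrightarrow> raises n w Y \<Longrightarrow> raises n w (X + Y)"
  by (auto simp: raises_def)

lemma raises_smult: "raises n w X \<Longrightarrow> raises n w (c \<cdot>\<^sub>m X)"
  by (auto simp: raises_def)

lemma raises_mult:
  assumes X: "raises n w X" and Y: "raises n w Y"
  shows "raises n w (X * Y)"
  unfolding raises_def
proof (intro conjI allI impI)
  note c = raisesD(1)[OF X] raisesD(1)[OF Y]
  then show "X * Y \<in> carrier_mat n n" by simp
  fix i j assume ij: "i < n" "j < n" "w i \<le> w j"
  have "X $$ (i,k) * Y $$ (k,j) = 0" if "k < n" for k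
    using raisesD(2)[OF X ij(1) that] raisesD(2)[OF Y that ij(2)] ij(3) by (cases "w i \<le> w k") auto
  then show "(X * Y) $$ (i,j) = 0" unfolding mat_mult_index[OF c ij(1,2)] by (intro sum.neutral) simp
qed

lemma wunip_add1: "raises n w X \<Longrightarrow> wunip n w (1\<^sub>m n + X)"
  by (auto simp: wunip_def raises_def)

lemma wunip_mult:
  assumes A: "wunip n w A" and B: "wunip n w B"
  shows "wunip n w (A * B)"
proof -
  have c: "A \<in> carrier_mat n n" "B \<in> carrier_mat n n" using A B by (auto simp: wunip_def)
  define X where "X = A - 1\<^sub>m n"
  define Y where "Y = B - 1\<^sub>m n"
  have XY: "raises n w X" "raises n w Y" using A B c by (auto simp: X_def Y_def wunip_iff)
  have e: "A = 1\<^sub>m n + X" "B = 1\<^sub>m n + Y" using c by (auto simp: X_def Y_def intro!: eq_matI)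
  have "A * B = (1\<^sub>m n + X) + (Y + X * Y)"
    unfolding e using raisesD(1)[OF XY(1)] raisesD(1)[OF XY(2)]
    by (simp add: mat_add_distrib carrier_matD[OF raisesD(1)[OF XY(1)]] carrier_matD[OF raisesD(1)[OF XY(2)]])
  also have "\<dots> = 1\<^sub>m n + (X + (Y + X * Y))"
    using raisesD(1)[OF XY(1)] raisesD(1)[OF XY(2)] by (intro assoc_add_mat[of _ n n]) auto
  finally show ?thesis using XY by (simp add: wunip_add1 raises_add raises_mult)
qed

text \<open>A permutation preserves the total weight, so unless it is the identity it moves some
  \<open>i\<close> to an index of at least the same weight, and the entry there is 0.\<close>

lemma det_wunip:
  assumes A: "wunip n w A"
  shows "det A = 1"
proof -
  have c: "A \<in> carrier_mat n n" using A by (simp add: wunip_def)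
  have "signof p * (\<Prod>i = 0..<n. A $$ (i, p i)) = (if p = id then 1 else 0)" if p: "p permutes {0..<n}" for p
  proof (cases "p = id")
    case True
    have "(\<Prod>i = 0..<n. A $$ (i, i)) = 1" using A by (intro prod.neutral) (auto simp: wunip_def)
    then show ?thesis using True by simp
  next
    case False
    have pl: "p i < n" if "i < n" for i using p that by (metis atLeastLessThan_iff permutes_in_image zero_le)
    have "\<exists>i<n. w i \<le> w (p i) \<and> p i \<noteq> i"
    proof (rule ccontr)
      assume "\<not> ?thesis"
      then have lt: "w (p i) < w i" if "i < n" "p i \<noteq> i" for i using that by force
      obtain k where k: "p k \<noteq> k" using False by (auto simp: fun_eq_iff)
      then have kn: "k < n" using p by (meson atLeastLessThan_iff permutes_not_in zero_le)
      have "(\<Sum>i = 0..<n. w (p i)) < (\<Sum>i = 0..<n. w i)"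
      proof (rule sum_strict_mono_ex1)
        show "\<forall>i\<in>{0..<n}. w (p i) \<le> w i" using lt by (metis atLeastLessThan_iff less_le_not_le order_refl)
        show "\<exists>i\<in>{0..<n}. w (p i) < w i" using lt[OF kn k] kn by (intro bexI[of _ k]) auto
      qed simp
      moreover have "(\<Sum>i = 0..<n. w (p i)) = (\<Sum>i = 0..<n. w i)"
        by (rule sum.reindex_bij_betw) (rule permutes_imp_bij[OF p])
      ultimately show False by simp
    qed
    then obtain i where "i < n" "w i \<le> w (p i)" "p i \<noteq> i" by auto
    then have "A $$ (i, p i) = 0" using A pl by (auto simp: wunip_def)
    then have "(\<Prod>i = 0..<n. A $$ (i, p i)) = 0" using \<open>i < n\<close> by (intro prod_zero) auto
    then show ?thesis using False by simp
  qed
  then have "det A = (\<Sum>p\<in>{p. p permutes {0..<n}}. if p = id then 1 else 0)"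
    unfolding det_def'[OF c] by (intro sum.cong) auto
  also have "\<dots> = 1" by (simp add: finite_permutations permutes_id)
  finally show ?thesis .
qed

text \<open>The rows of the inverse are determined in order of increasing weight: apart from
  \<open>B $$ (i,j)\<close> itself, the \<open>(i,j)\<close> entry of \<open>A * B = 1\<close>
  involves only rows of \<open>B\<close> of strictly smaller weight than row
  \<open>i\<close>.\<close>

lemma wunip_inverse:
  assumes A: "wunip n w A"
  obtains B where "wunip n w B" "A * B = 1\<^sub>m n" "B * A = 1\<^sub>m n"
proof -
  have c: "A \<in> carrier_mat n n" using A by (simp add: wunip_def)
  have "A \<in> Units (ring_mat TYPE('a) n ())" using det_non_zero_imp_unit[OF c] det_wunip[OF A] by simp
  then obtain B where B: "B \<in> carrier_mat n n" "A * B = 1\<^sub>m n" "B * A = 1\<^sub>m n"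
    unfolding Units_def ring_mat_def by auto
  have "\<forall>i<n. w i = t \<longrightarrow> (\<forall>j<n. w i \<le> w j \<longrightarrow> B $$ (i,j) = (if i = j then 1 else 0))" for t
  proof -
    have fin: "finite (w ` {..<n})" by simp
    define lo where "lo = (if n = 0 then 0 else Min (w ` {..<n}))"
    have lo: "lo \<le> w i" if "i < n" for i using that by (auto simp: lo_def)
    show ?thesis
    proof (induction "nat (t - lo)" arbitrary: t rule: less_induct)
      case less
      show ?case
      proof (intro allI impI)
        fix i j assume i: "i < n" and t: "w i = t" and j: "j < n" and ij: "w i \<le> w j"
        have z: "A $$ (i,k) * B $$ (k,j) = (if k = i then B $$ (i,j) else 0)" if k: "k < n" for k
        proof (cases "w i \<le> w k")
          case True then show ?thesis using A i k by (auto simp: wunip_def)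
        next
          case False
          then have "nat (w k - lo) < nat (t - lo)" using t lo[OF i] lo[OF k] by simp
          from less[OF this] k j False ij have "B $$ (k,j) = (if k = j then 1 else 0)" by auto
          moreover have "k \<noteq> j" "k \<noteq> i" using False ij by auto
          ultimately show ?thesis by simp
        qed
        have "(1\<^sub>m n) $$ (i,j) = (\<Sum>k<n. A $$ (i,k) * B $$ (k,j))"
          unfolding B(2)[symmetric] by (rule mat_mult_index[OF c B(1) i j])
        also have "\<dots> = (\<Sum>k<n. if k = i then B $$ (i,j) else 0)" using z by (intro sum.cong) auto
        also have "\<dots> = B $$ (i,j)" using i by simp
        finally show "B $$ (i,j) = (if i = j then 1 else 0)" using i j by simp
      qed
    qed
  qed
  then have "wunip n w B" using B(1) by (auto simp: wunip_def)
  then show thesis using that B by blast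
qed

lemma raises_nilpotent:
  assumes X: "raises n w X"
  obtains K where "X ^\<^sub>m K = 0\<^sub>m n n"
proof -
  have c: "X \<in> carrier_mat n n" by (rule raisesD[OF X])
  define lo where "lo = (if n = 0 then 0 else Min (w ` {..<n}))"
  define hi where "hi = (if n = 0 then 0 else Max (w ` {..<n}))"
  have lohi: "lo \<le> w i" "w i \<le> hi" if "i < n" for i using that by (auto simp: lo_def hi_def)
  have p: "(X ^\<^sub>m k) $$ (i,j) = 0" if "i < n" "j < n" "w i < w j + int k" for i j k
    using that
  proof (induction k arbitrary: i j)
    case 0 then show ?case using c by auto
  next
    case (Suc k)
    have "(X ^\<^sub>m k) $$ (i,l) * X $$ (l,j) = 0" if "l < n" for l
      using Suc.IH[OF Suc.prems(1) that] raisesD(2)[OF X that Suc.prems(2)] Suc.prems(3) by (cases "w i < w l + int k") auto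
    then show ?case unfolding pow_mat.simps mat_mult_index[OF pow_carrier_mat[OF c] c Suc.prems(1,2)] by (intro sum.neutral) simp
  qed
  have "X ^\<^sub>m nat (hi - lo + 1) = 0\<^sub>m n n"
  proof (rule eq_matI)
    fix i j assume "i < dim_row (0\<^sub>m n n :: 'a mat)" "j < dim_col (0\<^sub>m n n :: 'a mat)"
    then have ij: "i < n" "j < n" by auto
    show "(X ^\<^sub>m nat (hi - lo + 1)) $$ (i,j) = 0\<^sub>m n n $$ (i,j)"
      using p[OF ij, of "nat (hi - lo + 1)"] lohi[OF ij(1)] lohi[OF ij(2)] ij by simp
  qed (use c pow_carrier_mat[OF c] in auto)
  then show thesis by (rule that)
qed

text \<open>Peel off the smallest weight of \<open>I\<close>: \<open>X\<close> maps the span of the weights \<open>\<ge> m\<close> into that of the weights \<open>> m\<close>.\<close>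

lemma rk_raises_pow_aux:
  assumes X: "raises n w X" and T: "T \<subseteq> {..<n}"
    and stable: "\<And>i j. i < n \<Longrightarrow> j \<in> T \<Longrightarrow> X $$ (i,j) \<noteq> 0 \<Longrightarrow> i \<in> T"
    and I: "finite I" "\<And>t. t \<in> I \<Longrightarrow> s \<le> t"
  shows "rk n (X ^\<^sub>m card I * pr n {i \<in> T. s \<le> w i}) + card {i \<in> T. w i \<in> I} \<le> card {i \<in> T. s \<le> w i}"
  using I
proof (induction "card I" arbitrary: I s)
  case 0
  then have "I = {}" by simp
  have "{i \<in> T. s \<le> w i} \<inter> {..<n} = {i \<in> T. s \<le> w i}" using T by auto
  then show ?case using raisesD(1)[OF X] \<open>I = {}\<close> by (simp add: rk_pr)
next
  case (Suc r)
  note c = raisesD(1)[OF X]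
  note [simp] = carrier_matD[OF c]
  have finT: "finite T" using T finite_subset by blast
  have "I \<noteq> {}" using Suc by auto
  define m where "m = Min I"
  define I' where "I' = I - {m}"
  have mI: "m \<in> I" using \<open>I \<noteq> {}\<close> Suc by (simp add: m_def)
  have sm: "s \<le> m" using Suc.prems mI by auto
  have r: "r = card I'" "finite I'" using Suc mI by (auto simp: I'_def)
  have gt: "m + 1 \<le> t" if "t \<in> I'" for t
    using that Suc.prems(1) Min_le[of I t] by (auto simp: I'_def m_def order.order_iff_strict)
  let ?E = "\<lambda>s. pr n {i \<in> T. s \<le> w i} :: 'a mat"
  \<comment> \<open>The weights from \<open>s\<close> up to \<open>m\<close> lie outside
    \<open>I\<close>; they may contribute their full dimension to the rank.\<close>
  let ?D = "pr n {i \<in> T. s \<le> w i \<and> w i < m} :: 'a mat"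
  have IH: "rk n (X ^\<^sub>m r * ?E (m + 1)) + card {i \<in> T. w i \<in> I'} \<le> card {i \<in> T. m + 1 \<le> w i}"
    using Suc.hyps(1)[OF r(1) r(2) gt] r(1) by simp
  have "{i \<in> T. s \<le> w i} = {i \<in> T. m \<le> w i} \<union> {i \<in> T. s \<le> w i \<and> w i < m}" using sm by auto
  then have split: "?E s = ?E m + ?D" by (simp only:, intro pr_disjoint_add) auto
  have XE: "X * ?E m = ?E (m + 1) * (X * ?E m)"
  proof (rule eq_matI)
    fix i j assume "i < dim_row (?E (m + 1) * (X * ?E m))" "j < dim_col (?E (m + 1) * (X * ?E m))"
    then have ij: "i < n" "j < n" by auto
    have XEc: "X * ?E m \<in> carrier_mat n n" using c by auto
    show "(X * ?E m) $$ (i,j) = (?E (m + 1) * (X * ?E m)) $$ (i,j)"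
      unfolding pr_mult_left_index[OF XEc ij] pr_mult_right_index[OF c ij]
    proof (cases "X $$ (i,j) = 0 \<or> j \<notin> T \<or> w j < m")
      case False
      then have "i \<in> T" "w j < w i" using stable[OF ij(1), of j] raisesD(2)[OF X ij] by (auto simp: not_le[symmetric])
      then show "(if j \<in> {i \<in> T. m \<le> w i} then X $$ (i, j) else 0) =
        (if i \<in> {i \<in> T. m + 1 \<le> w i} then if j \<in> {i \<in> T. m \<le> w i} then X $$ (i, j) else 0 else 0)"
        using False by simp
    qed auto
  qed auto
  have card: "card I = Suc r" using Suc by simp
  have "rk n (X ^\<^sub>m card I * ?E s) \<le> rk n (X ^\<^sub>m Suc r * ?E m) + rk n (X ^\<^sub>m Suc r * ?D)"
    unfolding split card using rk_add[of "X ^\<^sub>m Suc r * ?E m" n n "X ^\<^sub>m Suc r * ?D"] pow_carrier_mat[OF c, of "Suc r"]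
    by (simp add: mat_add_distrib del: pow_mat.simps)
  also have "X ^\<^sub>m Suc r * ?E m = (X ^\<^sub>m r * ?E (m + 1)) * (X * ?E m)"
    using XE by (simp add: mat_assoc)
  also have "rk n \<dots> \<le> rk n (X ^\<^sub>m r * ?E (m + 1))"
    by (rule rk_prod_le_left[of _ n n _ n]) (use c in \<open>auto intro!: mult_carrier_mat[of _ n n] pow_carrier_mat\<close>)
  also have "rk n (X ^\<^sub>m Suc r * ?D) \<le> rk n ?D"
    by (rule rk_prod_le_right[of _ n n _ n]) (use c in \<open>auto intro!: mult_carrier_mat[of _ n n] pow_carrier_mat\<close>)
  also have "rk n ?D = card {i \<in> T. s \<le> w i \<and> w i < m}"
  proof -
    have "{i \<in> T. s \<le> w i \<and> w i < m} \<inter> {..<n} = {i \<in> T. s \<le> w i \<and> w i < m}" using T by auto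
    then show ?thesis by (simp add: rk_pr)
  qed
  finally have 1: "rk n (X ^\<^sub>m card I * ?E s) \<le> rk n (X ^\<^sub>m r * ?E (m + 1)) + card {i \<in> T. s \<le> w i \<and> w i < m}" by simp
  have 2: "card {i \<in> T. w i \<in> I} = card {i \<in> T. w i \<in> I'} + card {i \<in> T. w i = m}"
  proof -
    have "{i \<in> T. w i \<in> I} = {i \<in> T. w i \<in> I'} \<union> {i \<in> T. w i = m}" using mI by (auto simp: I'_def)
    then show ?thesis using finT by (simp add: card_Un_disjoint I'_def disjoint_iff)
  qed
  have 3: "card {i \<in> T. s \<le> w i} = card {i \<in> T. s \<le> w i \<and> w i < m} + (card {i \<in> T. w i = m} + card {i \<in> T. m + 1 \<le> w i})"
  proof -
    have "{i \<in> T. s \<le> w i} = {i \<in> T. s \<le> w i \<and> w i < m} \<union> ({i \<in> T. w i = m} \<union> {i \<in> T. m + 1 \<le> w i})" using sm by auto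
    then show ?thesis using finT by (simp add: card_Un_disjoint disjoint_iff)
  qed
  show ?case using 1 2 3 IH by simp
qed

text \<open>The peeling spends one factor \<open>X\<close> on each weight of \<open>I\<close>,
  starting below all weights. A stable \<open>T\<close> smaller than the whole basis serves the
  compression of \<open>x\<close> to the coordinates outside a totally singular subspace.\<close>

theorem rk_raises_pow:
  assumes X: "raises n w X" and T: "T \<subseteq> {..<n}"
    and stable: "\<And>i j. i < n \<Longrightarrow> j \<in> T \<Longrightarrow> X $$ (i,j) \<noteq> 0 \<Longrightarrow> i \<in> T"
    and I: "finite I"
  shows "rk n (X ^\<^sub>m card I * pr n T) + card {i \<in> T. w i \<in> I} \<le> card T"
proof -
  have fin: "finite (w ` T \<union> I)" using T I finite_subset by blast
  define s where "s = (if w ` T \<union> I = {} then 0 else Min (w ` T \<union> I))"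
  have s: "s \<le> t" if "t \<in> w ` T \<union> I" for t using that fin by (auto simp: s_def)
  have "{i \<in> T. s \<le> w i} = T" using s by auto
  then show ?thesis using rk_raises_pow_aux[of n w X T I s, OF X T stable I] s by auto
qed

section \<open>Parity of ranks for isometries\<close>

lemma pow_mat_commute:
  assumes "A \<in> carrier_mat n n" "B \<in> carrier_mat n n" "A * B = B * (A :: 'a::semiring_1 mat)"
  shows "A ^\<^sub>m k * B = B * A ^\<^sub>m k"
proof (induction k)
  case (Suc k)
  note [simp] = carrier_matD[OF assms(1)] carrier_matD[OF assms(2)]
  have "A ^\<^sub>m Suc k * B = A ^\<^sub>m k * (B * A)" by (simp add: mat_assoc assms(3))
  also have "\<dots> = (A ^\<^sub>m k * B) * A" by (simp add: mat_assoc)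
  also have "\<dots> = B * A ^\<^sub>m Suc k" unfolding Suc by (simp add: mat_assoc)
  finally show ?case .
qed (use assms in simp)

lemma pow_mat_inverse:
  assumes "A \<in> carrier_mat n n" "B \<in> carrier_mat n n" "A * B = (1\<^sub>m n :: 'a::semiring_1 mat)"
  shows "A ^\<^sub>m k * B ^\<^sub>m k = 1\<^sub>m n"
proof (induction k)
  case (Suc k)
  note [simp] = carrier_matD[OF assms(1)] carrier_matD[OF assms(2)]
  have "A ^\<^sub>m Suc k * B ^\<^sub>m Suc k = A ^\<^sub>m k * (A * (B * B ^\<^sub>m k))"
    unfolding pow_mat_Suc_left[OF assms(2)] by (simp add: mat_assoc)
  also have "\<dots> = 1\<^sub>m n" using Suc by (simp add: mat_cancel[OF assms(3)])
  finally show ?case .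
qed (use assms in simp)

lemma mat_diff_simps:
  fixes A B C :: "'a::ring_1 mat"
  assumes "dim_row A = dim_row B" "dim_col A = dim_col B"
  shows "- (A - B) = B - A" "A - (A - B) = B" "A + (B - A) = B"
    and "dim_row C = dim_row B \<Longrightarrow> dim_col C = dim_col B \<Longrightarrow> A + ((B - A) + (C - B)) = C"
  using assms by (auto intro!: eq_matI)

lemma mat_square_half:
  fixes X Y :: "'a::field mat"
  assumes "(2::'a) \<noteq> 0" "X \<in> carrier_mat n n" "Y \<in> carrier_mat n n"
  shows "1\<^sub>m n + X + (X + Y) - 1\<^sub>m n = 2 \<cdot>\<^sub>m (X + inverse 2 \<cdot>\<^sub>m Y)"
  using assms by (auto intro!: eq_matI simp: field_simps)

lemma mat_uminus_minus: "dim_row A = dim_row B \<Longrightarrow> dim_col A = dim_col B \<Longrightarrow> - (A - B) = B - (A :: 'a::ring_1 mat)"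
  by (rule mat_diff_simps)

lemma mat_smult_mult:
  fixes A B :: "'a::comm_ring_1 mat"
  assumes "dim_col A = dim_row B"
  shows "(c \<cdot>\<^sub>m A) * B = c \<cdot>\<^sub>m (A * B)" "A * (c \<cdot>\<^sub>m B) = c \<cdot>\<^sub>m (A * B)"
  by (rule mult_smult_assoc_mat[of A "dim_row A" "dim_col A" B "dim_col B"] mult_smult_distrib[of A "dim_row A" "dim_col A" B "dim_col B"];
    rule carrier_matI; simp add: assms)+

lemma mat_uminus_mult:
  fixes A B :: "'a::comm_ring_1 mat"
  assumes "dim_col A = dim_row B"
  shows "(- A) * B = - (A * B)" "A * (- B) = - (A * B)"
  using assms by auto

lemma mat_minus_transpose: "dim_row A = dim_row B \<Longrightarrow> dim_col A = dim_col B \<Longrightarrow>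
    transpose_mat (A - B) = transpose_mat A - transpose_mat (B :: 'a::ring_1 mat)"
  by (auto intro!: eq_matI)

lemma mat_vec_assoc:
  fixes A B :: "'a::field mat"
  shows "dim_col A = dim_row B \<Longrightarrow> dim_vec v = dim_col B \<Longrightarrow> A * B *\<^sub>v v = A *\<^sub>v (B *\<^sub>v v)"
  by (rule assoc_mult_mat_vec[of A "dim_row A" "dim_col A" B "dim_col B"]; (rule carrier_matI carrier_vecI; simp))

lemma mat_mult_one: "dim_col A = n \<Longrightarrow> A * 1\<^sub>m n = A" "dim_row A = n \<Longrightarrow> 1\<^sub>m n * A = (A :: 'a::semiring_1 mat)"
  by (auto intro: carrier_matI)

locale isometry =
  fixes n :: nat and G H v u :: "'a::field mat"
  assumes car: "G \<in> carrier_mat n n" "H \<in> carrier_mat n n" "v \<in> carrier_mat n n" "u \<in> carrier_mat n n"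
    and GH: "G * H = 1\<^sub>m n" "H * G = 1\<^sub>m n"
    and vu: "v * u = 1\<^sub>m n" "u * v = 1\<^sub>m n"
    and iso: "transpose_mat v * G * v = G"
begin

definition x where "x = v - 1\<^sub>m n"

lemma x_car: "x \<in> carrier_mat n n"
  unfolding x_def by (rule minus_carrier_mat) simp

lemmas dims [simp] = carrier_matD[OF car(1)] carrier_matD[OF car(2)] carrier_matD[OF car(3)] carrier_matD[OF car(4)]
  carrier_matD[OF x_car]

lemma vtG: "transpose_mat v * G = G * u"
proof -
  have "transpose_mat v * G * v * u = G * u" by (simp only: iso)
  then show ?thesis by (simp add: mat_assoc vu)
qed

lemma utG: "transpose_mat u * G = G * v"
proof -
  have "transpose_mat u * transpose_mat v = 1\<^sub>m n"
    using transpose_mult[OF car(3,4)] by (simp add: vu)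
  then have "transpose_mat u * (transpose_mat v * (G * v)) = G * v" by (rule mat_cancel) auto
  then show ?thesis using iso by (simp add: mat_assoc)
qed

lemma ux: "u * x = x * u" "u * x = 1\<^sub>m n - u"
  unfolding x_def by (simp_all add: mat_add_distrib vu mat_mult_one)

text \<open>The adjoint of \<open>v - 1\<close> is \<open>u - 1 = - u * x\<close>, so up to a unit
  commuting with \<open>x\<close> the adjoint of \<open>x\<close> is \<open>x\<close> again.\<close>

lemma xtG: "transpose_mat x * G = G * ((- u) * x)"
proof -
  have "transpose_mat x * G = transpose_mat v * G - transpose_mat (1\<^sub>m n) * G"
    unfolding x_def by (simp add: mat_minus_transpose mat_add_distrib)
  also have "\<dots> = G * (u - 1\<^sub>m n)"
    by (simp add: vtG mat_add_distrib mat_mult_one)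
  also have "u - 1\<^sub>m n = (- u) * x"
    by (simp add: ux(2) mat_uminus_mult mat_diff_simps)
  finally show ?thesis .
qed

lemma negu: "- u \<in> carrier_mat n n" "- v \<in> carrier_mat n n" "(- u) * (- v) = 1\<^sub>m n" "(- v) * (- u) = 1\<^sub>m n" "(- u) * x = x * (- u)"
  by (simp_all add: mat_uminus_mult vu ux(1) car)

lemma xptG: "transpose_mat (x ^\<^sub>m l) * G = G * ((- u) ^\<^sub>m l * x ^\<^sub>m l)"
proof (induction l)
  case 0 then show ?case using car x_car by simp
next
  case (Suc l)
  have [simp]: "dim_row (- u) = n" "dim_col (- u) = n" by auto
  have "transpose_mat (x ^\<^sub>m Suc l) * G = transpose_mat x * (transpose_mat (x ^\<^sub>m l) * G)"
    using transpose_mult[OF pow_carrier_mat[OF x_car] x_car] by (simp add: mat_assoc)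
  also have "\<dots> = (transpose_mat x * G) * ((- u) ^\<^sub>m l * x ^\<^sub>m l)" unfolding Suc by (simp add: mat_assoc)
  also have "\<dots> = G * ((- u) * (x * (- u) ^\<^sub>m l) * x ^\<^sub>m l)" unfolding xtG by (simp add: mat_assoc)
  also have "x * (- u) ^\<^sub>m l = (- u) ^\<^sub>m l * x" by (rule pow_mat_commute[symmetric, OF negu(1) x_car negu(5)])
  also have "G * ((- u) * ((- u) ^\<^sub>m l * x) * x ^\<^sub>m l) = G * ((- u) ^\<^sub>m Suc l * x ^\<^sub>m Suc l)"
    unfolding pow_mat_Suc_left[OF negu(1)] pow_mat_Suc_left[OF x_car] by (simp add: mat_assoc)
  finally show ?case .
qed

lemma rk_xptG:
  assumes M: "M \<in> carrier_mat n n"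
  shows "rk n (transpose_mat (x ^\<^sub>m l) * G * M) = rk n (x ^\<^sub>m l * M)"
proof -
  have [simp]: "dim_row (- u) = n" "dim_col (- u) = n" "dim_row M = n" "dim_col M = n" using M by auto
  have "transpose_mat (x ^\<^sub>m l) * G * M = G * ((- u) ^\<^sub>m l * (x ^\<^sub>m l * M))"
    unfolding xptG by (simp add: mat_assoc)
  moreover have c: "x ^\<^sub>m l * M \<in> carrier_mat n n" by (rule carrier_matI; simp)
  moreover have "rk n ((- u) ^\<^sub>m l * (x ^\<^sub>m l * M)) = rk n (x ^\<^sub>m l * M)"
    by (rule rk_mult_inv_left[OF pow_carrier_mat[OF negu(1)] pow_carrier_mat[OF negu(2)] pow_mat_inverse[OF negu(2,1,4)] c])
  moreover have "rk n (G * ((- u) ^\<^sub>m l * (x ^\<^sub>m l * M))) = rk n ((- u) ^\<^sub>m l * (x ^\<^sub>m l * M))"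
    by (rule rk_mult_inv_left[OF car(1,2) GH(2)]) ((rule carrier_matI; simp)+)
  ultimately show ?thesis by simp
qed

text \<open>Moving one factor \<open>x^l\<close> across the form shows that the alternating Gram
  matrix of the form on the image of \<open>x^l\<close> has the rank of
  \<open>x^(2l)\<close>.\<close>

lemma even_rk_alternating_form:
  assumes "alt_mat n G"
  shows "even (rk n (x ^\<^sub>m (2 * l)))"
proof -
  have "alt_mat n (transpose_mat (x ^\<^sub>m l) * G * x ^\<^sub>m l)"
    by (rule alt_mat_congruence[OF assms pow_carrier_mat[OF x_car]])
  from even_rk_alt[OF this] show ?thesis
    using rk_xptG[OF pow_carrier_mat[OF x_car], of l l] pow_mat_add[OF x_car, of l l] by (simp add: mult_2)
qed

text \<open>For a symmetric form \<open>G * (v - u)\<close> is skew, hence alternating where 2 is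
  invertible, and \<open>v - u\<close> is \<open>x\<close> times a unit commuting with
  \<open>x\<close>. Placing it between two factors \<open>x^l\<close> produces the rank of
  \<open>x^(2l+1)\<close>.\<close>

lemma even_rk_symmetric_form:
  assumes sym: "transpose_mat G = G" and two: "(2::'a) \<noteq> 0" and w: "wunip n w v"
  shows "even (rk n (x ^\<^sub>m (2 * l + 1)))"
proof -
  define A where "A = G * (v - u)"
  have A: "A \<in> carrier_mat n n" unfolding A_def by (rule carrier_matI; simp)
  have "transpose_mat A = transpose_mat (v - u) * transpose_mat G"
    unfolding A_def by (rule transpose_mult[of _ n n _ n]) ((rule carrier_matI; simp)+)
  also have "\<dots> = transpose_mat v * G - transpose_mat u * G"
    by (simp add: sym mat_minus_transpose mat_add_distrib)
  also have "\<dots> = G * (u - v)" by (simp add: vtG utG mat_add_distrib)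
  finally have At: "transpose_mat A = G * (u - v)" .
  have skew: "A $$ (j,i) = - A $$ (i,j)" if "i < n" "j < n" for i j
  proof -
    have "A $$ (j,i) = transpose_mat A $$ (i,j)" using A that by simp
    also have "transpose_mat A = - A" unfolding At unfolding A_def
      by (simp add: mat_add_distrib mat_uminus_minus)
    finally show ?thesis using A that by simp
  qed
  have "alt_mat n A" unfolding alt_mat_def
  proof (intro conjI allI impI A)
    fix i assume "i < n"
    with skew[of i i] have "2 * A $$ (i,i) = 0" by (metis add.right_inverse mult_2)
    then show "A $$ (i,i) = 0" using two by simp
  qed (use skew in blast)
  then have alt: "alt_mat n (transpose_mat (x ^\<^sub>m l) * A * x ^\<^sub>m l)"
    by (rule alt_mat_congruence[OF _ pow_carrier_mat[OF x_car]])
  \<comment> \<open>The unit comes from \<open>v^2 - 1 = 2 x + x^2 = 2 h x\<close>; it is invertible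
    because \<open>x\<close> raises weights.\<close>
  define h where "h = 1\<^sub>m n + inverse 2 \<cdot>\<^sub>m x"
  have h: "wunip n w h" unfolding h_def
    using w by (intro wunip_add1 raises_smult) (simp add: wunip_iff[OF car(3)] x_def)
  then have hc: "h \<in> carrier_mat n n" by (simp add: wunip_def)
  obtain h' where h': "wunip n w h'" "h * h' = 1\<^sub>m n" "h' * h = 1\<^sub>m n" by (rule wunip_inverse[OF h])
  then have hc': "h' \<in> carrier_mat n n" by (simp add: wunip_def)
  have [simp]: "dim_row h = n" "dim_col h = n" "dim_row h' = n" "dim_col h' = n" using hc hc' by auto
  have vdef: "v = 1\<^sub>m n + x" unfolding x_def by (simp add: mat_diff_simps)
  have hx: "h * x = x * h" unfolding h_def by (simp add: mat_add_distrib mat_smult_mult mat_mult_one)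
  have "v * v - 1\<^sub>m n = 2 \<cdot>\<^sub>m (h * x)"
  proof -
    have "v * v = (1\<^sub>m n + x) * (1\<^sub>m n + x)" by (rule arg_cong2[OF vdef vdef])
    also have "\<dots> = 1\<^sub>m n + x + (x + x * x)" by (simp add: mat_add_distrib mat_mult_one)
    finally have "v * v = 1\<^sub>m n + x + (x + x * x)" .
    moreover have "h * x = x + inverse 2 \<cdot>\<^sub>m (x * x)" unfolding h_def by (simp add: mat_add_distrib mat_mult_one mat_smult_mult)
    ultimately show ?thesis by (simp only:) (rule mat_square_half[OF two x_car], rule carrier_matI; simp)
  qed
  then have "u * (v * v - 1\<^sub>m n) = u * (2 \<cdot>\<^sub>m (h * x))" by simp
  then have vmu: "v - u = u * (2 \<cdot>\<^sub>m (h * x))"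
    by (simp add: mat_add_distrib mat_cancel[OF vu(2)] mat_mult_one)
  define W where "W = u * (2 \<cdot>\<^sub>m h)"
  have W: "W \<in> carrier_mat n n" unfolding W_def by (rule carrier_matI; simp)
  have vmu': "v - u = W * x" unfolding vmu W_def by (simp add: mat_assoc mat_smult_mult)
  define W' where "W' = (inverse 2 \<cdot>\<^sub>m h') * v"
  have W'W: "W' * W = 1\<^sub>m n" "W' \<in> carrier_mat n n"
  proof -
    show "W' \<in> carrier_mat n n" unfolding W'_def by (rule carrier_matI; simp)
    have "W' * W = (inverse 2 \<cdot>\<^sub>m h') * (v * (u * (2 \<cdot>\<^sub>m h)))" unfolding W_def W'_def by (simp add: mat_assoc)
    also have "\<dots> = (inverse 2 \<cdot>\<^sub>m h') * (2 \<cdot>\<^sub>m h)" by (simp add: mat_cancel[OF vu(1)])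
    also have "\<dots> = 1\<^sub>m n" using two by (simp add: mat_smult_mult h'(3)) (auto intro!: eq_matI)
    finally show "W' * W = 1\<^sub>m n" .
  qed
  have Wx: "W * x = x * W"
  proof -
    have "W * x = 2 \<cdot>\<^sub>m (u * (x * h))" unfolding W_def by (simp add: mat_assoc mat_smult_mult hx)
    also have "u * (x * h) = u * x * h" by (simp add: mat_assoc)
    also have "2 \<cdot>\<^sub>m (u * x * h) = x * W" unfolding ux(1) W_def by (simp add: mat_assoc mat_smult_mult)
    finally show ?thesis .
  qed
  have "rk n (transpose_mat (x ^\<^sub>m l) * A * x ^\<^sub>m l) = rk n (transpose_mat (x ^\<^sub>m l) * G * ((v - u) * x ^\<^sub>m l))"
    unfolding A_def by (simp add: mat_assoc)
  also have "\<dots> = rk n (x ^\<^sub>m l * ((v - u) * x ^\<^sub>m l))"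
    by (rule rk_xptG) ((rule carrier_matI; simp)+)
  also have "x ^\<^sub>m l * ((v - u) * x ^\<^sub>m l) = W * x ^\<^sub>m (2 * l + 1)"
  proof -
    have "x ^\<^sub>m l * ((v - u) * x ^\<^sub>m l) = (x ^\<^sub>m l * W) * (x * x ^\<^sub>m l)" unfolding vmu' using carrier_matD[OF W] by (simp add: mat_assoc)
    also have "x ^\<^sub>m l * W = W * x ^\<^sub>m l" by (rule pow_mat_commute[OF x_car W]) (rule Wx[symmetric])
    also have "x * x ^\<^sub>m l = x ^\<^sub>m Suc l" by (rule pow_mat_Suc_left[OF x_car, symmetric])
    also have "W * x ^\<^sub>m l * x ^\<^sub>m Suc l = W * (x ^\<^sub>m l * x ^\<^sub>m Suc l)" using carrier_matD[OF W] by (simp add: mat_assoc)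
    also have "x ^\<^sub>m l * x ^\<^sub>m Suc l = x ^\<^sub>m (2 * l + 1)" using pow_mat_add[OF x_car, of l "Suc l"] by (simp add: mult_2)
    finally show ?thesis .
  qed
  also have "rk n (W * x ^\<^sub>m (2 * l + 1)) = rk n (x ^\<^sub>m (2 * l + 1))"
    by (rule rk_mult_inv_left[OF W W'W(2,1) pow_carrier_mat[OF x_car]])
  finally show ?thesis using even_rk_alt[OF alt] by simp
qed

text \<open>For an isometry of a quadratic form that stabilises a maximal totally singular subspace (spanned by the
  basis vectors in \<open>E\<close>), the form \<open>(a,b) \<mapsto> B(x\<^sup>l a, x\<^sup>l\<^sup>+\<^sup>1 b)\<close> is alternating on the preimage
  of that subspace under \<open>x\<^sup>l\<^sup>+\<^sup>1\<close>; passing to it costs at most twice its codimension.\<close>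

lemma rk_odd_pow_bound:
  assumes E: "\<And>i j. i < n \<Longrightarrow> j \<in> E \<Longrightarrow> x $$ (i,j) \<noteq> 0 \<Longrightarrow> i \<in> E"
    and GE: "G * pr n E = pr n (- E) * G"
    and sing: "\<And>c. c \<in> carrier_vec n \<Longrightarrow> \<forall>i<n. i \<notin> E \<longrightarrow> (x *\<^sub>v c) $ i = 0 \<Longrightarrow> c \<bullet> (G *\<^sub>v (x *\<^sub>v c)) = 0"
  defines "R \<equiv> \<lambda>l. rk n (pr n (- E) * x ^\<^sub>m l)"
  obtains \<rho> where "even \<rho>" "rk n (x ^\<^sub>m (2 * l + 1)) \<le> \<rho> + 2 * R (Suc l)" "\<rho> + R (Suc l) \<le> R l"
proof -
  define f :: "'a mat" where "f = pr n (- E)"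
  have f: "f \<in> carrier_mat n n" and ff: "f * f = f" by (simp_all add: f_def pr_mult)
  have ef: "pr n E + f = 1\<^sub>m n" by (simp add: f_def pr_split)
  have fxE: "f * x * pr n E = 0\<^sub>m n n"
  proof (rule eq_matI)
    fix i j assume "i < dim_row (0\<^sub>m n n :: 'a mat)" "j < dim_col (0\<^sub>m n n :: 'a mat)"
    then have ij: "i < n" "j < n" by auto
    have c: "pr n (- E) * x \<in> carrier_mat n n" by (rule carrier_matI; simp)
    show "(f * x * pr n E) $$ (i,j) = 0\<^sub>m n n $$ (i,j)"
      unfolding f_def pr_mult_right_index[OF c ij] pr_mult_left_index[OF x_car ij] using E[of i j] ij by auto
  qed (simp_all add: f_def)
  have [simp]: "dim_row f = n" "dim_col f = n" using f by auto
  \<comment> \<open>\<open>x\<close> stabilises the span of \<open>E\<close>, so its powers modulo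
    that span depend only on the compression \<open>f * x\<close>.\<close>
  have fx: "f * x = f * x * f"
  proof -
    have "f * x = f * x * (pr n E + f)" unfolding ef by (simp add: mat_mult_one)
    also have "\<dots> = f * x * f" using fxE by (simp add: mat_add_distrib) (rule left_add_zero_mat, rule carrier_matI; simp)
    finally show ?thesis .
  qed
  have rec: "f * x ^\<^sub>m Suc l = f * x * (f * x ^\<^sub>m l)" for l
  proof -
    have "f * x ^\<^sub>m Suc l = f * x * x ^\<^sub>m l" unfolding pow_mat_Suc_left[OF x_car] by (simp add: mat_assoc)
    also have "\<dots> = f * x * f * x ^\<^sub>m l" using fx by simp
    finally show ?thesis by (simp add: mat_assoc)
  qed
  define B where "B = f * x ^\<^sub>m Suc l"
  have B: "B \<in> carrier_mat n n" unfolding B_def by (rule carrier_matI; simp)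
  obtain L Q L' Q' where LQ: "B = L * Q" "L \<in> carrier_mat n (rk n B)" "Q \<in> carrier_mat (rk n B) n"
    "Q' \<in> carrier_mat n (rk n B)" "Q * Q' = 1\<^sub>m (rk n B)"
    by (rule rank_factorization[OF B])
  \<comment> \<open>\<open>U\<close> projects onto the kernel of \<open>Q\<close>, which is that of
    \<open>B\<close>: the preimage of the span of \<open>E\<close> under
    \<open>x^(l+1)\<close>.\<close>
  define U where "U = 1\<^sub>m n - Q' * Q"
  note [simp] = carrier_matD[OF LQ(2)] carrier_matD[OF LQ(3)] carrier_matD[OF LQ(4)] carrier_matD[OF B]
  have U: "U \<in> carrier_mat n n" unfolding U_def by (rule carrier_matI; simp)
  have [simp]: "dim_row U = n" "dim_col U = n" using U by auto
  have BU: "B * U = 0\<^sub>m n n"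
  proof -
    have "B * U = B - B * (Q' * Q)" unfolding U_def by (simp add: mat_add_distrib mat_mult_one)
    also have "B * (Q' * Q) = L * Q * (Q' * Q)" using LQ(1) by (rule arg_cong)
    also have "\<dots> = L * (Q * (Q' * Q))" by (simp add: mat_assoc)
    also have "Q * (Q' * Q) = Q" by (intro mat_cancel[OF LQ(5)]) simp_all
    also have "L * Q = B" by (rule LQ(1)[symmetric])
    finally show ?thesis by (simp add: minus_r_inv_mat[OF B])
  qed
  have rU: "rk n (1\<^sub>m n - U) \<le> R (Suc l)"
  proof -
    have e: "1\<^sub>m n - U = Q' * Q" unfolding U_def by (rule mat_diff_simps(2)) simp_all
    have "rk n (1\<^sub>m n - U) \<le> rk n Q'" unfolding e by (rule rk_prod_le_left[OF LQ(4,3)])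
    also have "\<dots> \<le> rk n B" by (rule rk_le_nc[OF LQ(4)])
    also have "\<dots> = R (Suc l)" unfolding R_def B_def f_def ..
    finally show ?thesis .
  qed
  define \<Gamma> where "\<Gamma> = transpose_mat (x ^\<^sub>m l) * G * x ^\<^sub>m Suc l"
  have \<Gamma>: "\<Gamma> \<in> carrier_mat n n" unfolding \<Gamma>_def by (rule carrier_matI; simp)
  have [simp]: "dim_row \<Gamma> = n" "dim_col \<Gamma> = n" using \<Gamma> by auto
  have r\<Gamma>: "rk n \<Gamma> = rk n (x ^\<^sub>m (2 * l + 1))"
    unfolding \<Gamma>_def using rk_xptG[OF pow_carrier_mat[OF x_car], of l "Suc l"] pow_mat_add[OF x_car, of l "Suc l"]
    by (simp add: mult_2)
  define \<Delta> where "\<Delta> = transpose_mat U * \<Gamma> * U"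
  have \<Delta>: "\<Delta> \<in> carrier_mat n n" unfolding \<Delta>_def by (rule carrier_matI; simp)
  have "alt_mat n \<Delta>"
  proof (rule alt_matI[OF \<Delta>])
    fix a :: "'a vec" assume a: "a \<in> carrier_vec n"
    have [simp]: "dim_vec a = n" using a by simp
    define c where "c = x ^\<^sub>m l *\<^sub>v (U *\<^sub>v a)"
    have c: "c \<in> carrier_vec n" unfolding c_def by (rule carrier_vecI) simp
    have [simp]: "dim_vec c = n" using c by simp
    have xl: "x ^\<^sub>m l \<in> carrier_mat n n" "x ^\<^sub>m l * U \<in> carrier_mat n n" by ((rule carrier_matI; simp)+)
    have cU: "c = (x ^\<^sub>m l * U) *\<^sub>v a" unfolding c_def by (simp add: mat_vec_assoc)
    have "\<forall>i<n. i \<notin> E \<longrightarrow> (x *\<^sub>v c) $ i = 0"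
    proof (intro allI impI)
      fix i assume i: "i < n" "i \<notin> E"
      have "f *\<^sub>v (x *\<^sub>v c) = (B * U) *\<^sub>v a"
        unfolding B_def c_def pow_mat_Suc_left[OF x_car] by (simp add: mat_vec_assoc)
      then have "(f *\<^sub>v (x *\<^sub>v c)) $ i = 0" using BU a i by simp
      moreover have "(f *\<^sub>v (x *\<^sub>v c)) $ i = (x *\<^sub>v c) $ i"
      proof -
        have r: "row f i = unit_vec n i" using i by (auto simp: f_def pr_def)
        have "(f *\<^sub>v (x *\<^sub>v c)) $ i = row f i \<bullet> (x *\<^sub>v c)" using i(1) by (intro index_mult_mat_vec) simp
        also have "\<dots> = (x *\<^sub>v c) $ i" unfolding r
          by (rule scalar_prod_left_unit[OF _ i(1)], rule carrier_vecI) simp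
        finally show ?thesis .
      qed
      ultimately show "(x *\<^sub>v c) $ i = 0" by simp
    qed
    from sing[OF c this] have s: "c \<bullet> (G *\<^sub>v (x *\<^sub>v c)) = 0" .
    have \<Delta>e: "\<Delta> = transpose_mat (x ^\<^sub>m l * U) * (G * x) * (x ^\<^sub>m l * U)"
      unfolding \<Delta>_def \<Gamma>_def pow_mat_Suc_left[OF x_car] using transpose_mult[OF xl(1) U] by (simp add: mat_assoc)
    have "a \<bullet> (\<Delta> *\<^sub>v a) = a \<bullet> (transpose_mat (x ^\<^sub>m l * U) *\<^sub>v ((G * x) *\<^sub>v c))"
      unfolding \<Delta>e cU by (simp add: mat_vec_assoc)
    also have "\<dots> = ((G * x) *\<^sub>v c) \<bullet> c"
    proof -
      let ?M = "x ^\<^sub>m l * U"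
      have "(transpose_mat ?M *\<^sub>v d) \<bullet> a = d \<bullet> (?M *\<^sub>v a)" if "d \<in> carrier_vec n" for d
        by (rule transpose_vec_mult_scalar[OF xl(2) a that])
      moreover have "(G * x) *\<^sub>v c \<in> carrier_vec n" by (rule carrier_vecI) simp
      ultimately have "(transpose_mat ?M *\<^sub>v ((G * x) *\<^sub>v c)) \<bullet> a = ((G * x) *\<^sub>v c) \<bullet> c"
        unfolding cU[symmetric] by blast
      moreover have "a \<bullet> (transpose_mat ?M *\<^sub>v ((G * x) *\<^sub>v c)) = (transpose_mat ?M *\<^sub>v ((G * x) *\<^sub>v c)) \<bullet> a"
        by (rule comm_scalar_prod[OF a], rule carrier_vecI) simp
      ultimately show ?thesis by (simp only:)
    qed
    also have "\<dots> = c \<bullet> ((G * x) *\<^sub>v c)" by (rule comm_scalar_prod[of _ n], (rule carrier_vecI; simp)+)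
    also have "\<dots> = 0" using s by (simp add: mat_vec_assoc)
    finally show "a \<bullet> (\<Delta> *\<^sub>v a) = 0" .
  qed
  then have ev: "even (rk n \<Delta>)" by (rule even_rk_alt)
  \<comment> \<open>The complement \<open>1 - U\<close> has rank at most \<open>R (Suc l)\<close>
    and enters once on either side of the form, hence the factor 2.\<close>
  have b1: "rk n \<Gamma> \<le> rk n \<Delta> + 2 * R (Suc l)"
  proof -
    let ?V = "1\<^sub>m n - U"
    have V: "?V \<in> carrier_mat n n" by (rule carrier_matI; simp)
    have "\<Gamma> = \<Delta> + (transpose_mat U * \<Gamma> * ?V + transpose_mat ?V * \<Gamma>)"
    proof -
      have "transpose_mat U * \<Gamma> * ?V = transpose_mat U * \<Gamma> - \<Delta>" unfolding \<Delta>_def by (simp add: mat_add_distrib mat_mult_one)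
      moreover have "transpose_mat ?V * \<Gamma> = \<Gamma> - transpose_mat U * \<Gamma>"
        by (simp add: mat_minus_transpose mat_add_distrib mat_mult_one)
      ultimately show ?thesis using carrier_matD[OF \<Delta>] by (simp add: mat_diff_simps)
    qed
    then have "rk n \<Gamma> \<le> rk n \<Delta> + rk n (transpose_mat U * \<Gamma> * ?V + transpose_mat ?V * \<Gamma>)"
      using rk_add[OF \<Delta>, of "transpose_mat U * \<Gamma> * ?V + transpose_mat ?V * \<Gamma>"] by (simp only:) (erule meta_mp, rule carrier_matI; simp)
    also have "rk n (transpose_mat U * \<Gamma> * ?V + transpose_mat ?V * \<Gamma>) \<le> rk n (transpose_mat U * \<Gamma> * ?V) + rk n (transpose_mat ?V * \<Gamma>)"
      by (rule rk_add[of _ n n]) ((rule carrier_matI; simp)+)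
    also have "rk n (transpose_mat U * \<Gamma> * ?V) \<le> rk n ?V" by (rule rk_prod_le_right[of _ n n _ n]) ((rule carrier_matI; simp)+)
    also have "rk n (transpose_mat ?V * \<Gamma>) \<le> rk n (transpose_mat ?V)" by (rule rk_prod_le_left[of _ n n _ n]) ((rule carrier_matI; simp)+)
    also have "rk n (transpose_mat ?V) = rk n ?V" by (rule rk_transpose[OF V])
    finally show ?thesis using rU by simp
  qed
  \<comment> \<open>On the image of \<open>U\<close> the vectors \<open>x^(l+1) a\<close> lie in the
    span of \<open>E\<close>, which the form pairs only with coordinates outside \<open>E\<close>.
    So the rank is bounded by that of \<open>f * x^l\<close> on the kernel of
    \<open>f * x^(l+1)\<close>.\<close>
  have b2: "rk n \<Delta> + R (Suc l) \<le> R l"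
  proof -
    have "x ^\<^sub>m Suc l * U = pr n E * (x ^\<^sub>m Suc l * U)"
    proof -
      have "x ^\<^sub>m Suc l * U = (pr n E + f) * (x ^\<^sub>m Suc l * U)" unfolding ef by (simp add: mat_mult_one del: pow_mat.simps)
      also have "\<dots> = pr n E * (x ^\<^sub>m Suc l * U) + B * U" unfolding B_def by (simp add: mat_add_distrib mat_assoc del: pow_mat.simps)
      also have "\<dots> = pr n E * (x ^\<^sub>m Suc l * U)" unfolding BU by (rule right_add_zero_mat, rule carrier_matI; simp)
      finally show ?thesis .
    qed
    then have "\<Delta> = transpose_mat U * transpose_mat (x ^\<^sub>m l) * G * (pr n E * (x ^\<^sub>m Suc l * U))"
      unfolding \<Delta>_def \<Gamma>_def by (simp add: mat_assoc del: pow_mat.simps)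
    also have "\<dots> = transpose_mat U * transpose_mat (x ^\<^sub>m l) * (G * pr n E) * (x ^\<^sub>m Suc l * U)"
      by (simp add: mat_assoc del: pow_mat.simps)
    also have "\<dots> = (transpose_mat U * transpose_mat (x ^\<^sub>m l) * f) * (G * (x ^\<^sub>m Suc l * U))"
      unfolding GE f_def[symmetric] by (simp add: mat_assoc del: pow_mat.simps)
    also have "transpose_mat U * transpose_mat (x ^\<^sub>m l) * f = transpose_mat (f * x ^\<^sub>m l * U)"
    proof -
      have "transpose_mat f = f" by (auto simp: f_def pr_def intro!: eq_matI)
      moreover have "transpose_mat (f * x ^\<^sub>m l * U) = transpose_mat U * transpose_mat (f * x ^\<^sub>m l)"
        by (rule transpose_mult[of _ n n _ n]) ((rule carrier_matI; simp)+)
      moreover have "transpose_mat (f * x ^\<^sub>m l) = transpose_mat (x ^\<^sub>m l) * transpose_mat f"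
        by (rule transpose_mult[of _ n n _ n]) ((rule carrier_matI; simp)+)
      ultimately show ?thesis by (simp add: mat_assoc)
    qed
    finally have "rk n \<Delta> \<le> rk n (transpose_mat (f * x ^\<^sub>m l * U))"
      by (simp only:) (rule rk_prod_le_left[of _ n n _ n]; rule carrier_matI; simp)
    also have "\<dots> = rk n (f * x ^\<^sub>m l * U)"
      by (rule rk_transpose) ((rule carrier_matI; simp)+)
    finally have 1: "rk n \<Delta> \<le> rk n (f * x ^\<^sub>m l * U)" .
    have "rk n (f * x * (f * x ^\<^sub>m l)) + rk n (f * x ^\<^sub>m l * U) \<le> rk n (f * x ^\<^sub>m l) + rk n (f * x * (f * x ^\<^sub>m l) * U)"
      by (rule frobenius_rank[of _ n n _ n _ n]) ((rule carrier_matI; simp)+)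
    then have "R (Suc l) + rk n (f * x ^\<^sub>m l * U) \<le> R l + rk n (B * U)"
      unfolding rec[symmetric] R_def f_def[symmetric] B_def .
    then show ?thesis using 1 by (simp add: BU rk_zero)
  qed
  show thesis by (rule that[OF ev b1[unfolded r\<Gamma>] b2])
qed

end

section \<open>Sums of the largest parts\<close>

text \<open>If \<open>c i\<close> counts the blocks of size at least \<open>i\<close>, this is the
  sum of the \<open>k\<close> largest blocks for \<open>c (Suc j) \<le> k \<le> c j\<close>. As a
  function of \<open>k\<close> it is the line of slope \<open>j\<close> supporting that concave sum
  from above.\<close>

definition topF :: "(nat \<Rightarrow> nat) \<Rightarrow> nat \<Rightarrow> nat \<Rightarrow> nat \<Rightarrow> nat" where
  "topF c n j k = k * j + (\<Sum>i\<in>{j<..n}. c i)"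

lemma sum_Suc_head: "j < n \<Longrightarrow> (\<Sum>i\<in>{j<..n}. f i) = f (Suc j) + (\<Sum>i\<in>{Suc j<..n}. f i :: 'a::comm_monoid_add)"
proof -
  assume "j < n"
  then have "{j<..n} = insert (Suc j) {Suc j<..n}" by auto
  then show ?thesis by simp
qed

lemma topF_Suc: "j < n \<Longrightarrow> topF c n (Suc j) k + c (Suc j) = topF c n j k + k"
  by (simp add: topF_def sum_Suc_head)

text \<open>The parts of \<open>\<psi>(\<Lambda>)\<close> arise from the block sizes by moving \<open>A j\<close> parts from \<open>j\<close> up to \<open>j + 1\<close>
  and equally many down to \<open>j - 1\<close>; \<open>c\<close> and \<open>c'\<close> count the parts of size at least \<open>i\<close> before and after.\<close>

lemma sum_min_collapse:
  fixes c c' A :: "nat \<Rightarrow> nat"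
  assumes anti: "\<And>i i'. 1 \<le> i \<Longrightarrow> i \<le> i' \<Longrightarrow> c i' \<le> c i"
    and c': "\<And>i. 1 \<le> i \<Longrightarrow> i \<le> n \<Longrightarrow> c' i + A i = c i + A (i - 1)"
    and A0: "A 0 = 0" and An: "A n = 0" and A2: "\<And>j. 1 \<le> j \<Longrightarrow> c (Suc j) + 2 * A j \<le> c j"
    and iso: "\<And>j. 0 < A j \<Longrightarrow> A (j - 1) = 0 \<and> A (Suc j) = 0"
    and j: "1 \<le> j" "j < n" and k: "c (Suc j) \<le> k" "k \<le> c j"
  shows "(\<Sum>i\<in>{1..n}. min k (c' i)) = topF c n j k + min (A j) (min (k - c (Suc j)) (c j - k))"
proof -
  \<comment> \<open>Truncation at \<open>k\<close> can interact with the moves only at the sizes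
    \<open>j\<close> and \<open>j + 1\<close>: for smaller \<open>i\<close> the minimum is
    \<open>k\<close>, for larger \<open>i\<close> it is \<open>c' i\<close>.\<close>
  have low: "min k (c' i) = k" if "i \<in> {0<..j - 1}" for i
  proof -
    have "c j \<le> c (Suc i)" using that by (intro anti) auto
    moreover have "c (Suc i) + 2 * A i \<le> c i" using that by (intro A2) auto
    moreover have "c' i + A i = c i + A (i - 1)" using that j by (intro c') auto
    ultimately show ?thesis using k by simp
  qed
  have high: "c' i \<le> k \<and> c' i + A i = c i + A (i - 1)" if "i \<in> {Suc j<..n}" for i
  proof -
    have "c (i - 1) \<le> c (Suc j)" using that by (intro anti) auto
    moreover have "c (Suc (i - 1)) + 2 * A (i - 1) \<le> c (i - 1)" using that j by (intro A2) auto
    moreover have "c' i + A i = c i + A (i - 1)" using that j by (intro c') auto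
    ultimately show ?thesis using k that by simp
  qed
  \<comment> \<open>Moves inside the tail cancel; what remains are the parts moved up from size
    \<open>m\<close> into the tail.\<close>
  have tel: "(\<Sum>i\<in>{m<..n}. c' i) + A n = (\<Sum>i\<in>{m<..n}. c i) + A m" if "m \<le> n" for m
    using that
  proof (induction "n - m" arbitrary: m)
    case (Suc d)
    then have "m < n" by simp
    moreover have "d = n - Suc m" using Suc.hyps(2) by simp
    ultimately show ?case using Suc.hyps(1)[of "Suc m"] c'[of "Suc m"] by (simp add: sum_Suc_head)
  qed simp
  have "{1..n} = {0<..j - 1} \<union> {j, Suc j} \<union> {Suc j<..n}" using j by auto
  then have e1: "(\<Sum>i\<in>{1..n}. min k (c' i)) = (\<Sum>i\<in>{0<..j - 1} \<union> {j, Suc j} \<union> {Suc j<..n}. min k (c' i))" by (simp only:)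
  have e2: "(\<Sum>i\<in>{0<..j - 1} \<union> {j, Suc j} \<union> {Suc j<..n}. min k (c' i)) =
      (\<Sum>i\<in>{0<..j - 1}. min k (c' i)) + (\<Sum>i\<in>{j, Suc j}. min k (c' i)) + (\<Sum>i\<in>{Suc j<..n}. min k (c' i))"
    using j by (subst sum.union_disjoint, auto)+
  have e3: "(\<Sum>i\<in>{0<..j - 1}. min k (c' i)) = k * (j - 1)" using low by simp
  have e4: "(\<Sum>i\<in>{Suc j<..n}. min k (c' i)) = (\<Sum>i\<in>{Suc j<..n}. c' i)"
    using high by (intro sum.cong) auto
  have e5: "(\<Sum>i\<in>{Suc j<..n}. c' i) = (\<Sum>i\<in>{Suc j<..n}. c i) + A (Suc j)"
    using tel[of "Suc j"] j An by simp
  have e6: "topF c n j k = k * (j - 1) + k + c (Suc j) + (\<Sum>i\<in>{Suc j<..n}. c i)"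
  proof -
    have "k * j = k * (j - 1) + k" using j by (cases j) auto
    then show ?thesis unfolding topF_def using sum_Suc_head[OF j(2), of c] by simp
  qed
  have e7: "min k (c' j) + min k (c' (Suc j)) + A (Suc j) = k + c (Suc j) + min (A j) (min (k - c (Suc j)) (c j - k))"
  proof -
    have e: "c' j + A j = c j + A (j - 1)" "c' (Suc j) + A (Suc j) = c (Suc j) + A j"
      using c'[of j] c'[of "Suc j"] j by auto
    have a: "c (Suc j) + 2 * A j \<le> c j" "c (Suc (Suc j)) + 2 * A (Suc j) \<le> c (Suc j)" using A2[of j] A2[of "Suc j"] j by auto
    show ?thesis
    proof (cases "A j = 0")
      case True then show ?thesis using e a k by simp
    next
      case False
      then have "A (j - 1) = 0" "A (Suc j) = 0" using iso[of j] by auto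
      then show ?thesis using e a k by (auto simp: min_def)
    qed
  qed
  have e8: "(\<Sum>i\<in>{j, Suc j}. min k (c' i)) = min k (c' j) + min k (c' (Suc j))" by simp
  show ?thesis using e7 unfolding e1 e2 e3 e4 e5 e6 e8 by linarith
qed

text \<open>Once \<open>k\<close> reaches the number of blocks the truncation has no effect, and the
  moves preserve the total.\<close>

lemma sum_min_collapse_0:
  fixes c c' A :: "nat \<Rightarrow> nat"
  assumes anti: "\<And>i i'. 1 \<le> i \<Longrightarrow> i \<le> i' \<Longrightarrow> c i' \<le> c i"
    and c': "\<And>i. 1 \<le> i \<Longrightarrow> i \<le> n \<Longrightarrow> c' i + A i = c i + A (i - 1)"
    and A0: "A 0 = 0" and An: "A n = 0" and A2: "\<And>j. 1 \<le> j \<Longrightarrow> c (Suc j) + 2 * A j \<le> c j"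
    and k: "c 1 \<le> k"
  shows "(\<Sum>i\<in>{1..n}. min k (c' i)) = topF c n 0 k"
proof -
  have tel: "(\<Sum>i\<in>{m<..n}. c' i) + A n = (\<Sum>i\<in>{m<..n}. c i) + A m" if "m \<le> n" for m
    using that
  proof (induction "n - m" arbitrary: m)
    case (Suc d)
    then have "m < n" by simp
    moreover have "d = n - Suc m" using Suc.hyps(2) by simp
    ultimately show ?case using Suc.hyps(1)[of "Suc m"] c'[of "Suc m"] by (simp add: sum_Suc_head)
  qed simp
  have "c' i \<le> k" if "i \<in> {1..n}" for i
  proof (cases "i = 1")
    case True then show ?thesis using c'[of 1] that k A0 by simp
  next
    case False
    have "c (i - 1) \<le> c 1" using that False by (intro anti) auto
    moreover have "c (Suc (i - 1)) + 2 * A (i - 1) \<le> c (i - 1)" using that False by (intro A2) auto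
    moreover have "c' i + A i = c i + A (i - 1)" using that by (intro c') auto
    ultimately show ?thesis using k that by simp
  qed
  then have "(\<Sum>i\<in>{1..n}. min k (c' i)) = (\<Sum>i\<in>{1..n}. c' i)" by (intro sum.cong) auto
  also have "\<dots> = (\<Sum>i\<in>{0<..n}. c' i)" by (rule sum.cong) auto
  finally show ?thesis using tel[of 0] A0 An by (simp only: topF_def) simp
qed

text \<open>All blocks larger than \<open>j\<close> are taken, and the choice is filled up with
  blocks of size exactly \<open>j\<close>.\<close>

lemma select_weights:
  fixes d :: "'b \<Rightarrow> nat"
  assumes W: "finite W" and dn: "\<And>t. t \<in> W \<Longrightarrow> d t \<le> n"
    and j: "1 \<le> j" "j \<le> n" and k: "card {t \<in> W. Suc j \<le> d t} \<le> k" "k \<le> card {t \<in> W. j \<le> d t}"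
  obtains I where "I \<subseteq> W" "card I = k" "(\<Sum>t\<in>I. d t) = topF (\<lambda>i. card {t \<in> W. i \<le> d t}) n j k"
proof -
  let ?A = "{t \<in> W. Suc j \<le> d t}"
  let ?B = "{t \<in> W. j \<le> d t}"
  have "?A \<subseteq> ?B" by auto
  then obtain I where I: "?A \<subseteq> I" "I \<subseteq> ?B" "card I = k"
    using exists_subset_between[of ?A k ?B] k W by auto
  have finI: "finite I" using I(2) W finite_subset by fastforce
  have "(\<Sum>t\<in>I. d t) = (\<Sum>t\<in>I. \<Sum>i\<in>{0<..n}. if i \<le> d t then 1 else 0)"
  proof (rule sum.cong[OF refl])
    fix t assume "t \<in> I"
    then have "d t \<le> n" using I(2) dn by auto
    then have "{0<..n} \<inter> {i. i \<le> d t} = {0<..d t}" by auto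
    then show "d t = (\<Sum>i\<in>{0<..n}. if i \<le> d t then 1 else 0)" by (simp add: sum.If_cases)
  qed
  also have "\<dots> = (\<Sum>i\<in>{0<..n}. card {t \<in> I. i \<le> d t})"
    using finI by (subst sum.swap) (simp add: sum.If_cases Int_def)
  also have "{0<..n} = {0<..j} \<union> {j<..n}" using j by auto
  also have "(\<Sum>i\<in>{0<..j} \<union> {j<..n}. card {t \<in> I. i \<le> d t}) = (\<Sum>i\<in>{0<..j}. card {t \<in> I. i \<le> d t}) + (\<Sum>i\<in>{j<..n}. card {t \<in> I. i \<le> d t})"
    by (rule sum.union_disjoint) auto
  also have "(\<Sum>i\<in>{0<..j}. card {t \<in> I. i \<le> d t}) = (\<Sum>i\<in>{0<..j}. k)"
  proof (rule sum.cong[OF refl])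
    fix i assume "i \<in> {0<..j}"
    then have "{t \<in> I. i \<le> d t} = I" using I(2) by auto
    then show "card {t \<in> I. i \<le> d t} = k" using I(3) by simp
  qed
  also have "(\<Sum>i\<in>{j<..n}. card {t \<in> I. i \<le> d t}) = (\<Sum>i\<in>{j<..n}. card {t \<in> W. i \<le> d t})"
  proof (rule sum.cong[OF refl])
    fix i assume "i \<in> {j<..n}"
    then have "{t \<in> I. i \<le> d t} = {t \<in> W. i \<le> d t}" using I(1,2) by auto
    then show "card {t \<in> I. i \<le> d t} = card {t \<in> W. i \<le> d t}" by simp
  qed
  finally have "(\<Sum>t\<in>I. d t) = topF (\<lambda>i. card {t \<in> W. i \<le> d t}) n j k" by (simp add: topF_def mult.commute)
  moreover have "I \<subseteq> W" using I(2) by auto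
  ultimately show thesis using that I(3) by blast
qed

text \<open>The defect is given at odd offsets. At an even offset convexity bounds \<open>r\<close>
  by the mean of its neighbours while \<open>S\<close> is linear; the even length of the interval
  keeps both neighbours in its interior.\<close>

lemma concave_improve:
  fixes r S :: "nat \<Rightarrow> nat"
  assumes S: "\<And>k. k \<ge> a \<Longrightarrow> S k = s + (k - a) * j" 
    and conc: "\<And>k. 2 * r (Suc k) \<le> r k + r (Suc (Suc k))"
    and "even (b - a)" "a \<le> b"
    and imp: "\<And>k. a < k \<Longrightarrow> k < b \<Longrightarrow> odd (k - a) \<Longrightarrow> r k + S k + 1 \<le> n"
    and k: "a < k" "k < b"
  shows "r k + S k + 1 \<le> n"
proof (cases "odd (k - a)")
  case False
  then obtain m where m: "k = a + m" "even m" "0 < m" using k by (metis add_diff_inverse_nat less_imp_le_nat not_less zero_less_diff)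
  obtain m' where m': "m = Suc m'" using m by (cases m) auto
  have "r (k - 1) + S (k - 1) + 1 \<le> n" using k m m' by (intro imp) (auto intro: odd_pos)
  moreover have "k + 1 < b" using k m assms(3,4) by presburger
  then have "r (k + 1) + S (k + 1) + 1 \<le> n" using k m m' by (intro imp) auto
  moreover have "2 * r k \<le> r (k - 1) + r (k + 1)" using conc[of "k - 1"] m m' by simp
  moreover have "S (k - 1) + S (k + 1) = 2 * S k" using S[of k] S[of "k - 1"] S[of "k + 1"] m m' by (simp add: algebra_simps)
  ultimately show ?thesis by linarith
qed (use imp k in blast)

text \<open>Parity turns a defect of 1 at even offsets into 2, and convexity carries this to the odd
  offsets in between. Next to the ends only 1 is left, hence the inner minimum.\<close>

lemma concave_improve2:
  fixes r S :: "nat \<Rightarrow> nat"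
  assumes S: "\<And>k. k \<ge> a \<Longrightarrow> S k = s + (k - a) * j" 
    and conc: "\<And>k. 2 * r (Suc k) \<le> r k + r (Suc (Suc k))"
    and "even (b - a)" "a \<le> b"
    and imp: "\<And>k. a < k \<Longrightarrow> k < b \<Longrightarrow> r k + S k + 1 \<le> n"
    and par: "\<And>k. a < k \<Longrightarrow> k < b \<Longrightarrow> even (k - a) \<Longrightarrow> even (r k + S k + n)"
    and k: "a < k" "k < b"
  shows "r k + S k + min 2 (min (k - a) (b - k)) \<le> n"
proof -
  have ev: "r k + S k + 2 \<le> n" if "a < k" "k < b" "even (k - a)" for k
  proof -
    have "r k + S k + 1 \<noteq> n" using par[OF that] by (metis even_plus_one_iff odd_add)
    then show ?thesis using imp[OF that(1,2)] by linarith
  qed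
  show ?thesis
  proof (cases "even (k - a) \<or> k = a + 1 \<or> k + 1 = b")
    case True
    then show ?thesis using ev[OF k] imp[OF k] by auto
  next
    case False
    then have o: "odd (k - a)" "a + 1 < k" "k + 1 < b" using k by auto
    have "r (k - 1) + S (k - 1) + 2 \<le> n" using o by (intro ev) auto
    moreover have "r (k + 1) + S (k + 1) + 2 \<le> n" using o by (intro ev) auto
    moreover have "2 * r k \<le> r (k - 1) + r (k + 1)" using conc[of "k - 1"] o by simp
    moreover have "S (k - 1) + S (k + 1) = 2 * S k"
    proof -
      obtain m where "k = Suc (a + m)" using o by (metis Suc_eq_plus1 add.commute add_Suc_right less_imp_add_positive less_or_eq_imp_le not_less_eq plus_nat.simps(2) less_iff_Suc_add)
      then show ?thesis using S[of k] S[of "k - 1"] S[of "k + 1"] by (simp add: algebra_simps)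
    qed
    ultimately have "r k + S k + 2 \<le> n" by linarith
    then show ?thesis by linarith
  qed
qed

section \<open>Upper bounds for the ranks\<close>

definition dW :: "nat \<Rightarrow> (nat \<Rightarrow> int) \<Rightarrow> int \<Rightarrow> nat" where
  "dW n w t = card {i. i < n \<and> w i = t}"

text \<open>The conjugate of the partition formed by the block sizes.\<close>

definition cW :: "nat \<Rightarrow> (nat \<Rightarrow> int) \<Rightarrow> nat \<Rightarrow> nat" where
  "cW n w i = card {t \<in> w ` {..<n}. i \<le> dW n w t}"

lemma dW_le: "dW n w t \<le> n"
  unfolding dW_def using card_mono[of "{..<n}" "{i. i < n \<and> w i = t}"] by auto

lemma cW_anti: "i \<le> i' \<Longrightarrow> cW n w i' \<le> cW n w i"
  unfolding cW_def by (intro card_mono) auto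

lemma card_weights_in:
  fixes w :: "nat \<Rightarrow> int"
  assumes "finite I" "T \<subseteq> {..<n}"
  shows "card {i \<in> T. w i \<in> I} = (\<Sum>t\<in>I. card {i \<in> T. w i = t})"
proof -
  have "finite T" by (rule finite_subset[OF assms(2)]) simp
  have e: "{i \<in> T. w i \<in> I} = (\<Union>t\<in>I. {i \<in> T. w i = t})" by auto
  show ?thesis unfolding e
  proof (rule card_UN_disjoint[OF assms(1)])
    show "\<forall>t\<in>I. finite {i \<in> T. w i = t}" using \<open>finite T\<close> by simp
  qed auto
qed

lemma rk_raises_topF:
  assumes X: "raises n w X" and j: "1 \<le> j" "j \<le> n" and k: "cW n w (Suc j) \<le> k" "k \<le> cW n w j"
  shows "rk n (X ^\<^sub>m k) + topF (cW n w) n j k \<le> n"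
proof -
  obtain I where I: "I \<subseteq> w ` {..<n}" "card I = k" "(\<Sum>t\<in>I. dW n w t) = topF (cW n w) n j k"
  proof (rule select_weights[of "w ` {..<n}" "dW n w" n j k])
    show "card {t \<in> w ` {..<n}. Suc j \<le> dW n w t} \<le> k" "k \<le> card {t \<in> w ` {..<n}. j \<le> dW n w t}"
      using k by (simp_all only: cW_def)
    have "(\<lambda>i. card {t \<in> w ` {..<n}. i \<le> dW n w t}) = cW n w" by (rule ext) (simp only: cW_def)
    then show thesis if "I \<subseteq> w ` {..<n}" "card I = k" "(\<Sum>t\<in>I. dW n w t) = topF (\<lambda>i. card {t \<in> w ` {..<n}. i \<le> dW n w t}) n j k" for I
      using that \<open>\<And>I. I \<subseteq> w ` {..<n} \<Longrightarrow> card I = k \<Longrightarrow> (\<Sum>t\<in>I. dW n w t) = topF (cW n w) n j k \<Longrightarrow> thesis\<close> by simp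
  qed (use j dW_le in auto)
  have finI: "finite I" using I(1) finite_subset by blast
  have "rk n (X ^\<^sub>m card I * pr n {..<n}) + card {i \<in> {..<n}. w i \<in> I} \<le> card {..<n}"
    by (rule rk_raises_pow[OF X _ _ finI]) auto
  moreover have "card {i \<in> {..<n}. w i \<in> I} = (\<Sum>t\<in>I. dW n w t)"
    using card_weights_in[OF finI, of "{..<n}" n w] by (simp add: dW_def)
  moreover have "X ^\<^sub>m k * pr n {..<n} = X ^\<^sub>m k"
    using raisesD(1)[OF X] pow_carrier_mat[OF raisesD(1)[OF X], of k] by (simp add: pr_UNIV)
  ultimately show ?thesis using I by simp
qed

lemma sum_cW: "(\<Sum>i\<in>{0<..n}. cW n w i) = n"
proof -
  have "(\<Sum>i\<in>{0<..n}. cW n w i) = (\<Sum>i\<in>{0<..n}. \<Sum>t\<in>w ` {..<n}. if i \<le> dW n w t then 1 else 0)"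
    unfolding cW_def by (intro sum.cong refl) (simp add: sum.If_cases Int_def)
  also have "\<dots> = (\<Sum>t\<in>w ` {..<n}. \<Sum>i\<in>{0<..n}. if i \<le> dW n w t then 1 else 0)" by (rule sum.swap)
  also have "\<dots> = (\<Sum>t\<in>w ` {..<n}. dW n w t)"
  proof (rule sum.cong[OF refl])
    fix t
    have "{0<..n} \<inter> {i. i \<le> dW n w t} = {0<..dW n w t}" using dW_le[of n w t] by auto
    then show "(\<Sum>i\<in>{0<..n}. if i \<le> dW n w t then 1 else 0) = dW n w t" by (simp add: sum.If_cases)
  qed
  also have "\<dots> = card {i \<in> {..<n}. w i \<in> w ` {..<n}}"
    using card_weights_in[of "w ` {..<n}" "{..<n}" n w] by (simp add: dW_def)
  also have "{i \<in> {..<n}. w i \<in> w ` {..<n}} = {..<n}" by auto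
  finally show ?thesis by simp
qed

text \<open>With at least as many factors as there are weights the power vanishes, and
  \<open>topF\<close> at level 0 is the full dimension.\<close>

lemma rk_raises_topF_0:
  assumes X: "raises n w X" and k: "cW n w 1 \<le> k"
  shows "rk n (X ^\<^sub>m k) + topF (cW n w) n 0 k \<le> n"
proof -
  let ?I = "w ` {..<n}"
  have "rk n (X ^\<^sub>m card ?I * pr n {..<n}) + card {i \<in> {..<n}. w i \<in> ?I} \<le> card {..<n}"
    by (rule rk_raises_pow[OF X]) auto
  moreover have "{i \<in> {..<n}. w i \<in> ?I} = {..<n}" by auto
  moreover have "X ^\<^sub>m card ?I * pr n {..<n} = X ^\<^sub>m card ?I"
    using right_mult_one_mat[OF pow_carrier_mat[OF raisesD(1)[OF X], of "card ?I"]] by (simp add: pr_UNIV)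
  moreover have "card ?I \<le> k"
  proof -
    have "1 \<le> dW n w t" if "t \<in> ?I" for t
    proof -
      have "{i. i < n \<and> w i = t} \<noteq> {}" "finite {i. i < n \<and> w i = t}" using that by auto
      then show ?thesis unfolding dW_def using card_gt_0_iff by (metis One_nat_def Suc_leI)
    qed
    then have "{t \<in> ?I. 1 \<le> dW n w t} = ?I" by auto
    then show ?thesis using k by (simp add: cW_def)
  qed
  ultimately have "rk n (X ^\<^sub>m k) = 0" using rk_pow_mono[OF raisesD(1)[OF X], of "card ?I" k] by simp
  then show ?thesis using sum_cW[of n w] by (simp add: topF_def)
qed

text \<open>Under an antidiagonal form position \<open>i\<close> is dual to
  \<open>n - 1 - i\<close>, so a cocharacter of the isometry group has opposite weights at these
  positions.\<close>

definition sym_wt :: "nat \<Rightarrow> (nat \<Rightarrow> int) \<Rightarrow> bool" where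
  "sym_wt n w \<longleftrightarrow> (\<forall>i<n. w (n - 1 - i) = - w i)"

lemma dW_uminus:
  assumes "sym_wt n w"
  shows "dW n w (- t) = dW n w t"
  unfolding dW_def
proof (rule bij_betw_same_card[of "\<lambda>i. n - 1 - i"])
  show "bij_betw (\<lambda>i. n - 1 - i) {i. i < n \<and> w i = - t} {i. i < n \<and> w i = t}"
    using assms by (intro bij_betwI[where g = "\<lambda>i. n - 1 - i"]) (auto simp: sym_wt_def)
qed

lemma uminus_weights:
  assumes "sym_wt n w" "t \<in> w ` {..<n}"
  shows "- t \<in> w ` {..<n}"
proof -
  obtain i where i: "i < n" "t = w i" using assms(2) by auto
  then have "w (n - 1 - i) = - t" "n - 1 - i < n" using assms(1) by (auto simp: sym_wt_def)
  then show ?thesis by (metis image_eqI lessThan_iff)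
qed

lemma dW_pos: "t \<in> w ` {..<n} \<longleftrightarrow> 0 < dW n w t"
  unfolding dW_def by (subst card_gt_0_iff) auto

lemma cW_split_zero:
  assumes "1 \<le> i"
  shows "cW n w i = card {t \<in> w ` {..<n}. t \<noteq> 0 \<and> i \<le> dW n w t} + (if i \<le> dW n w 0 then 1 else 0)"
proof (cases "i \<le> dW n w 0")
  case True
  then have "0 \<in> w ` {..<n}" using assms by (simp add: dW_pos)
  then have "{t \<in> w ` {..<n}. i \<le> dW n w t} = insert 0 {t \<in> w ` {..<n}. t \<noteq> 0 \<and> i \<le> dW n w t}" using True by auto
  then show ?thesis using True by (simp add: cW_def)
next
  case False
  then have "{t \<in> w ` {..<n}. i \<le> dW n w t} = {t \<in> w ` {..<n}. t \<noteq> 0 \<and> i \<le> dW n w t}" by auto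
  then show ?thesis using False by (simp add: cW_def)
qed

lemma card_nonzero_weights:
  assumes "sym_wt n w"
  shows "card {t \<in> w ` {..<n}. t \<noteq> 0 \<and> i \<le> dW n w t} = 2 * card {t \<in> w ` {..<n}. t < 0 \<and> i \<le> dW n w t}"
proof -
  let ?N = "{t \<in> w ` {..<n}. t < 0 \<and> i \<le> dW n w t}"
  let ?P = "{t \<in> w ` {..<n}. t > 0 \<and> i \<le> dW n w t}"
  have "{t \<in> w ` {..<n}. t \<noteq> 0 \<and> i \<le> dW n w t} = ?N \<union> ?P" by auto
  moreover have "card ?P = card ?N"
  proof (rule bij_betw_same_card[of uminus])
    show "bij_betw uminus ?P ?N"
    proof (rule bij_betwI[where g = uminus])
      show "uminus \<in> ?P \<rightarrow> ?N" "uminus \<in> ?N \<rightarrow> ?P"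
        using uminus_weights[OF assms] by (auto simp only: dW_uminus[OF assms] mem_Collect_eq neg_less_0_iff_less neg_0_less_iff_less)
    qed simp_all
  qed
  moreover have "card (?N \<union> ?P) = card ?N + card ?P" by (rule card_Un_disjoint) auto
  ultimately show ?thesis by simp
qed

text \<open>The blocks of weights \<open>t\<close> and \<open>- t\<close> have equal size, so only
  the block of weight 0 can make the count odd.\<close>

lemma cW_parity:
  assumes "sym_wt n w" "1 \<le> i"
  shows "odd (cW n w i) \<longleftrightarrow> i \<le> dW n w 0"
  using cW_split_zero[OF assms(2), of n w] card_nonzero_weights[OF assms(1), of i] by simp

lemma n_parity:
  assumes "sym_wt n w"
  shows "even n \<longleftrightarrow> even (dW n w 0)"
proof -
  have "{..<n} = {i. i < n \<and> w i = 0} \<union> {i. i < n \<and> w i \<noteq> 0}" by auto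
  then have "card {..<n} = card ({i. i < n \<and> w i = 0} \<union> {i. i < n \<and> w i \<noteq> 0})" by (simp only:)
  also have "\<dots> = dW n w 0 + card {i. i < n \<and> w i \<noteq> 0}"
    unfolding dW_def by (rule card_Un_disjoint) auto
  finally have "n = dW n w 0 + card {i. i < n \<and> w i \<noteq> 0}" by simp
  moreover have "even (card {i. i < n \<and> w i \<noteq> 0})"
  proof (rule even_card_involution[of _ "\<lambda>i. n - 1 - i"])
    fix i assume i: "i \<in> {i. i < n \<and> w i \<noteq> 0}"
    then have "w (n - 1 - i) = - w i" using assms by (simp add: sym_wt_def)
    then show "n - 1 - i \<noteq> i" using i by auto
    show "n - 1 - i \<in> {i. i < n \<and> w i \<noteq> 0}" using i \<open>w (n - 1 - i) = - w i\<close> by auto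
    show "n - 1 - (n - 1 - i) = i" using i by auto
  qed simp
  ultimately show ?thesis by (metis even_add)
qed

text \<open>Beyond \<open>j\<close> the odd counts are those at indices up to the size of the middle
  block. The subtraction is truncated: past that size there are none.\<close>

lemma topF_parity:
  assumes s: "sym_wt n w" and j: "1 \<le> j" "j \<le> n"
  shows "even (topF (cW n w) n j k) \<longleftrightarrow> even (k * j + (dW n w 0 - j))"
proof -
  let ?d = "dW n w 0"
  have p: "odd (cW n w i) \<longleftrightarrow> odd (if i \<le> ?d then 1 else (0::nat))" if "i \<in> {j<..n}" for i
    using cW_parity[OF s, of i] that j by auto
  have "even (\<Sum>i\<in>{j<..n}. cW n w i) \<longleftrightarrow> even (card {i \<in> {j<..n}. odd (cW n w i)})" by (rule even_sum_iff) simp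
  also have "{i \<in> {j<..n}. odd (cW n w i)} = {j<..?d}" using p j dW_le[of n w 0] by (auto split: if_splits)
  finally show ?thesis by (simp add: topF_def)
qed

lemma topF_linear: "k \<ge> a \<Longrightarrow> topF c n j k = topF c n j a + (k - a) * j"
  by (simp add: topF_def) (metis add_mult_distrib le_add_diff_inverse)

lemma cW_diff_even:
  assumes s: "sym_wt n w" and j: "1 \<le> j" "j \<noteq> dW n w 0"
  shows "even (cW n w j - cW n w (Suc j))"
  using cW_parity[OF s, of j] cW_parity[OF s, of "Suc j"] j by (auto simp: even_diff_nat)

text \<open>In both ranges of \<open>crit\<close> equality in the general bound would make the rank
  odd.\<close>

lemma parity_gap:
  assumes s: "sym_wt n w" and X: "raises n w X" and j: "1 \<le> j" "j \<le> n"
    and k: "cW n w (Suc j) < k" "k < cW n w j" "odd (k - cW n w (Suc j))"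
    and crit: "j < dW n w 0 \<and> odd j \<and> even (dW n w 0) \<or> dW n w 0 < j \<and> odd (j + dW n w 0)"
    and ev: "even (rk n (X ^\<^sub>m k))"
  shows "rk n (X ^\<^sub>m k) + topF (cW n w) n j k + 1 \<le> n"
proof -
  let ?d = "dW n w 0"
  have "rk n (X ^\<^sub>m k) + topF (cW n w) n j k \<le> n" using k by (intro rk_raises_topF[OF X j]) auto
  moreover have "odd (topF (cW n w) n j k + n)"
  proof -
    have "odd k \<longleftrightarrow> even (cW n w (Suc j))" using k by (metis even_add less_imp_le_nat le_add_diff_inverse)
    then have "odd k \<longleftrightarrow> ?d < Suc j" using cW_parity[OF s, of "Suc j"] by auto
    then show ?thesis using topF_parity[OF s j, of k] n_parity[OF s] crit by auto
  qed
  ultimately show ?thesis using ev by (metis Suc_eq_plus1 Suc_leI even_add le_neq_implies_less)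
qed

lemma upper_collapse1:
  assumes s: "sym_wt n w" and X: "raises n w X" and j: "1 \<le> j" "j \<le> n" "j \<noteq> dW n w 0"
    and k: "cW n w (Suc j) \<le> k" "k \<le> cW n w j"
    and gap: "\<And>k. cW n w (Suc j) < k \<Longrightarrow> k < cW n w j \<Longrightarrow> odd (k - cW n w (Suc j)) \<Longrightarrow>
      rk n (X ^\<^sub>m k) + topF (cW n w) n j k + 1 \<le> n"
  shows "rk n (X ^\<^sub>m k) + topF (cW n w) n j k + min 1 (min (k - cW n w (Suc j)) (cW n w j - k)) \<le> n"
proof (cases "cW n w (Suc j) < k \<and> k < cW n w j")
  case True
  have "rk n (X ^\<^sub>m k) + topF (cW n w) n j k + 1 \<le> n"
    by (rule concave_improve[where a = "cW n w (Suc j)" and b = "cW n w j", OF topF_linear rk_pow_concave[OF raisesD(1)[OF X]]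
          cW_diff_even[OF s j(1,3)] cW_anti gap]) (use True in auto)
  then show ?thesis by linarith
next
  case False
  then have "min (k - cW n w (Suc j)) (cW n w j - k) = 0" using k by auto
  then show ?thesis using rk_raises_topF[OF X j(1,2) k] by simp
qed

text \<open>Here the even offsets are the even powers; their even rank rules out a defect of exactly
  1, so the defect grows to 2 away from the ends.\<close>

lemma upper_collapse2:
  assumes s: "sym_wt n w" and X: "raises n w X" and j: "1 \<le> j" "j \<le> n" "dW n w 0 < j" "odd (j + dW n w 0)"
    and k: "cW n w (Suc j) \<le> k" "k \<le> cW n w j"
    and "even n" and ev: "\<And>l. even (rk n (X ^\<^sub>m (2 * l)))"
    and gap: "\<And>k. cW n w (Suc j) < k \<Longrightarrow> k < cW n w j \<Longrightarrow> odd (k - cW n w (Suc j)) \<Longrightarrow>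
      rk n (X ^\<^sub>m k) + topF (cW n w) n j k + 1 \<le> n"
  shows "rk n (X ^\<^sub>m k) + topF (cW n w) n j k + min 2 (min (k - cW n w (Suc j)) (cW n w j - k)) \<le> n"
proof (cases "cW n w (Suc j) < k \<and> k < cW n w j")
  case True
  have gap': "rk n (X ^\<^sub>m k) + topF (cW n w) n j k + 1 \<le> n" if "cW n w (Suc j) < k" "k < cW n w j" for k
    by (rule concave_improve[where a = "cW n w (Suc j)" and b = "cW n w j", OF topF_linear rk_pow_concave[OF raisesD(1)[OF X]]
          cW_diff_even[OF s j(1)] cW_anti gap]) (use that j in auto)
  have par: "even (rk n (X ^\<^sub>m k) + topF (cW n w) n j k + n)"
    if "cW n w (Suc j) < k" "k < cW n w j" "even (k - cW n w (Suc j))" for k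
  proof -
    have "even (cW n w (Suc j))" using cW_parity[OF s, of "Suc j"] j by auto
    then have "even k" using that by (metis dvd_diffD less_imp_le_nat)
    then obtain l where l: "k = 2 * l" by auto
    have "even (topF (cW n w) n j k)" using topF_parity[OF s j(1,2), of k] \<open>even k\<close> j by simp
    then show ?thesis using ev[of l] l \<open>even n\<close> by simp
  qed
  show ?thesis
    by (rule concave_improve2[where a = "cW n w (Suc j)" and b = "cW n w j", OF topF_linear rk_pow_concave[OF raisesD(1)[OF X]]
          cW_diff_even[OF s j(1)] cW_anti gap' par]) (use True j in auto)
next
  case False
  then have "min (k - cW n w (Suc j)) (cW n w j - k) = 0" using k by auto
  then show ?thesis using rk_raises_topF[OF X j(1,2) k] by simp
qed


context isometry
begin

text \<open>Here \<open>k = 2 l + 1\<close>: \<open>l\<close> (respectively \<open>l + 1\<close>) of the \<open>k\<close> largest blocks can be chosen among the negative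
  weights, and the two resulting bounds add up to the bound for \<open>k\<close>, which is odd, whereas the rank is bounded by an even number.\<close>

lemma gap_singular:
  assumes s: "sym_wt n w" and X: "raises n w x" and j: "1 \<le> j" "j \<le> n" "dW n w 0 < j" "odd j" and "even n"
    and k: "cW n w (Suc j) < k" "k < cW n w j" "odd (k - cW n w (Suc j))"
    and G: "\<And>i j. i < n \<Longrightarrow> j < n \<Longrightarrow> G $$ (i,j) \<noteq> 0 \<Longrightarrow> j = n - 1 - i"
    and sing: "\<And>c. c \<in> carrier_vec n \<Longrightarrow> \<forall>i<n. \<not> (0 < w i \<or> w i = 0 \<and> i < n - 1 - i) \<longrightarrow> (x *\<^sub>v c) $ i = 0 \<Longrightarrow>
      c \<bullet> (G *\<^sub>v (x *\<^sub>v c)) = 0"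
  shows "rk n (x ^\<^sub>m k) + topF (cW n w) n j k + 1 \<le> n"
proof -
  \<comment> \<open>The positive weights and the first half of the zero block: this set meets each
    dual pair once, and its span is stable under \<open>x\<close> because \<open>x\<close> raises
    weights.\<close>
  define E where "E = {i. 0 < w i \<or> w i = 0 \<and> i < n - 1 - i}"
  define F where "F = {i. i < n \<and> i \<notin> E}"
  define f :: "'a mat" where "f = pr n (- E)"
  have star: "n - 1 - i \<in> E \<longleftrightarrow> i \<notin> E" if "i < n" for i
  proof -
    have "w (n - 1 - i) = - w i" using s that by (simp add: sym_wt_def)
    moreover have "i \<noteq> n - 1 - i" using that \<open>even n\<close> by presburger
    ultimately show ?thesis using that by (auto simp: E_def)
  qed
  have "even (cW n w (Suc j))" "even (cW n w j)" using cW_parity[OF s, of "Suc j"] cW_parity[OF s, of j] j by auto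
  then obtain l where l: "k = 2 * l + 1" using k by (metis dvd_diffD1 less_imp_le_nat oddE odd_add le_add_diff_inverse)
  have "rk n (x ^\<^sub>m k) \<le> n - topF (cW n w) n j k" using rk_raises_topF[OF X j(1,2), of k] k by simp
  have xE: "i \<in> E" if "i < n" "m \<in> E" "x $$ (i,m) \<noteq> 0" "m < n" for i m
    using raisesD(2)[OF X that(1,4)] that(2,3) by (auto simp: E_def not_le[symmetric])
  have GE: "G * pr n E = pr n (- E) * G"
  proof (rule eq_matI)
    fix i m assume "i < dim_row (pr n (- E) * G)" "m < dim_col (pr n (- E) * G)"
    then have im: "i < n" "m < n" by auto
    show "(G * pr n E) $$ (i,m) = (pr n (- E) * G) $$ (i,m)"
      unfolding pr_mult_left_index[OF car(1) im] pr_mult_right_index[OF car(1) im]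
      using G[OF im] star[OF im(1)] by auto
  qed auto
  define R where "R = (\<lambda>l. rk n (pr n (- E) * x ^\<^sub>m l))"
  have xE': "i \<in> E \<inter> {..<n}" if "i < n" "m \<in> E \<inter> {..<n}" "x $$ (i,m) \<noteq> 0" for i m
    using xE[of i m] that by auto
  have prE: "pr n (E \<inter> {..<n}) = (pr n E :: 'a mat)" "pr n (- (E \<inter> {..<n})) = (pr n (- E) :: 'a mat)"
    by (auto simp: pr_def intro!: eq_matI)
  obtain \<rho> where \<rho>: "even \<rho>" "rk n (x ^\<^sub>m (2 * l + 1)) \<le> \<rho> + 2 * R (Suc l)" "\<rho> + R (Suc l) \<le> R l"
  proof (rule rk_odd_pow_bound[of "E \<inter> {..<n}" l])
    fix c :: "'a vec" assume "c \<in> carrier_vec n" "\<forall>i<n. i \<notin> E \<inter> {..<n} \<longrightarrow> (x *\<^sub>v c) $ i = 0"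
    then show "c \<bullet> (G *\<^sub>v (x *\<^sub>v c)) = 0" by (intro sing) (auto simp: E_def)
  qed (use xE' GE in \<open>simp_all only: prE R_def\<close>)
  \<comment> \<open>\<open>\<delta>\<close> is the map induced by \<open>x\<close> on the quotient
    by the span of \<open>E\<close>, written on the coordinates outside \<open>E\<close>.\<close>
  define \<delta> where "\<delta> = f * x * f"
  have \<delta>e: "\<delta> $$ (i,m) = (if i \<in> E \<or> m \<in> E then 0 else x $$ (i,m))" if "i < n" "m < n" for i m
  proof -
    have c: "pr n (- E) * x \<in> carrier_mat n n" by (rule carrier_matI; simp)
    show ?thesis unfolding \<delta>_def f_def pr_mult_right_index[OF c that] pr_mult_left_index[OF x_car that] by auto
  qed
  have \<delta>c: "\<delta> \<in> carrier_mat n n" unfolding \<delta>_def f_def by (rule carrier_matI; simp)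
  have \<delta>: "raises n w \<delta>" unfolding raises_def using \<delta>c \<delta>e raisesD(2)[OF X] by auto
  have [simp]: "dim_row f = n" "dim_col f = n" "dim_row \<delta> = n" "dim_col \<delta> = n" using \<delta>c by (auto simp: f_def)
  have fx: "f * x = \<delta>  * f"
  proof (rule eq_matI)
    fix i m assume "i < dim_row (\<delta> * f)" "m < dim_col (\<delta> * f)"
    then have im: "i < n" "m < n" by auto
    show "(f * x) $$ (i,m) = (\<delta> * f) $$ (i,m)"
      unfolding f_def pr_mult_right_index[OF \<delta>c im] pr_mult_left_index[OF x_car im] using \<delta>e[OF im] xE[OF im(1), of m] im by auto
  qed auto
  have fxl: "f * x ^\<^sub>m l = \<delta> ^\<^sub>m l * f" for l
  proof (induction l)
    case (Suc l)
    have "f * x ^\<^sub>m Suc l = (f * x ^\<^sub>m l) * x" by (simp add: mat_assoc)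
    also have "\<dots> = \<delta> ^\<^sub>m l * (f * x)" unfolding Suc by (simp add: mat_assoc)
    also have "\<dots> = \<delta> ^\<^sub>m Suc l * f" unfolding fx by (simp add: mat_assoc)
    finally show ?case .
  qed (simp add: mat_mult_one)
  let ?N = "{t \<in> w ` {..<n}. t < 0}"
  let ?c = "\<lambda>i. card {t \<in> ?N. i \<le> dW n w t}"
  \<comment> \<open>From size \<open>j\<close> on the middle block is too small to be counted, so
    the negative weights carry exactly half of the blocks.\<close>
  have cN: "cW n w i = 2 * ?c i" if "j \<le> i" for i
  proof -
    have "{t \<in> ?N. i \<le> dW n w t} = {t \<in> w ` {..<n}. t < 0 \<and> i \<le> dW n w t}" by auto
    then show ?thesis using cW_split_zero[of i n w] card_nonzero_weights[OF s, of i] that j by simp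
  qed
  have Rb: "R m + topF ?c n j m \<le> card F" if m: "?c (Suc j) \<le> m" "m \<le> ?c j" for m
  proof -
    obtain I where I: "I \<subseteq> ?N" "card I = m" "(\<Sum>t\<in>I. dW n w t) = topF ?c n j m"
      by (rule select_weights[of ?N "dW n w" n j m]) (use m j dW_le in auto)
    have finI: "finite I" using I(1) by (rule finite_subset) simp
    have "rk n (\<delta> ^\<^sub>m card I * pr n F) + card {i \<in> F. w i \<in> I} \<le> card F"
    proof (rule rk_raises_pow[OF \<delta> _ _ finI])
      fix i m assume "i < n" "m \<in> F" "\<delta> $$ (i,m) \<noteq> 0"
      then show "i \<in> F" using \<delta>e[of i m] by (auto simp: F_def split: if_splits)
    qed (auto simp: F_def)
    moreover have "card {i \<in> F. w i \<in> I} = (\<Sum>t\<in>I. dW n w t)"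
    proof -
      have "card {i \<in> F. w i \<in> I} = (\<Sum>t\<in>I. card {i \<in> F. w i = t})"
        by (rule card_weights_in[OF finI, of _ n]) (auto simp: F_def)
      also have "\<dots> = (\<Sum>t\<in>I. dW n w t)"
      proof (rule sum.cong[OF refl])
        fix t assume "t \<in> I"
        then have "t < 0" using I(1) by auto
        then have "{i \<in> F. w i = t} = {i. i < n \<and> w i = t}" by (auto simp: F_def E_def)
        then show "card {i \<in> F. w i = t} = dW n w t" by (simp add: dW_def)
      qed
      finally show ?thesis .
    qed
    moreover have "\<delta> ^\<^sub>m m * pr n F = pr n (- E) * x ^\<^sub>m m"
    proof -
      have "pr n F = f" by (auto simp: F_def f_def pr_def intro!: eq_matI)
      then show ?thesis using fxl[of m] by (simp add: f_def)
    qed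
    ultimately show ?thesis using I by (simp add: R_def)
  qed
  have cF: "2 * card F = n"
  proof -
    let ?E = "{i. i < n \<and> i \<in> E}"
    have "card F = card ?E"
    proof (rule bij_betw_same_card[of "\<lambda>i. n - 1 - i"])
      show "bij_betw (\<lambda>i. n - 1 - i) F ?E"
        using star by (intro bij_betwI[where g = "\<lambda>i. n - 1 - i"]) (auto simp: F_def)
    qed
    moreover have "F \<union> ?E = {..<n}" "F \<inter> ?E = {}" by (auto simp: F_def)
    then have "card F + card ?E = n" by (metis card_Un_disjoint card_lessThan finite_Un finite_lessThan)
    ultimately show ?thesis by simp
  qed
  have kk: "2 * ?c (Suc j) < 2 * l + 1" "2 * l + 1 < 2 * ?c j" using k cN[of j] cN[of "Suc j"] l by auto
  have "R l + topF ?c n j l \<le> card F" "R (Suc l) + topF ?c n j (Suc l) \<le> card F" by (rule Rb; use kk in linarith)+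
  moreover have "topF ?c n j l + topF ?c n j (Suc l) = topF (cW n w) n j k"
  proof -
    have "(\<Sum>i\<in>{j<..n}. cW n w i) = (\<Sum>i\<in>{j<..n}. 2 * ?c i)" using cN by (intro sum.cong) auto
    also have "\<dots> = 2 * (\<Sum>i\<in>{j<..n}. ?c i)" by (rule sum_distrib_left[symmetric])
    finally show ?thesis unfolding topF_def l by (simp add: algebra_simps)
  qed
  ultimately have "\<rho> + 2 * R (Suc l) + topF (cW n w) n j k \<le> n" using \<rho>(3) cF by linarith
  \<comment> \<open>The left side of the preceding inequality is therefore odd, while
    \<open>n\<close> is even; this gains the last unit.\<close>
  moreover have "odd (topF (cW n w) n j k)"
    using topF_parity[OF s j(1,2), of k] j l by simp
  ultimately have "\<rho> + 2 * R (Suc l) + topF (cW n w) n j k + 1 \<le> n"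
    using \<rho>(1) \<open>even n\<close> by (metis Suc_eq_plus1 Suc_leI dvd_triv_left even_add le_neq_implies_less)
  then show ?thesis using \<rho>(2) l by simp
qed

end

section \<open>The classical groups\<close>

definition adiag :: "nat \<Rightarrow> (nat \<Rightarrow> 'a::field) \<Rightarrow> 'a mat" where
  "adiag N g = mat N N (\<lambda>(i,j). if j = N - 1 - i then g i else 0)"

lemma adiag_carrier [simp]: "adiag N g \<in> carrier_mat N N"
  by (simp add: adiag_def)

lemma adiag_dim [simp]: "dim_row (adiag N g) = N" "dim_col (adiag N g) = N"
  by (simp_all add: adiag_def)

lemma adiag_mult_inverse:
  assumes "\<And>i. i < N \<Longrightarrow> g i \<noteq> 0"
  shows "adiag N g * adiag N (\<lambda>i. inverse (g (N - 1 - i))) = 1\<^sub>m N"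
    "adiag N (\<lambda>i. inverse (g (N - 1 - i))) * adiag N g = 1\<^sub>m N"
proof -
  have e: "(adiag N g * adiag N h) $$ (i,j) = (if i = j then g i * h (N - 1 - i) else 0)" if "i < N" "j < N" for g h :: "nat \<Rightarrow> 'a" and i j
  proof -
    have "(adiag N g * adiag N h) $$ (i,j) = (\<Sum>k<N. if k = N - 1 - i then g i * (if j = N - 1 - k then h k else 0) else 0)"
      unfolding mat_mult_index[OF adiag_carrier adiag_carrier that] using that by (intro sum.cong) (auto simp: adiag_def)
    also have "\<dots> = (if i = j then g i * h (N - 1 - i) else 0)" using that by auto
    finally show ?thesis .
  qed
  show "adiag N g * adiag N (\<lambda>i. inverse (g (N - 1 - i))) = 1\<^sub>m N"
    using assms by (intro eq_matI) (auto simp: e simp del: index_mult_mat(1))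
  show "adiag N (\<lambda>i. inverse (g (N - 1 - i))) * adiag N g = 1\<^sub>m N"
    using assms by (intro eq_matI) (auto simp: e simp del: index_mult_mat(1))
qed

lemma adiag_form:
  assumes "a \<in> carrier_vec N" "b \<in> carrier_vec N"
  shows "a \<bullet> (adiag N g *\<^sub>v b) = (\<Sum>i<N. a $ i * g i * b $ (N - 1 - i))"
proof -
  have "a \<bullet> (adiag N g *\<^sub>v b) = (\<Sum>i<N. \<Sum>j<N. if j = N - 1 - i then a $ i * g i * b $ (N - 1 - i) else 0)"
    unfolding quad_expand[OF adiag_carrier assms] by (intro sum.cong) (auto simp: adiag_def)
  also have "\<dots> = (\<Sum>i<N. a $ i * g i * b $ (N - 1 - i))" by (intro sum.cong) auto
  finally show ?thesis .
qed

lemma sum_fold_halves: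
  fixes f :: "nat \<Rightarrow> 'a::comm_monoid_add"
  shows "(\<Sum>i<N. f i) = (\<Sum>i<N div 2. f i + f (N - 1 - i)) + (if odd N then f (N div 2) else 0)"
proof -
  have "{..<N} = {..<N div 2} \<union> {N - N div 2..<N} \<union> (if odd N then {N div 2} else {})" by (auto elim: oddE)
  then have "(\<Sum>i<N. f i) = sum f ({..<N div 2} \<union> {N - N div 2..<N} \<union> (if odd N then {N div 2} else {}))" by (simp only:)
  also have "\<dots> = sum f ({..<N div 2} \<union> {N - N div 2..<N}) + sum f (if odd N then {N div 2} else {})"
    by (rule sum.union_disjoint) (auto elim: oddE)
  also have "sum f ({..<N div 2} \<union> {N - N div 2..<N}) = sum f {..<N div 2} + sum f {N - N div 2..<N}"
    by (rule sum.union_disjoint) auto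
  also have "sum f {N - N div 2..<N} = (\<Sum>i<N div 2. f (N - 1 - i))"
    by (rule sum.reindex_bij_witness[of _ "\<lambda>i. N - 1 - i" "\<lambda>i. N - 1 - i"]) auto
  finally show ?thesis by (simp add: sum.distrib)
qed

text \<open>The Gram matrix of the polar form of \<open>qform\<close>; in the middle the square of
  one coordinate polarizes to twice a product.\<close>

definition Gq :: "nat \<Rightarrow> 'a::field mat" where
  "Gq N = adiag N (\<lambda>i. if i = N - 1 - i then 2 else 1)"

lemma qform_polar:
  assumes "a \<in> carrier_vec N" "b \<in> carrier_vec N"
  shows "qform N (a + b) = qform N a + qform N b + a \<bullet> (Gq N *\<^sub>v (b :: 'a::field vec))"
proof -
  have s: "(a + b) $ i = a $ i + b $ i" if "i < N" for i using assms that by simp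
  have "a \<bullet> (Gq N *\<^sub>v b) = (\<Sum>i<N. a $ i * (if i = N - 1 - i then 2 else 1) * b $ (N - 1 - i))"
    unfolding Gq_def by (rule adiag_form[OF assms])
  also have "\<dots> = (\<Sum>i<N div 2. a $ i * b $ (N - 1 - i) + a $ (N - 1 - i) * b $ i)
      + (if odd N then a $ (N div 2) * 2 * b $ (N div 2) else 0)"
  proof -
    have "N - 1 - N div 2 = N div 2" if "odd N" using that by (auto elim: oddE)
    moreover have "N - 1 - (N - 1 - i) = i \<and> i \<noteq> N - 1 - i \<and> N - 1 - i \<noteq> i" if "i < N div 2" for i using that by auto
    ultimately show ?thesis unfolding sum_fold_halves[of _ N] by (auto intro!: sum.cong)
  qed
  moreover have "(\<Sum>i<N div 2. (a + b) $ i * (a + b) $ (N - 1 - i)) = (\<Sum>i<N div 2. a $ i * a $ (N - 1 - i))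
      + (\<Sum>i<N div 2. b $ i * b $ (N - 1 - i)) + (\<Sum>i<N div 2. a $ i * b $ (N - 1 - i) + a $ (N - 1 - i) * b $ i)"
    unfolding sum.distrib[symmetric] using s by (intro sum.cong) (auto simp: algebra_simps)
  moreover have "(if odd N then ((a + b) $ (N div 2))\<^sup>2 else 0) = (if odd N then (a $ (N div 2))\<^sup>2 else 0)
      + (if odd N then (b $ (N div 2))\<^sup>2 else 0) + (if odd N then a $ (N div 2) * 2 * b $ (N div 2) else 0)"
    using s[of "N div 2"] by (auto simp: power2_eq_square algebra_simps odd_pos)
  ultimately show ?thesis unfolding qform_def by (simp only: algebra_simps)
qed

lemma bilinear_ext:
  fixes A B :: "'a::field mat"
  assumes A: "A \<in> carrier_mat n n" "B \<in> carrier_mat n n"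
    and e: "\<And>a b. a \<in> carrier_vec n \<Longrightarrow> b \<in> carrier_vec n \<Longrightarrow> a \<bullet> (A *\<^sub>v b) = a \<bullet> (B *\<^sub>v b)"
  shows "A = B"
proof (rule eq_matI)
  fix i j assume "i < dim_row B" "j < dim_col B"
  then have ij: "i < n" "j < n" using A by auto
  have u: "unit_vec n i \<bullet> (M *\<^sub>v unit_vec n j) = M $$ (i,j)" if "M \<in> carrier_mat n n" for M :: "'a mat"
  proof -
    have "unit_vec n i \<bullet> (M *\<^sub>v unit_vec n j) = (M *\<^sub>v unit_vec n j) $ i"
      by (rule scalar_prod_left_unit[OF _ ij(1)]) (use that in \<open>auto intro: carrier_vecI\<close>)
    also have "\<dots> = row M i \<bullet> unit_vec n j" using that ij by simp
    also have "\<dots> = row M i $ j" by (rule scalar_prod_right_unit) (use that ij in auto)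
    finally show ?thesis using that ij by simp
  qed
  show "A $$ (i,j) = B $$ (i,j)" using e[of "unit_vec n i" "unit_vec n j"] u[OF A(1)] u[OF A(2)] by simp
qed (use A in auto)

lemma vec_transpose_form:
  fixes v G :: "'a::field mat"
  assumes "v \<in> carrier_mat n n" "G \<in> carrier_mat n n" "a \<in> carrier_vec n" "b \<in> carrier_vec n"
  shows "(v *\<^sub>v a) \<bullet> (G *\<^sub>v (v *\<^sub>v b)) = a \<bullet> (transpose_mat v * G * v *\<^sub>v b)"
proof -
  have [simp]: "dim_row v = n" "dim_col v = n" "dim_row G = n" "dim_col G = n" "dim_vec a = n" "dim_vec b = n" using assms by auto
  have c: "v *\<^sub>v a \<in> carrier_vec n" "G *\<^sub>v (v *\<^sub>v b) \<in> carrier_vec n" by (rule carrier_vecI; simp)+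
  have "a \<bullet> (transpose_mat v * G * v *\<^sub>v b) = a \<bullet> (transpose_mat v *\<^sub>v (G *\<^sub>v (v *\<^sub>v b)))"
    by (simp add: mat_vec_assoc)
  also have "\<dots> = (transpose_mat v *\<^sub>v (G *\<^sub>v (v *\<^sub>v b))) \<bullet> a"
    by (rule comm_scalar_prod[OF assms(3)]) (rule carrier_vecI, simp)
  also have "\<dots> = (G *\<^sub>v (v *\<^sub>v b)) \<bullet> (v *\<^sub>v a)" by (rule transpose_vec_mult_scalar[OF assms(1,3) c(2)])
  also have "\<dots> = (v *\<^sub>v a) \<bullet> (G *\<^sub>v (v *\<^sub>v b))" by (rule comm_scalar_prod[OF c(2,1)])
  finally show ?thesis by simp
qed

lemma orth_group_iso:
  assumes "v \<in> orth_group N"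
  shows "transpose_mat v * Gq N * v = Gq N"
proof (rule bilinear_ext)
  have v: "v \<in> carrier_mat N N" using assms by (simp add: orth_group_def)
  have q: "qform N (v *\<^sub>v a) = qform N a" if "a \<in> carrier_vec N" for a using assms that by (simp add: orth_group_def)
  have G: "Gq N \<in> carrier_mat N N" by (simp add: Gq_def)
  then show "transpose_mat v * Gq N * v \<in> carrier_mat N N" "Gq N \<in> carrier_mat N N" using v by auto
  fix a b :: "'a vec" assume ab: "a \<in> carrier_vec N" "b \<in> carrier_vec N"
  have vab: "v *\<^sub>v a \<in> carrier_vec N" "v *\<^sub>v b \<in> carrier_vec N" using v ab by auto
  have "qform N (v *\<^sub>v a + v *\<^sub>v b) = qform N (a + b)"
    using q[of "a + b"] mult_add_distrib_mat_vec[OF v ab] ab by simp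
  then have "(v *\<^sub>v a) \<bullet> (Gq N *\<^sub>v (v *\<^sub>v b)) = a \<bullet> (Gq N *\<^sub>v b)"
    unfolding qform_polar[OF ab] qform_polar[OF vab] q[OF ab(1)] q[OF ab(2)] by simp
  then show "a \<bullet> (transpose_mat v * Gq N * v *\<^sub>v b) = a \<bullet> (Gq N *\<^sub>v b)"
    using vec_transpose_form[OF v G ab] by simp
qed

lemma Jsp_adiag: "Jsp N = adiag N (\<lambda>i. if i < N div 2 then 1 else - 1)"
  unfolding Jsp_def adiag_def by (rule eq_matI) auto

lemma alt_adiag:
  assumes "\<And>i. i < N \<Longrightarrow> g (N - 1 - i) = - g i" "\<And>i. i < N \<Longrightarrow> i \<noteq> N - 1 - i"
  shows "alt_mat N (adiag N g)"
  unfolding alt_mat_def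
proof (intro conjI allI impI)
  fix i j assume ij: "i < N" "j < N"
  show "adiag N g $$ (i,j) = - adiag N g $$ (j,i)"
  proof (cases "j = N - 1 - i")
    case True
    then have "i = N - 1 - j" using ij by auto
    then show ?thesis using True ij assms(1)[OF ij(1)] by (simp add: adiag_def)
  next
    case False
    then have "i \<noteq> N - 1 - j" using ij by auto
    then show ?thesis using False ij by (simp add: adiag_def)
  qed
qed (use assms(2) in \<open>auto simp: adiag_def\<close>)

text \<open>The number of parts of size \<open>j\<close> that \<open>\<psi>\<close> can move, in terms of the size \<open>d\<close> of the middle block.\<close>

definition collapse :: "cgroup \<Rightarrow> nat \<Rightarrow> nat \<Rightarrow> nat \<Rightarrow> nat" where
  "collapse ty p d j = (case ty of
      GLt \<Rightarrow> 0
    | SOeven \<Rightarrow> (if even j then 0 else if p \<noteq> 2 then (if d < j then 1 else 0) else (if j < d then 1 else 2))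
    | SOodd \<Rightarrow> (if even j \<and> d < j then 1 else 0)
    | Spt \<Rightarrow> (if odd j \<and> j < d then 1 else 0))"

text \<open>The parity of \<open>cW\<close> at \<open>Suc j\<close> decides which powers sit at odd
  offsets: even ones below the size of the middle block, odd ones above it.\<close>

lemma parity_cases:
  assumes s: "sym_wt n w" and X: "raises n w X" and j: "1 \<le> j" "j \<le> n"
    and k: "cW n w (Suc j) < k" "k < cW n w j" "odd (k - cW n w (Suc j))"
  shows "j < dW n w 0 \<Longrightarrow> odd j \<Longrightarrow> even (dW n w 0) \<Longrightarrow> (\<And>l. even (rk n (X ^\<^sub>m (2 * l)))) \<Longrightarrow>
      rk n (X ^\<^sub>m k) + topF (cW n w) n j k + 1 \<le> n"
    and "dW n w 0 < j \<Longrightarrow> odd (j + dW n w 0) \<Longrightarrow> (\<And>l. even (rk n (X ^\<^sub>m (2 * l + 1)))) \<Longrightarrow>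
      rk n (X ^\<^sub>m k) + topF (cW n w) n j k + 1 \<le> n"
proof -
  have o: "odd k \<longleftrightarrow> even (cW n w (Suc j))" using k by (metis even_add less_imp_le_nat le_add_diff_inverse)
  have p: "odd (cW n w (Suc j)) \<longleftrightarrow> Suc j \<le> dW n w 0" using cW_parity[OF s] by simp
  show "rk n (X ^\<^sub>m k) + topF (cW n w) n j k + 1 \<le> n"
    if "j < dW n w 0" "odd j" "even (dW n w 0)" "\<And>l. even (rk n (X ^\<^sub>m (2 * l)))"
  proof -
    have "even k" using o p that by auto
    then show ?thesis using that(4)[of "k div 2"] that(1-3) by (intro parity_gap[OF s X j k]) auto
  qed
  show "rk n (X ^\<^sub>m k) + topF (cW n w) n j k + 1 \<le> n"
    if "dW n w 0 < j" "odd (j + dW n w 0)" "\<And>l. even (rk n (X ^\<^sub>m (2 * l + 1)))"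
  proof -
    have "odd k" using o p that by auto
    then obtain l where "k = 2 * l + 1" by (elim oddE)
    then show ?thesis using that(3)[of l] that(1,2) by (intro parity_gap[OF s X j k]) auto
  qed
qed

text \<open>Symplectic groups use even powers, orthogonal groups where 2 is invertible use odd
  powers. In characteristic 2 the polar form is alternating: even powers settle \<open>j\<close>
  below the middle block, the quadratic form together with parity settles \<open>j\<close> above
  it.\<close>

lemma rk_upper_bound:
  fixes v :: "'a::field mat"
  assumes v: "v \<in> grp ty n" and N: "N = dimN ty n" and w: "wunip N w v"
    and s: "ty \<noteq> GLt \<Longrightarrow> sym_wt N w" and odd2: "\<not> (ty = SOodd \<and> CHAR('a) = 2)"
    and j: "1 \<le> j" "j \<le> N" and k: "cW N w (Suc j) \<le> k" "k \<le> cW N w j"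
  shows "rk N ((v - 1\<^sub>m N) ^\<^sub>m k) + topF (cW N w) N j k
    + min (collapse ty CHAR('a) (dW N w 0) j) (min (k - cW N w (Suc j)) (cW N w j - k)) \<le> N"
proof -
  let ?d = "dW N w 0"
  let ?g = "collapse ty CHAR('a) ?d j"
  have vc: "v \<in> carrier_mat N N" using w by (simp add: wunip_def)
  obtain u where u: "wunip N w u" "v * u = 1\<^sub>m N" "u * v = 1\<^sub>m N" by (rule wunip_inverse[OF w])
  have uc: "u \<in> carrier_mat N N" using u by (simp add: wunip_def)
  have X: "raises N w (v - 1\<^sub>m N)" using w vc by (simp add: wunip_iff)
  have two: "(2::'a) \<noteq> 0" if "CHAR('a) \<noteq> 2"
  proof
    assume "(2::'a) = 0"
    then have "CHAR('a) dvd 2" using of_nat_eq_0_iff_char_dvd[where 'a = 'a, of 2] by simp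
    moreover from this have "CHAR('a) \<noteq> 0" by (metis dvd_0_left zero_neq_numeral)
    ultimately have "CHAR('a) \<le> 2" "CHAR('a) \<noteq> 0" "CHAR('a) \<noteq> 1" using CHAR_not_1[where 'a = 'a] by (auto intro: dvd_imp_le)
    with that show False by linarith
  qed
  show ?thesis
  proof (cases "?g = 0")
    case True
    then show ?thesis using rk_raises_topF[OF X j k] by simp
  next
    case False
    then have ty: "ty \<noteq> GLt" by (auto simp: collapse_def)
    note s = s[OF ty]
    have dpar: "even ?d \<longleftrightarrow> ty \<noteq> SOodd" using n_parity[OF s] N ty by (cases ty) auto
    have iso: "isometry N (adiag N g) (adiag N (\<lambda>i. inverse (g (N - 1 - i)))) v u"
      if "transpose_mat v * adiag N g * v = adiag N g" "\<And>i. i < N \<Longrightarrow> g i \<noteq> 0" for g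
      by unfold_locales (use vc uc u(2,3) that adiag_mult_inverse[of N g] in auto)
    show ?thesis
    proof (cases "ty = Spt")
      case True
      then have "transpose_mat v * Jsp N * v = Jsp N" using v N by (simp add: grp_def Let_def)
      then interpret I: isometry N "adiag N (\<lambda>i. if i < N div 2 then 1 else - 1)" "adiag N (\<lambda>i. inverse (if N - 1 - i < N div 2 then 1 else - 1))" v u
        by (intro iso) (auto simp: Jsp_adiag)
      have alt: "alt_mat N (adiag N (\<lambda>i. if i < N div 2 then 1 else - 1 :: 'a))"
      proof (rule alt_adiag)
        fix i assume i: "i < N"
        then show "i \<noteq> N - 1 - i" using N True by simp presburger
        show "(if N - 1 - i < N div 2 then 1 else - 1) = - (if i < N div 2 then 1 else - 1 :: 'a)"
          using i N True by auto
      qed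
      have g: "?g = 1" "odd j" "j < ?d" using False True by (auto simp: collapse_def split: if_splits)
      show ?thesis unfolding g(1)
        by (rule upper_collapse1[OF s X j _ k], use g in simp)
          (rule parity_cases(1)[OF s X j], use g True dpar I.even_rk_alternating_form[OF alt] in \<open>auto simp: I.x_def\<close>)
    next
      case nSp: False
      then have "v \<in> orth_group N" using v N ty by (cases ty) (auto simp: grp_def Let_def)
      have gq: "ty = SOeven \<or> (2::'a) \<noteq> 0" using odd2 two ty nSp by (cases ty) auto
      have mid: "i \<noteq> N - 1 - i" "N - Suc i \<noteq> i" if "i < N" "ty = SOeven" for i using that N by (simp; presburger)+
      interpret I: isometry N "Gq N" "adiag N (\<lambda>i. inverse (if N - 1 - i = N - 1 - (N - 1 - i) then 2 else 1))" v u
        unfolding Gq_def by (rule iso) (use orth_group_iso[OF \<open>v \<in> orth_group N\<close>] gq mid in \<open>auto simp: Gq_def\<close>)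
      have Gsym: "transpose_mat (Gq N) = (Gq N :: 'a mat)" by (auto simp: Gq_def adiag_def intro!: eq_matI)
      show ?thesis
      proof (cases "CHAR('a) = 2")
        case p: False
        have g: "?g = 1" "?d < j" "odd (j + ?d)" using False nSp ty p dpar
          by (cases ty; simp add: collapse_def split: if_splits)+
        show ?thesis unfolding g(1)
          by (rule upper_collapse1[OF s X j _ k], use g in simp)
            (rule parity_cases(2)[OF s X j], use g I.even_rk_symmetric_form[OF Gsym two[OF p] w] in \<open>auto simp: I.x_def\<close>)
      next
        case p: True
        then have t: "ty = SOeven" using ty nSp odd2 by (cases ty) auto
        then have evN: "even N" using N by simp
        have oj: "odd j" using False t p by (auto simp: collapse_def split: if_splits)
        have m1: "- 1 = (1::'a)"
        proof -
          have "of_nat 2 = (0::'a)" by (subst of_nat_eq_0_iff_char_dvd) (simp add: p)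
          then have "1 + 1 = (0::'a)" by simp
          then show ?thesis by (simp add: minus_equation_iff eq_neg_iff_add_eq_0)
        qed
        have alt: "alt_mat N (Gq N :: 'a mat)" unfolding Gq_def
          by (rule alt_adiag) (use mid t m1 in auto)
        note ev = I.even_rk_alternating_form[OF alt]
        show ?thesis
        proof (cases "j < ?d")
          case True
          have g: "?g = 1" using t p oj True by (simp add: collapse_def)
          show ?thesis unfolding g
            by (rule upper_collapse1[OF s X j _ k], use True in simp)
              (rule parity_cases(1)[OF s X j], use True oj t dpar ev in \<open>auto simp: I.x_def\<close>)
        next
          case False
          then have dj: "?d < j" using dpar t oj by (cases "?d = j") auto
          have g: "?g = 2" using t p oj False by (simp add: collapse_def)
          \<comment> \<open>With \<open>y = x c\<close> and \<open>v c = c + y\<close>, invariance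
            of the form gives \<open>q(y) + B(c,y) = 0\<close>. Since one coordinate of each dual
            pair of \<open>y\<close> vanishes, \<open>q(y) = 0\<close>.\<close>
          have sing: "c \<bullet> (Gq N *\<^sub>v (I.x *\<^sub>v c)) = 0"
            if c: "c \<in> carrier_vec N" and z: "\<forall>i<N. \<not> (0 < w i \<or> w i = 0 \<and> i < N - 1 - i) \<longrightarrow> (I.x *\<^sub>v c) $ i = 0" for c
          proof -
            let ?y = "I.x *\<^sub>v c"
            have y: "?y \<in> carrier_vec N" by (rule carrier_vecI) simp
            have "v *\<^sub>v c = c + ?y"
            proof -
              have "c + ?y = (1\<^sub>m N + I.x) *\<^sub>v c"
                using c I.x_car by (subst add_mult_distrib_mat_vec[of _ N N]) auto
              also have "1\<^sub>m N + I.x = v" unfolding I.x_def by (simp add: mat_diff_simps)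
              finally show ?thesis by simp
            qed
            then have "qform N (c + ?y) = qform N c" using \<open>v \<in> orth_group N\<close> c by (auto simp: orth_group_def)
            then have "qform N ?y + c \<bullet> (Gq N *\<^sub>v ?y) = 0" unfolding qform_polar[OF c y] by simp
            moreover have "qform N ?y = 0"
            proof -
              have "?y $ i * ?y $ (N - 1 - i) = 0" if "i < N div 2" for i
              proof -
                have "w (N - 1 - i) = - w i" "i < N" using s that by (auto simp: sym_wt_def)
                then have "\<not> (0 < w i \<or> w i = 0 \<and> i < N - 1 - i) \<or>
                  \<not> (0 < w (N - 1 - i) \<or> w (N - 1 - i) = 0 \<and> N - 1 - i < N - 1 - (N - 1 - i))" by auto
                then show ?thesis using z[rule_format, of i] z[rule_format, of "N - 1 - i"] \<open>i < N\<close> by auto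
              qed
              then have "(\<Sum>i<N div 2. ?y $ i * ?y $ (N - 1 - i)) = 0" by (intro sum.neutral) blast
              then show ?thesis using evN by (simp add: qform_def del: index_mult_mat_vec)
            qed
            ultimately show ?thesis by simp
          qed
          show ?thesis unfolding g
          proof (rule upper_collapse2[OF s X j dj _ k evN])
            show "odd (j + ?d)" using oj dpar t by simp
            show "even (rk N ((v - 1\<^sub>m N) ^\<^sub>m (2 * l)))" for l using ev[of l] by (simp add: I.x_def)
            show "rk N ((v - 1\<^sub>m N) ^\<^sub>m k) + topF (cW N w) N j k + 1 \<le> N"
              if "cW N w (Suc j) < k" "k < cW N w j" "odd (k - cW N w (Suc j))" for k
              unfolding I.x_def[symmetric]
              by (rule I.gap_singular[OF s _ j dj oj evN that _ sing])
                (use X in \<open>auto simp: I.x_def Gq_def adiag_def split: if_splits\<close>)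
          qed
        qed
      qed
    qed
  qed
qed

section \<open>Constructing isometries from chains\<close>

definition supp_in :: "nat \<Rightarrow> nat set \<Rightarrow> nat set \<Rightarrow> 'a::field mat \<Rightarrow> bool" where
  "supp_in n A B M \<longleftrightarrow> M \<in> carrier_mat n n \<and> (\<forall>l<n. \<forall>i<n. M $$ (l,i) \<noteq> 0 \<longrightarrow> l \<in> A \<and> i \<in> B)"

lemma supp_inD: "supp_in n A B M \<Longrightarrow> l < n \<Longrightarrow> i < n \<Longrightarrow> l \<notin> A \<or> i \<notin> B \<Longrightarrow> M $$ (l,i) = 0"
  unfolding supp_in_def by blast

lemma supp_in_mult_0:
  assumes M: "supp_in n A B M" and M': "supp_in n C D M'" and "B \<inter> C = {}"
  shows "M * M' = 0\<^sub>m n n"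
proof (rule eq_matI)
  have c: "M \<in> carrier_mat n n" "M' \<in> carrier_mat n n" using M M' by (auto simp: supp_in_def)
  fix l i assume "l < dim_row (0\<^sub>m n n :: 'a mat)" "i < dim_col (0\<^sub>m n n :: 'a mat)"
  then have li: "l < n" "i < n" by auto
  have "M $$ (l,k) * M' $$ (k,i) = 0" if "k < n" for k
    using supp_inD[OF M li(1) that] supp_inD[OF M' that li(2)] assms(3) by (cases "k \<in> B") auto
  then have "(M * M') $$ (l,i) = 0" unfolding mat_mult_index[OF c li] by (intro sum.neutral) auto
  then show "(M * M') $$ (l,i) = 0\<^sub>m n n $$ (l,i)" using li by simp
qed (use M M' in \<open>auto simp: supp_in_def\<close>)

lemma supp_in_pr: "supp_in n A A (pr n A)"
  by (auto simp: supp_in_def pr_def split: if_splits)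

lemma mat_zero_simps:
  "M \<in> carrier_mat n n \<Longrightarrow> M + 0\<^sub>m n n = M" "M \<in> carrier_mat n n \<Longrightarrow> 0\<^sub>m n n + M = M" "M \<in> carrier_mat n n \<Longrightarrow> M - 0\<^sub>m n n = (M :: 'a::ring_1 mat)"
  by (auto intro!: eq_matI)

lemma commute_inverse:
  assumes "dim_row e = n" "dim_col e = n" "dim_row P = n" "dim_col P = n" "dim_row V = n" "dim_col V = n"
    and "P * V = 1\<^sub>m n" "V * P = (1\<^sub>m n :: 'a::ring_1 mat)" "e * P = P * e"
  shows "e * V = V * e"
proof -
  note [simp] = assms(1-6)
  have "V * e = V * (e * (P * V))" unfolding assms(7) by (simp add: mat_mult_one)
  also have "\<dots> = V * ((e * P) * V)" by (simp add: mat_assoc)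
  also have "\<dots> = V * (P * (e * V))" unfolding assms(9) by (simp add: mat_assoc)
  also have "\<dots> = e * V" by (rule mat_cancel[OF assms(8)]) simp_all
  finally show ?thesis by simp
qed

lemma mat_add_eq_diff:
  fixes A B C :: "'a::ring_1 mat"
  assumes "A + B = C" "dim_row A = dim_row B" "dim_col A = dim_col B"
  shows "A - C = - B"
  unfolding assms(1)[symmetric] using assms(2,3) by (auto intro!: eq_matI)

text \<open>\<open>A\<close> is meant to index a totally singular coordinate subspace and
  \<open>B\<close> the one dual to it; \<open>Hm * (transpose_mat Y * G)\<close> is the adjoint of
  \<open>Y\<close>. The support of \<open>S\<close> makes \<open>Y * S\<close> and \<open>S\<close>
  times the adjoint vanish, which later linearises the product.\<close>

locale chain_iso =
  fixes n :: nat and w :: "nat \<Rightarrow> int" and G Hm Y S :: "'a::field mat" and A B :: "nat set"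
  assumes car: "G \<in> carrier_mat n n" "Hm \<in> carrier_mat n n"
    and GH: "G * Hm = 1\<^sub>m n" "Hm * G = 1\<^sub>m n"
    and Gsym: "transpose_mat G = G \<or> transpose_mat G = - G"
    and AB: "A \<inter> B = {}"
    and Y: "supp_in n A A Y" "raises n w Y"
    and Ys: "supp_in n B B (Hm * (transpose_mat Y * G))" "raises n w (Hm * (transpose_mat Y * G))"
    and S: "supp_in n (- A) (- B) S" "raises n w S"
    and Siso: "transpose_mat (1\<^sub>m n + S) * G * (1\<^sub>m n + S) = G"
begin

definition Z where "Z = Hm * (transpose_mat Y * G)"
definition P where "P = 1\<^sub>m n + Z"
definition V where "V = (SOME Q. wunip n w Q \<and> P * Q = 1\<^sub>m n \<and> Q * P = 1\<^sub>m n)"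
definition D where "D = (1\<^sub>m n + Y) * V"
definition v where "v = D * (1\<^sub>m n + S)"
definition x where "x = v - 1\<^sub>m n"
definition y where "y = Y - Z + S"

lemma Zr: "raises n w Z" "supp_in n B B Z"
  using Ys by (simp_all add: Z_def)

lemma Pw: "wunip n w P"
  unfolding P_def by (rule wunip_add1[OF Zr(1)])

lemma V: "wunip n w V" "P * V = 1\<^sub>m n" "V * P = 1\<^sub>m n"
proof -
  have "\<exists>Q. wunip n w Q \<and> P * Q = 1\<^sub>m n \<and> Q * P = 1\<^sub>m n" using wunip_inverse[OF Pw] by metis
  from someI_ex[OF this] show "wunip n w V" "P * V = 1\<^sub>m n" "V * P = 1\<^sub>m n" unfolding V_def by auto
qed

lemma cars: "Y \<in> carrier_mat n n" "Z \<in> carrier_mat n n" "S \<in> carrier_mat n n" "P \<in> carrier_mat n n" "V \<in> carrier_mat n n"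
  using raisesD(1)[OF Y(2)] raisesD(1)[OF Zr(1)] raisesD(1)[OF S(2)] Pw V(1) by (auto simp: wunip_def)

lemmas dims [simp] = carrier_matD[OF car(1)] carrier_matD[OF car(2)] carrier_matD[OF cars(1)] carrier_matD[OF cars(2)]
  carrier_matD[OF cars(3)] carrier_matD[OF cars(4)] carrier_matD[OF cars(5)]

lemma cars': "D \<in> carrier_mat n n" "v \<in> carrier_mat n n" "x \<in> carrier_mat n n" "y \<in> carrier_mat n n"
  unfolding x_def v_def D_def y_def by (rule carrier_matI; simp)+

lemmas dims' [simp] = carrier_matD[OF cars'(1)] carrier_matD[OF cars'(2)] carrier_matD[OF cars'(3)] carrier_matD[OF cars'(4)]

lemma YZ: "Y * Z = 0\<^sub>m n n" "Z * Y = 0\<^sub>m n n"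
  using supp_in_mult_0[OF Y(1) Zr(2)] supp_in_mult_0[OF Zr(2) Y(1)] AB by auto

lemma YS: "Y * S = 0\<^sub>m n n" "S * Z = 0\<^sub>m n n"
  using supp_in_mult_0[OF Y(1) S(1)] supp_in_mult_0[OF S(1) Zr(2)] by auto

lemma wunip_D: "wunip n w D"
  unfolding D_def by (rule wunip_mult[OF wunip_add1[OF Y(2)] V(1)])

lemma wunip_v: "wunip n w v"
  unfolding v_def by (rule wunip_mult[OF wunip_D wunip_add1[OF S(2)]])

lemma YPcomm: "(1\<^sub>m n + Y) * P = P * (1\<^sub>m n + Y)"
  unfolding P_def by (simp add: mat_add_distrib mat_mult_one YZ mat_zero_simps[of _ n])
    (rule eq_matI; simp add: algebra_simps)

text \<open>The adjoint of \<open>1 + Y\<close> is \<open>1 + Z\<close> and conversely,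
  \<open>G\<close> being symmetric up to sign. As \<open>Y\<close> and \<open>Z\<close> annihilate
  each other these factors commute, so the adjoint of \<open>D\<close> is its inverse.\<close>

lemma iso_D: "transpose_mat D * G * D = G"
proof -
  have GZ: "G * Z = transpose_mat Y * G" unfolding Z_def by (rule mat_cancel[OF GH(1)]) simp_all
  have t1: "transpose_mat (1\<^sub>m n + M) = 1\<^sub>m n + transpose_mat M" if "M \<in> carrier_mat n n" for M :: "'a mat"
    using that by (auto intro!: eq_matI)
  have GP: "transpose_mat (1\<^sub>m n + Y) * G = G * P"
    unfolding P_def t1[OF cars(1)] by (simp add: mat_add_distrib mat_mult_one GZ)
  have PG: "transpose_mat P * G = G * (1\<^sub>m n + Y)"
  proof -
    have "transpose_mat (transpose_mat (1\<^sub>m n + Y) * G) = transpose_mat (G * P)" using GP by simp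
    moreover have "transpose_mat (transpose_mat (1\<^sub>m n + Y) * G) = transpose_mat G * (1\<^sub>m n + Y)"
      by (subst transpose_mult[of _ n n _ n]) ((rule carrier_matI; simp) | simp)+
    moreover have "transpose_mat (G * P) = transpose_mat P * transpose_mat G"
      by (rule transpose_mult[of _ n n _ n]) ((rule carrier_matI; simp)+)
    ultimately have "transpose_mat G * (1\<^sub>m n + Y) = transpose_mat P * transpose_mat G" by simp
    then show ?thesis using Gsym
    proof (elim disjE)
      assume e: "transpose_mat G * (1\<^sub>m n + Y) = transpose_mat P * transpose_mat G" "transpose_mat G = - G"
      then have "- (G * (1\<^sub>m n + Y)) = - (transpose_mat P * G)" by (simp add: mat_uminus_mult)
      then have "- (- (G * (1\<^sub>m n + Y))) = - (- (transpose_mat P * G))" by simp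
      then show ?thesis by (simp add: uminus_uminus_mat)
    qed simp
  qed
  have "transpose_mat D = transpose_mat V * transpose_mat (1\<^sub>m n + Y)"
    unfolding D_def by (rule transpose_mult[of _ n n _ n]) ((rule carrier_matI; simp)+)
  then have "transpose_mat D * G * D = transpose_mat V * ((transpose_mat (1\<^sub>m n + Y) * G) * ((1\<^sub>m n + Y) * V))"
    by (simp add: mat_assoc D_def)
  also have "\<dots> = transpose_mat V * (G * ((P * (1\<^sub>m n + Y)) * V))" unfolding GP by (simp add: mat_assoc)
  also have "\<dots> = transpose_mat V * (G * ((1\<^sub>m n + Y) * (P * V)))" unfolding YPcomm[symmetric] by (simp add: mat_assoc)
  also have "\<dots> = transpose_mat V * (transpose_mat P * G)" unfolding V(2) PG by (simp add: mat_mult_one)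
  also have "\<dots> = G"
  proof (rule mat_cancel)
    show "transpose_mat V * transpose_mat P = 1\<^sub>m n"
      using transpose_mult[OF cars(4,5)] unfolding V(2) by simp
  qed simp_all
  finally show ?thesis .
qed

lemma iso_v: "transpose_mat v * G * v = G"
proof -
  have "transpose_mat v = transpose_mat (1\<^sub>m n + S) * transpose_mat D"
    unfolding v_def by (rule transpose_mult[of _ n n _ n]) ((rule carrier_matI; simp)+)
  then have "transpose_mat v * G * v = transpose_mat (1\<^sub>m n + S) * ((transpose_mat D * G * D) * (1\<^sub>m n + S))"
    by (simp add: mat_assoc v_def)
  also have "\<dots> = G" unfolding iso_D using Siso by (simp add: mat_assoc)
  finally show ?thesis .
qed

text \<open>Up to the unit \<open>P\<close>, the nilpotent part of the product is the linear
  expression \<open>Y - Z + S\<close>. Its entries are the arrows themselves, so the rank of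
  \<open>x\<close> becomes that of an explicit sparse matrix.\<close>

lemma Px: "P * x = y"
proof -
  have PD: "P * D = 1\<^sub>m n + Y"
  proof -
    have "P * D = (1\<^sub>m n + Y) * (P * V)" unfolding D_def by (simp add: mat_assoc[symmetric] YPcomm)
    then show ?thesis unfolding V(2) by (simp add: mat_mult_one)
  qed
  have "P * x = (P * D) * (1\<^sub>m n + S) - P" unfolding x_def v_def by (simp add: mat_add_distrib mat_mult_one mat_assoc)
  also have "\<dots> = (1\<^sub>m n + Y) + S - (1\<^sub>m n + Z)" unfolding PD unfolding P_def
    by (simp add: mat_add_distrib mat_mult_one YS mat_zero_simps(1)[OF cars(3)])
  also have "\<dots> = y" unfolding y_def by (rule eq_matI) (auto simp: algebra_simps)
  finally show ?thesis .
qed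

lemma rk_x: "rk n (M * x) = rk n (M * y)" if "M \<in> carrier_mat n n" "M * P = P * M"
proof -
  have [simp]: "dim_row M = n" "dim_col M = n" using that(1) by auto
  have "M * y = P * (M * x)" unfolding Px[symmetric] using that(2) by (simp add: mat_assoc[symmetric])
  then show ?thesis using rk_mult_inv_left[OF cars(4,5) V(3), of "M * x" n] by (simp add: carrier_matI)
qed

lemma commute_x:
  assumes E: "E \<in> carrier_mat n n" and "E * Y = Y * E" "E * Z = Z * E" "E * S = S * E"
  shows "E * P = P * E" "E * V = V * E" "E * x = x * E" "E * D = D * E"
proof -
  have [simp]: "dim_row E = n" "dim_col E = n" using E by auto
  show EP: "E * P = P * E" unfolding P_def by (simp add: mat_add_distrib mat_mult_one assms)
  show EPi: "E * V = V * E" by (rule commute_inverse[OF _ _ _ _ _ _ V(2,3) EP]) simp_all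
  have EY: "E * (1\<^sub>m n + Y) = (1\<^sub>m n + Y) * E" by (simp add: mat_add_distrib mat_mult_one assms)
  have ES: "E * (1\<^sub>m n + S) = (1\<^sub>m n + S) * E" by (simp add: mat_add_distrib mat_mult_one assms)
  have "E * D = (E * (1\<^sub>m n + Y)) * V" unfolding D_def by (simp add: mat_assoc)
  also have "\<dots> = (1\<^sub>m n + Y) * (E * V)" unfolding EY by (simp add: mat_assoc)
  also have "\<dots> = D * E" unfolding EPi D_def by (simp add: mat_assoc)
  finally show ED: "E * D = D * E" .
  have "E * v = (E * D) * (1\<^sub>m n + S)" unfolding v_def by (simp add: mat_assoc)
  also have "\<dots> = D * (E * (1\<^sub>m n + S))" unfolding ED by (simp add: mat_assoc)
  also have "\<dots> = v * E" unfolding ES v_def by (simp add: mat_assoc)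
  finally show "E * x = x * E" unfolding x_def by (simp add: mat_add_distrib mat_mult_one)
qed

text \<open>\<open>D\<close> stabilises the span of \<open>A\<close> and that of the complementary
  coordinates; the quadratic form of its columns is controlled by this.\<close>

lemma commute_A: "pr n A * D = D * pr n A"
proof -
  have a: "pr n A * Y = Y" "Y * pr n A = Y"
  proof -
    have "(pr n A * Y) $$ (i,j) = Y $$ (i,j)" "(Y * pr n A) $$ (i,j) = Y $$ (i,j)" if "i < n" "j < n" for i j
      using supp_inD[OF Y(1) that] pr_mult_left_index[OF cars(1) that] pr_mult_right_index[OF cars(1) that] by auto
    then show "pr n A * Y = Y" "Y * pr n A = Y" by (auto intro!: eq_matI simp del: index_mult_mat(1))
  qed
  have "pr n A * Z = 0\<^sub>m n n" "Z * pr n A = 0\<^sub>m n n"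
    using supp_in_mult_0[OF supp_in_pr Zr(2)] supp_in_mult_0[OF Zr(2) supp_in_pr] AB by auto
  then have P: "pr n A * P = P * pr n A" unfolding P_def by (simp add: mat_add_distrib mat_mult_one)
  have V: "pr n A * V = V * pr n A" by (rule commute_inverse[OF _ _ _ _ _ _ V(2,3) P]) simp_all
  have "pr n A * D = (pr n A * (1\<^sub>m n + Y)) * V" unfolding D_def by (simp add: mat_assoc)
  also have "pr n A * (1\<^sub>m n + Y) = (1\<^sub>m n + Y) * pr n A" by (simp add: mat_add_distrib mat_mult_one a)
  also have "(1\<^sub>m n + Y) * pr n A * V = (1\<^sub>m n + Y) * (pr n A * V)" by (simp add: mat_assoc)
  also have "\<dots> = D * pr n A" unfolding V D_def by (simp add: mat_assoc)
  finally show ?thesis .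
qed

lemma ZV: "Z * V = V * Z" "V - 1\<^sub>m n = - (Z * V)"
proof -
  have "Z * P = P * Z" unfolding P_def by (simp add: mat_add_distrib mat_mult_one)
  then show "Z * V = V * Z" by (rule commute_inverse[OF _ _ _ _ _ _ V(2,3), rotated -1]) simp_all
  have "V + Z * V = 1\<^sub>m n" using V(2) unfolding P_def by (simp add: mat_add_distrib mat_mult_one)
  then show "V - 1\<^sub>m n = - (Z * V)" by (rule mat_add_eq_diff) simp_all
qed

text \<open>On the span of \<open>B\<close> the factors \<open>1 + Y\<close> and
  \<open>1 + S\<close> act as the identity, which leaves \<open>V\<close>.\<close>

lemma x_on_B: "x * pr n B = - (Z * V) * pr n B"
proof -
  have Sf: "S * pr n B = 0\<^sub>m n n" "Y * pr n B = 0\<^sub>m n n"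
    using supp_in_mult_0[OF S(1) supp_in_pr] supp_in_mult_0[OF Y(1) supp_in_pr] AB by auto
  have "pr n B * Z = Z" "Z * pr n B = Z"
  proof -
    have "(pr n B * Z) $$ (i,j) = Z $$ (i,j)" "(Z * pr n B) $$ (i,j) = Z $$ (i,j)" if "i < n" "j < n" for i j
      using supp_inD[OF Zr(2) that] pr_mult_left_index[OF cars(2) that] pr_mult_right_index[OF cars(2) that] by auto
    then show "pr n B * Z = Z" "Z * pr n B = Z" by (auto intro!: eq_matI simp del: index_mult_mat(1))
  qed
  then have "pr n B * P = P * pr n B" unfolding P_def by (simp add: mat_add_distrib mat_mult_one)
  then have c: "pr n B * V = V * pr n B" by (rule commute_inverse[OF _ _ _ _ _ _ V(2,3), rotated -1]) simp_all
  have "v * pr n B = D * ((1\<^sub>m n + S) * pr n B)" unfolding v_def by (simp add: mat_assoc)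
  also have "(1\<^sub>m n + S) * pr n B = pr n B" by (simp add: mat_add_distrib mat_mult_one Sf mat_zero_simps[of _ n])
  also have "D * pr n B = (1\<^sub>m n + Y) * (pr n B * V)" unfolding c D_def by (simp add: mat_assoc)
  also have "\<dots> = ((1\<^sub>m n + Y) * pr n B) * V" by (simp add: mat_assoc)
  also have "(1\<^sub>m n + Y) * pr n B = pr n B" by (simp add: mat_add_distrib mat_mult_one Sf mat_zero_simps[of _ n])
  also have "pr n B * V = V * pr n B" by (rule c)
  finally have "x * pr n B = (V - 1\<^sub>m n) * pr n B" unfolding x_def by (simp add: mat_add_distrib mat_mult_one)
  then show ?thesis unfolding ZV(2) .
qed

text \<open>\<open>V\<close> fixes the span of \<open>A\<close>, and \<open>Y\<close> kills the span
  of \<open>B\<close>; so the factor \<open>V\<close> is visible only on the image of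
  \<open>S\<close>.\<close>

lemma x_on_A:
  assumes a: "a \<in> carrier_vec n" "pr n A *\<^sub>v a = a" and b: "S *\<^sub>v a = pr n B *\<^sub>v (S *\<^sub>v a)"
  shows "x *\<^sub>v a = Y *\<^sub>v a + V *\<^sub>v (S *\<^sub>v a)"
proof -
  have [simp]: "dim_vec a = n" using a by simp
  have "Z * pr n A = 0\<^sub>m n n" using supp_in_mult_0[OF Zr(2) supp_in_pr] AB by auto
  then have "P * pr n A = pr n A" unfolding P_def by (simp add: mat_add_distrib mat_mult_one mat_zero_simps[of _ n])
  then have "V * (P * pr n A) = V * pr n A" by simp
  then have "V * pr n A = pr n A" by (simp add: mat_cancel[OF V(3)])
  then have Pa: "V *\<^sub>v a = a" using a(2) mat_vec_assoc[of V "pr n A" a] by simp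
  have Yf: "Y * pr n B = 0\<^sub>m n n" using supp_in_mult_0[OF Y(1) supp_in_pr] AB by auto
  have "pr n B * Z = Z" "Z * pr n B = Z"
  proof -
    have "(pr n B * Z) $$ (i,j) = Z $$ (i,j)" "(Z * pr n B) $$ (i,j) = Z $$ (i,j)" if "i < n" "j < n" for i j
      using supp_inD[OF Zr(2) that] pr_mult_left_index[OF cars(2) that] pr_mult_right_index[OF cars(2) that] by auto
    then show "pr n B * Z = Z" "Z * pr n B = Z" by (auto intro!: eq_matI simp del: index_mult_mat(1))
  qed
  then have "pr n B * P = P * pr n B" unfolding P_def by (simp add: mat_add_distrib mat_mult_one)
  then have c: "pr n B * V = V * pr n B" by (rule commute_inverse[OF _ _ _ _ _ _ V(2,3), rotated -1]) simp_all
  let ?s = "S *\<^sub>v a"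
  have "Y *\<^sub>v (V *\<^sub>v ?s) = (Y * (V * pr n B)) *\<^sub>v ?s" using b by (simp add: mat_vec_assoc)
  also have "Y * (V * pr n B) = (Y * pr n B) * V" unfolding c[symmetric] by (simp add: mat_assoc)
  finally have YPs: "Y *\<^sub>v (V *\<^sub>v ?s) = 0\<^sub>v n" unfolding Yf by (simp add: mat_vec_assoc) (rule eq_vecI; simp add: scalar_prod_def)
  have add: "(M + M') *\<^sub>v c = M *\<^sub>v c + M' *\<^sub>v c" if "M \<in> carrier_mat n n" "M' \<in> carrier_mat n n" "c \<in> carrier_vec n" for M M' :: "'a mat" and c
    by (rule add_mult_distrib_mat_vec[OF that])
  have addv: "M *\<^sub>v (c + c') = M *\<^sub>v c + M *\<^sub>v c'" if "M \<in> carrier_mat n n" "c \<in> carrier_vec n" "c' \<in> carrier_vec n" for M :: "'a mat" and c c'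
    by (rule mult_add_distrib_mat_vec[OF that])
  have sc: "?s \<in> carrier_vec n" "V *\<^sub>v ?s \<in> carrier_vec n" "Y *\<^sub>v a \<in> carrier_vec n" by (rule carrier_vecI; simp)+
  have one: "1\<^sub>m n *\<^sub>v c = c" if "c \<in> carrier_vec n" for c :: "'a vec" using that by simp
  have va: "v *\<^sub>v a = (1\<^sub>m n + Y) *\<^sub>v (V *\<^sub>v ((1\<^sub>m n + S) *\<^sub>v a))" unfolding v_def D_def by (simp add: mat_vec_assoc)
  also have "(1\<^sub>m n + S) *\<^sub>v a = a + ?s" using add[OF one_carrier_mat cars(3) a(1)] one[OF a(1)] by simp
  also have "V *\<^sub>v (a + ?s) = a + V *\<^sub>v ?s" using addv[OF cars(5) a(1) sc(1)] Pa by simp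
  also have "(1\<^sub>m n + Y) *\<^sub>v (a + V *\<^sub>v ?s) = (a + V *\<^sub>v ?s) + (Y *\<^sub>v a + Y *\<^sub>v (V *\<^sub>v ?s))"
    using add[OF one_carrier_mat cars(1), of "a + V *\<^sub>v ?s"] one[of "a + V *\<^sub>v ?s"] addv[OF cars(1) a(1) sc(2)] a(1) sc(2) by simp
  finally have vv: "v *\<^sub>v a = (a + V *\<^sub>v ?s) + (Y *\<^sub>v a + 0\<^sub>v n)" unfolding YPs .
  have "x *\<^sub>v a = v *\<^sub>v a - a" unfolding x_def using minus_mult_distrib_mat_vec[OF cars'(2) one_carrier_mat a(1)] one[OF a(1)] by simp
  also have "\<dots> = Y *\<^sub>v a + V *\<^sub>v ?s" unfolding vv using a(1) sc by (intro eq_vecI) auto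
  finally show ?thesis .
qed

end

text \<open>Ordered by weight, the rows \<open>\<pi> i\<close> against the columns \<open>i\<close>
  form a triangular matrix with nonzero diagonal. \<open>Q\<close> moves and rescales these rows so
  that, completed by the identity outside \<open>D\<close>, the matrix is unipotent for the weight
  and has determinant 1.\<close>

lemma rk_ge_triangular:
  fixes M :: "'a::field mat"
  assumes M: "M \<in> carrier_mat n n" and D: "D \<subseteq> {..<n}" and \<pi>: "\<And>i. i \<in> D \<Longrightarrow> \<pi> i < n \<and> M $$ (\<pi> i, i) \<noteq> 0"
    and tri: "\<And>i i'. i \<in> D \<Longrightarrow> i' \<in> D \<Longrightarrow> i' \<noteq> i \<Longrightarrow> M $$ (\<pi> i, i') \<noteq> 0 \<Longrightarrow> w i' < (w i :: int)"
  shows "card D \<le> rk n M"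
proof -
  define Q where "Q = mat n n (\<lambda>(i,k). if i \<in> D \<and> k = \<pi> i then inverse (M $$ (\<pi> i, i)) else 0)"
  have Q: "Q \<in> carrier_mat n n" by (simp add: Q_def)
  have QM: "Q * M \<in> carrier_mat n n" using Q M by simp
  have e: "(Q * M) $$ (i,j) = (if i \<in> D then inverse (M $$ (\<pi> i, i)) * M $$ (\<pi> i, j) else 0)" if "i < n" "j < n" for i j
  proof -
    have "(Q * M) $$ (i,j) = (\<Sum>k<n. if k = \<pi> i then (if i \<in> D then inverse (M $$ (\<pi> i, i)) * M $$ (\<pi> i, j) else 0) else 0)"
      unfolding mat_mult_index[OF Q M that] using that by (intro sum.cong) (auto simp: Q_def)
    then show ?thesis using \<pi>[of i] by auto
  qed
  have "wunip n w (Q * M * pr n D + pr n (- D))"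
    unfolding wunip_def
  proof (intro conjI allI impI)
    fix i j assume ij: "i < n" "j < n" "w i \<le> w j"
    have "(Q * M * pr n D) $$ (i,j) = (if j \<in> D \<and> i \<in> D then inverse (M $$ (\<pi> i, i)) * M $$ (\<pi> i, j) else 0)"
      unfolding pr_mult_right_index[OF QM ij(1,2)] e[OF ij(1,2)] by auto
    also have "\<dots> = (if i = j \<and> i \<in> D then 1 else 0)"
      using tri[of i j] \<pi>[of i] ij by auto
    moreover have "(Q * M * pr n D + pr n (- D)) $$ (i,j) = (Q * M * pr n D) $$ (i,j) + pr n (- D) $$ (i,j)"
      using ij by (intro index_add_mat) auto
    ultimately show "(Q * M * pr n D + pr n (- D)) $$ (i,j) = (if i = j then 1 else 0)"
      using ij by (auto simp: pr_def)
  qed (use QM in auto)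
  then have "det (Q * M * pr n D + pr n (- D)) = 1" by (rule det_wunip)
  moreover have "Q * M * pr n D + pr n (- D) \<in> carrier_mat n n" using QM by auto
  ultimately have "n = rk n (Q * M * pr n D + pr n (- D))" using vec_space.det_rank_iff by (metis zero_neq_one)
  also have "\<dots> \<le> rk n (Q * M * pr n D) + rk n (pr n (- D) :: 'a mat)" by (rule rk_add[of _ n n]) (use QM in auto)
  also have "rk n (Q * M * pr n D) \<le> rk n M" by (rule rk_factor_le[OF Q M pr_carrier])
  also have "rk n (pr n (- D) :: 'a mat) = card ({..<n} - D)" by (simp add: rk_pr Diff_eq Int_commute)
  also have "card ({..<n} - D) = n - card D" using D card_Diff_subset[of D "{..<n}"] finite_subset by fastforce
  finally have "n \<le> rk n M + (n - card D)" by simp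
  moreover have "card D \<le> n" using D card_mono[of "{..<n}" D] by simp
  ultimately show ?thesis by linarith
qed

section \<open>Labelling the basis\<close>

lemma pr_commute:
  assumes M: "M \<in> carrier_mat n n" and e: "\<And>l i. l < n \<Longrightarrow> i < n \<Longrightarrow> M $$ (l,i) \<noteq> 0 \<Longrightarrow> l \<in> E \<longleftrightarrow> i \<in> E"
  shows "pr n E * M = M * pr n E"
proof (rule eq_matI)
  fix l i assume "l < dim_row (M * pr n E)" "i < dim_col (M * pr n E)"
  then have li: "l < n" "i < n" using M by auto
  show "(pr n E * M) $$ (l,i) = (M * pr n E) $$ (l,i)"
    unfolding pr_mult_left_index[OF M li] pr_mult_right_index[OF M li] using e[OF li] by auto
qed (use M in auto)

lemma labelling_exists:
  fixes B :: "int \<Rightarrow> nat set"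
  assumes "\<And>s. finite (B s)" "\<And>s i. i \<in> B s \<Longrightarrow> w i = s"
  obtains h where "\<And>s. bij_betw h (B s) {..<card (B s)}"
proof -
  have "\<exists>f. bij_betw f (B s) {..<card (B s)}" for s
    using ex_bij_betw_finite_nat[OF assms(1)[of s]] by (simp add: lessThan_atLeast0)
  then obtain f where f: "\<And>s. bij_betw (f s) (B s) {..<card (B s)}" by metis
  have "bij_betw (\<lambda>i. f (w i) i) (B s) {..<card (B s)}" for s
  proof -
    have "bij_betw (f s) (B s) {..<card (B s)} \<longleftrightarrow> bij_betw (\<lambda>i. f (w i) i) (B s) {..<card (B s)}"
      by (rule bij_betw_cong) (simp add: assms(2))
    then show ?thesis using f[of s] by simp
  qed
  then show thesis using that by blast
qed

text \<open>\<open>h\<close> numbers only one vector of each dual pair, the labels of the others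
  being dictated by duality. In odd dimension the central vector needs a self-dual label below
  \<open>t\<close>, which exists only for odd \<open>t\<close>.\<close>

locale levels =
  fixes N t :: nat and w :: "nat \<Rightarrow> int" and h :: "nat \<Rightarrow> nat"
  assumes sym: "sym_wt N w" and odd_t: "odd N \<Longrightarrow> odd t"
    and hbij: "\<And>s. bij_betw h {i. i < N \<and> (w i < 0 \<or> w i = 0 \<and> i < N - 1 - i) \<and> w i = s}
      {..<card {i. i < N \<and> (w i < 0 \<or> w i = 0 \<and> i < N - 1 - i) \<and> w i = s}}"
begin

definition star :: "nat \<Rightarrow> nat" where "star i = N - 1 - i"

definition left :: "nat \<Rightarrow> bool" where "left i \<longleftrightarrow> w i < 0 \<or> w i = 0 \<and> i < star i"

text \<open>In the zero block the left half may use only \<open>t div 2\<close> of the labels below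
  \<open>t\<close>, as its dual half takes the mirrored ones; the remaining vectors continue from
  \<open>t\<close> on.\<close>

definition labl :: "nat \<Rightarrow> nat" where
  "labl i = (if w i < 0 \<or> h i < t div 2 then h i else t + (h i - t div 2))"

text \<open>The chain labelled \<open>a\<close> is dual to the one labelled
  \<open>t - 1 - a\<close>, while labels from \<open>t\<close> on are self-dual.\<close>

definition flip :: "nat \<Rightarrow> nat" where "flip a = (if a < t then t - 1 - a else a)"

definition lab :: "nat \<Rightarrow> nat" where
  "lab i = (if left i then labl i else if star i = i then t div 2 else flip (labl (star i)))"

definition T where "T = {i. i < N \<and> lab i < t}"
definition T1 where "T1 = {i. i < N \<and> lab i = t}"

text \<open>One vector of each dual pair: whole chains for the labels in the lower half, and the
  left halves of the self-dual chains.\<close>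

definition H where
  "H = {i. i < N \<and> (if lab i < t \<and> 2 * lab i + 1 \<noteq> t then 2 * lab i + 1 < t else left i)}"

lemma star: "i < N \<Longrightarrow> star i < N" "i < N \<Longrightarrow> star (star i) = i" "i < N \<Longrightarrow> w (star i) = - w i"
  using sym by (auto simp: star_def sym_wt_def)

lemma star_inj: "i < N \<Longrightarrow> l < N \<Longrightarrow> star i = star l \<Longrightarrow> i = l"
  by (metis star(2))

lemma left_star: "i < N \<Longrightarrow> star i \<noteq> i \<Longrightarrow> left (star i) \<longleftrightarrow> \<not> left i"
  using star[of i] by (auto simp: left_def)

lemma center: "i < N \<Longrightarrow> star i = i \<Longrightarrow> odd N \<and> w i = 0 \<and> i = N div 2 \<and> \<not> left i"
  using star(3)[of i] by (auto simp: left_def star_def) presburger+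

lemma flip_flip: "flip (flip a) = a"
  by (auto simp: flip_def)

lemma flip_less: "flip a < t \<longleftrightarrow> a < t" "flip a = t \<longleftrightarrow> a = t" "flip a \<le> t \<longleftrightarrow> a \<le> t"
  by (auto simp: flip_def)

lemma lab_star: "i < N \<Longrightarrow> lab (star i) = flip (lab i)"
proof (cases "star i = i")
  case True
  assume i: "i < N"
  then have "odd t" using center[OF i True] odd_t by simp
  then show ?thesis using center[OF i True] True by (auto simp: lab_def flip_def elim!: oddE)
next
  case False
  assume i: "i < N"
  then show ?thesis using left_star[OF i False] False star(2)[OF i]
    by (cases "left i") (auto simp: lab_def flip_flip)
qed

lemma h_inj: "i < N \<Longrightarrow> l < N \<Longrightarrow> left i \<Longrightarrow> left l \<Longrightarrow> w i = w l \<Longrightarrow> h i = h l \<Longrightarrow> i = l"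
  using bij_betw_imp_inj_on[OF hbij[of "w i"]] unfolding inj_on_def left_def star_def by auto

lemma labl_inj: "i < N \<Longrightarrow> l < N \<Longrightarrow> left i \<Longrightarrow> left l \<Longrightarrow> w i = w l \<Longrightarrow> labl i = labl l \<Longrightarrow> i = l"
  by (rule h_inj) (auto simp: labl_def left_def split: if_splits)

lemma lab_zero_left: "left i \<Longrightarrow> w i = 0 \<Longrightarrow> lab i < t \<Longrightarrow> lab i < t div 2"
  by (auto simp: lab_def labl_def split: if_splits)

lemma lab_inj_aux:
  assumes il: "i < N" "l < N" and e: "w i = w l" "lab i = lab l" and li: "left i"
  shows "l = i \<or> w i = 0 \<and> t \<le> lab i \<and> l = star i"
proof (cases "left l")
  case True
  then show ?thesis using labl_inj[OF il li True e(1)] e(2) li by (simp add: lab_def)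
next
  case False
  then have z: "w i = 0" using li e by (auto simp: left_def)
  show ?thesis
  proof (cases "lab i < t")
    case lt: True
    then have "2 * lab i + 1 < t" using lab_zero_left[OF li z] by auto
    moreover have "t \<le> 2 * lab l + 1"
    proof (cases "star l = l")
      case True
      then have "lab l = t div 2" using False by (simp add: lab_def)
      then show ?thesis by simp
    next
      case F: False
      then have "left (star l)" using left_star[OF il(2)] False by simp
      moreover have "lab (star l) < t" using lab_star[OF il(2)] lt e by (simp add: flip_less)
      ultimately have "lab (star l) < t div 2" using lab_zero_left[of "star l"] star(3)[OF il(2)] z e by simp
      then show ?thesis using lab_star[OF il(2)] lt e by (auto simp: flip_def split: if_splits)
    qed
    ultimately show ?thesis using e by simp
  next
    case ge: False
    have nc: "star l \<noteq> l"
    proof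
      assume c: "star l = l"
      then have "lab l = t div 2" using False by (simp add: lab_def)
      moreover have "odd t" using center[OF il(2) c] odd_t by simp
      ultimately show False using ge e by (auto elim!: oddE)
    qed
    then have "left (star l)" using left_star[OF il(2)] False by simp
    moreover have "lab (star l) = lab i" using lab_star[OF il(2)] ge e by (simp add: flip_def)
    moreover have "w (star l) = w i" using star(3)[OF il(2)] z e by simp
    ultimately have "star l = i" using labl_inj[OF star(1)[OF il(2)] il(1) _ li] li by (simp add: lab_def)
    then show ?thesis using ge z star(2)[OF il(2)] by auto
  qed
qed

text \<open>The right half of the zero block takes its labels from the left half: those below
  \<open>t\<close> are mirrored and stay distinct, those from \<open>t\<close> on are repeated. This
  repetition is the only coincidence.\<close>

lemma lab_inj:
  assumes il: "i < N" "l < N" and e: "w i = w l" "lab i = lab l"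
  shows "l = i \<or> w i = 0 \<and> t \<le> lab i \<and> l = star i"
proof (cases "left i \<or> left l")
  case True
  then show ?thesis
  proof
    assume "left l"
    then show ?thesis using lab_inj_aux[OF il(2,1)] e star(2)[OF il(1)] star(2)[OF il(2)] by auto
  qed (use lab_inj_aux[OF il e] in blast)
next
  case False
  show ?thesis
  proof (cases "star i = i \<and> star l = l")
    case True
    then show ?thesis using center[OF il(1)] center[OF il(2)] by simp
  next
    case nc: False
    then have "left (star i) \<or> left (star l)" using left_star[OF il(1)] left_star[OF il(2)] False by auto
    moreover have e': "w (star i) = w (star l)" "lab (star i) = lab (star l)" using e star(3) il lab_star by auto
    ultimately have "star l = star i \<or> w (star i) = 0 \<and> t \<le> lab (star i) \<and> star l = star (star i)"
      using lab_inj_aux[OF star(1)[OF il(1)] star(1)[OF il(2)] e']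
        lab_inj_aux[OF star(1)[OF il(2)] star(1)[OF il(1)] e'[symmetric]] star il by metis
    then show ?thesis
    proof
      assume "star l = star i" then show ?thesis using star_inj[OF il(2,1)] by simp
    next
      assume a: "w (star i) = 0 \<and> t \<le> lab (star i) \<and> star l = star (star i)"
      then have "w i = 0" "t \<le> lab i" using star(3)[OF il(1)] lab_star[OF il(1)] flip_less(1)[of "lab i"] by (auto simp: not_less[symmetric])
      moreover have "l = star i" using a star(2)[OF il(2)] star(2)[OF il(1)] by metis
      ultimately show ?thesis by simp
    qed
  qed
qed

lemma lab_inj_T: "i \<in> T \<Longrightarrow> l \<in> T \<Longrightarrow> w i = w l \<Longrightarrow> lab i = lab l \<Longrightarrow> i = l"
proof -
  assume a: "i \<in> T" "l \<in> T" "w i = w l" "lab i = lab l"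
  then have "i < N" "l < N" "\<not> t \<le> lab i" by (simp_all add: T_def)
  then show "i = l" using lab_inj[OF _ _ a(3,4)] by blast
qed

lemma T_star: "i < N \<Longrightarrow> star i \<in> T \<longleftrightarrow> i \<in> T" "i < N \<Longrightarrow> star i \<in> T1 \<longleftrightarrow> i \<in> T1"
  using star(1) lab_star flip_less by (auto simp: T_def T1_def)

lemma H_star:
  assumes i: "i < N" and nc: "star i \<noteq> i"
  shows "star i \<in> H \<longleftrightarrow> i \<notin> H"
proof (cases "lab i < t")
  case True
  then have "lab (star i) = t - 1 - lab i" using lab_star[OF i] by (simp add: flip_def)
  then show ?thesis using True i star(1)[OF i] left_star[OF i nc] by (auto simp: H_def)
next
  case False
  then have "lab (star i) = lab i" using lab_star[OF i] by (simp add: flip_def)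
  then show ?thesis using False i star(1)[OF i] left_star[OF i nc] by (auto simp: H_def)
qed

lemma H_center: "i < N \<Longrightarrow> star i = i \<Longrightarrow> i \<notin> H"
proof -
  assume i: "i < N" "star i = i"
  then have c: "odd N" "\<not> left i" using center by auto
  then have "lab i = t div 2" "odd t" using i odd_t by (auto simp: lab_def)
  then show "i \<notin> H" using c by (auto simp: H_def elim!: oddE)
qed

lemma H_lt: "i \<in> H \<Longrightarrow> i < N"
  by (simp add: H_def)

lemma H_not_star: "i \<in> H \<Longrightarrow> star i \<notin> H"
  using H_star[of i] H_center[of i] H_lt[of i] by (cases "star i = i") auto

lemma H_inj: "i \<in> H \<Longrightarrow> l \<in> H \<Longrightarrow> w i = w l \<Longrightarrow> lab i = lab l \<Longrightarrow> i = l"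
  using lab_inj[of i l] H_not_star[of i] H_lt by blast

definition arr :: "nat \<Rightarrow> nat \<Rightarrow> bool" where
  "arr i l \<longleftrightarrow> i \<in> H \<and> l \<in> H \<and> lab l = lab i \<and> lab i \<le> t \<and> w i < w l \<and>
    (\<forall>l'\<in>H. lab l' = lab i \<longrightarrow> \<not> (w i < w l' \<and> w l' < w l))"

lemma arrD: "arr i l \<Longrightarrow> i \<in> H" "arr i l \<Longrightarrow> l \<in> H" "arr i l \<Longrightarrow> lab l = lab i" "arr i l \<Longrightarrow> w i < w l" "arr i l \<Longrightarrow> lab i \<le> t"
  by (auto simp: arr_def)

lemma finT: "finite T" "finite T1" "finite H"
  by (auto simp: T_def T1_def H_def)

definition nonterm where "nonterm = {i \<in> T. \<exists>l\<in>T. lab l = lab i \<and> w i < w l}"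

text \<open>Unlike \<open>arr\<close>, this follows a whole chain, also where it crosses from
  \<open>H\<close> to the dual half; label \<open>t\<close> is left out.\<close>

definition nxt :: "nat \<Rightarrow> nat" where
  "nxt i = arg_min_on w {l \<in> T. lab l = lab i \<and> w i < w l}"

lemma nxt:
  assumes "i \<in> nonterm"
  shows "nxt i \<in> T" "lab (nxt i) = lab i" "w i < w (nxt i)" "\<And>l. l \<in> T \<Longrightarrow> lab l = lab i \<Longrightarrow> w i < w l \<Longrightarrow> w (nxt i) \<le> w l"
proof -
  let ?X = "{l \<in> T. lab l = lab i \<and> w i < w l}"
  have X: "finite ?X" "?X \<noteq> {}" using finT assms by (auto simp: nonterm_def)
  have m: "nxt i \<in> ?X" unfolding nxt_def by (rule arg_min_if_finite(1)[OF X])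
  then show "nxt i \<in> T" "lab (nxt i) = lab i" "w i < w (nxt i)" by auto
  show "w (nxt i) \<le> w l" if "l \<in> T" "lab l = lab i" "w i < w l" for l
    using arg_min_if_finite(2)[OF X, of w] that unfolding nxt_def by (auto simp: not_less)
qed

lemma nxt_eqI:
  assumes "i \<in> T" "l \<in> T" "lab l = lab i" "w i < w l" "\<And>l'. l' \<in> T \<Longrightarrow> lab l' = lab i \<Longrightarrow> \<not> (w i < w l' \<and> w l' < w l)"
  shows "i \<in> nonterm" "nxt i = l"
proof -
  show n: "i \<in> nonterm" using assms by (auto simp: nonterm_def)
  have "w (nxt i) \<le> w l" by (rule nxt(4)[OF n assms(2-4)])
  moreover have "\<not> w (nxt i) < w l" using assms(5)[OF nxt(1,2)[OF n]] nxt(3)[OF n] by simp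
  ultimately show "nxt i = l" using lab_inj_T[OF nxt(1)[OF n] assms(2)] nxt(2)[OF n] assms(3) by simp
qed

lemma nxt_inj:
  assumes "i \<in> nonterm" "i' \<in> nonterm" "nxt i = nxt i'"
  shows "i = i'"
proof -
  have T: "i \<in> T" "i' \<in> T" using assms by (auto simp: nonterm_def)
  have lab: "lab i = lab i'" using nxt(2)[OF assms(1)] nxt(2)[OF assms(2)] assms(3) by simp
  have "\<not> w i < w i'" using nxt(4)[OF assms(1) T(2)] nxt(3)[OF assms(2)] lab assms(3) by auto
  moreover have "\<not> w i' < w i" using nxt(4)[OF assms(2) T(1)] nxt(3)[OF assms(1)] lab assms(3) by auto
  ultimately show ?thesis using lab_inj_T[OF T] lab by simp
qed

text \<open>Each label below \<open>t\<close> has at most one terminal vector.\<close>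

lemma card_nonterm: "card T \<le> card nonterm + t"
proof -
  have "inj_on lab (T - nonterm)"
  proof (rule inj_onI)
    fix i l assume il: "i \<in> T - nonterm" "l \<in> T - nonterm" "lab i = lab l"
    then have "\<not> w i < w l" "\<not> w l < w i" by (auto simp: nonterm_def)
    then show "i = l" using il lab_inj_T[of i l] by simp
  qed
  moreover have "lab ` (T - nonterm) \<subseteq> {..<t}" by (auto simp: T_def)
  ultimately have "card (T - nonterm) \<le> t" using card_inj_on_le[of lab "T - nonterm" "{..<t}"] by simp
  moreover have "nonterm \<subseteq> T" by (auto simp: nonterm_def)
  then have "card T = card nonterm + card (T - nonterm)" using finT
    by (metis card_Diff_subset card_mono finite_subset le_add_diff_inverse)
  ultimately show ?thesis by simp
qed

lemma card_left_block:
  assumes "\<And>i. i < N \<Longrightarrow> left i \<Longrightarrow> w i = s \<Longrightarrow> Q i \<longleftrightarrow> R (h i)"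
  shows "card {i. i < N \<and> left i \<and> w i = s \<and> Q i} = card {r. r < card {i. i < N \<and> left i \<and> w i = s} \<and> R r}"
proof (rule bij_betw_same_card[of h])
  have b: "bij_betw h {i. i < N \<and> left i \<and> w i = s} {..<card {i. i < N \<and> left i \<and> w i = s}}"
    using hbij[of s] unfolding left_def star_def by simp
  show "bij_betw h {i. i < N \<and> left i \<and> w i = s \<and> Q i} {r. r < card {i. i < N \<and> left i \<and> w i = s} \<and> R r}"
    unfolding bij_betw_def
  proof
    show "inj_on h {i. i < N \<and> left i \<and> w i = s \<and> Q i}" using b by (auto simp: bij_betw_def inj_on_def)
    have im: "h ` {i. i < N \<and> left i \<and> w i = s} = {..<card {i. i < N \<and> left i \<and> w i = s}}" using b by (simp add: bij_betw_def)
    show "h ` {i. i < N \<and> left i \<and> w i = s \<and> Q i} = {r. r < card {i. i < N \<and> left i \<and> w i = s} \<and> R r}"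
    proof (intro equalityI subsetI)
      fix r assume "r \<in> h ` {i. i < N \<and> left i \<and> w i = s \<and> Q i}"
      then obtain i where "i < N" "left i" "w i = s" "Q i" "r = h i" by auto
      then show "r \<in> {r. r < card {i. i < N \<and> left i \<and> w i = s} \<and> R r}" using im assms by auto
    next
      fix r assume r: "r \<in> {r. r < card {i. i < N \<and> left i \<and> w i = s} \<and> R r}"
      then have "r \<in> h ` {i. i < N \<and> left i \<and> w i = s}" using im by simp
      then obtain i where "i < N" "left i" "w i = s" "r = h i" by auto
      then show "r \<in> h ` {i. i < N \<and> left i \<and> w i = s \<and> Q i}" using r assms by auto
    qed
  qed
qed

lemma card_block_star:
  "card {i. i < N \<and> w i = s \<and> i \<in> X} = card {i. i < N \<and> w i = - s \<and> star i \<in> X}"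
  by (rule bij_betw_same_card[of star]) (rule bij_betwI[where g = star]; auto simp: star)

lemma card_T_neg:
  assumes "s < 0"
  shows "card {i. i < N \<and> w i = s \<and> i \<in> T} = min (dW N w s) t"
    and "card {i. i < N \<and> w i = s \<and> i \<in> T1} = (if t < dW N w s then 1 else 0)"
proof -
  have d: "card {i. i < N \<and> left i \<and> w i = s} = dW N w s"
    unfolding dW_def by (rule arg_cong[of _ _ card]) (use assms in \<open>auto simp: left_def\<close>)
  have l: "lab i = h i" if "i < N" "w i = s" for i using that assms by (simp add: lab_def left_def labl_def)
  have "card {i. i < N \<and> w i = s \<and> i \<in> T} = card {i. i < N \<and> left i \<and> w i = s \<and> lab i < t}"
    by (rule arg_cong[of _ _ card]) (use assms in \<open>auto simp: left_def T_def\<close>)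
  also have "\<dots> = card {r. r < dW N w s \<and> r < t}" unfolding d[symmetric] by (rule card_left_block) (simp add: l)
  also have "{r. r < dW N w s \<and> r < t} = {..<min (dW N w s) t}" by auto
  finally show "card {i. i < N \<and> w i = s \<and> i \<in> T} = min (dW N w s) t" by simp
  have "card {i. i < N \<and> w i = s \<and> i \<in> T1} = card {i. i < N \<and> left i \<and> w i = s \<and> lab i = t}"
    by (rule arg_cong[of _ _ card]) (use assms in \<open>auto simp: left_def T1_def\<close>)
  also have "\<dots> = card {r. r < dW N w s \<and> r = t}" unfolding d[symmetric] by (rule card_left_block) (simp add: l)
  also have "{r. r < dW N w s \<and> r = t} = (if t < dW N w s then {t} else {})" by auto
  finally show "card {i. i < N \<and> w i = s \<and> i \<in> T1} = (if t < dW N w s then 1 else 0)" by simp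
qed

lemma card_T_nonzero:
  assumes "s \<noteq> 0"
  shows "card {i. i < N \<and> w i = s \<and> i \<in> T} = min (dW N w s) t"
    and "card {i. i < N \<and> w i = s \<and> i \<in> T1} = (if t < dW N w s then 1 else 0)"
proof -
  have "card {i. i < N \<and> w i = s \<and> i \<in> X} = card {i. i < N \<and> w i = - s \<and> i \<in> X}" if "\<And>i. i < N \<Longrightarrow> star i \<in> X \<longleftrightarrow> i \<in> X" for X
    unfolding card_block_star[of s X] by (rule arg_cong[of _ _ card]) (use that in auto)
  then have e: "card {i. i < N \<and> w i = s \<and> i \<in> T} = card {i. i < N \<and> w i = - s \<and> i \<in> T}"
    "card {i. i < N \<and> w i = s \<and> i \<in> T1} = card {i. i < N \<and> w i = - s \<and> i \<in> T1}" using T_star by blast+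
  show "card {i. i < N \<and> w i = s \<and> i \<in> T} = min (dW N w s) t"
    and "card {i. i < N \<and> w i = s \<and> i \<in> T1} = (if t < dW N w s then 1 else 0)"
    using card_T_neg[of s] card_T_neg[of "- s"] e assms dW_uminus[OF sym, of s] by (cases "s < 0"; auto)+
qed

lemma card_zero_split:
  assumes X: "\<And>i. i < N \<Longrightarrow> star i \<in> X \<longleftrightarrow> i \<in> X"
  shows "card {i. i < N \<and> w i = 0 \<and> i \<in> X} = 2 * card {i. i < N \<and> left i \<and> w i = 0 \<and> i \<in> X} + (if odd N \<and> N div 2 \<in> X then 1 else 0)"
proof -
  let ?L = "{i. i < N \<and> left i \<and> w i = 0 \<and> i \<in> X}"
  let ?R = "{i. i < N \<and> left (star i) \<and> w i = 0 \<and> i \<in> X}"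
  let ?C = "if odd N \<and> N div 2 \<in> X then {N div 2} else {}"
  have c: "star i = i \<longleftrightarrow> odd N \<and> i = N div 2" if "i < N" for i
  proof -
    have "star i = i \<longleftrightarrow> N = 2 * i + 1" using that unfolding star_def by linarith
    also have "\<dots> \<longleftrightarrow> odd N \<and> i = N div 2" by (auto elim!: oddE)
    finally show ?thesis .
  qed
  have c0: "w (N div 2) = 0" "N div 2 < N" if "odd N"
  proof -
    show "N div 2 < N" using that by (cases N) auto
    then show "w (N div 2) = 0" using c[of "N div 2"] that center by blast
  qed
  have nb: "\<not> (left i \<and> left (star i))" if "i < N" for i
    using left_star[OF that] center[OF that] by metis
  have ex: "left i \<or> left (star i) \<or> odd N \<and> i = N div 2" if "i < N" for i
    using left_star[OF that] c[OF that] by metis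
  have cc: "\<not> left (N div 2)" "\<not> left (star (N div 2))" if "odd N"
    using c[OF c0(2)[OF that]] that center[OF c0(2)[OF that]] by simp_all
  have "{i. i < N \<and> w i = 0 \<and> i \<in> X} = ?L \<union> ?R \<union> ?C"
  proof (intro equalityI subsetI)
    fix i assume "i \<in> {i. i < N \<and> w i = 0 \<and> i \<in> X}"
    then show "i \<in> ?L \<union> ?R \<union> ?C" using ex[of i] by auto
  next
    fix i assume "i \<in> ?L \<union> ?R \<union> ?C"
    then show "i \<in> {i. i < N \<and> w i = 0 \<and> i \<in> X}" using c0 by (auto split: if_splits)
  qed
  moreover have "card ?R = card ?L"
    by (rule bij_betw_same_card[of star]) (rule bij_betwI[where g = star]; auto simp: star X)
  moreover have "?L \<inter> ?R = {}" using nb by blast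
  moreover have "(?L \<union> ?R) \<inter> ?C = {}" using cc by (auto split: if_splits)
  moreover have "card (?L \<union> ?R \<union> ?C) = card (?L \<union> ?R) + card ?C"
    by (rule card_Un_disjoint) (use calculation(4) in auto)
  moreover have "card (?L \<union> ?R) = card ?L + card ?R"
    by (rule card_Un_disjoint) (use calculation(3) in auto)
  ultimately show ?thesis by simp
qed

text \<open>Each half of the zero block receives \<open>t div 2\<close> labels below
  \<open>t\<close>. For even dimension and odd \<open>t\<close> this leaves one label without a
  vector there, which is the unit lost in the symplectic case.\<close>

lemma card_T_zero:
  defines "m \<equiv> dW N w 0 div 2"
  shows "card {i. i < N \<and> w i = 0 \<and> i \<in> T} = 2 * min m (t div 2) + (if odd N then 1 else 0)"
    and "card {i. i < N \<and> w i = 0 \<and> i \<in> T1} = (if t div 2 < m then 2 else 0)"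
    and "dW N w 0 = 2 * m + (if odd N then 1 else 0)"
proof -
  have "dW N w 0 = 2 * card {i. i < N \<and> left i \<and> w i = 0} + (if odd N then 1 else 0)"
    using card_zero_split[of UNIV] by (simp add: dW_def)
  then have m: "card {i. i < N \<and> left i \<and> w i = 0} = m" "dW N w 0 = 2 * m + (if odd N then 1 else 0)"
    by (auto simp: m_def)
  then show "dW N w 0 = 2 * m + (if odd N then 1 else 0)" by simp
  have l: "lab i = (if h i < t div 2 then h i else t + (h i - t div 2))" if "left i" "w i = 0" for i
    using that by (simp add: lab_def labl_def)
  have ctr: "lab (N div 2) = t div 2" "odd t" if "odd N"
  proof -
    have "star (N div 2) = N div 2" "N div 2 < N" using that unfolding star_def by (auto elim!: oddE)
    then show "lab (N div 2) = t div 2" using center[of "N div 2"] by (simp add: lab_def)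
    show "odd t" using odd_t that .
  qed
  have "card {i. i < N \<and> left i \<and> w i = 0 \<and> i \<in> T} = card {i. i < N \<and> left i \<and> w i = 0 \<and> lab i < t}"
    by (rule arg_cong[of _ _ card]) (auto simp: T_def)
  also have "\<dots> = card {r. r < m \<and> r < t div 2}" unfolding m(1)[symmetric] by (rule card_left_block) (auto simp: l)
  also have "{r. r < m \<and> r < t div 2} = {..<min m (t div 2)}" by auto
  finally have 1: "card {i. i < N \<and> left i \<and> w i = 0 \<and> i \<in> T} = min m (t div 2)" by simp
  have "odd N \<and> N div 2 \<in> T \<longleftrightarrow> odd N" using ctr by (auto simp: T_def elim!: oddE)
  then show "card {i. i < N \<and> w i = 0 \<and> i \<in> T} = 2 * min m (t div 2) + (if odd N then 1 else 0)"
    using card_zero_split[of T] T_star 1 by simp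
  have "card {i. i < N \<and> left i \<and> w i = 0 \<and> i \<in> T1} = card {i. i < N \<and> left i \<and> w i = 0 \<and> lab i = t}"
    by (rule arg_cong[of _ _ card]) (auto simp: T1_def)
  also have "\<dots> = card {r. r < m \<and> r = t div 2}" unfolding m(1)[symmetric] by (rule card_left_block) (auto simp: l)
  also have "{r. r < m \<and> r = t div 2} = (if t div 2 < m then {t div 2} else {})" by auto
  finally have 2: "card {i. i < N \<and> left i \<and> w i = 0 \<and> i \<in> T1} = (if t div 2 < m then 1 else 0)" by simp
  have "\<not> (odd N \<and> N div 2 \<in> T1)" using ctr by (auto simp: T1_def elim!: oddE)
  then show "card {i. i < N \<and> w i = 0 \<and> i \<in> T1} = (if t div 2 < m then 2 else 0)"
    using card_zero_split[of T1] T_star 2 by auto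
qed

end

section \<open>Isometries attached to a labelling\<close>

lemma adiag_transpose: "transpose_mat (adiag N g) = adiag N (\<lambda>i. g (N - 1 - i))"
  by (rule eq_matI) (auto simp: adiag_def)

lemma adiag_mult_index:
  assumes "M \<in> carrier_mat N N" "i < N" "j < N"
  shows "(adiag N g * M) $$ (i,j) = g i * M $$ (N - 1 - i, j)"
    and "(M * adiag N g) $$ (i,j) = M $$ (i, N - 1 - j) * g (N - 1 - j)"
proof -
  have "(adiag N g * M) $$ (i,j) = (\<Sum>k<N. if k = N - 1 - i then g i * M $$ (N - 1 - i, j) else 0)"
    unfolding mat_mult_index[OF adiag_carrier assms] using assms by (intro sum.cong) (auto simp: adiag_def)
  then show "(adiag N g * M) $$ (i,j) = g i * M $$ (N - 1 - i, j)" using assms by simp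
  have "(M * adiag N g) $$ (i,j) = (\<Sum>k<N. if k = N - 1 - j then M $$ (i, N - 1 - j) * g (N - 1 - j) else 0)"
    unfolding mat_mult_index[OF assms(1) adiag_carrier assms(2,3)] using assms by (intro sum.cong) (auto simp: adiag_def)
  then show "(M * adiag N g) $$ (i,j) = M $$ (i, N - 1 - j) * g (N - 1 - j)" using assms by simp
qed

lemma iso_one_plus:
  fixes S :: "'a::field mat"
  assumes S: "S \<in> carrier_mat N N"
    and e: "\<And>i j. i < N \<Longrightarrow> j < N \<Longrightarrow> S $$ (N - 1 - j, i) * g (N - 1 - j) + g i * S $$ (N - 1 - i, j)
      + (\<Sum>k<N. S $$ (k,i) * (g k * S $$ (N - 1 - k, j))) = 0"
  shows "transpose_mat (1\<^sub>m N + S) * adiag N g * (1\<^sub>m N + S) = adiag N g"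
proof -
  let ?G = "adiag N g"
  note [simp] = carrier_matD[OF S]
  have t: "transpose_mat (1\<^sub>m N + S) = 1\<^sub>m N + transpose_mat S" using S by (auto intro!: eq_matI)
  have "transpose_mat (1\<^sub>m N + S) * ?G * (1\<^sub>m N + S) = ?G + transpose_mat S * ?G + (?G * S + transpose_mat S * (?G * S))"
    unfolding t by (simp add: mat_add_distrib mat_mult_one mat_assoc)
  also have "\<dots> = ?G"
  proof (rule eq_matI)
    fix i j assume "i < dim_row ?G" "j < dim_col ?G"
    then have ij: "i < N" "j < N" by auto
    have c: "transpose_mat S \<in> carrier_mat N N" "?G * S \<in> carrier_mat N N" using S by auto
    have 1: "(?G * S) $$ (i,j) = g i * S $$ (N - 1 - i, j)" by (rule adiag_mult_index(1)[OF S ij])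
    have 2: "(transpose_mat S * ?G) $$ (i,j) = S $$ (N - 1 - j, i) * g (N - 1 - j)"
      using adiag_mult_index(2)[OF c(1) ij] ij by simp
    have 3: "(transpose_mat S * (?G * S)) $$ (i,j) = (\<Sum>k<N. S $$ (k,i) * (g k * S $$ (N - 1 - k, j)))"
      unfolding mat_mult_index[OF c ij] using ij by (intro sum.cong refl) (simp add: adiag_mult_index(1)[OF S] del: index_mult_mat(1))
    have "(?G + transpose_mat S * ?G + (?G * S + transpose_mat S * (?G * S))) $$ (i,j) =
      ?G $$ (i,j) + ((transpose_mat S * ?G) $$ (i,j) + ((?G * S) $$ (i,j) + (transpose_mat S * (?G * S)) $$ (i,j)))"
      using ij by (simp add: add.assoc del: index_mult_mat(1))
    also have "\<dots> = ?G $$ (i,j)" unfolding 1 2 3 using e[OF ij] by (simp add: algebra_simps)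
    finally show "(?G + transpose_mat S * ?G + (?G * S + transpose_mat S * (?G * S))) $$ (i,j) = ?G $$ (i,j)" .
  qed auto
  finally show ?thesis .
qed

definition arrow_mat :: "nat \<Rightarrow> (nat \<Rightarrow> nat \<Rightarrow> bool) \<Rightarrow> 'a::field mat" where
  "arrow_mat N R = mat N N (\<lambda>(l,i). if R i l then 1 else 0)"

lemma arrow_mat_index: "l < N \<Longrightarrow> i < N \<Longrightarrow> arrow_mat N R $$ (l,i) = (if R i l then 1 else 0)"
  by (simp add: arrow_mat_def)

lemma arrow_mat_dim [simp]: "dim_row (arrow_mat N R) = N" "dim_col (arrow_mat N R) = N"
  by (simp_all add: arrow_mat_def)

context levels
begin

text \<open>A step inside \<open>H\<close> skips no vector of its chain: in the self-dual chain
  everything of smaller weight than a left vector is left as well.\<close>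

lemma between_H:
  assumes i: "i \<in> T" "i \<in> H" and l: "l \<in> H" "lab l = lab i" "w i < w l" and l': "l' \<in> T" "lab l' = lab i" "w l' < w l"
  shows "l' \<in> H"
proof (cases "2 * lab i + 1 = t")
  case False
  then show ?thesis using assms by (auto simp: H_def T_def)
next
  case True
  then have lt: "lab i < t" by simp
  have "left l" using l True by (simp add: H_def)
  then have "w l \<le> 0" by (auto simp: left_def)
  then have "left l'" using l' by (auto simp: left_def)
  then show ?thesis using l' True by (auto simp: H_def T_def)
qed

lemma H_T: "l \<in> H \<Longrightarrow> lab l = lab i \<Longrightarrow> i \<in> T \<Longrightarrow> l \<in> T"
  by (auto simp: H_def T_def)

lemma arr_nxt:
  assumes i: "i \<in> T" and a: "arr i l"
  shows "i \<in> nonterm" "nxt i = l"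
proof -
  have l: "l \<in> T" using H_T[OF arrD(2)[OF a] arrD(3)[OF a] i] .
  have "\<not> (w i < w l' \<and> w l' < w l)" if "l' \<in> T" "lab l' = lab i" for l'
    using between_H[OF i arrD(1-4)[OF a] that] a that(2) by (auto simp: arr_def)
  then show "i \<in> nonterm" "nxt i = l" using nxt_eqI[OF i l arrD(3,4)[OF a]] by auto
qed

lemma nxt_arr:
  assumes "i \<in> nonterm" "i \<in> H" "nxt i \<in> H"
  shows "arr i (nxt i)"
  unfolding arr_def
proof (intro conjI ballI impI)
  have i: "i \<in> T" using assms by (simp add: nonterm_def)
  then show "lab i \<le> t" by (simp add: T_def)
  fix l' assume l': "l' \<in> H" "lab l' = lab i"
  then have "l' \<in> T" using H_T i by blast
  then show "\<not> (w i < w l' \<and> w l' < w (nxt i))" using nxt(4)[OF assms(1) _ l'(2)] by auto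
qed (use assms nxt in auto)

text \<open>Duality negates weights and mirrors labels, so a step of one chain becomes a backward
  step of the dual chain.\<close>

lemma nxt_star:
  assumes i: "i \<in> nonterm"
  shows "star (nxt i) \<in> nonterm" "nxt (star (nxt i)) = star i"
proof -
  have T: "i \<in> T" "nxt i \<in> T" "i < N" "nxt i < N" using i nxt(1)[OF i] by (auto simp: nonterm_def T_def)
  have "\<not> (w (star (nxt i)) < w l' \<and> w l' < w (star i))" if l': "l' \<in> T" "lab l' = lab (star (nxt i))" for l'
  proof
    assume a: "w (star (nxt i)) < w l' \<and> w l' < w (star i)"
    have l'N: "l' < N" using l' by (simp add: T_def)
    have "lab (star l') = lab i" unfolding lab_star[OF l'N] l'(2) lab_star[OF T(4)] nxt(2)[OF i] flip_flip ..
    moreover have "star l' \<in> T" using T_star l'N l' by simp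
    moreover have "w i < w (star l')" "w (star l') < w (nxt i)" using a star(3) l'N T by auto
    ultimately show False using nxt(4)[OF i, of "star l'"] by auto
  qed
  then show "star (nxt i) \<in> nonterm" "nxt (star (nxt i)) = star i"
    using nxt_eqI[of "star (nxt i)" "star i"] T T_star star lab_star nxt(2,3)[OF i] by auto
qed

end

text \<open>\<open>S1\<close> asks \<open>S\<close> to supply the steps that neither
  \<open>Y\<close> nor its adjoint contains, namely those crossing from \<open>H\<close> to its
  dual. \<open>S2\<close> keeps the remaining entries of \<open>S\<close> compatible with a
  triangular shape.\<close>

locale levels_form = levels +
  fixes g :: "nat \<Rightarrow> 'a::field" and S :: "'a mat"
  assumes gnz: "\<And>i. i < N \<Longrightarrow> g i \<noteq> 0"
    and gsym: "(\<forall>i<N. g (star i) = g i) \<or> (\<forall>i<N. g (star i) = - g i)"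
    and S: "supp_in N (- H) (- (star ` H)) S" "raises N w S"
    and Siso: "transpose_mat (1\<^sub>m N + S) * adiag N g * (1\<^sub>m N + S) = adiag N g"
    and ST: "\<And>l i. l < N \<Longrightarrow> i < N \<Longrightarrow> S $$ (l,i) \<noteq> 0 \<Longrightarrow> (l \<in> T \<longleftrightarrow> i \<in> T) \<and> (l \<in> T1 \<longleftrightarrow> i \<in> T1)"
    and S1: "\<And>i. i \<in> nonterm \<Longrightarrow> \<not> (i \<in> H \<and> nxt i \<in> H) \<Longrightarrow> \<not> (star i \<in> H \<and> star (nxt i) \<in> H) \<Longrightarrow> S $$ (nxt i, i) \<noteq> 0"
    and S2: "\<And>i i'. i \<in> nonterm \<Longrightarrow> i' \<in> nonterm \<Longrightarrow> i' \<noteq> i \<Longrightarrow> S $$ (nxt i, i') \<noteq> 0 \<Longrightarrow> w i' < w i"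
begin

abbreviation Ymat :: "'a mat" where "Ymat \<equiv> arrow_mat N arr"
abbreviation Gm where "Gm \<equiv> adiag N g"
definition Hm where "Hm = adiag N (\<lambda>i. inverse (g (N - 1 - i)))"
abbreviation B where "B \<equiv> star ` H"

lemma Zindex:
  assumes "l < N" "i < N"
  shows "(Hm * (transpose_mat Ymat * Gm)) $$ (l,i) = (if arr (star l) (star i) then inverse (g (star l)) * g (star i) else 0)"
proof -
  have c: "transpose_mat Ymat \<in> carrier_mat N N" "transpose_mat Ymat * Gm \<in> carrier_mat N N" by (rule carrier_matI; simp)+
  have sl: "N - 1 - l < N" "N - 1 - i < N" using assms by auto
  show ?thesis
    unfolding Hm_def adiag_mult_index(1)[OF c(2) assms] adiag_mult_index(2)[OF c(1) sl(1) assms(2)]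
    using sl by (simp add: star_def arrow_mat_def)
qed

lemma in_B: "i < N \<Longrightarrow> i \<in> B \<longleftrightarrow> star i \<in> H"
proof -
  assume i: "i < N"
  show "i \<in> B \<longleftrightarrow> star i \<in> H"
  proof
    assume "i \<in> B"
    then obtain k where k: "k \<in> H" "i = star k" by blast
    then show "star i \<in> H" using star(2)[OF H_lt[OF k(1)]] by simp
  next
    assume "star i \<in> H"
    then have "star (star i) \<in> B" by (rule imageI)
    then show "i \<in> B" using star(2)[OF i] by simp
  qed
qed

sublocale C: chain_iso N w Gm Hm Ymat S H B
proof unfold_locales
  show c: "Gm \<in> carrier_mat N N" "Hm \<in> carrier_mat N N" by (auto simp: Hm_def)
  show "Gm * Hm = 1\<^sub>m N" "Hm * Gm = 1\<^sub>m N" unfolding Hm_def using adiag_mult_inverse gnz by blast+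
  show "transpose_mat Gm = Gm \<or> transpose_mat Gm = - Gm"
  proof -
    have e: "transpose_mat Gm = adiag N (\<lambda>i. g (star i))" unfolding adiag_transpose star_def ..
    from gsym show ?thesis
    proof
      assume "\<forall>i<N. g (star i) = g i"
      then have "transpose_mat Gm = Gm" unfolding e by (auto simp: adiag_def intro!: eq_matI)
      then show ?thesis ..
    next
      assume "\<forall>i<N. g (star i) = - g i"
      then have "transpose_mat Gm = - Gm" unfolding e by (auto simp: adiag_def intro!: eq_matI)
      then show ?thesis ..
    qed
  qed
  show "H \<inter> B = {}" using H_not_star H_lt star(2) by fastforce
  show "supp_in N H H Ymat" unfolding supp_in_def using arrD(1,2) by (auto simp: arrow_mat_def split: if_splits)
  show "raises N w Ymat" unfolding raises_def using arrD(4) by (force simp: arrow_mat_def)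
  have Zc: "Hm * (transpose_mat Ymat * Gm) \<in> carrier_mat N N" using c(2) by (auto intro!: carrier_matI)
  show "supp_in N B B (Hm * (transpose_mat Ymat * Gm))" unfolding supp_in_def
  proof (intro conjI allI impI Zc)
    fix l i assume li: "l < N" "i < N" "(Hm * (transpose_mat Ymat * Gm)) $$ (l,i) \<noteq> 0"
    then have "arr (star l) (star i)" using Zindex[OF li(1,2)] by (auto split: if_splits)
    then show "l \<in> B" "i \<in> B" using in_B li(1,2) arrD(1,2) by blast+
  qed
  show "raises N w (Hm * (transpose_mat Ymat * Gm))" unfolding raises_def
  proof (intro conjI allI impI Zc)
    fix l i assume li: "l < N" "i < N" "w l \<le> w i"
    then have "\<not> arr (star l) (star i)" using arrD(4)[of "star l" "star i"] star(3) by auto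
    then show "(Hm * (transpose_mat Ymat * Gm)) $$ (l,i) = 0" using Zindex[OF li(1,2)] by simp
  qed
qed (use S Siso in auto)

lemma Zi: "l < N \<Longrightarrow> i < N \<Longrightarrow> C.Z $$ (l,i) = (if arr (star l) (star i) then inverse (g (star l)) * g (star i) else 0)"
  unfolding C.Z_def by (rule Zindex)

lemma yi: "l < N \<Longrightarrow> i < N \<Longrightarrow> C.y $$ (l,i) = Ymat $$ (l,i) - C.Z $$ (l,i) + S $$ (l,i)"
  unfolding C.y_def by simp

lemma commT:
  assumes "E = T \<or> E = T1"
  shows "pr N E * Ymat = Ymat * pr N E" "pr N E * C.Z = C.Z * pr N E" "pr N E * S = S * pr N E"
proof -
  have lab: "lab l = lab i \<Longrightarrow> l < N \<Longrightarrow> i < N \<Longrightarrow> l \<in> E \<longleftrightarrow> i \<in> E" for l i using assms by (auto simp: T_def T1_def)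
  show "pr N E * Ymat = Ymat * pr N E"
  proof (rule pr_commute[OF C.cars(1)])
    fix l i assume li: "l < N" "i < N" "Ymat $$ (l,i) \<noteq> (0::'a)"
    then have "lab l = lab i" using arrD(3) by (auto simp: arrow_mat_index split: if_splits)
    then show "l \<in> E \<longleftrightarrow> i \<in> E" by (rule lab[OF _ li(1,2)])
  qed
  show "pr N E * C.Z = C.Z * pr N E"
  proof (rule pr_commute[OF C.cars(2)])
    fix l i assume li: "l < N" "i < N" "C.Z $$ (l,i) \<noteq> 0"
    then have "lab (star i) = lab (star l)" using arrD(3) by (auto simp: Zi split: if_splits)
    then have "lab (star (star i)) = lab (star (star l))"
      unfolding lab_star[OF star(1)[OF li(1)]] lab_star[OF star(1)[OF li(2)]] by simp
    then have "lab l = lab i" unfolding star(2)[OF li(1)] star(2)[OF li(2)] by simp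
    then show "l \<in> E \<longleftrightarrow> i \<in> E" by (rule lab[OF _ li(1,2)])
  qed
  show "pr N E * S = S * pr N E"
    by (rule pr_commute[OF C.cars(3)]) (use ST assms in blast)
qed

text \<open>Every step of a chain is a nonzero entry of \<open>y\<close>, coming from
  \<open>Y\<close> inside \<open>H\<close>, from the adjoint inside the dual half, and from
  \<open>S\<close> at a crossing.\<close>

lemma rk_T: "card nonterm \<le> rk N (pr N T * C.x)"
proof -
  have "pr N T * C.P = C.P * pr N T" by (rule C.commute_x(1)[OF pr_carrier]) (simp_all add: commT)
  then have "rk N (pr N T * C.x) = rk N (pr N T * C.y)" by (intro C.rk_x) auto
  also have "card nonterm \<le> \<dots>"
  proof (rule rk_ge_triangular[where \<pi> = nxt and w = w])
    show "pr N T * C.y \<in> carrier_mat N N" by (rule carrier_matI; simp)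
    show "nonterm \<subseteq> {..<N}" by (auto simp: nonterm_def T_def)
    have e: "(pr N T * C.y) $$ (nxt i, i') = C.y $$ (nxt i, i')" if "i \<in> nonterm" "i' < N" for i i'
      using nxt(1)[OF that(1)] pr_mult_left_index[OF C.cars'(4), of "nxt i" i' T] that by (auto simp: T_def)
    show "nxt i < N \<and> (pr N T * C.y) $$ (nxt i, i) \<noteq> 0" if i: "i \<in> nonterm" for i
    proof
      have N: "i < N" "nxt i < N" using i nxt(1)[OF i] by (auto simp: nonterm_def T_def)
      then show "nxt i < N" by simp
      have "C.y $$ (nxt i, i) \<noteq> 0"
      proof -
        consider "i \<in> H" "nxt i \<in> H" | "star i \<in> H" "star (nxt i) \<in> H"
          | "\<not> (i \<in> H \<and> nxt i \<in> H)" "\<not> (star i \<in> H \<and> star (nxt i) \<in> H)" by blast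
        then show ?thesis
        proof cases
          case 1
          then have "Ymat $$ (nxt i, i) = (1::'a)" using nxt_arr[OF i] N by (simp add: arrow_mat_index)
          moreover have "C.Z $$ (nxt i, i) = 0" using supp_inD[OF C.Zr(2) N(2,1)] in_B[OF N(1)] H_not_star 1 by blast
          moreover have "S $$ (nxt i, i) = 0" using supp_inD[OF S(1) N(2,1)] 1 by blast
          ultimately show ?thesis using yi N by simp
        next
          case 2
          have "arr (star (nxt i)) (star i)" using nxt_arr[OF nxt_star(1)[OF i]] nxt_star(2)[OF i] 2 by simp
          then have "C.Z $$ (nxt i, i) \<noteq> 0" using Zi[OF N(2,1)] gnz star(1) N by simp
          moreover have "Ymat $$ (nxt i, i) = (0::'a)" using arrD(1) H_not_star 2(1) star(2)[OF N(1)] N by (auto simp: arrow_mat_index)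
          moreover have "S $$ (nxt i, i) = 0" using supp_inD[OF S(1) N(2,1)] in_B[OF N(1)] 2 by blast
          ultimately show ?thesis using yi N by simp
        next
          case 3
          then have "S $$ (nxt i, i) \<noteq> 0" using S1[OF i] by simp
          moreover have "Ymat $$ (nxt i, i) = (0::'a)" using arrD(1,2) 3(1) N by (auto simp: arrow_mat_index)
          moreover have "C.Z $$ (nxt i, i) = 0" using arrD(1,2) 3(2) N by (auto simp: Zi)
          ultimately show ?thesis using yi N by simp
        qed
      qed
      then show "(pr N T * C.y) $$ (nxt i, i) \<noteq> 0" using e[OF i N(1)] by simp
    qed
    show "w i' < w i" if i: "i \<in> nonterm" "i' \<in> nonterm" "i' \<noteq> i" "(pr N T * C.y) $$ (nxt i, i') \<noteq> 0" for i i'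
    proof -
      have N: "i' < N" "nxt i < N" "i' \<in> T" "nxt i \<in> T" using i nxt(1)[OF i(1)] by (auto simp: nonterm_def T_def)
      have nn: "nxt i' \<noteq> nxt i" using nxt_inj[OF i(1,2)] i(3) by auto
      have "Ymat $$ (nxt i, i') = (0::'a)" using arr_nxt(2)[OF N(3)] nn N by (auto simp: arrow_mat_index)
      moreover have "C.Z $$ (nxt i, i') = 0"
      proof (rule ccontr)
        assume "C.Z $$ (nxt i, i') \<noteq> 0"
        then have a: "arr (star (nxt i)) (star i')" using Zi N by (auto split: if_splits)
        have "nxt (star (nxt i)) = star i'" by (rule arr_nxt(2)[OF _ a]) (use T_star N in simp)
        then have "star i = star i'" using nxt_star(2)[OF i(1)] by simp
        then have "i = i'" using star_inj[of i i'] i(1) N by (auto simp: nonterm_def T_def)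
        then show False using i(3) by simp
      qed
      ultimately have "S $$ (nxt i, i') \<noteq> 0" using i(4) e[OF i(1) N(1)] yi N by auto
      then show ?thesis using S2 i by blast
    qed
  qed
  finally show ?thesis .
qed

text \<open>Each factor \<open>x\<close> costs at most \<open>t\<close> dimensions on
  \<open>T\<close>, one for each chain.\<close>

lemma rk_T_pow: "card T \<le> rk N (pr N T * C.x ^\<^sub>m k) + k * t"
proof -
  have "rk N (pr N T :: 'a mat) = card T" using rk_pr[of N T, where 'a = 'a] by (simp add: T_def Int_def conj_commute)
  moreover have "rk N (pr N T :: 'a mat) + k * rk N (pr N T * C.x) \<le> rk N (pr N T * C.x ^\<^sub>m k) + k * rk N (pr N T :: 'a mat)"
    by (rule rk_compress_pow[OF C.cars'(3) pr_carrier]) (simp_all add: pr_mult C.commute_x(3)[OF pr_carrier] commT)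
  moreover have "k * card T \<le> k * rk N (pr N T * C.x) + k * t"
    using mult_le_mono2[OF order_trans[OF card_nonterm add_right_mono[OF rk_T]], of k] by (simp add: add_mult_distrib2)
  ultimately show ?thesis by simp
qed

lemma rk_pow_ge: "rk N (pr N T * C.x ^\<^sub>m k) + rk N (pr N T1 * C.x ^\<^sub>m k) \<le> rk N (C.x ^\<^sub>m k)"
proof -
  have c: "pr N E * C.x ^\<^sub>m k = C.x ^\<^sub>m k * pr N E" if "E = T \<or> E = T1" for E
    by (rule pow_mat_commute[symmetric, OF C.cars'(3) pr_carrier])
      (rule C.commute_x(3)[symmetric, OF pr_carrier]; simp add: commT[OF that])
  have "T \<inter> T1 = {}" by (auto simp: T_def T1_def)
  from rk_ge_blocks[OF pow_carrier_mat[OF C.cars'(3), of k] this c] show ?thesis using c[of T1] by simp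
qed

end

section \<open>The self-dual chain and the extra column\<close>

context levels
begin

text \<open>The last vector of negative weight in the self-dual chain, where the chain has to cross
  to the dual half.\<close>

definition mid :: "nat \<Rightarrow> bool" where
  "mid i \<longleftrightarrow> i \<in> T \<and> 2 * lab i + 1 = t \<and> w i < 0 \<and> (\<forall>i'\<in>T. lab i' = lab i \<longrightarrow> \<not> (w i < w i' \<and> w i' < 0))"

lemma mid_unique: "mid i \<Longrightarrow> mid l \<Longrightarrow> i = l"
proof -
  assume a: "mid i" "mid l"
  then have T: "i \<in> T" "l \<in> T" "lab i = lab l" "w i < 0" "w l < 0" by (auto simp: mid_def)
  have "\<not> w i < w l" "\<not> w l < w i" using a T by (auto simp: mid_def)
  then show "i = l" using lab_inj_T[OF T(1,2) _ T(3)] by simp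
qed

lemma lab_half_zero:
  assumes i: "i \<in> T" "2 * lab i + 1 = t" "w i = 0"
  shows "star i = i"
proof (rule ccontr)
  assume n: "star i \<noteq> i"
  have iN: "i < N" "lab i < t" using i by (auto simp: T_def)
  have s: "lab (star i) = lab i" unfolding lab_star[OF iN(1)] using iN i(2) by (simp add: flip_def)
  have "left i \<or> left (star i)" using left_star[OF iN(1) n] by blast
  then have "lab i < t div 2" using lab_zero_left[of i] lab_zero_left[of "star i"] s iN star(3)[OF iN(1)] i(3) by auto
  then show False using i(2) by simp
qed

lemma H_half: "i \<in> T \<Longrightarrow> 2 * lab i + 1 = t \<Longrightarrow> i \<in> H \<longleftrightarrow> w i < 0"
proof -
  assume i: "i \<in> T" "2 * lab i + 1 = t"
  then have iN: "i < N" "lab i < t" by (auto simp: T_def)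
  have "left i \<longleftrightarrow> w i < 0" using lab_half_zero[OF i] by (auto simp: left_def)
  then show "i \<in> H \<longleftrightarrow> w i < 0" using i iN by (simp add: H_def)
qed

lemma mid_H: "mid i \<Longrightarrow> i \<in> H" "mid i \<Longrightarrow> i < N" "mid i \<Longrightarrow> star i \<notin> H" "mid i \<Longrightarrow> i \<in> T" "mid i \<Longrightarrow> star i \<in> T" "mid i \<Longrightarrow> w i < 0"
  using H_half H_not_star H_lt T_star by (auto simp: mid_def)

lemma ctr:
  assumes "odd N"
  shows "N div 2 < N" "star (N div 2) = N div 2" "N div 2 \<notin> H" "N div 2 \<in> T" "2 * lab (N div 2) + 1 = t" "w (N div 2) = 0"
proof -
  show c: "N div 2 < N" "star (N div 2) = N div 2" using assms unfolding star_def by (auto elim!: oddE)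
  then show "N div 2 \<notin> H" by (rule H_center)
  show "2 * lab (N div 2) + 1 = t" using odd_t[OF assms] center[OF c] c by (auto simp: lab_def elim!: oddE)
  then show "N div 2 \<in> T" using c by (auto simp: T_def)
  show "w (N div 2) = 0" using center[OF c] by simp
qed

lemma star_fixed: "i < N \<Longrightarrow> star i = i \<Longrightarrow> odd N \<and> i = N div 2"
  using center by blast

lemma lab_half_star: "i \<in> T \<Longrightarrow> 2 * lab i + 1 = t \<Longrightarrow> star i \<in> T \<and> lab (star i) = lab i \<and> w (star i) = - w i"
  using lab_star[of i] T_star[of i] star(3)[of i] by (auto simp: T_def flip_def)

lemma mid_nxt_even:
  assumes m: "mid i" and N: "even N"
  shows "i \<in> nonterm" "nxt i = star i"
proof -
  have i: "i \<in> T" "2 * lab i + 1 = t" "w i < 0" using m by (auto simp: mid_def)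
  note s = lab_half_star[OF i(1,2)]
  have "\<not> (w i < w l \<and> w l < w (star i))" if l: "l \<in> T" "lab l = lab i" for l
  proof
    assume a: "w i < w l \<and> w l < w (star i)"
    have l2: "2 * lab l + 1 = t" "l < N" using l i by (auto simp: T_def)
    have "w l \<noteq> 0" using lab_half_zero[OF l(1) l2(1)] star_fixed[OF l2(2)] N by blast
    moreover have "\<not> w l < 0" using m l a by (auto simp: mid_def)
    moreover note lab_half_star[OF l(1) l2(1)]
    moreover have "\<not> (w i < w (star l) \<and> w (star l) < 0)" if "star l \<in> T" "lab (star l) = lab i"
      using m that by (simp add: mid_def)
    ultimately show False using a s l(2) by linarith
  qed
  then show "i \<in> nonterm" "nxt i = star i" using nxt_eqI[of i "star i"] i s by auto
qed

lemma mid_nxt_odd: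
  assumes m: "mid i" and N: "odd N"
  shows "i \<in> nonterm" "nxt i = N div 2" "N div 2 \<in> nonterm" "nxt (N div 2) = star i"
proof -
  have i: "i \<in> T" "2 * lab i + 1 = t" "w i < 0" using m by (auto simp: mid_def)
  note c = ctr[OF N]
  have e: "lab (N div 2) = lab i" using c(5) i(2) by simp
  have "\<not> (w i < w l \<and> w l < w (N div 2))" if l: "l \<in> T" "lab l = lab i" for l
    using m l c(6) by (auto simp: mid_def)
  then show 1: "i \<in> nonterm" "nxt i = N div 2" using nxt_eqI[OF i(1) c(4) e] i(3) c(6) by auto
  show "N div 2 \<in> nonterm" "nxt (N div 2) = star i" using nxt_star[OF 1(1)] unfolding 1(2) c(2) by auto
qed

text \<open>A chain with a non-central label lies entirely in \<open>H\<close> or in its dual, so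
  only the self-dual chain crosses: directly in even dimension, through the central vector in odd
  dimension.\<close>

lemma mixed:
  assumes i: "i \<in> nonterm" and mx: "\<not> (i \<in> H \<and> nxt i \<in> H)" "\<not> (star i \<in> H \<and> star (nxt i) \<in> H)"
  shows "even N \<Longrightarrow> mid i" "odd N \<Longrightarrow> mid i \<or> i = N div 2 \<and> mid (star (nxt i))"
proof -
  let ?l = "nxt i"
  have T: "i \<in> T" "?l \<in> T" "i < N" "?l < N" "lab i < t" using i nxt(1)[OF i] by (auto simp: nonterm_def T_def)
  note lab = nxt(2)[OF i] and wl = nxt(3)[OF i]
  have half: "2 * lab i + 1 = t"
  proof (rule ccontr)
    assume ne: "2 * lab i + 1 \<noteq> t"
    have "i \<in> H \<longleftrightarrow> 2 * lab i + 1 < t" "?l \<in> H \<longleftrightarrow> 2 * lab i + 1 < t" using T ne lab by (auto simp: H_def)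
    moreover have "star i \<noteq> i" "star ?l \<noteq> ?l" using star_fixed T ctr(5) ne lab by metis+
    ultimately show False using mx H_star T by blast
  qed
  have half': "2 * lab ?l + 1 = t" using half lab by simp
  note s = lab_half_star[OF T(1) half] and s' = lab_half_star[OF T(2) half']
  have Hs: "i \<in> H \<longleftrightarrow> w i < 0" "?l \<in> H \<longleftrightarrow> w ?l < 0" "star i \<in> H \<longleftrightarrow> w i > 0" "star ?l \<in> H \<longleftrightarrow> w ?l > 0"
    using H_half[OF T(1) half] H_half[OF T(2) half'] H_half[of "star i"] H_half[of "star ?l"] s s' half half' by auto
  then have w: "w i \<le> 0" "0 \<le> w ?l" using mx wl by auto
  have mi: "mid i" if "w i < 0"
    unfolding mid_def
  proof (intro conjI ballI impI)
    fix i' assume i': "i' \<in> T" "lab i' = lab i"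
    show "\<not> (w i < w i' \<and> w i' < 0)" using nxt(4)[OF i i'] w by auto
  qed (use T half that in auto)
  have z: "odd N \<and> i = N div 2" if "w i = 0" using lab_half_zero[OF T(1) half that] star_fixed T by blast
  show "even N \<Longrightarrow> mid i" using mi z w by fastforce
  show "mid i \<or> i = N div 2 \<and> mid (star ?l)" if N: "odd N"
  proof (cases "w i < 0")
    case False
    then have z0: "w i = 0" using w by simp
    have "mid (star ?l)"
      unfolding mid_def
    proof (intro conjI ballI impI)
      fix i' assume i': "i' \<in> T" "lab i' = lab (star ?l)"
      then have h: "2 * lab i' + 1 = t" using s' half' by simp
      note s2 = lab_half_star[OF i'(1) h]
      show "\<not> (w (star ?l) < w i' \<and> w i' < 0)" using nxt(4)[OF i, of "star i'"] s2 s' i' lab z0 by auto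
    qed (use s' half' wl z0 in auto)
    then show ?thesis using z[OF z0] by simp
  qed (use mi in simp)
qed

lemma card_T1: "card T1 = 2 * card (T1 \<inter> H)"
proof -
  have ne: "star i \<noteq> i" if "i \<in> T1" for i
  proof
    assume "star i = i"
    moreover have "i < N" "lab i = t" using that by (auto simp: T1_def)
    ultimately show False using star_fixed[of i] ctr(5) by auto
  qed
  have N: "i \<in> T1 \<Longrightarrow> i < N" for i by (simp add: T1_def)
  have "card (T1 - H) = card (T1 \<inter> H)"
  proof (rule bij_betw_same_card[of star], rule bij_betwI[where g = star])
    show "star \<in> T1 - H \<rightarrow> T1 \<inter> H"
    proof
      fix i assume i: "i \<in> T1 - H"
      then show "star i \<in> T1 \<inter> H" using H_star[OF N ne, of i] T_star(2)[OF N, of i] by blast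
    qed
    show "star \<in> T1 \<inter> H \<rightarrow> T1 - H"
    proof
      fix i assume i: "i \<in> T1 \<inter> H"
      then show "star i \<in> T1 - H" using H_not_star[of i] T_star(2)[OF N, of i] by blast
    qed
  qed (use star(2)[OF N] in blast)+
  moreover have "card T1 = card (T1 \<inter> H) + card (T1 - H)"
    using card_Int_Diff[OF finT(2)] .
  ultimately show ?thesis by simp
qed

lemma T1_H: "i \<in> T1 \<Longrightarrow> i \<in> H \<longleftrightarrow> left i"
  by (auto simp: T1_def H_def)

text \<open>Label \<open>t\<close> occurs at most once per weight within \<open>H\<close>, so the
  left half of the column can be listed by increasing weight.\<close>

lemma column_enumeration:
  obtains a where "bij_betw a {..<card (T1 \<inter> H)} (T1 \<inter> H)"
    "\<And>r s. r < card (T1 \<inter> H) \<Longrightarrow> s < card (T1 \<inter> H) \<Longrightarrow> w (a r) < w (a s) \<longleftrightarrow> r < s"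
proof -
  let ?X = "T1 \<inter> H"
  have inj: "inj_on w ?X"
  proof (rule inj_onI)
    fix i l assume a: "i \<in> ?X" "l \<in> ?X" "w i = w l"
    then have "i \<in> H" "l \<in> H" "lab i = lab l" by (simp_all add: T1_def)
    then show "i = l" using a(3) by (intro H_inj[of i l])
  qed
  define ws where "ws = sorted_list_of_set (w ` ?X)"
  have ws: "set ws = w ` ?X" "sorted_wrt (<) ws" "length ws = card ?X"
    using finT by (auto simp: ws_def strict_sorted_list_of_set card_image[OF inj])
  have lt: "ws ! r < ws ! s \<longleftrightarrow> r < s" if "r < card ?X" "s < card ?X" for r s
    using sorted_wrt_nth_less[OF ws(2), of r s] sorted_wrt_nth_less[OF ws(2), of s r] that ws(3)
    by (cases r s rule: linorder_cases) auto
  define a where "a r = the_inv_into ?X w (ws ! r)" for r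
  have wa: "w (a r) = ws ! r" "a r \<in> ?X" if "r < card ?X" for r
  proof -
    have m: "ws ! r \<in> w ` ?X" using that ws nth_mem by metis
    show "w (a r) = ws ! r" unfolding a_def by (rule f_the_inv_into_f[OF inj m])
    show "a r \<in> ?X" unfolding a_def by (rule the_inv_into_into[OF inj m]) simp
  qed
  have "inj_on a {..<card ?X}"
  proof (rule inj_onI)
    fix r s assume rs: "r \<in> {..<card ?X}" "s \<in> {..<card ?X}" "a r = a s"
    then have "ws ! r = ws ! s" using wa(1)[of r] wa(1)[of s] by simp
    then have "\<not> r < s" "\<not> s < r" using lt[of r s] lt[of s r] rs by auto
    then show "r = s" by simp
  qed
  moreover have "a ` {..<card ?X} \<subseteq> ?X" using wa by auto
  ultimately have "bij_betw a {..<card ?X} ?X"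
    unfolding bij_betw_def using card_subset_eq[of ?X "a ` {..<card ?X}"] card_image[of a "{..<card ?X}"] finT by simp
  then show thesis using that wa(1) lt by auto
qed

end

locale levels_column = levels +
  fixes a :: "nat \<Rightarrow> nat"
  assumes abij: "bij_betw a {..<card (T1 \<inter> H)} (T1 \<inter> H)"
    and aless: "\<And>r s. r < card (T1 \<inter> H) \<Longrightarrow> s < card (T1 \<inter> H) \<Longrightarrow> w (a r) < w (a s) \<longleftrightarrow> r < s"
begin

abbreviation L where "L \<equiv> card (T1 \<inter> H)"

lemma aT: "r < L \<Longrightarrow> a r \<in> T1" "r < L \<Longrightarrow> a r \<in> H" "r < L \<Longrightarrow> a r < N" "r < L \<Longrightarrow> lab (a r) = t"
  using abij by (auto simp: bij_betw_def T1_def)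

lemma a_inj: "r < L \<Longrightarrow> s < L \<Longrightarrow> a r = a s \<longleftrightarrow> r = s"
  using abij by (auto simp: bij_betw_def inj_on_def)

lemma a_surj: "i \<in> H \<Longrightarrow> lab i = t \<Longrightarrow> \<exists>r<L. i = a r"
proof -
  assume "i \<in> H" "lab i = t"
  then have "i \<in> a ` {..<L}" using abij by (auto simp: bij_betw_def T1_def H_lt)
  then show "\<exists>r<L. i = a r" by auto
qed

lemma arr_a:
  assumes "r < L" "s < L"
  shows "arr (a r) (a s) \<longleftrightarrow> s = Suc r"
proof
  assume ar: "arr (a r) (a s)"
  then have "r < s" using aless[OF assms] arrD(4)[OF ar] by simp
  moreover have "\<not> Suc r < s"
  proof
    assume "Suc r < s"
    then have "w (a r) < w (a (Suc r))" "w (a (Suc r)) < w (a s)" "Suc r < L" using aless assms by auto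
    then show False using ar aT[of "Suc r"] aT[of r] assms unfolding arr_def by auto
  qed
  ultimately show "s = Suc r" by simp
next
  assume s: "s = Suc r"
  show "arr (a r) (a s)" unfolding arr_def
  proof (intro conjI ballI impI)
    fix l' assume l': "l' \<in> H" "lab l' = lab (a r)"
    then obtain r' where r': "r' < L" "l' = a r'" using a_surj[of l'] aT(4)[OF assms(1)] by auto
    show "\<not> (w (a r) < w l' \<and> w l' < w (a s))" using aless r' assms s by auto
  qed (use aT assms aless s in auto)
qed

lemma arr_out: "r < L \<Longrightarrow> arr (a r) l \<longleftrightarrow> Suc r < L \<and> l = a (Suc r)"
proof
  assume r: "r < L" and l: "arr (a r) l"
  obtain s where "s < L" "l = a s" using a_surj[of l] arrD(2,3)[OF l] aT(4)[OF r] by auto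
  then show "Suc r < L \<and> l = a (Suc r)" using arr_a r l by auto
qed (use arr_a in auto)

lemma arr_in: "Suc r < L \<Longrightarrow> arr k (a (Suc r)) \<longleftrightarrow> k = a r"
proof
  assume r: "Suc r < L" and k: "arr k (a (Suc r))"
  obtain s where "s < L" "k = a s" using a_surj[of k] arrD(1,3)[OF k] aT(4)[OF r] by auto
  then show "k = a r" using arr_a r k by auto
qed (use arr_a in auto)

lemma arr_in0: "0 < L \<Longrightarrow> \<not> arr k (a 0)"
proof
  assume r: "0 < L" and k: "arr k (a 0)"
  obtain s where "s < L" "k = a s" using a_surj[of k] arrD(1,3)[OF k] aT(4)[OF r] by auto
  then show False using arr_a r k by auto
qed

lemma a_left: "r < L \<Longrightarrow> left (a r)"
  using T1_H aT by blast

lemma a_neg: "Suc r < L \<Longrightarrow> w (a r) < 0"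
proof -
  assume r: "Suc r < L"
  then have "w (a r) < w (a (Suc r))" using aless by simp
  moreover have "w (a (Suc r)) \<le> 0" using a_left[OF r] by (auto simp: left_def)
  ultimately show "w (a r) < 0" by simp
qed

end

section \<open>The action of \<open>x\<close> on the extra column\<close>

lemma mat_vec_zero: "M \<in> carrier_mat n n \<Longrightarrow> M *\<^sub>v 0\<^sub>v n = (0\<^sub>v n :: 'a::field vec)"
  by (intro eq_vecI) (auto simp: scalar_prod_def)

lemma mat_vec_uminus: "M \<in> carrier_mat n n \<Longrightarrow> u \<in> carrier_vec n \<Longrightarrow> (- M) *\<^sub>v u = (- 1) \<cdot>\<^sub>v (M *\<^sub>v (u :: 'a::field vec))"
  by (intro eq_vecI) (auto simp: scalar_prod_def sum_negf[symmetric] intro!: sum.cong)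

lemma mat_unit_vec:
  fixes M :: "'a::field mat"
  assumes M: "M \<in> carrier_mat n n" and i: "i < n" and e: "\<And>l. l < n \<Longrightarrow> M $$ (l,i) = v $ l" and v: "v \<in> carrier_vec n"
  shows "M *\<^sub>v unit_vec n i = v"
proof (rule eq_vecI)
  fix l assume "l < dim_vec v"
  then have l: "l < n" using v by simp
  have "row M l \<bullet> unit_vec n i = row M l $ i" by (rule scalar_prod_right_unit) (use M l i in auto)
  then show "(M *\<^sub>v unit_vec n i) $ l = v $ l" using M l i e by simp
qed (use M v in auto)

lemma mat_pow_vec: "x \<in> carrier_mat n n \<Longrightarrow> v \<in> carrier_vec n \<Longrightarrow> x ^\<^sub>m (a + b) *\<^sub>v v = x ^\<^sub>m a *\<^sub>v (x ^\<^sub>m b *\<^sub>v (v :: 'a::field vec))"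
  unfolding pow_mat_add by (rule assoc_mult_mat_vec[of _ n n _ n]) auto

context chain_iso
begin

lemma pr_B: "pr n B * Z = Z" "Z * pr n B = Z" "pr n B * V = V * pr n B"
proof -
  have "(pr n B * Z) $$ (i,j) = Z $$ (i,j)" "(Z * pr n B) $$ (i,j) = Z $$ (i,j)" if "i < n" "j < n" for i j
    using supp_inD[OF Zr(2) that] pr_mult_left_index[OF cars(2) that] pr_mult_right_index[OF cars(2) that] by auto
  then show z: "pr n B * Z = Z" "Z * pr n B = Z" by (auto intro!: eq_matI simp del: index_mult_mat(1))
  then have "pr n B * P = P * pr n B" unfolding P_def by (simp add: mat_add_distrib mat_mult_one)
  then show "pr n B * V = V * pr n B" by (rule commute_inverse[OF _ _ _ _ _ _ V(2,3), rotated -1]) simp_all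
qed

text \<open>On the span of \<open>B\<close> the map \<open>x\<close> is \<open>- Z * V\<close>, and
  \<open>Z\<close> commutes with \<open>V\<close>: every step applies \<open>Z\<close> and leaves
  one more factor \<open>V\<close> behind.\<close>

lemma x_V_pow:
  assumes f: "f \<in> carrier_vec n" "pr n B *\<^sub>v f = f"
  shows "x *\<^sub>v (V ^\<^sub>m p *\<^sub>v f) = (- 1) \<cdot>\<^sub>v (V ^\<^sub>m Suc p *\<^sub>v (Z *\<^sub>v f))"
proof -
  note vc = pow_carrier_mat[OF cars(5), of p]
  note [simp] = carrier_matD[OF vc] carrier_vecD[OF f(1)]
  have c: "V ^\<^sub>m p * pr n B = pr n B * V ^\<^sub>m p" by (rule pow_mat_commute[OF cars(5) pr_carrier pr_B(3)[symmetric]])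
  have d: "V ^\<^sub>m p * Z = Z * V ^\<^sub>m p" by (rule pow_mat_commute[OF cars(5) cars(2) ZV(1)[symmetric]])
  have "V ^\<^sub>m p *\<^sub>v f = (V ^\<^sub>m p * pr n B) *\<^sub>v f" using f by (simp add: mat_vec_assoc)
  also have "\<dots> = pr n B *\<^sub>v (V ^\<^sub>m p *\<^sub>v f)" unfolding c by (simp add: mat_vec_assoc)
  finally have "x *\<^sub>v (V ^\<^sub>m p *\<^sub>v f) = (x * pr n B) *\<^sub>v (V ^\<^sub>m p *\<^sub>v f)" by (simp add: mat_vec_assoc)
  also have "\<dots> = (- (Z * V)) *\<^sub>v (pr n B *\<^sub>v (V ^\<^sub>m p *\<^sub>v f))" unfolding x_on_B by (simp add: mat_vec_assoc)
  also have "pr n B *\<^sub>v (V ^\<^sub>m p *\<^sub>v f) = (V ^\<^sub>m p * pr n B) *\<^sub>v f" unfolding c by (simp add: mat_vec_assoc)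
  also have "\<dots> = V ^\<^sub>m p *\<^sub>v f" using f by (simp add: mat_vec_assoc)
  also have "(- (Z * V)) *\<^sub>v (V ^\<^sub>m p *\<^sub>v f) = (- 1) \<cdot>\<^sub>v ((Z * V) *\<^sub>v (V ^\<^sub>m p *\<^sub>v f))"
    by (rule mat_vec_uminus[of _ n]) ((rule carrier_matI carrier_vecI; simp)+)
  also have "(Z * V) *\<^sub>v (V ^\<^sub>m p *\<^sub>v f) = (V * (Z * V ^\<^sub>m p)) *\<^sub>v f" unfolding ZV(1) by (simp add: mat_vec_assoc)
  also have "V * (Z * V ^\<^sub>m p) = V ^\<^sub>m Suc p * Z" unfolding d[symmetric] pow_mat_Suc_left[OF cars(5)] by (simp add: mat_assoc)
  also have "(V ^\<^sub>m Suc p * Z) *\<^sub>v f = V ^\<^sub>m Suc p *\<^sub>v (Z *\<^sub>v f)" by (rule mat_vec_assoc) simp_all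
  finally show ?thesis .
qed

lemma V_pow_nz:
  assumes f: "f \<in> carrier_vec n" "f \<noteq> 0\<^sub>v n"
  shows "V ^\<^sub>m p *\<^sub>v f \<noteq> 0\<^sub>v n"
proof
  assume a: "V ^\<^sub>m p *\<^sub>v f = 0\<^sub>v n"
  note vc = pow_carrier_mat[OF cars(5), of p] and pc = pow_carrier_mat[OF cars(4), of p]
  have "f = (P ^\<^sub>m p * V ^\<^sub>m p) *\<^sub>v f" unfolding pow_mat_inverse[OF cars(4,5) V(2)] using f by simp
  also have "\<dots> = P ^\<^sub>m p *\<^sub>v (V ^\<^sub>m p *\<^sub>v f)" by (rule assoc_mult_mat_vec[OF pc vc f(1)])
  also have "\<dots> = 0\<^sub>v n" unfolding a by (rule mat_vec_zero[OF pc])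
  finally show False using f by simp
qed

end

text \<open>A link from the last vector of the left half to its own dual would violate the quadratic
  form. Instead the last but one vector is linked to the dual of the last, and the last, with
  opposite sign, to the dual of the last but one.\<close>

locale column_form = levels_form N t w h g S + levels_column N t w h a
  for N t w h and g :: "nat \<Rightarrow> 'a::field" and S a +
  assumes g1: "\<And>i. i \<in> T1 \<Longrightarrow> g i = 1"
    and Sa: "\<And>l r. l < N \<Longrightarrow> r < L \<Longrightarrow> S $$ (l, a r) =
      (if Suc (Suc r) = L \<and> l = star (a (Suc r)) then 1 else if 0 < r \<and> Suc r = L \<and> l = star (a (r - 1)) then - 1 else 0)"
begin

text \<open>The index is shifted by 1 and \<open>bb 0\<close> is zero, so that \<open>Z\<close>
  lowers the index by 1 down to the end of the column.\<close>

definition bb :: "nat \<Rightarrow> 'a vec" where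
  "bb r = (case r of 0 \<Rightarrow> 0\<^sub>v N | Suc r \<Rightarrow> unit_vec N (star (a r)))"

lemma bb_carrier [simp]: "bb r \<in> carrier_vec N"
  by (cases r) (auto simp: bb_def)

lemma bb_Suc: "bb (Suc r) = unit_vec N (star (a r))"
  by (simp add: bb_def)

lemma star_a: "r < L \<Longrightarrow> star (a r) < N" "r < L \<Longrightarrow> star (star (a r)) = a r" "r < L \<Longrightarrow> star (a r) \<in> T1" "r < L \<Longrightarrow> star (a r) \<in> B"
  using star[OF aT(3)] T_star(2)[OF aT(3)] aT by auto

lemma bb_B: "r \<le> L \<Longrightarrow> pr N B *\<^sub>v bb r = bb r"
proof (cases r)
  case 0
  then show ?thesis using mat_vec_zero[OF pr_carrier] by (auto simp: bb_def)
next
  case (Suc s)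
  assume "r \<le> L"
  then have s: "s < L" using Suc by simp
  have "pr N B *\<^sub>v unit_vec N (star (a s)) = (unit_vec N (star (a s)) :: 'a vec)"
    by (rule mat_unit_vec[OF pr_carrier]) (use star_a[OF s] in \<open>auto simp: pr_def unit_vec_def\<close>)
  then show ?thesis using Suc by (simp add: bb_def)
qed

lemma Z_bb: "Suc r \<le> L \<Longrightarrow> C.Z *\<^sub>v bb (Suc r) = bb r"
proof -
  assume "Suc r \<le> L"
  then have r: "r < L" by simp
  have "C.Z *\<^sub>v unit_vec N (star (a r)) = bb r"
  proof (rule mat_unit_vec[OF C.cars(2)])
    fix l assume l: "l < N"
    have e: "C.Z $$ (l, star (a r)) = (if arr (star l) (a r) then inverse (g (star l)) else 0)"
      unfolding Zi[OF l star_a(1)[OF r]] star_a(2)[OF r] g1[OF aT(1)[OF r]] by simp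
    show "C.Z $$ (l, star (a r)) = bb r $ l"
    proof (cases r)
      case 0
      then show ?thesis using e arr_in0[of "star l"] r l by (simp add: bb_def)
    next
      case (Suc s)
      then have s: "Suc s < L" "s < L" using r by auto
      have "arr (star l) (a r) \<longleftrightarrow> l = star (a s)"
      proof -
        have "arr (star l) (a r) \<longleftrightarrow> star l = a s" unfolding Suc using arr_in[OF s(1)] .
        also have "\<dots> \<longleftrightarrow> l = star (a s)" using star(2)[OF l] star_a(2)[OF s(2)] by auto
        finally show ?thesis .
      qed
      then show ?thesis using e Suc l star_a[OF s(2)] g1[OF aT(1)[OF s(2)]] by (auto simp: bb_def)
    qed
  qed (use star_a r in auto)
  then show ?thesis by (simp add: bb_def)
qed

lemma x_pow_bb: "m + r \<le> L \<Longrightarrow> \<exists>s. s \<noteq> 0 \<and> C.x ^\<^sub>m m *\<^sub>v (C.V ^\<^sub>m p *\<^sub>v bb (m + r)) = s \<cdot>\<^sub>v (C.V ^\<^sub>m (p + m) *\<^sub>v bb r)"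
proof (induction m arbitrary: p)
  case 0
  have "C.V ^\<^sub>m p *\<^sub>v bb r \<in> carrier_vec N" by (rule mult_mat_vec_carrier[OF pow_carrier_mat[OF C.cars(5)]]) simp
  then show ?case using C.cars'(3) by (intro exI[of _ 1]) (auto simp: one_smult_vec)
next
  case (Suc m)
  have vc: "C.V ^\<^sub>m p *\<^sub>v bb r \<in> carrier_vec N" for p r
    by (rule mult_mat_vec_carrier[OF pow_carrier_mat[OF C.cars(5)]]) simp
  have xc: "C.x ^\<^sub>m m \<in> carrier_mat N N" by (rule pow_carrier_mat[OF C.cars'(3)])
  have "C.x ^\<^sub>m Suc m *\<^sub>v (C.V ^\<^sub>m p *\<^sub>v bb (Suc m + r)) = C.x ^\<^sub>m m *\<^sub>v (C.x *\<^sub>v (C.V ^\<^sub>m p *\<^sub>v bb (Suc m + r)))"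
    using assoc_mult_mat_vec[OF xc C.cars'(3) vc] by simp
  also have "C.x *\<^sub>v (C.V ^\<^sub>m p *\<^sub>v bb (Suc m + r)) = (- 1) \<cdot>\<^sub>v (C.V ^\<^sub>m Suc p *\<^sub>v bb (m + r))"
    using C.x_V_pow[OF bb_carrier bb_B, of "Suc m + r" p] Z_bb[of "m + r"] Suc.prems by simp
  also have "C.x ^\<^sub>m m *\<^sub>v \<dots> = (- 1) \<cdot>\<^sub>v (C.x ^\<^sub>m m *\<^sub>v (C.V ^\<^sub>m Suc p *\<^sub>v bb (m + r)))"
    by (rule mult_mat_vec[OF xc vc])
  finally have e: "C.x ^\<^sub>m Suc m *\<^sub>v (C.V ^\<^sub>m p *\<^sub>v bb (Suc m + r)) = (- 1) \<cdot>\<^sub>v (C.x ^\<^sub>m m *\<^sub>v (C.V ^\<^sub>m Suc p *\<^sub>v bb (m + r)))" .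
  have "m + r \<le> L" using Suc.prems by simp
  from Suc.IH[OF this, of "Suc p"] obtain s where s: "s \<noteq> 0"
    "C.x ^\<^sub>m m *\<^sub>v (C.V ^\<^sub>m Suc p *\<^sub>v bb (m + r)) = s \<cdot>\<^sub>v (C.V ^\<^sub>m (Suc p + m) *\<^sub>v bb r)" by blast
  show ?case unfolding e s(2) using s(1) by (intro exI[of _ "- s"]) (auto simp: smult_smult_assoc)
qed

lemma Y_a: "r < L \<Longrightarrow> Ymat *\<^sub>v unit_vec N (a r) = (if Suc r < L then unit_vec N (a (Suc r)) else 0\<^sub>v N)"
proof -
  assume r: "r < L"
  show ?thesis
  proof (rule mat_unit_vec[OF C.cars(1)])
    fix l assume l: "l < N"
    show "Ymat $$ (l, a r) = (if Suc r < L then unit_vec N (a (Suc r)) else 0\<^sub>v N) $ l"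
      unfolding arrow_mat_index[OF l aT(3)[OF r]] arr_out[OF r] using l aT(3)[of "Suc r"] by auto
  qed (use aT(3)[OF r] in auto)
qed

lemma S_a:
  "Suc (Suc r) < L \<Longrightarrow> S *\<^sub>v unit_vec N (a r) = 0\<^sub>v N"
  "Suc (Suc r) = L \<Longrightarrow> S *\<^sub>v unit_vec N (a r) = bb L"
  "Suc (Suc r) = L \<Longrightarrow> S *\<^sub>v unit_vec N (a (Suc r)) = (- 1) \<cdot>\<^sub>v bb (Suc r)"
proof -
  show "S *\<^sub>v unit_vec N (a r) = 0\<^sub>v N" if "Suc (Suc r) < L"
    by (rule mat_unit_vec[OF C.cars(3)]) (use that Sa[of _ r] aT(3)[of r] in auto)
  show "S *\<^sub>v unit_vec N (a r) = bb L" if e: "Suc (Suc r) = L"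
  proof -
    have "S *\<^sub>v unit_vec N (a r) = bb (Suc (Suc r))" unfolding bb_Suc
      by (rule mat_unit_vec[OF C.cars(3)]) (use e Sa[of _ r] aT(3)[of r] star_a(1)[of "Suc r"] in auto)
    then show ?thesis using e by simp
  qed
  show "S *\<^sub>v unit_vec N (a (Suc r)) = (- 1) \<cdot>\<^sub>v bb (Suc r)" if e: "Suc (Suc r) = L" unfolding bb_Suc
    by (rule mat_unit_vec[OF C.cars(3)]) (use e Sa[of _ "Suc r"] aT(3)[of "Suc r"] star_a(1)[of r] in auto)
qed

lemma pr_a: "r < L \<Longrightarrow> pr N H *\<^sub>v unit_vec N (a r) = (unit_vec N (a r) :: 'a vec)"
  by (rule mat_unit_vec[OF pr_carrier]) (use aT in \<open>auto simp: pr_def unit_vec_def\<close>)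

lemma x_a:
  "Suc (Suc r) < L \<Longrightarrow> C.x *\<^sub>v unit_vec N (a r) = unit_vec N (a (Suc r))"
  "Suc (Suc r) = L \<Longrightarrow> C.x *\<^sub>v unit_vec N (a r) = unit_vec N (a (Suc r)) + C.V *\<^sub>v bb L"
  "Suc (Suc r) = L \<Longrightarrow> C.x *\<^sub>v unit_vec N (a (Suc r)) = (- 1) \<cdot>\<^sub>v (C.V *\<^sub>v bb (Suc r))"
proof -
  have z: "pr N B *\<^sub>v 0\<^sub>v N = (0\<^sub>v N :: 'a vec)" "C.V *\<^sub>v 0\<^sub>v N = 0\<^sub>v N"
    using mat_vec_zero[OF pr_carrier] mat_vec_zero[OF C.cars(5)] by auto
  have vb: "C.V *\<^sub>v bb r \<in> carrier_vec N" for r by (rule mult_mat_vec_carrier[OF C.cars(5)]) simp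
  show "C.x *\<^sub>v unit_vec N (a r) = unit_vec N (a (Suc r))" if "Suc (Suc r) < L"
    using C.x_on_A[OF _ pr_a, of r] S_a(1)[OF that] Y_a[of r] that z by simp
  show "C.x *\<^sub>v unit_vec N (a r) = unit_vec N (a (Suc r)) + C.V *\<^sub>v bb L" if "Suc (Suc r) = L"
    using C.x_on_A[OF _ pr_a, of r] S_a(2)[OF that] Y_a[of r] that bb_B[of L] by simp
  show "C.x *\<^sub>v unit_vec N (a (Suc r)) = (- 1) \<cdot>\<^sub>v (C.V *\<^sub>v bb (Suc r))" if e: "Suc (Suc r) = L"
  proof -
    have "pr N B *\<^sub>v ((- 1) \<cdot>\<^sub>v bb (Suc r)) = (- 1) \<cdot>\<^sub>v bb (Suc r)"
      using mult_mat_vec[OF pr_carrier bb_carrier] bb_B[of "Suc r"] e by simp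
    then have "C.x *\<^sub>v unit_vec N (a (Suc r)) = 0\<^sub>v N + C.V *\<^sub>v ((- 1) \<cdot>\<^sub>v bb (Suc r))"
      using C.x_on_A[OF _ pr_a, of "Suc r"] S_a(3)[OF e] Y_a[of "Suc r"] e by simp
    then show ?thesis using mult_mat_vec[OF C.cars(5) bb_carrier] vb by simp
  qed
qed

lemma x_pow_a: "Suc (Suc r) \<le> L \<Longrightarrow> C.x ^\<^sub>m r *\<^sub>v unit_vec N (a 0) = unit_vec N (a r)"
proof (induction r)
  case 0
  then show ?case using C.cars'(3) by simp
next
  case (Suc r)
  have "C.x ^\<^sub>m Suc r *\<^sub>v unit_vec N (a 0) = C.x *\<^sub>v (C.x ^\<^sub>m r *\<^sub>v unit_vec N (a 0))"
    unfolding pow_mat_Suc_left[OF C.cars'(3)]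
    by (rule assoc_mult_mat_vec[OF C.cars'(3) pow_carrier_mat[OF C.cars'(3)]]) simp
  then show ?case using Suc x_a(1)[of r] by simp
qed

text \<open>There are two routes across the centre, one through each link. Rewriting
  \<open>V b = V^2 (b + Z b)\<close> brings both to the same power of \<open>V\<close>, and their
  leading terms add up to \<open>- 2\<close> instead of cancelling.\<close>

lemma x2_a:
  assumes r: "Suc (Suc r) = L"
  shows "C.x ^\<^sub>m 2 *\<^sub>v unit_vec N (a r) = (- 2) \<cdot>\<^sub>v (C.V ^\<^sub>m 2 *\<^sub>v bb (Suc r)) + (- 1) \<cdot>\<^sub>v (C.V ^\<^sub>m 2 *\<^sub>v bb r)"
proof -
  have c: "C.V ^\<^sub>m p *\<^sub>v bb r \<in> carrier_vec N" for p r
    by (rule mult_mat_vec_carrier[OF pow_carrier_mat[OF C.cars(5)]]) simp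
  have V1: "C.V ^\<^sub>m 1 = C.V" and V2: "C.V ^\<^sub>m 2 = C.V * C.V" using C.cars(5) by (simp_all add: numeral_2_eq_2)
  have vb: "C.V *\<^sub>v bb r \<in> carrier_vec N" for r using c[of 1] V1 by simp
  have L: "C.x *\<^sub>v (C.V *\<^sub>v bb L) = (- 1) \<cdot>\<^sub>v (C.V ^\<^sub>m 2 *\<^sub>v bb (Suc r))"
    using C.x_V_pow[OF bb_carrier bb_B, of L 1] Z_bb[of "Suc r"] r V1 by (simp add: numeral_2_eq_2)
  have PV: "C.V *\<^sub>v bb (Suc r) = C.V ^\<^sub>m 2 *\<^sub>v bb (Suc r) + C.V ^\<^sub>m 2 *\<^sub>v bb r"
  proof -
    have "bb (Suc r) + bb r = C.P *\<^sub>v bb (Suc r)"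
      unfolding C.P_def using add_mult_distrib_mat_vec[OF one_carrier_mat C.cars(2) bb_carrier, of "Suc r"] Z_bb[of r] r by simp
    then have "C.V *\<^sub>v (C.V *\<^sub>v (bb (Suc r) + bb r)) = C.V *\<^sub>v ((C.V * C.P) *\<^sub>v bb (Suc r))"
      using assoc_mult_mat_vec[OF C.cars(5,4) bb_carrier] by simp
    also have "\<dots> = C.V *\<^sub>v bb (Suc r)" unfolding C.V(3) by simp
    also have "C.V *\<^sub>v (C.V *\<^sub>v (bb (Suc r) + bb r)) = C.V ^\<^sub>m 2 *\<^sub>v (bb (Suc r) + bb r)"
      unfolding V2 by (rule assoc_mult_mat_vec[OF C.cars(5,5), symmetric]) simp
    also have "\<dots> = C.V ^\<^sub>m 2 *\<^sub>v bb (Suc r) + C.V ^\<^sub>m 2 *\<^sub>v bb r"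
      by (rule mult_add_distrib_mat_vec[OF pow_carrier_mat[OF C.cars(5)]]) simp_all
    finally show ?thesis by simp
  qed
  have "C.x ^\<^sub>m 2 *\<^sub>v unit_vec N (a r) = C.x *\<^sub>v (C.x *\<^sub>v unit_vec N (a r))"
    using assoc_mult_mat_vec[OF C.cars'(3,3), of "unit_vec N (a r)"] C.cars'(3) by (simp add: numeral_2_eq_2)
  also have "\<dots> = C.x *\<^sub>v unit_vec N (a (Suc r)) + C.x *\<^sub>v (C.V *\<^sub>v bb L)"
    unfolding x_a(2)[OF r] by (rule mult_add_distrib_mat_vec[OF C.cars'(3)]) (use vb in auto)
  also have "\<dots> = (- 1) \<cdot>\<^sub>v (C.V ^\<^sub>m 2 *\<^sub>v bb (Suc r) + C.V ^\<^sub>m 2 *\<^sub>v bb r) + (- 1) \<cdot>\<^sub>v (C.V ^\<^sub>m 2 *\<^sub>v bb (Suc r))"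
    unfolding x_a(3)[OF r] L PV ..
  also have "\<dots> = (- 2) \<cdot>\<^sub>v (C.V ^\<^sub>m 2 *\<^sub>v bb (Suc r)) + (- 1) \<cdot>\<^sub>v (C.V ^\<^sub>m 2 *\<^sub>v bb r)"
  proof -
    have "(- 1) \<cdot>\<^sub>v (u + v) + (- 1) \<cdot>\<^sub>v u = (- 2) \<cdot>\<^sub>v u + (- 1) \<cdot>\<^sub>v v" if "u \<in> carrier_vec N" "v \<in> carrier_vec N" for u v :: "'a vec"
      using that by (intro eq_vecI) auto
    then show ?thesis using c by blast
  qed
  finally show ?thesis .
qed

lemma bb_V_nz: "0 < L \<Longrightarrow> C.V ^\<^sub>m p *\<^sub>v bb (Suc 0) \<noteq> 0\<^sub>v N"
  using C.V_pow_nz[OF bb_carrier, of "Suc 0" p] star_a(1)[of 0] by (simp add: bb_def)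

text \<open>Where 2 is invertible the leading term of \<open>x2_a\<close> survives and the column
  carries a chain of \<open>2 L - 1\<close> vectors. In characteristic 2 only the term one step
  further down is left, and the chain is one shorter.\<close>

lemma column_nonzero:
  assumes L: "2 \<le> L" and e: "e = (if (2::'a) \<noteq> 0 then 2 else 3)"
  shows "C.x ^\<^sub>m (2 * L - e) *\<^sub>v unit_vec N (a 0) \<noteq> 0\<^sub>v N"
proof -
  note xc = C.cars'(3)
  obtain r where r: "Suc (Suc r) = L" using L le_Suc_ex[OF L] by auto
  have c: "C.V ^\<^sub>m p *\<^sub>v bb r \<in> carrier_vec N" for p r
    by (rule mult_mat_vec_carrier[OF pow_carrier_mat[OF C.cars(5)]]) simp
  have px: "C.x ^\<^sub>m m *\<^sub>v (s \<cdot>\<^sub>v (C.V ^\<^sub>m 2 *\<^sub>v bb (Suc r)) + s' \<cdot>\<^sub>v (C.V ^\<^sub>m 2 *\<^sub>v bb r))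
    = s \<cdot>\<^sub>v (C.x ^\<^sub>m m *\<^sub>v (C.V ^\<^sub>m 2 *\<^sub>v bb (Suc r))) + s' \<cdot>\<^sub>v (C.x ^\<^sub>m m *\<^sub>v (C.V ^\<^sub>m 2 *\<^sub>v bb r))" for m s s'
    using mult_add_distrib_mat_vec[OF pow_carrier_mat[OF xc], of "s \<cdot>\<^sub>v (C.V ^\<^sub>m 2 *\<^sub>v bb (Suc r))" "s' \<cdot>\<^sub>v (C.V ^\<^sub>m 2 *\<^sub>v bb r)" m]
      mult_mat_vec[OF pow_carrier_mat[OF xc] c] c by simp
  have p: "C.x ^\<^sub>m (m + (2 + r)) *\<^sub>v unit_vec N (a 0) = (- 2) \<cdot>\<^sub>v (C.x ^\<^sub>m m *\<^sub>v (C.V ^\<^sub>m 2 *\<^sub>v bb (Suc r))) + (- 1) \<cdot>\<^sub>v (C.x ^\<^sub>m m *\<^sub>v (C.V ^\<^sub>m 2 *\<^sub>v bb r))" for m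
    using mat_pow_vec[OF xc, of "unit_vec N (a 0)" m "2 + r"] mat_pow_vec[OF xc, of "unit_vec N (a 0)" 2 r]
      x_pow_a[of r] x2_a[OF r] r px[of m "- 2" "- 1"] by simp
  have nz: "s \<cdot>\<^sub>v u \<noteq> 0\<^sub>v N" if "s \<noteq> 0" "u \<in> carrier_vec N" "u \<noteq> 0\<^sub>v N" for s :: 'a and u
  proof
    assume "s \<cdot>\<^sub>v u = 0\<^sub>v N"
    then have "(s \<cdot>\<^sub>v u) $ i = 0" if "i < N" for i using that by simp
    then have "u = 0\<^sub>v N" using that by (intro eq_vecI) auto
    then show False using that by simp
  qed
  show ?thesis
  proof (cases "(2::'a) = 0")
    case False
    have el: "2 * L - e = r + (2 + r)" using False e r by auto
    have l: "r + 1 \<le> L" "r + 0 \<le> L" using r by auto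
    from x_pow_bb[OF l(1), of 2] obtain s where s: "s \<noteq> 0"
      "C.x ^\<^sub>m r *\<^sub>v (C.V ^\<^sub>m 2 *\<^sub>v bb (r + 1)) = s \<cdot>\<^sub>v (C.V ^\<^sub>m (2 + r) *\<^sub>v bb 1)" by blast
    from x_pow_bb[OF l(2), of 2] obtain s' where s':
      "C.x ^\<^sub>m r *\<^sub>v (C.V ^\<^sub>m 2 *\<^sub>v bb (r + 0)) = s' \<cdot>\<^sub>v (C.V ^\<^sub>m (2 + r) *\<^sub>v bb 0)" by blast
    have b0: "C.V ^\<^sub>m (2 + r) *\<^sub>v bb 0 = 0\<^sub>v N"
      unfolding bb_def nat.case using mat_vec_zero[OF pow_carrier_mat[OF C.cars(5)]] .
    define U where "U = C.V ^\<^sub>m (2 + r) *\<^sub>v bb 1"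
    have U: "U \<in> carrier_vec N" "U \<noteq> 0\<^sub>v N" unfolding U_def using c bb_V_nz L by (simp_all del: pow_mat.simps)
    have "C.x ^\<^sub>m (2 * L - e) *\<^sub>v unit_vec N (a 0) = (- 2) \<cdot>\<^sub>v (s \<cdot>\<^sub>v U) + (- 1) \<cdot>\<^sub>v (s' \<cdot>\<^sub>v 0\<^sub>v N)"
      unfolding el p U_def using s(2) s' b0 by (simp del: pow_mat.simps)
    also have "\<dots> = (- 2 * s) \<cdot>\<^sub>v U" using U by (intro eq_vecI) auto
    finally show ?thesis using nz[of "- 2 * s" U] U s(1) False by simp
  next
    case True
    show ?thesis
    proof (cases r)
      \<comment> \<open>For \<open>L = 2\<close> the surviving term is \<open>bb 0\<close>, which is
        zero. Here \<open>x\<close> applied once suffices: the result has coordinate 1 at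
        \<open>a 1\<close>, to which the part in the span of \<open>B\<close> does not
        contribute.\<close>
      case 0
      have "C.x ^\<^sub>m 1 *\<^sub>v unit_vec N (a 0) = unit_vec N (a (Suc 0)) + C.V *\<^sub>v bb L"
        using x_a(2)[of 0] r 0 xc by simp
      moreover have "unit_vec N (a (Suc 0)) + C.V *\<^sub>v bb L \<noteq> 0\<^sub>v N"
      proof -
        have a1: "a 1 < N" "a 1 \<in> H" using aT[of 1] L by auto
        have vb: "C.V *\<^sub>v bb L \<in> carrier_vec N" by (rule mult_mat_vec_carrier[OF C.cars(5)]) simp
        have "C.V *\<^sub>v bb L = C.V *\<^sub>v (pr N B *\<^sub>v bb L)" using bb_B[of L] by simp
        also have "\<dots> = (C.V * pr N B) *\<^sub>v bb L" by (rule assoc_mult_mat_vec[OF C.cars(5) pr_carrier, symmetric]) simp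
        also have "\<dots> = pr N B *\<^sub>v (C.V *\<^sub>v bb L)" unfolding C.pr_B(3)[symmetric]
          by (rule assoc_mult_mat_vec[OF pr_carrier C.cars(5)]) simp
        finally have "(C.V *\<^sub>v bb L) $ a 1 = (pr N B *\<^sub>v (C.V *\<^sub>v bb L)) $ a 1" by (rule arg_cong)
        also have "\<dots> = row (pr N B) (a 1) \<bullet> (C.V *\<^sub>v bb L)" by (rule index_mult_mat_vec) (use a1 in simp)
        also have "\<dots> = 0" unfolding scalar_prod_def
        proof (intro sum.neutral ballI)
          fix k assume "k \<in> {0..<dim_vec (C.V *\<^sub>v bb L)}"
          then have "k < N" using vb by auto
          then show "row (pr N B) (a 1) $ k * (C.V *\<^sub>v bb L) $ k = 0"
            using H_not_star[OF a1(2)] in_B[OF a1(1)] a1 by (auto simp: pr_def)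
        qed
        finally have "(C.V *\<^sub>v bb L) $ a 1 = 0" .
        then have "(unit_vec N (a (Suc 0)) + C.V *\<^sub>v bb L) $ a 1 \<noteq> 0"
          using index_add_vec(1)[of "a 1" "C.V *\<^sub>v bb L" "unit_vec N (a (Suc 0))"] carrier_vecD[OF vb] a1(1) by simp
        then show ?thesis using index_zero_vec(1)[OF a1(1), where 'a = 'a] by (auto simp del: index_add_vec)
      qed
      moreover have "2 * L - e = 1" using e True r 0 by auto
      ultimately show ?thesis by simp
    next
      case (Suc q)
      have el: "2 * L - e = q + (2 + r)" using True e r Suc by auto
      have l: "q + 1 \<le> L" using r Suc by auto
      from x_pow_bb[OF l, of 2] obtain s where s: "s \<noteq> 0"
        "C.x ^\<^sub>m q *\<^sub>v (C.V ^\<^sub>m 2 *\<^sub>v bb (q + 1)) = s \<cdot>\<^sub>v (C.V ^\<^sub>m (2 + q) *\<^sub>v bb 1)" by blast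
      define U where "U = C.V ^\<^sub>m (2 + q) *\<^sub>v bb 1"
      have U: "U \<in> carrier_vec N" "U \<noteq> 0\<^sub>v N" unfolding U_def using c bb_V_nz L by (simp_all del: pow_mat.simps)
      define U' where "U' = C.x ^\<^sub>m q *\<^sub>v (C.V ^\<^sub>m 2 *\<^sub>v bb (Suc r))"
      have U': "U' \<in> carrier_vec N" unfolding U'_def
        by (rule mult_mat_vec_carrier[OF pow_carrier_mat[OF xc] c])
      have z: "- 2 = (0::'a)" using True by simp
      have "C.x ^\<^sub>m (2 * L - e) *\<^sub>v unit_vec N (a 0) = (- 2) \<cdot>\<^sub>v U' + (- 1) \<cdot>\<^sub>v (s \<cdot>\<^sub>v U)"
        unfolding el p U_def U'_def using s(2) Suc by (simp del: pow_mat.simps)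
      also have "\<dots> = (- s) \<cdot>\<^sub>v U" unfolding z using U U' by (intro eq_vecI) auto
      finally show ?thesis using nz[of "- s" U] U s(1) by simp
    qed
  qed
qed

text \<open>The final constant is the number of vectors by which the chain falls short of the whole
  column; for \<open>L < 2\<close> the column has at most two vectors and \<open>k\<close> is at
  least 1.\<close>

lemma column_rank:
  assumes k: "1 \<le> k"
  shows "card T1 \<le> rk N (pr N T1 * C.x ^\<^sub>m k) + k + (if (2::'a) \<noteq> 0 then 1 else 2)"
proof (cases "2 \<le> L")
  case False
  then show ?thesis using card_T1 k by auto
next
  case True
  define X where "X = pr N T1 * C.x"
  have cm: "pr N T1 * C.x = C.x * pr N T1" by (rule C.commute_x(3)[OF pr_carrier]) (simp_all add: commT)
  have Xp: "X ^\<^sub>m Suc i = pr N T1 * C.x ^\<^sub>m Suc i" for i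
  proof (induction i)
    case 0
    then show ?case using C.cars'(3) by (simp add: X_def)
  next
    case (Suc i)
    have xc: "C.x ^\<^sub>m Suc i \<in> carrier_mat N N" by (rule pow_carrier_mat[OF C.cars'(3)])
    have pc: "pr N T1 * C.x ^\<^sub>m Suc i = C.x ^\<^sub>m Suc i * pr N T1"
      by (rule pow_mat_commute[symmetric, OF C.cars'(3) pr_carrier cm[symmetric]])
    have "X ^\<^sub>m Suc (Suc i) = X ^\<^sub>m Suc i * X" by (rule pow_mat.simps(2))
    also have "\<dots> = (C.x ^\<^sub>m Suc i * pr N T1) * (pr N T1 * C.x)" by (simp only: Suc pc) (simp only: X_def)
    also have "\<dots> = C.x ^\<^sub>m Suc i * ((pr N T1 * pr N T1) * C.x)" using xc C.cars'(3) by (simp add: mat_assoc del: pow_mat.simps)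
    also have "pr N T1 * pr N T1 = (pr N T1 :: 'a mat)" by (simp add: pr_mult)
    also have "C.x ^\<^sub>m Suc i * (pr N T1 * C.x) = (C.x ^\<^sub>m Suc i * pr N T1) * C.x" using xc C.cars'(3) by (simp add: mat_assoc del: pow_mat.simps)
    also have "\<dots> = pr N T1 * C.x ^\<^sub>m Suc (Suc i)" unfolding pc[symmetric] using xc C.cars'(3) by (simp add: mat_assoc)
    finally show ?case .
  qed
  let ?e = "if (2::'a) \<noteq> 0 then 2 else 3"
  have Xc: "X \<in> carrier_mat N N" using C.cars'(3) by (auto simp: X_def)
  have "raises N w X" unfolding raises_def
  proof (intro conjI allI impI Xc)
    fix i j assume ij: "i < N" "j < N" "w i \<le> w j"
    have "raises N w C.x" using C.wunip_v C.cars'(2) by (simp add: wunip_iff C.x_def)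
    then show "X $$ (i,j) = 0" unfolding X_def pr_mult_left_index[OF C.cars'(3) ij(1,2)] using raisesD(2) ij by auto
  qed
  then obtain K where K: "X ^\<^sub>m K = 0\<^sub>m N N" by (rule raises_nilpotent)
  have a0: "a 0 < N" "a 0 \<in> T1" using aT[of 0] True by auto
  have "X ^\<^sub>m (2 * L - ?e) \<noteq> 0\<^sub>m N N"
  proof
    assume z: "X ^\<^sub>m (2 * L - ?e) = 0\<^sub>m N N"
    have "0 < 2 * L - ?e" using True by auto
    then obtain i where i: "2 * L - ?e = Suc i" using gr0_implies_Suc by blast
    have pa: "pr N T1 *\<^sub>v unit_vec N (a 0) = (unit_vec N (a 0) :: 'a vec)"
      by (rule mat_unit_vec[OF pr_carrier]) (use a0 in \<open>auto simp: pr_def unit_vec_def\<close>)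
    have xc: "C.x ^\<^sub>m Suc i \<in> carrier_mat N N" by (rule pow_carrier_mat[OF C.cars'(3)])
    have "C.x ^\<^sub>m Suc i *\<^sub>v unit_vec N (a 0) = (C.x ^\<^sub>m Suc i * pr N T1) *\<^sub>v unit_vec N (a 0)"
      using assoc_mult_mat_vec[OF xc pr_carrier, of "unit_vec N (a 0)" T1] pa by simp
    also have "C.x ^\<^sub>m Suc i * pr N T1 = X ^\<^sub>m Suc i" unfolding Xp
      by (rule pow_mat_commute[OF C.cars'(3) pr_carrier cm[symmetric]])
    also have "\<dots> *\<^sub>v unit_vec N (a 0) = 0\<^sub>v N" using z i by (intro eq_vecI) (auto simp: scalar_prod_def)
    finally show False using column_nonzero[OF True refl] i by simp
  qed
  then have 1: "2 * L - ?e + 1 \<le> rk N (X ^\<^sub>m k) + k" by (rule rk_pow_nilpotent[OF Xc K])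
  have 2: "X ^\<^sub>m k = pr N T1 * C.x ^\<^sub>m k" using Xp[of "k - 1"] k by (simp del: pow_mat.simps)
  have "card T1 \<le> (2 * L - ?e + 1) + (if (2::'a) \<noteq> 0 then 1 else 2)" using card_T1 True by auto
  also have "\<dots> \<le> rk N (X ^\<^sub>m k) + k + (if (2::'a) \<noteq> 0 then 1 else 2)" by (rule add_right_mono[OF 1])
  finally show ?thesis unfolding 2 .
qed

end

section \<open>The linking matrix for each type\<close>

lemma two_nz: "CHAR('a::field) \<noteq> 2 \<Longrightarrow> (2::'a) \<noteq> 0"
proof
  assume c: "CHAR('a) \<noteq> 2" and z: "(2::'a) = 0"
  have "CHAR('a) dvd 2" using of_nat_eq_0_iff_char_dvd[where 'a = 'a, of 2] z by simp
  moreover from this have "CHAR('a) \<noteq> 0" by (metis dvd_0_left zero_neq_numeral)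
  ultimately have "CHAR('a) \<le> 2" "CHAR('a) \<noteq> 0" "CHAR('a) \<noteq> 1" using CHAR_not_1[where 'a = 'a] by (auto intro: dvd_imp_le)
  with c show False by linarith
qed

lemma two_zero: "CHAR('a::field) = 2 \<Longrightarrow> (2::'a) = 0"
  using of_nat_CHAR[where 'a = 'a] by simp

definition form_entry :: "cgroup \<Rightarrow> nat \<Rightarrow> nat \<Rightarrow> 'a::field" where
  "form_entry ty N i = (if ty = Spt then (if i < N div 2 then 1 else - 1) else if i = N - 1 - i then 2 else 1)"

lemma last_two_entries:
  fixes m r :: nat
  assumes "r < m"
  shows "(if 1 < m \<and> r = m - 2 \<and> P (m - 1) then 1 else if 1 < m \<and> r = m - 1 \<and> P (m - 2) then - 1 else 0)
    = (if Suc (Suc r) = m \<and> P (Suc r) then 1 else if 0 < r \<and> Suc r = m \<and> P (r - 1) then - 1 else (0::'a::ring_1))"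
proof -
  consider "m = Suc r" | "m = Suc (Suc r)" | "Suc (Suc r) < m" using assms by linarith
  then show ?thesis by cases (auto simp: numeral_2_eq_2)
qed

lemma if_neq_zeroD: "(if R then 0 else if X then c else if Y then d else 0) \<noteq> (0::'b::zero) \<Longrightarrow> \<not> R \<and> (X \<or> Y)"
  by (auto split: if_splits)

text \<open>The parameter \<open>two\<close> stands for the scalar 2 and at the same time fixes the
  coefficient field of the locale.\<close>

locale levels_type = levels_column N t w h a for N t w h a +
  fixes ty :: cgroup and two :: "'a::field"
  assumes two: "two = 2" and ty: "ty \<noteq> GLt" "ty = SOodd \<longleftrightarrow> odd N" "ty = SOeven \<Longrightarrow> even t" "odd N \<Longrightarrow> two \<noteq> 0"
begin

definition K :: "nat \<Rightarrow> nat \<Rightarrow> 'a" where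
  "K i j = (if mid i then (if ty = Spt then (if j = i then 1 else 0) else if odd N then (if j = N div 2 then 1 else if j = i then - 1 else 0) else 0)
    else if ty = Spt then 0
    else if odd N \<and> i = N div 2 then (if mid j then - two else 0)
    else if 1 < L \<and> i = a (L - 2) \<and> j = a (L - 1) then 1
    else if 1 < L \<and> i = a (L - 1) \<and> j = a (L - 2) then - 1 else 0)"

definition S where "S = mat N N (\<lambda>(l,i). K i (star l))"
abbreviation g where "g \<equiv> form_entry ty N :: nat \<Rightarrow> 'a"

lemma S_index: "l < N \<Longrightarrow> i < N \<Longrightarrow> S $$ (l,i) = K i (star l)"
  by (simp add: S_def)

lemma S_carrier: "S \<in> carrier_mat N N"
  by (simp add: S_def)

lemma mid_ctr: "odd N \<Longrightarrow> \<not> mid (N div 2)"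
  using ctr(6) by (auto simp: mid_def)

lemma K_cases:
  assumes "K i j \<noteq> 0"
  obtains (mm) "mid i" "j = i" "ty = Spt \<or> odd N"
  | (mc) "ty \<noteq> Spt" "odd N" "mid i" "j = N div 2" "K i j = 1"
  | (cm) "ty \<noteq> Spt" "odd N" "i = N div 2" "mid j" "K i j = - two"
  | (aa) r s where "ty \<noteq> Spt" "1 < L" "r < L" "s < L" "i = a r" "j = a s" "r \<noteq> s" "r = L - 2 \<and> s = L - 1 \<or> r = L - 1 \<and> s = L - 2"
proof (cases "mid i")
  case True
  have e: "K i j = (if ty = Spt then (if j = i then 1 else 0) else if odd N then (if j = N div 2 then 1 else if j = i then - 1 else 0) else 0)"
    unfolding K_def using True by simp
  consider "ty = Spt" | "ty \<noteq> Spt" "odd N" | "ty \<noteq> Spt" "even N" by blast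
  then show ?thesis
  proof cases
    case 1
    then have "j = i" using e assms by (auto split: if_splits)
    then show ?thesis using that(1) True 1 by blast
  next
    case 2
    then consider "j = N div 2" | "j = i" using e assms by (auto split: if_splits)
    then show ?thesis
    proof cases
      case 1
      then have "K i j = 1" using e 2 by simp
      then show ?thesis using that(2) True 2 1 by blast
    qed (use that(1) True 2 in blast)
  next
    case 3
    then show ?thesis using e assms by simp
  qed
next
  case False
  show ?thesis
  proof (cases "odd N \<and> i = N div 2")
    case True
    then show ?thesis using assms False that(3) by (auto simp: K_def split: if_splits)
  next
    case f: False
    have "(if ty = Spt then 0 else if 1 < L \<and> i = a (L - 2) \<and> j = a (L - 1) then 1
      else if 1 < L \<and> i = a (L - 1) \<and> j = a (L - 2) then - 1 else 0) \<noteq> (0::'a)"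
      using assms unfolding K_def if_not_P[OF False] if_not_P[OF f] .
    from if_neq_zeroD[OF this] consider "ty \<noteq> Spt" "1 < L" "i = a (L - 2)" "j = a (L - 1)" | "ty \<noteq> Spt" "1 < L" "i = a (L - 1)" "j = a (L - 2)"
      by blast
    then show ?thesis
    proof cases
      case 1
      then show ?thesis using that(4)[of "L - 2" "L - 1"] by auto
    next
      case 2
      then show ?thesis using that(4)[of "L - 1" "L - 2"] by auto
    qed
  qed
qed

lemma a_not_mid: "r < L \<Longrightarrow> \<not> mid (a r)" "r < L \<Longrightarrow> a r \<noteq> N div 2 \<or> even N" "r < L \<Longrightarrow> a r \<notin> T"
proof -
  show n: "a r \<notin> T" if "r < L" using aT(4)[OF that] by (simp add: T_def)
  show "\<not> mid (a r)" if "r < L" using n[OF that] mid_H(4) by blast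
  show "a r \<noteq> N div 2 \<or> even N" if "r < L" using n[OF that] ctr(4) by metis
qed

lemma K_props:
  assumes K: "K i j \<noteq> 0"
  shows "i < N" "j < N" "star i \<notin> H" "star j \<notin> H" "i \<in> T \<longleftrightarrow> j \<in> T" "i \<in> T1 \<longleftrightarrow> j \<in> T1" "w i + w j < 0"
proof -
  have TT1: "i \<in> T \<Longrightarrow> i \<notin> T1" for i by (auto simp: T_def T1_def)
  have "i < N \<and> j < N \<and> star i \<notin> H \<and> star j \<notin> H \<and> (i \<in> T \<longleftrightarrow> j \<in> T) \<and> (i \<in> T1 \<longleftrightarrow> j \<in> T1) \<and> w i + w j < 0"
    using K
  proof (cases rule: K_cases)
    case mm
    then show ?thesis using mid_H[of i] by simp
  next
    case mc
    then show ?thesis using mid_H[of i] ctr[OF mc(2)] TT1[of i] TT1[of "N div 2"] by simp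
  next
    case cm
    then show ?thesis using mid_H[of j] ctr[OF cm(2)] TT1[of j] TT1[of "N div 2"] by simp
  next
    case (aa r s)
    have le: "w (a r) \<le> 0" "w (a s) \<le> 0" using a_left[OF aa(3)] a_left[OF aa(4)] by (auto simp: left_def)
    have "Suc r < L \<or> Suc s < L" using aa(2,8) by auto
    then have "w (a r) + w (a s) < 0" using a_neg[of r] a_neg[of s] le by auto
    then show ?thesis using aT[OF aa(3)] aT[OF aa(4)] a_not_mid(3)[OF aa(3)] a_not_mid(3)[OF aa(4)] H_not_star[of "a r"] H_not_star[of "a s"]
      unfolding aa(5,6) by simp
  qed
  then show "i < N" "j < N" "star i \<notin> H" "star j \<notin> H" "i \<in> T \<longleftrightarrow> j \<in> T" "i \<in> T1 \<longleftrightarrow> j \<in> T1" "w i + w j < 0" by blast+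
qed

lemma star_neq: "i < N \<Longrightarrow> even N \<Longrightarrow> star i \<noteq> i"
  using star_fixed by blast

lemma g_facts:
  "i < N \<Longrightarrow> ty = Spt \<Longrightarrow> g (star i) = - g i"
  "i < N \<Longrightarrow> ty \<noteq> Spt \<Longrightarrow> g (star i) = g i"
  "i < N \<Longrightarrow> g i \<noteq> 0"
  "i < N \<Longrightarrow> ty \<noteq> Spt \<Longrightarrow> star i \<noteq> i \<Longrightarrow> g i = 1"
  "ty \<noteq> Spt \<Longrightarrow> odd N \<Longrightarrow> g (N div 2) = two"
proof -
  assume i: "i < N"
  show s: "g (star i) = - g i" if "ty = Spt"
  proof -
    have "even N" using ty(2) that by simp
    then have "star i < N div 2 \<longleftrightarrow> \<not> i < N div 2" using i unfolding star_def by (auto elim!: evenE)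
    then show ?thesis using that by (simp add: form_entry_def)
  qed
  show "g (star i) = g i" if "ty \<noteq> Spt"
  proof -
    have "star i = N - 1 - star i \<longleftrightarrow> i = N - 1 - i" using i unfolding star_def by linarith
    then show ?thesis using that by (simp add: form_entry_def)
  qed
  show "g i \<noteq> 0"
  proof (cases "star i = i")
    case True
    then have "odd N" using star_fixed[OF i] by simp
    then show ?thesis using ty(4) two by (simp add: form_entry_def)
  next
    case False
    then show ?thesis by (simp add: form_entry_def star_def)
  qed
  show "g i = 1" if "ty \<noteq> Spt" "star i \<noteq> i" using that by (simp add: form_entry_def star_def)
next
  assume "ty \<noteq> Spt" "odd N"
  then show "g (N div 2) = two" using ctr(2) by (simp add: form_entry_def star_def two)
qed

text \<open>The rows of \<open>S\<close> avoid \<open>H\<close>, which meets every dual pair off the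
  centre; so the quadratic term survives only at the centre.\<close>

lemma K_sum:
  assumes ij: "i < N" "j < N"
  shows "(\<Sum>k<N. S $$ (k,i) * (g k * S $$ (N - 1 - k, j))) = (if odd N \<and> mid i \<and> mid j then two else 0)"
proof -
  have z: "S $$ (k,i) * (g k * S $$ (star k, j)) = 0" if k: "k < N" "star k \<noteq> k" for k
  proof (cases "S $$ (k,i) = 0 \<or> S $$ (star k, j) = 0")
    case False
    then have "K i (star k) \<noteq> 0" "K j (star (star k)) \<noteq> 0" using S_index[OF k(1) ij(1)] S_index[OF star(1)[OF k(1)] ij(2)] by auto
    then have "star (star k) \<notin> H" "star (star (star k)) \<notin> H" using K_props(4) by blast+
    then show ?thesis using star(2)[OF k(1)] H_star[OF k] by simp
  qed auto
  show ?thesis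
  proof (cases "odd N")
    case False
    then show ?thesis using z star_neq unfolding star_def by (auto intro!: sum.neutral)
  next
    case True
    note c = ctr[OF True]
    have tyS: "ty \<noteq> Spt" using ty(2) True by auto
    have Kc: "K i (N div 2) = (if mid i then 1 else 0)" if "i < N" for i
    proof (cases "mid i")
      case False
      have "K i (N div 2) = 0"
      proof (rule ccontr)
        assume "K i (N div 2) \<noteq> 0"
        then show False
          using False mid_ctr[OF True] True a_not_mid(2) by (cases rule: K_cases) auto
      qed
      then show ?thesis using False by simp
    qed (use tyS True in \<open>simp add: K_def\<close>)
    have "(\<Sum>k<N. S $$ (k,i) * (g k * S $$ (star k, j))) = (\<Sum>k<N. if k = N div 2 then S $$ (k,i) * (g k * S $$ (star k, j)) else 0)"
    proof (rule sum.cong[OF refl])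
      fix k assume "k \<in> {..<N}"
      then have k: "k < N" by simp
      show "S $$ (k,i) * (g k * S $$ (star k, j)) = (if k = N div 2 then S $$ (k,i) * (g k * S $$ (star k, j)) else 0)"
      proof (cases "k = N div 2")
        case ne: False
        then have "star k \<noteq> k" using star_fixed[OF k] by blast
        from z[OF k this] show ?thesis using ne by (simp only: if_False)
      qed simp
    qed
    also have "\<dots> = S $$ (N div 2,i) * (g (N div 2) * S $$ (star (N div 2), j))" using c(1) by simp
    also have "\<dots> = (if odd N \<and> mid i \<and> mid j then two else 0)"
      unfolding c(2) S_index[OF c(1) ij(1)] S_index[OF c(1) ij(2)] g_facts(5)[OF tyS True] Kc[OF ij(1)] Kc[OF ij(2)]
      using True by simp
    finally show ?thesis by (simp add: star_def)
  qed
qed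

text \<open>For symplectic groups \<open>K\<close> is symmetric and the sign change of the form
  cancels the linear terms. For orthogonal groups \<open>K\<close> is skew away from the centre, and
  there the quadratic term compensates.\<close>

lemma S_form:
  assumes ij: "i < N" "j < N"
  shows "S $$ (N - 1 - j, i) * g (N - 1 - j) + g i * S $$ (N - 1 - i, j)
      + (\<Sum>k<N. S $$ (k,i) * (g k * S $$ (N - 1 - k, j))) = 0"
proof -
  have e: "S $$ (star j, i) = K i j" "S $$ (star i, j) = K j i"
    using S_index star ij by auto
  have "K i j * g (star j) + g i * K j i + (if odd N \<and> mid i \<and> mid j then two else 0) = 0"
  proof (cases "ty = Spt")
    case True
    then have N: "even N" using ty(2) by auto
    have Ks: "K i j = (if mid i \<and> j = i then 1 else 0)" for i j unfolding K_def using True by simp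
    show ?thesis unfolding Ks using N g_facts(1)[OF ij(2) True] by auto
  next
    case nS: False
    note gs = g_facts(2)[OF ij(2) nS]
    show ?thesis
    proof (cases "K i j = 0 \<and> K j i = 0")
      case z: True
      have "\<not> (odd N \<and> mid i \<and> mid j)"
      proof
        assume a: "odd N \<and> mid i \<and> mid j"
        then have "i = j" using mid_unique by blast
        then have "K i j = - 1" using a nS mid_ctr by (auto simp: K_def)
        then show False using z by simp
      qed
      then have "(if odd N \<and> mid i \<and> mid j then two else 0) = 0" by (rule if_not_P)
      then show ?thesis using z by (simp only:) simp
    next
      case False
      have main: "K i j * g j + g i * K j i + (if odd N \<and> mid i \<and> mid j then two else 0) = 0"
        if k: "K i j \<noteq> 0" and ij: "i < N" "j < N" for i j
        using k
      proof (cases rule: K_cases)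
        case mm
        then have N: "odd N" using nS by simp
        have "star i \<noteq> i" using mid_H[OF mm(1)] by auto
        then have "g i = 1" using g_facts(4)[OF ij(1) nS] by simp
        moreover have "K i i = - 1" using mm N nS mid_ctr[OF N] by (auto simp: K_def)
        ultimately show ?thesis using mm N two by simp
      next
        case mc
        have "star i \<noteq> i" using mid_H[OF mc(3)] by auto
        then have "g i = 1" using g_facts(4)[OF ij(1) nS] by simp
        moreover have "K j i = - two" using mc mid_ctr[OF mc(2)] by (simp add: K_def)
        ultimately show ?thesis using mc g_facts(5)[OF nS mc(2)] mid_ctr[OF mc(2)] by simp
      next
        case cm
        have "star j \<noteq> j" using mid_H[OF cm(4)] by auto
        then have "g j = 1" using g_facts(4)[OF ij(2) nS] by simp
        moreover have "K j i = 1" using cm by (simp add: K_def)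
        ultimately show ?thesis using cm g_facts(5)[OF nS cm(2)] mid_ctr[OF cm(2)] by simp
      next
        case (aa r s)
        have "star i \<noteq> i" "star j \<noteq> j" using aT(2)[OF aa(3)] aT(2)[OF aa(4)] H_not_star aa(5,6) by metis+
        then have g1: "g i = 1" "g j = 1" using g_facts(4) ij nS by auto
        have nm: "\<not> mid i" "\<not> mid j" "\<not> (odd N \<and> i = N div 2)" "\<not> (odd N \<and> j = N div 2)"
          using a_not_mid aa by auto
        have ne: "a (L - 1) \<noteq> a (L - 2)" using a_inj[of "L - 1" "L - 2"] aa(2) by auto
        have "K i j + K j i = 0" using aa(8)
        proof
          assume "r = L - 2 \<and> s = L - 1"
          then have "i = a (L - 2)" "j = a (L - 1)" using aa(5,6) by auto
          then show ?thesis using nm aa(1,2) ne by (simp add: K_def)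
        next
          assume "r = L - 1 \<and> s = L - 2"
          then have "i = a (L - 1)" "j = a (L - 2)" using aa(5,6) by auto
          then show ?thesis using nm aa(1,2) ne by (simp add: K_def)
        qed
        then show ?thesis using g1 nm by simp
      qed
      show ?thesis
      proof (cases "K i j = 0")
        case True
        then have "K j i * g i + g j * K i j + (if odd N \<and> mid j \<and> mid i then two else 0) = 0" using False main ij by blast
        then show ?thesis unfolding gs by (simp add: algebra_simps conj_commute)
      qed (use main ij gs in auto)
    qed
  qed
  then show ?thesis unfolding K_sum[OF ij] using e by (simp add: star_def)
qed

sublocale F: levels_form N t w h g S
proof unfold_locales
  show "(\<forall>i<N. g (star i) = g i) \<or> (\<forall>i<N. g (star i) = - g i)" using g_facts(1,2) by (cases "ty = Spt") auto
  have inB: "i \<in> star ` H \<Longrightarrow> star i \<in> H" for i using star(2) H_lt by fastforce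
  show "supp_in N (- H) (- (star ` H)) S" unfolding supp_in_def
  proof (intro conjI allI impI S_carrier)
    fix l i assume li: "l < N" "i < N" "S $$ (l,i) \<noteq> 0"
    then have "K i (star l) \<noteq> 0" using S_index by simp
    from K_props(3,4)[OF this] show "l \<in> - H" "i \<in> - (star ` H)" using star(2)[OF li(1)] inB by auto
  qed
  show "raises N w S" unfolding raises_def
  proof (intro conjI allI impI S_carrier)
    fix l i assume li: "l < N" "i < N" "w l \<le> w i"
    show "S $$ (l,i) = 0"
    proof (rule ccontr)
      assume "S $$ (l,i) \<noteq> 0"
      then have "K i (star l) \<noteq> 0" using S_index li by simp
      from K_props(7)[OF this] show False using star(3)[OF li(1)] li(3) by simp
    qed
  qed
  show "transpose_mat (1\<^sub>m N + S) * adiag N g * (1\<^sub>m N + S) = adiag N g"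
    by (rule iso_one_plus[OF S_carrier S_form])
  show "(l \<in> T \<longleftrightarrow> i \<in> T) \<and> (l \<in> T1 \<longleftrightarrow> i \<in> T1)" if li: "l < N" "i < N" "S $$ (l,i) \<noteq> 0" for l i
  proof -
    have "K i (star l) \<noteq> 0" using S_index li by simp
    from K_props(5,6)[OF this] show ?thesis using T_star[OF li(1)] by simp
  qed
  show "S $$ (nxt i, i) \<noteq> 0" if i: "i \<in> nonterm" and mx: "\<not> (i \<in> H \<and> nxt i \<in> H)" "\<not> (star i \<in> H \<and> star (nxt i) \<in> H)" for i
  proof -
    have N: "i < N" "nxt i < N" using i nxt(1)[OF i] by (auto simp: nonterm_def T_def)
    have "K i (star (nxt i)) \<noteq> 0"
    proof (cases "odd N")
      case False
      then have m: "mid i" using mixed(1)[OF i mx] by simp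
      then have "2 * lab i + 1 = t" by (simp add: mid_def)
      moreover have "odd (2 * lab i + 1)" by simp
      ultimately have "odd t" by (rule subst)
      then have tS: "ty = Spt" using ty False by (cases ty) auto
      have "star (nxt i) = i" using mid_nxt_even(2)[OF m] False star(2)[OF N(1)] by simp
      then show ?thesis unfolding K_def using m tS by simp
    next
      case True
      then have tS: "ty \<noteq> Spt" using ty(2) by auto
      from mixed(2)[OF i mx True] show ?thesis
      proof
        assume m: "mid i"
        then show ?thesis using mid_nxt_odd(2)[OF m True] ctr(2)[OF True] True tS by (simp add: K_def)
      next
        assume "i = N div 2 \<and> mid (star (nxt i))"
        then have m: "i = N div 2" "mid (star (nxt i))" by auto
        have "\<not> mid i" unfolding m(1) by (rule mid_ctr[OF True])
        then have "K i (star (nxt i)) = - two" unfolding K_def using m True tS by (simp only: if_True if_False simp_thms)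
        then show ?thesis using ty(4)[OF True] by simp
      qed
    qed
    then show ?thesis using S_index[OF N(2,1)] by simp
  qed
  show "w i' < w i" if i: "i \<in> nonterm" "i' \<in> nonterm" "i' \<noteq> i" "S $$ (nxt i, i') \<noteq> 0" for i i'
  proof -
    have N: "i' < N" "nxt i < N" "i' \<in> T" using i nxt(1)[OF i(1)] by (auto simp: nonterm_def T_def)
    have "K i' (star (nxt i)) \<noteq> 0" using S_index[OF N(2,1)] i(4) by simp
    then show ?thesis
    proof (cases rule: K_cases)
      case mm
      then have n: "nxt i = star i'" using star(2)[OF N(2)] by simp
      show ?thesis
      proof (cases "odd N")
        case True
        then have "i = N div 2" using mid_nxt_odd(3,4)[OF mm(1) True] n nxt_inj[OF i(1)] by simp
        then show ?thesis using ctr(6)[OF True] mid_H(6)[OF mm(1)] by simp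
      next
        case False
        then have "nxt i' = nxt i" using mid_nxt_even(2)[OF mm(1)] n by simp
        then show ?thesis using nxt_inj[OF i(2,1)] i(3) by simp
      qed
    next
      case mc
      then have "nxt i = N div 2" using star(2)[OF N(2)] ctr(2)[OF mc(2)] by simp
      then have "nxt i' = nxt i" using mid_nxt_odd(2)[OF mc(3,2)] by simp
      then show ?thesis using nxt_inj[OF i(2,1)] i(3) by simp
    next
      case cm
      have "nxt i = star (star (nxt i))" using star(2)[OF N(2)] by simp
      also have "\<dots> = nxt (N div 2)" using mid_nxt_odd(4)[OF cm(4,2)] by simp
      finally show ?thesis using nxt_inj[OF i(1,2)] cm(3) i(3) by simp
    next
      case (aa r s)
      then show ?thesis using a_not_mid(3)[OF aa(3)] N(3) by simp
    qed
  qed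
qed (use g_facts(3) in auto)

lemma column_bound:
  assumes nS: "ty \<noteq> Spt" and k: "1 \<le> k"
  shows "card T1 \<le> rk N (pr N T1 * F.C.x ^\<^sub>m k) + k + (if (2::'a) \<noteq> 0 then 1 else 2)"
proof -
  interpret CF: column_form N t w h g S a
  proof unfold_locales
    show "g i = 1" if "i \<in> T1" for i
    proof -
      have "i < N" "i \<notin> T" using that by (auto simp: T1_def T_def)
      moreover from this have "star i \<noteq> i" using star_fixed ctr(4) by blast
      ultimately show ?thesis using g_facts(4) nS by blast
    qed
    show "S $$ (l, a r) = (if Suc (Suc r) = L \<and> l = star (a (Suc r)) then 1 else if 0 < r \<and> Suc r = L \<and> l = star (a (r - 1)) then - 1 else 0)"
      if lr: "l < N" "r < L" for l r
    proof -
      have sl: "star l = a s \<longleftrightarrow> l = star (a s)" if "s < L" for s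
        using star(2)[OF lr(1)] star(2)[OF aT(3)[OF that]] by metis
      have e: "1 < L \<Longrightarrow> a r = a (L - 2) \<longleftrightarrow> r = L - 2" "1 < L \<Longrightarrow> a r = a (L - 1) \<longleftrightarrow> r = L - 1"
        by (rule a_inj[OF lr(2)]; simp)+
      have sl2: "1 < L \<Longrightarrow> star l = a (L - 1) \<longleftrightarrow> l = star (a (L - 1))" "1 < L \<Longrightarrow> star l = a (L - 2) \<longleftrightarrow> l = star (a (L - 2))"
        by (rule sl; simp)+
      have nc: "\<not> (odd N \<and> a r = N div 2)" using a_not_mid(2)[OF lr(2)] by blast
      have "S $$ (l, a r) = K (a r) (star l)" using S_index lr aT(3) by simp
      also have "\<dots> = (if 1 < L \<and> a r = a (L - 2) \<and> star l = a (L - 1) then 1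
        else if 1 < L \<and> a r = a (L - 1) \<and> star l = a (L - 2) then - 1 else 0)"
        unfolding K_def if_not_P[OF a_not_mid(1)[OF lr(2)]] if_not_P[OF nS] if_not_P[OF nc] ..
      also have "1 < L \<and> a r = a (L - 2) \<and> star l = a (L - 1) \<longleftrightarrow> 1 < L \<and> r = L - 2 \<and> l = star (a (L - 1))"
        using e(1) sl2(1) by blast
      also have "1 < L \<and> a r = a (L - 1) \<and> star l = a (L - 2) \<longleftrightarrow> 1 < L \<and> r = L - 1 \<and> l = star (a (L - 2))"
        using e(2) sl2(2) by blast
      also note last_two_entries[OF lr(2), of "\<lambda>s. l = star (a s)"]
      finally show ?thesis .
    qed
  qed
  show ?thesis by (rule CF.column_rank[OF k])
qed

end

section \<open>Quadratic forms\<close>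

lemma qform_two:
  assumes a: "a \<in> carrier_vec N"
  shows "2 * qform N a = a \<bullet> (Gq N *\<^sub>v (a :: 'a::field vec))"
proof -
  have s: "(a + a) $ i = 2 * a $ i" if "i < N" for i using a that by simp
  have "qform N (a + a) = 4 * qform N a"
    unfolding qform_def distrib_left sum_distrib_left
  proof (rule arg_cong2[where f = "(+)"])
    show "(\<Sum>i<N div 2. (a + a) $ i * (a + a) $ (N - 1 - i)) = (\<Sum>i<N div 2. 4 * (a $ i * a $ (N - 1 - i)))"
      by (rule sum.cong) (use s in auto)
    show "(if odd N then ((a + a) $ (N div 2))\<^sup>2 else 0) = 4 * (if odd N then (a $ (N div 2))\<^sup>2 else 0)"
    proof (cases "odd N")
      case True
      then have "N div 2 < N" by (auto elim: oddE)
      then show ?thesis using True s[of "N div 2"] by (simp add: power_mult_distrib)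
    qed simp
  qed
  then show ?thesis unfolding qform_polar[OF a a] by (simp add: algebra_simps)
qed

lemma isometry_qform:
  fixes v :: "'a::field mat"
  assumes two: "(2::'a) \<noteq> 0" and v: "v \<in> carrier_mat N N" "transpose_mat v * Gq N * v = Gq N" and a: "a \<in> carrier_vec N"
  shows "qform N (v *\<^sub>v a) = qform N a"
proof -
  have G: "Gq N \<in> carrier_mat N N" by (simp add: Gq_def)
  have va: "v *\<^sub>v a \<in> carrier_vec N" by (rule mult_mat_vec_carrier[OF v(1) a])
  have "2 * qform N (v *\<^sub>v a) = a \<bullet> (transpose_mat v * Gq N * v *\<^sub>v a)"
    unfolding qform_two[OF va] by (rule vec_transpose_form[OF v(1) G a a])
  also have "\<dots> = 2 * qform N a" unfolding v(2) qform_two[OF a] ..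
  finally show ?thesis using two by simp
qed

lemma mat_entry_form:
  assumes "M \<in> carrier_mat n n" "i < n" "j < n"
  shows "unit_vec n i \<bullet> (M *\<^sub>v unit_vec n j) = (M $$ (i,j) :: 'a::field)"
proof -
  have "unit_vec n i \<bullet> (M *\<^sub>v unit_vec n j) = (M *\<^sub>v unit_vec n j) $ i"
    by (rule scalar_prod_left_unit[OF _ assms(2)]) (use assms in \<open>auto intro: carrier_vecI\<close>)
  also have "\<dots> = row M i \<bullet> unit_vec n j" using assms by simp
  also have "\<dots> = row M i $ j" by (rule scalar_prod_right_unit) (use assms in auto)
  finally show ?thesis using assms by simp
qed

text \<open>Preserving the polar form does not imply preserving \<open>q\<close> in characteristic
  2. With \<open>U\<close> chosen so that \<open>q(b)\<close> is the value of \<open>U\<close> at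
  \<open>(b,b)\<close>, invariance of the polar form makes \<open>?W - U\<close> skew, and singular
  columns make its diagonal zero, so it is alternating.\<close>

lemma isometry_qform_columns:
  fixes v :: "'a::field mat"
  assumes N: "even N" and v: "v \<in> carrier_mat N N" "transpose_mat v * Gq N * v = Gq N"
    and c: "\<And>i. i < N \<Longrightarrow> qform N (col v i) = 0" and a: "a \<in> carrier_vec N"
  shows "qform N (v *\<^sub>v a) = qform N a"
proof -
  define U :: "'a mat" where "U = adiag N (\<lambda>i. if i < N div 2 then 1 else 0)"
  have U: "U \<in> carrier_mat N N" by (simp add: U_def)
  have ni: "i < N \<Longrightarrow> i \<noteq> N - 1 - i" "i < N \<Longrightarrow> N - 1 - i < N div 2 \<longleftrightarrow> \<not> i < N div 2" for i
    using N by (presburger, auto elim!: evenE)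
  have q: "qform N b = b \<bullet> (U *\<^sub>v b)" if b: "b \<in> carrier_vec N" for b
  proof -
    have "b \<bullet> (U *\<^sub>v b) = (\<Sum>i<N div 2. b $ i * b $ (N - 1 - i))"
      unfolding U_def adiag_form[OF b b] sum_fold_halves[of _ N] using N ni(2) by (auto intro!: sum.cong)
    then show ?thesis using N by (simp add: qform_def)
  qed
  have UT: "transpose_mat U \<in> carrier_mat N N" using U by simp
  have UU: "U + transpose_mat U = Gq N" unfolding U_def adiag_transpose Gq_def
  proof (rule eq_matI)
    fix i j assume "i < dim_row (adiag N (\<lambda>i. if i = N - 1 - i then 2 else 1) :: 'a mat)" "j < dim_col (adiag N (\<lambda>i. if i = N - 1 - i then 2 else 1) :: 'a mat)"
    then have "i < N" "j < N" by auto
    then show "(adiag N (\<lambda>i. if i < N div 2 then 1 else 0) + adiag N (\<lambda>i. if N - 1 - i < N div 2 then 1 else 0)) $$ (i,j)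
      = (adiag N (\<lambda>i. if i = N - 1 - i then 2 else 1) $$ (i,j) :: 'a)"
      using ni[of i] by (auto simp: adiag_def)
  qed auto
  let ?W = "transpose_mat v * U * v"
  note [simp] = carrier_matD[OF v(1)] carrier_matD[OF U]
  have W: "?W \<in> carrier_mat N N" by (rule carrier_matI; simp)
  have WT: "transpose_mat ?W = transpose_mat v * (transpose_mat U * v)"
  proof -
    have "transpose_mat ?W = transpose_mat v * transpose_mat (transpose_mat v * U)"
      by (rule transpose_mult[of _ N N _ N]) (use v in \<open>auto intro!: carrier_matI\<close>)
    also have "transpose_mat (transpose_mat v * U) = transpose_mat U * v"
      using transpose_mult[of "transpose_mat v" N N U N] v U by simp
    finally show ?thesis .
  qed
  have sum: "?W + transpose_mat ?W = U + transpose_mat U"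
  proof -
    have "?W + transpose_mat ?W = transpose_mat v * ((U + transpose_mat U) * v)"
      unfolding WT by (simp add: mat_add_distrib mat_assoc)
    then show ?thesis unfolding UU using v(2) by (simp add: mat_assoc Gq_def)
  qed
  have M: "?W - U \<in> carrier_mat N N" by (rule carrier_matI; simp)
  have "alt_mat N (?W - U)" unfolding alt_mat_def
  proof (intro conjI allI impI M)
    fix i assume i: "i < N"
    have ve: "v *\<^sub>v unit_vec N i = col v i" using v(1) i by (intro eq_vecI) (auto simp: scalar_prod_right_unit[of _ N])
    have "?W $$ (i,i) = (v *\<^sub>v unit_vec N i) \<bullet> (U *\<^sub>v (v *\<^sub>v unit_vec N i))"
      unfolding mat_entry_form[OF W i i, symmetric] by (rule vec_transpose_form[OF v(1) U, symmetric]) simp_all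
    also have "\<dots> = 0" unfolding ve q[symmetric, OF col_carrier_vec[OF i v(1)]] using c[OF i] .
    finally have "?W $$ (i,i) = 0" .
    moreover have "U $$ (i,i) = 0" using i ni(1)[of i] by (simp add: U_def adiag_def)
    moreover have "(?W - U) $$ (i,i) = ?W $$ (i,i) - U $$ (i,i)" using i by (intro index_minus_mat) simp_all
    ultimately show "(?W - U) $$ (i,i) = 0" by simp
  next
    fix i j assume ij: "i < N" "j < N"
    have "(?W + transpose_mat ?W) $$ (i,j) = (U + transpose_mat U) $$ (i,j)" using sum by simp
    then have "?W $$ (i,j) + ?W $$ (j,i) = U $$ (i,j) + U $$ (j,i)" using ij by (simp del: index_mult_mat(1))
    moreover have "(?W - U) $$ (i,j) = ?W $$ (i,j) - U $$ (i,j)" "(?W - U) $$ (j,i) = ?W $$ (j,i) - U $$ (j,i)" using ij by simp_all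
    ultimately show "(?W - U) $$ (i,j) = - (?W - U) $$ (j,i)"
      unfolding eq_neg_iff_add_eq_0 by (simp only: add_diff_add[symmetric] diff_self)
  qed
  then have "a \<bullet> ((?W - U) *\<^sub>v a) = 0" by (rule alt_mat_quad[OF _ a])
  moreover have "(?W - U) *\<^sub>v a = ?W *\<^sub>v a - U *\<^sub>v a" by (rule minus_mult_distrib_mat_vec[OF W U a])
  moreover have "a \<bullet> (?W *\<^sub>v a - U *\<^sub>v a) = a \<bullet> (?W *\<^sub>v a) - a \<bullet> (U *\<^sub>v a)"
    by (rule scalar_prod_minus_distrib[OF a]) (rule mult_mat_vec_carrier[OF W a], rule mult_mat_vec_carrier[OF U a])
  moreover have "a \<bullet> (?W *\<^sub>v a) = qform N (v *\<^sub>v a)"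
    unfolding q[OF mult_mat_vec_carrier[OF v(1) a]] by (rule vec_transpose_form[OF v(1) U a a, symmetric])
  ultimately show ?thesis using q[OF a] by simp
qed

lemma qform_isotropic:
  assumes "even N" "\<And>r. r < N \<Longrightarrow> c $ r = 0 \<or> c $ (N - 1 - r) = 0"
  shows "qform N c = 0"
  unfolding qform_def using assms by (auto intro!: sum.neutral)

context levels_type
begin

lemma g_SO: "ty \<noteq> Spt \<Longrightarrow> adiag N g = Gq N"
  unfolding Gq_def by (rule arg_cong[of _ _ "adiag N"]) (simp add: form_entry_def fun_eq_iff)

lemma K_even:
  assumes "ty = SOeven"
  shows "K i i = 0" "i < N \<Longrightarrow> j < N \<Longrightarrow> K i j = - K j i"
proof -
  have N: "even N" "ty \<noteq> Spt" using assms ty(2) by auto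
  show "K i i = 0"
  proof (rule ccontr)
    assume "K i i \<noteq> 0"
    then show False
    proof (cases rule: K_cases)
      case (aa r s)
      then show False using a_inj[OF aa(3,4)] by simp
    qed (use N in auto)
  qed
  assume ij: "i < N" "j < N"
  have "K i j * g (star j) + g i * K j i = 0"
    using S_form[OF ij] S_index[OF star(1)[OF ij(2)] ij(1)] S_index[OF star(1)[OF ij(1)] ij(2)] star(2) ij K_sum[OF ij] N by (simp add: star_def)
  moreover have "g (star j) = 1" "g i = 1" using g_facts(2,4) star_neq N ij by auto
  ultimately show "K i j = - K j i" by (simp add: eq_neg_iff_add_eq_0)
qed

text \<open>Each column of \<open>D\<close> is supported in \<open>H\<close> or in its complement,
  and both contain exactly one vector of every dual pair.\<close>

lemma D_columns:
  assumes "even N" "i < N"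
  shows "qform N (col F.C.D i) = 0"
proof (rule qform_isotropic[OF assms(1)])
  fix r assume r: "r < N"
  have e: "F.C.D $$ (r,i) = 0 \<or> (r \<in> H \<longleftrightarrow> i \<in> H)" if "r < N" for r
  proof -
    have "(pr N H * F.C.D) $$ (r,i) = (F.C.D * pr N H) $$ (r,i)" unfolding F.C.commute_A ..
    then show ?thesis
      unfolding pr_mult_left_index[OF F.C.cars'(1) that assms(2)] pr_mult_right_index[OF F.C.cars'(1) that assms(2)] by (auto split: if_splits)
  qed
  have "star r \<in> H \<longleftrightarrow> r \<notin> H" by (rule H_star[OF r star_neq[OF r assms(1)]])
  then have "F.C.D $$ (r,i) = 0 \<or> F.C.D $$ (star r,i) = 0" using e[OF r] e[OF star(1)[OF r]] by blast
  then show "col F.C.D i $ r = 0 \<or> col F.C.D i $ (N - 1 - r) = 0"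
    using r assms(2) star(1)[OF r] by (simp add: star_def)
qed

text \<open>The entries of \<open>S\<close> avoid \<open>H\<close>, so they fill no dual pair alone;
  and \<open>K i i = 0\<close> keeps the dual of \<open>e_i\<close> out of column
  \<open>i\<close>.\<close>

lemma S_columns:
  assumes "ty = SOeven" "i < N"
  shows "qform N (col (1\<^sub>m N + S) i) = 0"
proof (rule qform_isotropic)
  show N: "even N" using assms ty(2) by auto
  fix r assume r: "r < N"
  have e: "(1\<^sub>m N + S) $$ (r,i) = (if r = i then 1 else 0) + K i (star r)" if "r < N" for r
    using S_index[OF that assms(2)] S_carrier that assms(2) by simp
  have sr: "star r < N" "star (star r) = r" using star r by auto
  have "(1\<^sub>m N + S) $$ (r,i) = 0 \<or> (1\<^sub>m N + S) $$ (star r,i) = 0"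
  proof (rule ccontr)
    assume "\<not> ?thesis"
    then have nz: "r = i \<or> K i (star r) \<noteq> 0" "star r = i \<or> K i r \<noteq> 0" unfolding e[OF r] e[OF sr(1)] sr(2) by auto
    have "r \<noteq> star r" using star_neq[OF r N] by auto
    then have "K i (star r) \<noteq> 0 \<and> K i r \<noteq> 0" using nz K_even(1)[OF assms(1)] by auto
    then have "star (star r) \<notin> H" "star r \<notin> H" using K_props(4) by blast+
    then show False using H_star[OF r star_neq[OF r N]] sr(2) by simp
  qed
  then show "col (1\<^sub>m N + S) i $ r = 0 \<or> col (1\<^sub>m N + S) i $ (N - 1 - r) = 0"
    using r assms(2) sr(1) S_carrier by (simp add: star_def)
qed

text \<open>In characteristic 2 the factors \<open>D\<close> and \<open>1 + S\<close> are checked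
  one after the other, because singularity of the columns is visible for each of them but not for
  the product.\<close>

lemma v_qform:
  assumes "ty \<noteq> Spt" and b: "b \<in> carrier_vec N"
  shows "qform N (F.C.v *\<^sub>v b) = qform N b"
proof (cases "(2::'a) = 0")
  case False
  then show ?thesis using isometry_qform[OF False F.C.cars'(2) _ b] F.C.iso_v unfolding g_SO[OF assms(1)] by blast
next
  case True
  then have t: "ty = SOeven" using assms ty two by (cases ty) auto
  then have N: "even N" using ty(2) by auto
  have Sc: "1\<^sub>m N + S \<in> carrier_mat N N" using S_carrier by auto
  have sa: "(1\<^sub>m N + S) *\<^sub>v b \<in> carrier_vec N" by (rule mult_mat_vec_carrier[OF Sc b])
  have "F.C.v *\<^sub>v b = F.C.D *\<^sub>v ((1\<^sub>m N + S) *\<^sub>v b)" unfolding F.C.v_def by (rule assoc_mult_mat_vec[OF F.C.cars'(1) Sc b])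
  also have "qform N \<dots> = qform N ((1\<^sub>m N + S) *\<^sub>v b)"
    by (rule isometry_qform_columns[OF N F.C.cars'(1) _ D_columns[OF N] sa]) (use F.C.iso_D g_SO[OF assms(1)] in simp_all)
  also have "\<dots> = qform N b"
    by (rule isometry_qform_columns[OF N Sc _ S_columns[OF t] b]) (use F.Siso g_SO[OF assms(1)] in simp_all)
  finally show ?thesis .
qed

text \<open>This is the vanishing of the Dickson invariant: \<open>x\<close> has the rank of the
  form matrix of \<open>y\<close>, which is alternating because \<open>Y - Z\<close> and
  \<open>S\<close> are skew with respect to the form.\<close>

lemma even_rk_x:
  assumes t: "ty = SOeven"
  shows "even (rk N F.C.x)"
proof -
  have N: "even N" "ty \<noteq> Spt" using t ty(2) by auto
  have g1: "g i = 1" if "i < N" for i using g_facts(4)[OF that N(2) star_neq[OF that N(1)]] .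
  have "rk N F.C.x = rk N F.C.y" using F.C.rk_x[of "1\<^sub>m N"] F.C.cars'(3,4) by (simp add: mat_mult_one)
  also have "\<dots> = rk N (adiag N g * F.C.y)"
    by (rule rk_mult_inv_left[symmetric, OF F.C.car F.C.GH(2) F.C.cars'(4)])
  also have "even \<dots>"
  proof (rule even_rk_alt)
    have c: "adiag N g * F.C.y \<in> carrier_mat N N" by (rule carrier_matI; simp)
    have e: "(adiag N g * F.C.y) $$ (i,j) = (if arr j (star i) then 1 else 0) - (if arr i (star j) then 1 else 0) + K j i"
      if ij: "i < N" "j < N" for i j
    proof -
      have s: "star i < N" "star (star i) = i" using star ij by auto
      have "(adiag N g * F.C.y) $$ (i,j) = F.C.y $$ (star i, j)"
        unfolding adiag_mult_index(1)[OF F.C.cars'(4) ij] g1[OF ij(1)] star_def by simp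
      also have "\<dots> = F.Ymat $$ (star i, j) - F.C.Z $$ (star i, j) + S $$ (star i, j)" by (rule F.yi[OF s(1) ij(2)])
      also have "\<dots> = (if arr j (star i) then 1 else 0) - (if arr i (star j) then 1 else 0) + K j i"
        unfolding F.Zi[OF s(1) ij(2)] S_index[OF s(1) ij(2)] s(2) arrow_mat_index[OF s(1) ij(2)] g1[OF ij(1)] g1[OF star(1)[OF ij(2)]] by simp
      finally show ?thesis .
    qed
    show "alt_mat N (adiag N g * F.C.y)" unfolding alt_mat_def
    proof (intro conjI allI impI c)
      fix i assume i: "i < N"
      show "(adiag N g * F.C.y) $$ (i,i) = 0" unfolding e[OF i i] K_even(1)[OF t] by simp
    next
      fix i j assume ij: "i < N" "j < N"
      show "(adiag N g * F.C.y) $$ (i,j) = - (adiag N g * F.C.y) $$ (j,i)"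
        unfolding e[OF ij] e[OF ij(2,1)] using K_even(2)[OF t ij] by (simp add: algebra_simps)
    qed
  qed
  finally show ?thesis .
qed

lemma v_in_grp:
  assumes "N = dimN ty n"
  shows "F.C.v \<in> grp ty n"
proof (cases "ty = Spt")
  case True
  have "adiag N g = Jsp N" unfolding Jsp_adiag
    by (rule arg_cong[of _ _ "adiag N"]) (simp add: form_entry_def True fun_eq_iff)
  then have "transpose_mat F.C.v * Jsp N * F.C.v = Jsp N" using F.C.iso_v by simp
  then show ?thesis using True F.C.cars'(2) assms unfolding grp_def Let_def by simp
next
  case False
  have d: "det F.C.v = 1" by (rule det_wunip[OF F.C.wunip_v])
  have o: "F.C.v \<in> orth_group N" unfolding orth_group_def using d F.C.cars'(2) v_qform[OF False] by simp
  show ?thesis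
  proof (cases "ty = SOodd")
    case True
    then show ?thesis using o d assms unfolding grp_def Let_def by simp
  next
    case F: False
    then have t: "ty = SOeven" using False ty by (cases ty) auto
    have "even (rk N (F.C.v - 1\<^sub>m N))" using even_rk_x[OF t] unfolding F.C.x_def .
    then show ?thesis using o d t assms unfolding grp_def Let_def by simp
  qed
qed

end

section \<open>Lower bounds for the ranks\<close>

lemma card_fibres:
  fixes w :: "nat \<Rightarrow> int"
  shows "card {i. i < N \<and> i \<in> X} = (\<Sum>s\<in>w ` {..<N}. card {i. i < N \<and> w i = s \<and> i \<in> X})"
proof -
  have "(\<Sum>s\<in>w ` {..<N}. sum (\<lambda>_. 1::nat) {i \<in> {i. i < N \<and> i \<in> X}. w i = s}) = sum (\<lambda>_. 1) {i. i < N \<and> i \<in> X}"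
    by (rule sum.group) auto
  moreover have "{i \<in> {i. i < N \<and> i \<in> X}. w i = s} = {i. i < N \<and> w i = s \<and> i \<in> X}" for s by auto
  ultimately show ?thesis by simp
qed

lemma cW_eq_sum: "cW N w i = (\<Sum>s\<in>w ` {..<N}. if i \<le> dW N w s then 1 else 0)"
  unfolding cW_def by (simp add: sum.If_cases Int_def)

lemma sum_min_dW: "(\<Sum>s\<in>w ` {..<N}. min (dW N w s) t) = (\<Sum>i\<in>{0<..t}. cW N w i)"
proof -
  have "(\<Sum>i\<in>{0<..t}. cW N w i) = (\<Sum>s\<in>w ` {..<N}. \<Sum>i\<in>{0<..t}. if i \<le> dW N w s then 1 else 0)"
    unfolding cW_eq_sum by (rule sum.swap)
  also have "\<dots> = (\<Sum>s\<in>w ` {..<N}. min (dW N w s) t)"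
  proof (rule sum.cong)
    fix s
    have "{0<..t} \<inter> {i. i \<le> dW N w s} = {0<..min (dW N w s) t}" by auto
    then show "(\<Sum>i\<in>{0<..t}. if i \<le> dW N w s then 1 else 0) = min (dW N w s) t" by (simp add: sum.If_cases)
  qed simp
  finally show ?thesis ..
qed

lemma sum_cW_split: "t \<le> N \<Longrightarrow> (\<Sum>i\<in>{0<..t}. cW N w i) + (\<Sum>i\<in>{t<..N}. cW N w i) = N"
proof -
  assume "t \<le> N"
  then have "{0<..N} = {0<..t} \<union> {t<..N}" by auto
  then have "(\<Sum>i\<in>{0<..N}. cW N w i) = (\<Sum>i\<in>{0<..t}. cW N w i) + (\<Sum>i\<in>{t<..N}. cW N w i)"
    by (simp only:) (rule sum.union_disjoint; auto)
  then show ?thesis using sum_cW[of N w] by simp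
qed

lemma zero_block_min:
  fixes d m t :: nat
  assumes d: "d = 2 * m + (if odd N then 1 else 0)" and t: "odd N \<Longrightarrow> odd t"
  shows "2 * min m (t div 2) + (if odd N then 1 else 0) + (if even N \<and> odd t \<and> t < d then 1 else 0) = min d t"
proof (cases "even t")
  case True
  then obtain s where "t = 2 * s" by (rule evenE)
  then show ?thesis using d t by (auto simp: min_def)
next
  case False
  then obtain s where "t = 2 * s + 1" by (rule oddE)
  then show ?thesis using d by (auto simp: min_def)
qed

context levels
begin

lemma zero_weight: "0 < dW N w 0 \<Longrightarrow> (0::int) \<in> w ` {..<N}"
  using dW_pos[of 0 w N] by simp

text \<open>A block of size \<open>d\<close> contributes \<open>min d t\<close> vectors, in total
  the sum of the first \<open>t\<close> block counts. Only the zero block can fall one short, by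
  \<open>zero_block_min\<close>.\<close>

lemma card_T:
  assumes "t \<le> N"
  shows "card T + (\<Sum>i\<in>{t<..N}. cW N w i) + (if even N \<and> odd t \<and> t < dW N w 0 then 1 else 0) = N"
proof -
  let ?P = "even N \<and> odd t \<and> t < dW N w 0"
  have e: "card {i. i < N \<and> w i = s \<and> i \<in> T} + (if s = 0 then if ?P then 1 else 0 else 0) = min (dW N w s) t" for s
  proof (cases "s = 0")
    case False
    then show ?thesis using card_T_nonzero(1) by simp
  next
    case True
    show ?thesis unfolding True using zero_block_min[OF card_T_zero(3) odd_t] card_T_zero(1) by simp
  qed
  have "(\<Sum>s\<in>w ` {..<N}. card {i. i < N \<and> w i = s \<and> i \<in> T}) + (\<Sum>s\<in>w ` {..<N}. if s = 0 then if ?P then 1 else 0 else 0)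
    = (\<Sum>s\<in>w ` {..<N}. min (dW N w s) t)"
    unfolding sum.distrib[symmetric] e ..
  moreover have "(\<Sum>s\<in>w ` {..<N}. if s = 0 then if ?P then 1 else 0 else 0) = (if ?P then 1 else 0::nat)"
    using zero_weight by auto
  moreover have "(\<Sum>s\<in>w ` {..<N}. card {i. i < N \<and> w i = s \<and> i \<in> T}) = card T"
    unfolding card_fibres[symmetric] by (rule arg_cong[of _ _ card]) (auto simp: T_def)
  ultimately show ?thesis using sum_cW_split[OF assms, of w] unfolding sum_min_dW by linarith
qed

text \<open>Every block larger than \<open>t\<close> has a vector labelled \<open>t\<close>, and the
  zero block has one in each half.\<close>

lemma card_T1_eq:
  assumes "even N \<Longrightarrow> even t"
  shows "card T1 = cW N w (Suc t) + (if t < dW N w 0 then 1 else 0)"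
proof -
  let ?P = "t < dW N w 0"
  have e: "card {i. i < N \<and> w i = s \<and> i \<in> T1} = (if Suc t \<le> dW N w s then 1 else 0) + (if s = 0 then if ?P then 1 else 0 else 0)" for s
  proof (cases "s = 0")
    case False
    then show ?thesis using card_T_nonzero(2) by simp
  next
    case True
    have "t div 2 < dW N w 0 div 2 \<longleftrightarrow> t < dW N w 0"
    proof (cases "even N")
      case True
      then have "even t" "dW N w 0 = 2 * (dW N w 0 div 2)" using assms card_T_zero(3) by auto
      then show ?thesis by linarith
    next
      case False
      then have "odd t" "dW N w 0 = 2 * (dW N w 0 div 2) + 1" using odd_t card_T_zero(3) by auto
      moreover from this(1) obtain s where "t = 2 * s + 1" by (rule oddE)
      moreover from this have "t div 2 = s" by simp
      ultimately show ?thesis by linarith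
    qed
    then show ?thesis using card_T_zero(2) True by auto
  qed
  have "card T1 = (\<Sum>s\<in>w ` {..<N}. card {i. i < N \<and> w i = s \<and> i \<in> T1})"
    unfolding card_fibres[symmetric] by (rule arg_cong[of _ _ card]) (auto simp: T1_def)
  also have "\<dots> = cW N w (Suc t) + (\<Sum>s\<in>w ` {..<N}. if s = 0 then if ?P then 1 else 0 else 0)"
    unfolding e sum.distrib cW_eq_sum ..
  also have "(\<Sum>s\<in>w ` {..<N}. if s = 0 then if ?P then 1 else 0 else 0) = (if ?P then 1 else 0::nat)"
    using zero_weight by auto
  finally show ?thesis .
qed

end

text \<open>The chains alone reach the line of level \<open>t\<close>. Adding the column raises this
  to level \<open>t + 1\<close>, up to its shortfall and with one extra unit if the zero block takes
  part.\<close>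

lemma (in levels_type) rk_lower:
  assumes "t \<le> N"
  shows "N \<le> rk N (F.C.x ^\<^sub>m k) + topF (cW N w) N t k + (if even N \<and> odd t \<and> t < dW N w 0 then 1 else 0)"
    and "ty \<noteq> Spt \<Longrightarrow> t < N \<Longrightarrow> 1 \<le> k \<Longrightarrow>
      N + (if t < dW N w 0 then 1 else 0) \<le> rk N (F.C.x ^\<^sub>m k) + topF (cW N w) N (Suc t) k + (if (2::'a) \<noteq> 0 then 1 else 2)"
proof -
  have a: "card T \<le> rk N (pr N T * F.C.x ^\<^sub>m k) + k * t" by (rule F.rk_T_pow)
  have b: "rk N (pr N T * F.C.x ^\<^sub>m k) + rk N (pr N T1 * F.C.x ^\<^sub>m k) \<le> rk N (F.C.x ^\<^sub>m k)" by (rule F.rk_pow_ge)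
  show "N \<le> rk N (F.C.x ^\<^sub>m k) + topF (cW N w) N t k + (if even N \<and> odd t \<and> t < dW N w 0 then 1 else 0)"
    using a b card_T[OF assms] unfolding topF_def by linarith
  assume nS: "ty \<noteq> Spt" and t: "t < N" and k: "1 \<le> k"
  have ev: "even N \<Longrightarrow> even t" using ty nS by (cases ty) auto
  have "topF (cW N w) N (Suc t) k + cW N w (Suc t) = k * t + (\<Sum>i\<in>{t<..N}. cW N w i) + k"
    using topF_Suc[OF t, of "cW N w" k] unfolding topF_def by simp
  moreover have "card T + (\<Sum>i\<in>{t<..N}. cW N w i) = N"
  proof -
    have "\<not> (even N \<and> odd t \<and> t < dW N w 0)" using ev by blast
    from card_T[OF assms, unfolded if_not_P[OF this]] show ?thesis by simp
  qed
  ultimately show "N + (if t < dW N w 0 then 1 else 0) \<le> rk N (F.C.x ^\<^sub>m k) + topF (cW N w) N (Suc t) k + (if (2::'a) \<noteq> 0 then 1 else 2)"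
    using a b column_bound[OF nS k] card_T1_eq[OF ev] by linarith
qed

lemma rk_lower_level:
  assumes N: "N = dimN ty n" and s: "sym_wt N w" and ty: "ty \<noteq> GLt" "\<not> (ty = SOodd \<and> CHAR('a::field) = 2)"
    and t: "t \<le> N" "ty = SOeven \<Longrightarrow> even t" "ty = SOodd \<Longrightarrow> odd t"
  obtains v :: "'a::field mat" where "v \<in> grp ty n" "wunip N w v"
    "\<And>k. N \<le> rk N ((v - 1\<^sub>m N) ^\<^sub>m k) + topF (cW N w) N t k + (if ty = Spt \<and> odd t \<and> t < dW N w 0 then 1 else 0)"
    "\<And>k. ty \<noteq> Spt \<Longrightarrow> t < N \<Longrightarrow> 1 \<le> k \<Longrightarrow>
      N + (if t < dW N w 0 then 1 else 0) \<le> rk N ((v - 1\<^sub>m N) ^\<^sub>m k) + topF (cW N w) N (Suc t) k + (if (2::'a::field) \<noteq> 0 then 1 else 2)"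
proof -
  let ?B = "\<lambda>s. {i. i < N \<and> (w i < 0 \<or> w i = 0 \<and> i < N - 1 - i) \<and> w i = s}"
  obtain h where h: "\<And>s. bij_betw h (?B s) {..<card (?B s)}"
    by (rule labelling_exists[of ?B w]) auto
  have tyN: "ty = SOodd \<longleftrightarrow> odd N" unfolding N using ty by (cases ty) auto
  interpret levels N t w h by unfold_locales (use s t tyN h in auto)
  obtain a where a: "bij_betw a {..<card (T1 \<inter> H)} (T1 \<inter> H)"
    "\<And>r s. r < card (T1 \<inter> H) \<Longrightarrow> s < card (T1 \<inter> H) \<Longrightarrow> w (a r) < w (a s) \<longleftrightarrow> r < s" by (rule column_enumeration) blast
  have two: "odd N \<Longrightarrow> (2::'a) \<noteq> 0" using two_nz ty tyN by blast
  interpret levels_type N t w h a ty "2::'a" by unfold_locales (use a ty t tyN two in auto)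
  show thesis
  proof (rule that[of F.C.v])
    show "F.C.v \<in> grp ty n" by (rule v_in_grp[OF N])
    show "wunip N w F.C.v" by (rule F.C.wunip_v)
    have e: "(if even N \<and> odd t \<and> t < dW N w 0 then 1 else 0) = (if ty = Spt \<and> odd t \<and> t < dW N w 0 then 1 else 0::nat)"
      using ty t tyN by (cases ty) auto
    show "N \<le> rk N ((F.C.v - 1\<^sub>m N) ^\<^sub>m k) + topF (cW N w) N t k + (if ty = Spt \<and> odd t \<and> t < dW N w 0 then 1 else 0)" for k
      using rk_lower(1)[OF t(1)] unfolding F.C.x_def e .
    show "N + (if t < dW N w 0 then 1 else 0) \<le> rk N ((F.C.v - 1\<^sub>m N) ^\<^sub>m k) + topF (cW N w) N (Suc t) k + (if (2::'a) \<noteq> 0 then 1 else 2)"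
      if "ty \<noteq> Spt" "t < N" "1 \<le> k" for k
      using rk_lower(2)[OF t(1) that] unfolding F.C.x_def .
  qed
qed

text \<open>Without a form no duality constrains the labels: \<open>X\<close> simply follows all
  chains labelled below \<open>t\<close>.\<close>

lemma gl_chains:
  fixes w :: "nat \<Rightarrow> int"
  assumes tN: "t \<le> N"
  obtains X :: "'a::field mat" where "raises N w X" "\<And>k. N \<le> rk N (X ^\<^sub>m k) + topF (cW N w) N t k"
proof -
  let ?B = "\<lambda>s. {i. i < N \<and> w i = s}"
  obtain h where h: "\<And>s. bij_betw h (?B s) {..<card (?B s)}"
    by (rule labelling_exists[of ?B w]) auto
  define T where "T = {i. i < N \<and> h i < t}"
  define F where "F i = {l \<in> T. h l = h i \<and> w i < w l}" for i
  define nt where "nt = {i \<in> T. F i \<noteq> {}}"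
  define nx where "nx i = arg_min_on w (F i)" for i
  define X :: "'a mat" where "X = mat N N (\<lambda>(l,i). if i \<in> nt \<and> l = nx i then 1 else 0)"
  have finT: "finite T" by (simp add: T_def)
  have inj: "i = l" if "i \<in> T" "l \<in> T" "w i = w l" "h i = h l" for i l
    using bij_betw_imp_inj_on[OF h[of "w i"]] that unfolding inj_on_def T_def by auto
  have nx: "nx i \<in> F i" "\<And>l. l \<in> F i \<Longrightarrow> w (nx i) \<le> w l" if "i \<in> nt" for i
  proof -
    have f: "finite (F i)" "F i \<noteq> {}" using that finT by (auto simp: nt_def F_def)
    show "nx i \<in> F i" unfolding nx_def by (rule arg_min_if_finite(1)[OF f])
    show "w (nx i) \<le> w l" if "l \<in> F i" for l
      using arg_min_if_finite(2)[OF f, of w] that unfolding nx_def by (auto simp: not_less)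
  qed
  have nxD: "nx i \<in> T" "nx i < N" "h (nx i) = h i" "w i < w (nx i)" if "i \<in> nt" for i
    using nx(1)[OF that] by (auto simp: F_def T_def)
  have ntT: "i \<in> nt \<Longrightarrow> i \<in> T" "i \<in> nt \<Longrightarrow> i < N" for i by (auto simp: nt_def T_def)
  have nxinj: "i = i'" if i: "i \<in> nt" "i' \<in> nt" "nx i = nx i'" for i i'
  proof -
    have e: "h i = h i'" using nxD(3)[OF i(1)] nxD(3)[OF i(2)] i(3) by simp
    have "\<not> w i < w i'"
    proof
      assume "w i < w i'"
      then have "w (nx i) \<le> w i'" using e ntT(1)[OF i(2)] by (intro nx(2)[OF i(1)]) (simp add: F_def)
      then show False using nxD(4)[OF i(2)] i(3) by simp
    qed
    moreover have "\<not> w i' < w i"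
    proof
      assume "w i' < w i"
      then have "w (nx i') \<le> w i" using e ntT(1)[OF i(1)] by (intro nx(2)[OF i(2)]) (simp add: F_def)
      then show False using nxD(4)[OF i(1)] i(3) by simp
    qed
    ultimately show ?thesis using inj[OF ntT(1)[OF i(1)] ntT(1)[OF i(2)] _ e] by simp
  qed
  have "inj_on h (T - nt)"
  proof (rule inj_onI)
    fix i l assume il: "i \<in> T - nt" "l \<in> T - nt" "h i = h l"
    then have "\<not> w i < w l" "\<not> w l < w i" by (auto simp: nt_def F_def)
    then show "i = l" using il inj[of i l] by simp
  qed
  moreover have "h ` (T - nt) \<subseteq> {..<t}" by (auto simp: T_def)
  ultimately have "card (T - nt) \<le> t" using card_inj_on_le[of h "T - nt" "{..<t}"] by simp
  moreover have "nt \<subseteq> T" by (auto simp: nt_def)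
  then have "card T = card nt + card (T - nt)"
    using card_Int_Diff[OF finT, of nt] by (simp add: Int_absorb1)
  ultimately have cT: "card T \<le> card nt + t" by simp
  have Xc: "X \<in> carrier_mat N N" by (simp add: X_def)
  have Xi: "X $$ (l,i) = (if i \<in> nt \<and> l = nx i then 1 else 0)" if "l < N" "i < N" for l i using that by (simp add: X_def)
  have Xr: "raises N w X" unfolding raises_def
  proof (intro conjI allI impI Xc)
    fix l i assume "l < N" "i < N" "w l \<le> w i"
    then show "X $$ (l,i) = 0" using Xi nxD(4)[of i] by auto
  qed
  have comm: "pr N T * X = X * pr N T"
  proof (rule pr_commute[OF Xc])
    fix l i assume "l < N" "i < N" "X $$ (l,i) \<noteq> 0"
    then have "i \<in> nt" "l = nx i" using Xi by (auto split: if_splits)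
    then show "l \<in> T \<longleftrightarrow> i \<in> T" using nxD(1) ntT(1) by blast
  qed
  have rX: "card nt \<le> rk N (pr N T * X)"
  proof (rule rk_ge_triangular[where \<pi> = nx and w = w])
    show "pr N T * X \<in> carrier_mat N N" using Xc by auto
    show "nt \<subseteq> {..<N}" using ntT(2) by auto
    have e: "(pr N T * X) $$ (nx i, i') = (if i' \<in> nt \<and> nx i = nx i' then 1 else 0)" if "i \<in> nt" "i' < N" for i i'
      unfolding pr_mult_left_index[OF Xc nxD(2)[OF that(1)] that(2)] using nxD(1,2)[OF that(1)] Xi that(2) by simp
    show "nx i < N \<and> (pr N T * X) $$ (nx i, i) \<noteq> 0" if "i \<in> nt" for i
      using e[OF that ntT(2)[OF that]] nxD(2)[OF that] that by simp
    show "w i' < w i" if "i \<in> nt" "i' \<in> nt" "i' \<noteq> i" "(pr N T * X) $$ (nx i, i') \<noteq> 0" for i i'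
      using e[OF that(1) ntT(2)[OF that(2)]] that nxinj[OF that(1,2)] by (auto split: if_splits)
  qed
  have fib: "card {i. i < N \<and> w i = s \<and> i \<in> T} = min (dW N w s) t" for s
  proof -
    have im: "h ` ?B s = {..<dW N w s}" "inj_on h (?B s)" using h[of s] by (auto simp: bij_betw_def dW_def)
    have "h ` {i. i < N \<and> w i = s \<and> i \<in> T} = {..<min (dW N w s) t}"
    proof (intro equalityI subsetI)
      fix r assume "r \<in> h ` {i. i < N \<and> w i = s \<and> i \<in> T}"
      then obtain i where i: "i \<in> ?B s" "h i < t" "r = h i" by (auto simp: T_def)
      then have "h i \<in> {..<dW N w s}" using im(1) by blast
      then show "r \<in> {..<min (dW N w s) t}" using i by simp
    next
      fix r assume r: "r \<in> {..<min (dW N w s) t}"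
      then have "r \<in> h ` ?B s" using im by simp
      then obtain i where "i \<in> ?B s" "r = h i" by auto
      then show "r \<in> h ` {i. i < N \<and> w i = s \<and> i \<in> T}" using r by (auto simp: T_def)
    qed
    moreover have "inj_on h {i. i < N \<and> w i = s \<and> i \<in> T}" by (rule inj_on_subset[OF im(2)]) auto
    ultimately show ?thesis using card_image[of h "{i. i < N \<and> w i = s \<and> i \<in> T}"] by simp
  qed
  have "card T = card {i. i < N \<and> i \<in> T}" by (rule arg_cong[of _ _ card]) (auto simp: T_def)
  also have "\<dots> = (\<Sum>i\<in>{0<..t}. cW N w i)" unfolding card_fibres[of N T w] fib sum_min_dW ..
  finally have cN: "card T + (\<Sum>i\<in>{t<..N}. cW N w i) = N" using sum_cW_split[OF tN] by simp
  show thesis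
  proof (rule that[OF Xr])
    fix k
    have e: "rk N (pr N T :: 'a mat) = card T" using rk_pr[of N T, where 'a = 'a] by (simp add: T_def Int_def conj_commute)
    have "rk N (pr N T :: 'a mat) + k * rk N (pr N T * X) \<le> rk N (pr N T * X ^\<^sub>m k) + k * rk N (pr N T :: 'a mat)"
      by (rule rk_compress_pow[OF Xc pr_carrier]) (simp_all add: pr_mult comm)
    moreover have "k * card T \<le> k * rk N (pr N T * X) + k * t"
      using mult_le_mono2[OF order_trans[OF cT add_right_mono[OF rX]], of k] by (simp add: add_mult_distrib2)
    moreover have "rk N (pr N T * X ^\<^sub>m k) \<le> rk N (X ^\<^sub>m k)"
      by (rule rk_prod_le_right[OF pr_carrier pow_carrier_mat[OF Xc]])
    ultimately show "N \<le> rk N (X ^\<^sub>m k) + topF (cW N w) N t k" using cN unfolding topF_def e by linarith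
  qed
qed

text \<open>The minimum in the claim is a choice of witness. Level \<open>j + 1\<close> exceeds
  level \<open>j\<close> by \<open>k - c (j+1)\<close>, level \<open>j - 1\<close> by
  \<open>c j - k\<close>, and a construction reaching level \<open>j\<close> itself loses only
  \<open>collapse\<close>.\<close>

lemma rk_lower_bound:
  assumes N: "N = dimN ty n" and s: "ty \<noteq> GLt \<Longrightarrow> sym_wt N w" and odd2: "\<not> (ty = SOodd \<and> CHAR('a::field) = 2)"
    and j: "1 \<le> j" "j < N" and k: "cW N w (Suc j) \<le> k" "k \<le> cW N w j" "1 \<le> k"
  shows "\<exists>v::'a::field mat. v \<in> grp ty n \<and> wunip N w v \<and> N \<le> rk N ((v - 1\<^sub>m N) ^\<^sub>m k) + topF (cW N w) N j k
    + min (collapse ty CHAR('a) (dW N w 0) j) (min (k - cW N w (Suc j)) (cW N w j - k))"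
proof (cases "ty = GLt")
  case True
  obtain X :: "'a mat" where X: "raises N w X" "\<And>k. N \<le> rk N (X ^\<^sub>m k) + topF (cW N w) N j k"
    using gl_chains[of j N w] j by auto
  have c: "X \<in> carrier_mat N N" by (rule raisesD(1)[OF X(1)])
  have w: "wunip N w (1\<^sub>m N + X)" by (rule wunip_add1[OF X(1)])
  have "1\<^sub>m N + X - 1\<^sub>m N = X" using c by (intro eq_matI) auto
  moreover have "1\<^sub>m N + X \<in> grp ty n" using det_wunip[OF w] c N True by (simp add: grp_def)
  ultimately show ?thesis using w X(2)[of k] by (intro exI[of _ "1\<^sub>m N + X"]) (simp add: trans_le_add1)
next
  case nG: False
  let ?c = "cW N w" and ?d = "dW N w 0" and ?g = "collapse ty CHAR('a) (dW N w 0) j"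
  let ?A = "k - cW N w (Suc j)" and ?B = "cW N w j - k"
  let ?goal = "\<lambda>e. \<exists>v::'a mat. v \<in> grp ty n \<and> wunip N w v \<and> N \<le> rk N ((v - 1\<^sub>m N) ^\<^sub>m k) + topF ?c N j k + e"
  note s = s[OF nG]
  have dpar: "even ?d \<longleftrightarrow> ty \<noteq> SOodd" using n_parity[OF s] N nG by (cases ty) auto
  have up: "topF ?c N (Suc j) k = topF ?c N j k + ?A" using topF_Suc[OF j(2), of ?c k] k by simp
  have down: "topF ?c N (j - 1) k = topF ?c N j k + ?B" using topF_Suc[of "j - 1" N ?c k] j k by simp
  have lvl: "?goal (topF ?c N t k - topF ?c N j k + (if ty = Spt \<and> odd t \<and> t < ?d then 1 else 0))"
    if tk: "topF ?c N j k \<le> topF ?c N t k" and tt: "t \<le> N" "ty = SOeven \<Longrightarrow> even t" "ty = SOodd \<Longrightarrow> odd t" for t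
  proof -
    obtain v :: "'a mat" where v: "v \<in> grp ty n" "wunip N w v"
      "\<And>k. N \<le> rk N ((v - 1\<^sub>m N) ^\<^sub>m k) + topF ?c N t k + (if ty = Spt \<and> odd t \<and> t < ?d then 1 else 0)"
      by (rule rk_lower_level[OF N s nG odd2 tt]) auto
    have "rk N ((v - 1\<^sub>m N) ^\<^sub>m k) + topF ?c N t k + (if ty = Spt \<and> odd t \<and> t < ?d then 1 else 0) =
      rk N ((v - 1\<^sub>m N) ^\<^sub>m k) + topF ?c N j k + (topF ?c N t k - topF ?c N j k + (if ty = Spt \<and> odd t \<and> t < ?d then 1 else 0))"
      using tk by simp
    with v show ?thesis by metis
  qed
  \<comment> \<open>The neighbouring levels have the parity the form requires, so no label of the
    zero block is wasted there.\<close>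
  have A: "?goal ?A" if ev: "even j \<and> ty \<noteq> SOeven \<or> odd j \<and> ty \<noteq> SOodd" and Sp: "ty = Spt \<Longrightarrow> odd j"
  proof -
    have z: "\<not> (ty = Spt \<and> odd (Suc j) \<and> Suc j < ?d)" using Sp by auto
    have "topF ?c N (Suc j) k - topF ?c N j k + 0 = ?A" unfolding up by simp
    moreover have "?goal (topF ?c N (Suc j) k - topF ?c N j k + 0)"
    proof (rule lvl[of "Suc j", unfolded if_not_P[OF z]])
      show "topF ?c N j k \<le> topF ?c N (Suc j) k" unfolding up by simp
      show "Suc j \<le> N" using j by simp
      show "even (Suc j)" if "ty = SOeven" using ev that by auto
      show "odd (Suc j)" if "ty = SOodd" using ev that by auto
    qed
    ultimately show ?thesis by (simp only:)
  qed
  have B: "?goal ?B" if ev: "even j \<and> ty \<noteq> SOeven \<or> odd j \<and> ty \<noteq> SOodd" and Sp: "ty = Spt \<Longrightarrow> odd j"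
  proof -
    have z: "\<not> (ty = Spt \<and> odd (j - 1) \<and> j - 1 < ?d)" using Sp j by auto
    have "topF ?c N (j - 1) k - topF ?c N j k + 0 = ?B" unfolding down by simp
    moreover have "?goal (topF ?c N (j - 1) k - topF ?c N j k + 0)"
    proof (rule lvl[of "j - 1", unfolded if_not_P[OF z]])
      show "topF ?c N j k \<le> topF ?c N (j - 1) k" unfolding down by simp
      show "j - 1 \<le> N" using j by simp
      show "even (j - 1)" if "ty = SOeven" using ev that j by auto
      show "odd (j - 1)" if "ty = SOodd" using ev that j by auto
    qed
    ultimately show ?thesis by (simp only:)
  qed
  have gA: "?goal (min ?g (min ?A ?B))" if "?goal ?g" "?goal ?A" "?goal ?B"
    using that by (auto simp: min_def)
  show ?thesis unfolding add.assoc[symmetric]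
  proof (cases "(ty = SOeven \<longrightarrow> even j) \<and> (ty = SOodd \<longrightarrow> odd j)")
    case R: True
    have lj: "?goal (if ty = Spt \<and> odd j \<and> j < ?d then 1 else 0)" using lvl[of j] R j by auto
    show "?goal (min ?g (min ?A ?B))"
    proof (cases "ty = Spt \<and> odd j \<and> j < ?d")
      case True
      then have "?g = 1" by (simp add: collapse_def)
      then show ?thesis using lj A B True by (intro gA) auto
    next
      case False
      from lj[unfolded if_not_P[OF this]] have "?goal 0" .
      moreover have "?g = 0" using R nG False by (cases ty) (auto simp: collapse_def)
      ultimately show ?thesis by simp
    qed
  next
    \<comment> \<open>Now \<open>j\<close> labels have the wrong parity for the form, so
      \<open>j - 1\<close> labels are used together with the extra column.\<close>
    case R: False
    then have tyS: "ty \<noteq> Spt" "even j \<and> ty = SOodd \<or> odd j \<and> ty = SOeven" by auto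
    obtain v :: "'a mat" where v: "v \<in> grp ty n" "wunip N w v"
      "\<And>k. ty \<noteq> Spt \<Longrightarrow> j - 1 < N \<Longrightarrow> 1 \<le> k \<Longrightarrow> N + (if j - 1 < ?d then 1 else 0) \<le>
        rk N ((v - 1\<^sub>m N) ^\<^sub>m k) + topF ?c N (Suc (j - 1)) k + (if (2::'a) \<noteq> 0 then 1 else 2)"
      by (rule rk_lower_level[OF N s nG odd2, of "j - 1"]) (use tyS j in auto)
    have "j \<noteq> ?d" using tyS dpar by auto
    then have "j - 1 < ?d \<longleftrightarrow> j < ?d" using j by linarith
    \<comment> \<open>The shortfall of the column is reduced by its extra vector in the zero block
      when \<open>j\<close> is below the middle block; the difference is exactly
      \<open>collapse\<close>.\<close>
    then have "?g + (if j - 1 < ?d then 1 else 0) = (if (2::'a) \<noteq> 0 then 1 else 2)"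
      using tyS odd2 two_nz[where 'a = 'a] two_zero[where 'a = 'a] dpar by (auto simp: collapse_def)
    moreover have "Suc (j - 1) = j" using j by simp
    ultimately have "N + (if j - 1 < ?d then 1 else 0) \<le> rk N ((v - 1\<^sub>m N) ^\<^sub>m k) + topF ?c N j k + (?g + (if j - 1 < ?d then 1 else 0))"
      using v(3)[of k] tyS(1) j k(3) by (simp only:) simp
    then have "?goal ?g" using v by (intro exI[of _ v]) simp
    then show "?goal (min ?g (min ?A ?B))" using A B tyS by (intro gA) auto
  qed
qed

section \<open>Density and Jordan types\<close>

text \<open>Equality with a polynomial is required only on \<open>N\<close> by \<open>N\<close>
  matrices, since operations such as the determinant agree with their polynomial expressions only
  there.\<close>

definition poly_on :: "nat \<Rightarrow> ('a::field mat \<Rightarrow> 'a) \<Rightarrow> bool" where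
  "poly_on N f \<longleftrightarrow> (\<exists>p\<in>polyfun N. \<forall>A\<in>carrier_mat N N. f A = p A)"

lemma poly_on_const: "poly_on N (\<lambda>_. c)"
  unfolding poly_on_def by (intro bexI[where x = "\<lambda>_. c"] ballI polyfun.const refl)

lemma poly_on_coord: "i < N \<Longrightarrow> j < N \<Longrightarrow> poly_on N (\<lambda>A. A $$ (i,j))"
  unfolding poly_on_def by (intro bexI[where x = "\<lambda>A. A $$ (i,j)"] ballI polyfun.coord refl)

lemma poly_on_add:
  assumes "poly_on N f" "poly_on N g"
  shows "poly_on N (\<lambda>A. f A + g A)"
proof -
  obtain p q where "p \<in> polyfun N" "\<forall>A\<in>carrier_mat N N. f A = p A" "q \<in> polyfun N" "\<forall>A\<in>carrier_mat N N. g A = q A"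
    using assms unfolding poly_on_def by blast
  then show ?thesis unfolding poly_on_def by (intro bexI[where x = "\<lambda>A. p A + q A"]) (auto intro: polyfun.add)
qed

lemma poly_on_mult:
  assumes "poly_on N f" "poly_on N g"
  shows "poly_on N (\<lambda>A. f A * g A)"
proof -
  obtain p q where "p \<in> polyfun N" "\<forall>A\<in>carrier_mat N N. f A = p A" "q \<in> polyfun N" "\<forall>A\<in>carrier_mat N N. g A = q A"
    using assms unfolding poly_on_def by blast
  then show ?thesis unfolding poly_on_def by (intro bexI[where x = "\<lambda>A. p A * q A"]) (auto intro: polyfun.mult)
qed

lemma poly_on_cong: "poly_on N f \<Longrightarrow> (\<And>A. A \<in> carrier_mat N N \<Longrightarrow> g A = f A) \<Longrightarrow> poly_on N g"
  unfolding poly_on_def by (elim bexE, rule bexI) auto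

lemma poly_on_sum: "finite S \<Longrightarrow> (\<And>s. s \<in> S \<Longrightarrow> poly_on N (f s)) \<Longrightarrow> poly_on N (\<lambda>A. \<Sum>s\<in>S. f s A)"
  by (induction S rule: finite_induct) (auto intro: poly_on_const poly_on_add)

lemma poly_on_prod: "finite S \<Longrightarrow> (\<And>s. s \<in> S \<Longrightarrow> poly_on N (f s)) \<Longrightarrow> poly_on N (\<lambda>A. \<Prod>s\<in>S. f s A)"
  by (induction S rule: finite_induct) (auto intro: poly_on_const poly_on_mult)

definition poly_mat :: "nat \<Rightarrow> ('a::field mat \<Rightarrow> 'a mat) \<Rightarrow> bool" where
  "poly_mat N E \<longleftrightarrow> (\<forall>A\<in>carrier_mat N N. E A \<in> carrier_mat N N) \<and> (\<forall>i<N. \<forall>j<N. poly_on N (\<lambda>A. E A $$ (i,j)))"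

lemma poly_matD: "poly_mat N E \<Longrightarrow> A \<in> carrier_mat N N \<Longrightarrow> E A \<in> carrier_mat N N"
  "poly_mat N E \<Longrightarrow> i < N \<Longrightarrow> j < N \<Longrightarrow> poly_on N (\<lambda>A. E A $$ (i,j))"
  by (auto simp: poly_mat_def)

lemma poly_mat_const: "M \<in> carrier_mat N N \<Longrightarrow> poly_mat N (\<lambda>_. M)"
  by (simp add: poly_mat_def poly_on_const)

lemma poly_mat_id: "poly_mat N (\<lambda>A. A)"
  by (simp add: poly_mat_def poly_on_coord)

lemma poly_mat_add:
  assumes "poly_mat N E" "poly_mat N F"
  shows "poly_mat N (\<lambda>A. E A + F A)"
  unfolding poly_mat_def
proof (intro conjI ballI allI impI)
  fix i j assume ij: "i < N" "j < N"
  show "poly_on N (\<lambda>A. (E A + F A) $$ (i,j))"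
  proof (rule poly_on_cong[OF poly_on_add[OF poly_matD(2)[OF assms(1) ij] poly_matD(2)[OF assms(2) ij]]])
    fix A :: "'a mat" assume "A \<in> carrier_mat N N"
    then have "F A \<in> carrier_mat N N" by (rule poly_matD(1)[OF assms(2)])
    then show "(E A + F A) $$ (i,j) = E A $$ (i,j) + F A $$ (i,j)" using ij by (intro index_add_mat) auto
  qed
next
  fix A :: "'a mat" assume A: "A \<in> carrier_mat N N"
  show "E A + F A \<in> carrier_mat N N" by (rule add_carrier_mat[OF poly_matD(1)[OF assms(2) A]])
qed

lemma poly_mat_mult:
  assumes "poly_mat N E" "poly_mat N F"
  shows "poly_mat N (\<lambda>A. E A * F A)"
  unfolding poly_mat_def
proof (intro conjI ballI allI impI)
  fix i j assume ij: "i < N" "j < N"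
  have "poly_on N (\<lambda>A. \<Sum>k<N. E A $$ (i,k) * F A $$ (k,j))"
  proof (rule poly_on_sum)
    fix k assume "k \<in> {..<N}"
    then have k: "k < N" by simp
    show "poly_on N (\<lambda>A. E A $$ (i,k) * F A $$ (k,j))"
      by (rule poly_on_mult[OF poly_matD(2)[OF assms(1) ij(1) k] poly_matD(2)[OF assms(2) k ij(2)]])
  qed simp
  then show "poly_on N (\<lambda>A. (E A * F A) $$ (i,j))"
  proof (rule poly_on_cong)
    fix A :: "'a mat" assume A: "A \<in> carrier_mat N N"
    show "(E A * F A) $$ (i,j) = (\<Sum>k<N. E A $$ (i,k) * F A $$ (k,j))"
      by (rule mat_mult_index[OF poly_matD(1)[OF assms(1) A] poly_matD(1)[OF assms(2) A] ij])
  qed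
next
  fix A :: "'a mat" assume A: "A \<in> carrier_mat N N"
  show "E A * F A \<in> carrier_mat N N" by (rule mult_carrier_mat[OF poly_matD(1)[OF assms(1) A] poly_matD(1)[OF assms(2) A]])
qed

lemma poly_mat_pow: "poly_mat N E \<Longrightarrow> poly_mat N (\<lambda>A. E A ^\<^sub>m k)"
proof (induction k)
  case 0
  have e: "E A ^\<^sub>m 0 = 1\<^sub>m N" if "A \<in> carrier_mat N N" for A using poly_matD(1)[OF 0 that] by simp
  show ?case unfolding poly_mat_def
  proof (intro conjI ballI allI impI)
    fix i j assume "i < N" "j < N"
    show "poly_on N (\<lambda>A. (E A ^\<^sub>m 0) $$ (i,j))"
      by (rule poly_on_cong[OF poly_on_const[of N "1\<^sub>m N $$ (i,j)"]]) (simp only: e)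
  qed (simp only: e one_carrier_mat)
next
  case (Suc k)
  have "poly_mat N (\<lambda>A. E A ^\<^sub>m k * E A)" by (rule poly_mat_mult[OF Suc.IH[OF Suc.prems] Suc.prems])
  then show ?case by simp
qed

lemma poly_on_det:
  assumes "poly_mat N E"
  shows "poly_on N (\<lambda>A. det (E A))"
proof (rule poly_on_cong)
  show "poly_on N (\<lambda>A. \<Sum>p\<in>{p. p permutes {0..<N}}. signof p * (\<Prod>i = 0..<N. E A $$ (i, p i)))"
  proof (rule poly_on_sum)
    fix p assume "p \<in> {p. p permutes {0..<N}}"
    then have p: "p i < N" if "i < N" for i using permutes_in_image[of p "{0..<N}" i] that by simp
    show "poly_on N (\<lambda>A. signof p * (\<Prod>i = 0..<N. E A $$ (i, p i)))"
    proof (rule poly_on_mult[OF poly_on_const poly_on_prod])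
      fix i assume "i \<in> {0..<N}"
      then have i: "i < N" by simp
      show "poly_on N (\<lambda>A. E A $$ (i, p i))" by (rule poly_matD(2)[OF assms i p[OF i]])
    qed simp
  qed (rule finite_permutations; simp)
  fix A :: "'a mat" assume "A \<in> carrier_mat N N"
  then show "det (E A) = (\<Sum>p\<in>{p. p permutes {0..<N}}. signof p * (\<Prod>i = 0..<N. E A $$ (i, p i)))"
    by (rule det_def'[OF poly_matD(1)[OF assms]])
qed

text \<open>\<open>B\<close> and \<open>C\<close> bring \<open>M\<close> to a leading identity
  block, which the complementary projection completes to the identity; a matrix of smaller rank
  cannot fill the gap. Rank at least that of \<open>M\<close> is thus witnessed near
  \<open>M\<close> by one nonvanishing polynomial.\<close>

lemma rank_certificate:
  fixes M :: "'a::field mat"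
  assumes M: "M \<in> carrier_mat n n"
  obtains B C where "B \<in> carrier_mat n n" "C \<in> carrier_mat n n"
    "det (B * M * C + pr n (- {..<rk n M})) \<noteq> 0"
    "\<And>M'. M' \<in> carrier_mat n n \<Longrightarrow> rk n M' < rk n M \<Longrightarrow> det (B * M' * C + pr n (- {..<rk n M})) = 0"
proof -
  define r where "r = rk n M"
  have rn: "r \<le> n" unfolding r_def by (rule rk_le_nr[OF M])
  obtain L R L' R' where LR: "M = L * R" "L \<in> carrier_mat n r" "R \<in> carrier_mat r n" "L' \<in> carrier_mat r n" "R' \<in> carrier_mat n r"
    "L' * L = 1\<^sub>m r" "R * R' = 1\<^sub>m r" unfolding r_def by (rule rank_factorization[OF M])
  let ?I = "inc n r :: 'a mat"
  have I: "?I \<in> carrier_mat n r" by (simp add: inc_def)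
  note [simp] = carrier_matD[OF I] carrier_matD[OF LR(2)] carrier_matD[OF LR(3)] carrier_matD[OF LR(4)] carrier_matD[OF LR(5)]
  have B: "?I * L' \<in> carrier_mat n n" and C: "R' * transpose_mat ?I \<in> carrier_mat n n" by (rule carrier_matI; simp)+
  have II: "?I * transpose_mat ?I = pr n {..<r}"
  proof (rule eq_matI)
    fix i j assume "i < dim_row (pr n {..<r} :: 'a mat)" "j < dim_col (pr n {..<r} :: 'a mat)"
    then have ij: "i < n" "j < n" by auto
    have It: "transpose_mat ?I \<in> carrier_mat r n" by (rule carrier_matI; simp)
    have "(?I * transpose_mat ?I) $$ (i,j) = (\<Sum>k<r. if k = i then (if i = j then 1 else 0) else 0)"
      unfolding mat_mult_index[OF I It ij] using ij rn by (intro sum.cong) (auto simp: inc_def)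
    also have "\<dots> = pr n {..<r} $$ (i,j)" using ij by (simp add: pr_def)
    finally show "(?I * transpose_mat ?I) $$ (i,j) = pr n {..<r} $$ (i,j)" .
  qed simp_all
  have "?I * L' * M * (R' * transpose_mat ?I) = ?I * ((L' * L) * ((R * R') * transpose_mat ?I))"
    unfolding LR(1) by (simp add: mat_assoc)
  also have "\<dots> = pr n {..<r}" unfolding LR(6,7) II[symmetric] by (simp add: mat_mult_one)
  finally have e: "?I * L' * M * (R' * transpose_mat ?I) + pr n (- {..<r}) = 1\<^sub>m n" by (simp only: pr_split)
  show thesis
  proof (rule that[OF B C], fold r_def)
    show "det (?I * L' * M * (R' * transpose_mat ?I) + pr n (- {..<r})) \<noteq> 0" unfolding e by simp
    fix M' :: "'a mat" assume M': "M' \<in> carrier_mat n n" "rk n M' < r"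
    let ?E = "?I * L' * M' * (R' * transpose_mat ?I) + pr n (- {..<r})"
    have Xc: "?I * L' * M' * (R' * transpose_mat ?I) \<in> carrier_mat n n" using B C M' by auto
    have "rk n ?E \<le> rk n (?I * L' * M' * (R' * transpose_mat ?I)) + rk n (pr n (- {..<r}) :: 'a mat)"
      by (rule rk_add[OF Xc pr_carrier])
    also have "rk n (?I * L' * M' * (R' * transpose_mat ?I)) \<le> rk n M'" by (rule rk_factor_le[OF B M'(1) C])
    also have "rk n (pr n (- {..<r}) :: 'a mat) = n - r"
    proof -
      have "{r..} \<inter> {..<n} = {r..<n}" by auto
      then show ?thesis by (simp add: rk_pr)
    qed
    finally have "rk n ?E \<noteq> n" using M'(2) rn by simp
    moreover have "?E \<in> carrier_mat n n" using Xc by auto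
    ultimately show "det ?E = 0" using vec_space.det_rank_iff by blast
  qed
qed

text \<open>If some \<open>v\<close> had larger rank, its certificate would be a polynomial
  vanishing on the dense set but not at \<open>v\<close>.\<close>

lemma zdense_rank_bound:
  fixes Q D :: "'a::field mat set"
  assumes dense: "zdense_in N Q D" and Q: "Q \<subseteq> carrier_mat N N" and v: "v \<in> Q"
    and D: "\<And>A. A \<in> D \<Longrightarrow> rk N ((A - 1\<^sub>m N) ^\<^sub>m k) = r"
  shows "rk N ((v - 1\<^sub>m N) ^\<^sub>m k) \<le> r"
proof (rule ccontr)
  assume "\<not> ?thesis"
  then have lt: "r < rk N ((v - 1\<^sub>m N) ^\<^sub>m k)" by simp
  \<comment> \<open>Subtraction is written as addition of a constant matrix, so that the closure
    properties of polynomial matrices apply.\<close>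
  let ?P = "\<lambda>A :: 'a mat. (A + (- 1\<^sub>m N)) ^\<^sub>m k"
  have m1: "- 1\<^sub>m N \<in> carrier_mat N (N :: nat)" by simp
  have P: "?P A = (A - 1\<^sub>m N) ^\<^sub>m k" if "A \<in> carrier_mat N N" for A :: "'a mat"
    by (rule arg_cong[of _ _ "\<lambda>M. M ^\<^sub>m k"]) (rule eq_matI; use that in simp)
  have vc: "v \<in> carrier_mat N N" using v Q by auto
  have Mc: "(v - 1\<^sub>m N) ^\<^sub>m k \<in> carrier_mat N N" by (rule pow_carrier_mat) (use vc in auto)
  obtain B C where BC: "B \<in> carrier_mat N N" "C \<in> carrier_mat N N"
    "det (B * (v - 1\<^sub>m N) ^\<^sub>m k * C + pr N (- {..<rk N ((v - 1\<^sub>m N) ^\<^sub>m k)})) \<noteq> 0"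
    "\<And>M'. M' \<in> carrier_mat N N \<Longrightarrow> rk N M' < rk N ((v - 1\<^sub>m N) ^\<^sub>m k) \<Longrightarrow>
      det (B * M' * C + pr N (- {..<rk N ((v - 1\<^sub>m N) ^\<^sub>m k)})) = 0"
    by (rule rank_certificate[OF Mc]) blast
  let ?f = "\<lambda>A. det (B * ?P A * C + pr N (- {..<rk N ((v - 1\<^sub>m N) ^\<^sub>m k)}))"
  have "poly_on N ?f"
    by (intro poly_on_det poly_mat_add poly_mat_mult poly_mat_pow poly_mat_const poly_mat_id BC(1,2) pr_carrier) simp
  then obtain p where p: "p \<in> polyfun N" "\<And>A. A \<in> carrier_mat N N \<Longrightarrow> ?f A = p A" unfolding poly_on_def by blast
  let ?T = "{A \<in> Q. \<forall>f\<in>{p}. f A = 0}"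
  have "zclosed_in N Q ?T" unfolding zclosed_in_def by (rule exI[of _ "{p}"]) (use p(1) in simp)
  moreover have "D \<subseteq> ?T"
  proof
    fix A assume A: "A \<in> D"
    then have AQ: "A \<in> Q" using dense by (auto simp: zdense_in_def)
    then have Ac: "A \<in> carrier_mat N N" using Q by auto
    have "(A - 1\<^sub>m N) ^\<^sub>m k \<in> carrier_mat N N" by (rule pow_carrier_mat) (use Ac in auto)
    then have "?f A = 0" unfolding P[OF Ac] by (rule BC(4)) (use D[OF A] lt in simp)
    then show "A \<in> ?T" using AQ p(2)[OF Ac] by simp
  qed
  ultimately have "?T = Q" using dense unfolding zdense_in_def by blast
  then have "v \<in> ?T" using v by simp
  then have "?f v = 0" using p(2)[OF vc] by simp
  then show False using BC(3) unfolding P[OF vc] by simp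
qed

text \<open>The empty set is closed, as the zero set of the constant 1.\<close>

lemma zdense_nonempty:
  assumes "zdense_in N Q D" "Q \<noteq> {}"
  shows "D \<noteq> {}"
proof
  assume D: "D = {}"
  have "zclosed_in N Q {}" unfolding zclosed_in_def
    by (rule exI[of _ "{\<lambda>_. 1}"]) (auto intro: polyfun.const)
  then show False using assms D unfolding zdense_in_def by blast
qed

section \<open>Similarity, Jordan types and conjugate partitions\<close>

lemma intertwine_similar:
  fixes h :: "'a::field mat"
  assumes h: "h \<in> carrier_mat N N" "hi \<in> carrier_mat N N" "h * hi = 1\<^sub>m N" "hi * h = 1\<^sub>m N"
    and A: "A \<in> carrier_mat N N" and B: "B \<in> carrier_mat N N" and e: "h * A = B * h"
  shows "similar_mat B A"
proof -
  note [simp] = carrier_matD[OF h(1)] carrier_matD[OF h(2)] carrier_matD[OF A] carrier_matD[OF B]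
  have "h * A * hi = B * (h * hi)" unfolding e by (simp add: mat_assoc)
  then have "B = h * A * hi" unfolding h(3) by (simp add: mat_mult_one)
  then have "similar_mat_wit B A h hi" using h A B by (simp add: similar_mat_wit_def Let_def)
  then show ?thesis unfolding similar_mat_def by blast
qed

lemma similar_rk_pow:
  fixes A B :: "'a::field mat"
  assumes "similar_mat A B" and A: "A \<in> carrier_mat N N"
  shows "rk N ((A - 1\<^sub>m N) ^\<^sub>m k) = rk N ((B - 1\<^sub>m N) ^\<^sub>m k)" "B \<in> carrier_mat N N"
proof -
  obtain P R where w: "similar_mat_wit A B P R" using assms(1) unfolding similar_mat_def by blast
  have dA: "dim_row A = N" using A by simp
  have c: "B \<in> carrier_mat N N" "P \<in> carrier_mat N N" "R \<in> carrier_mat N N" "P * R = 1\<^sub>m N" "R * P = 1\<^sub>m N" "A = P * B * R"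
    using w dA by (simp_all add: similar_mat_wit_def Let_def)
  show "B \<in> carrier_mat N N" by (rule c)
  note [simp] = carrier_matD[OF A] carrier_matD[OF c(1)] carrier_matD[OF c(2)] carrier_matD[OF c(3)]
  have x: "A - 1\<^sub>m N = P * (B - 1\<^sub>m N) * R"
    unfolding c(6) using c(4) by (simp add: mat_add_distrib mat_assoc mat_mult_one)
  have Bc: "B - 1\<^sub>m N \<in> carrier_mat N N" by (rule carrier_matI; simp)
  have "(A - 1\<^sub>m N) ^\<^sub>m k = P * ((B - 1\<^sub>m N) ^\<^sub>m k * R)"
  proof (induction k)
    case 0
    then show ?case using c by (simp add: mat_mult_one)
  next
    case (Suc k)
    note pc = pow_carrier_mat[OF Bc, of k]
    note [simp] = carrier_matD[OF pc]
    have "(A - 1\<^sub>m N) ^\<^sub>m Suc k = P * ((B - 1\<^sub>m N) ^\<^sub>m k * R) * (P * ((B - 1\<^sub>m N) * R))"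
      using Suc x by (simp add: mat_assoc)
    also have "\<dots> = P * ((B - 1\<^sub>m N) ^\<^sub>m k * ((R * P) * ((B - 1\<^sub>m N) * R)))" by (simp add: mat_assoc)
    also have "\<dots> = P * ((B - 1\<^sub>m N) ^\<^sub>m Suc k * R)" unfolding c(5) by (simp add: mat_assoc mat_mult_one)
    finally show ?case .
  qed
  then show "rk N ((A - 1\<^sub>m N) ^\<^sub>m k) = rk N ((B - 1\<^sub>m N) ^\<^sub>m k)"
    using rk_mult_inv_left[OF c(2,3,5), of "(B - 1\<^sub>m N) ^\<^sub>m k * R" N]
      rk_mult_inv_right[OF c(3,2,5), of "(B - 1\<^sub>m N) ^\<^sub>m k" N] pow_carrier_mat[OF Bc, of k] c(3) by simp
qed

text \<open>Listing the basis by decreasing weight makes \<open>v\<close> upper triangular, and a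
  triangular matrix has a Jordan normal form over its own field.\<close>

lemma wunip_jordan_nf:
  fixes v :: "'a::field mat"
  assumes v: "wunip N w v"
  obtains n_as where "jordan_nf v n_as"
proof -
  have vc: "v \<in> carrier_mat N N" using v by (simp add: wunip_def)
  define xs where "xs = sort_key (\<lambda>i. - w i) [0..<N]"
  have xs: "length xs = N" "set xs = {0..<N}" "distinct xs" by (simp_all add: xs_def)
  have xl: "xs ! i < N" if "i < N" for i using nth_mem[of i xs] that xs by auto
  have le: "w (xs ! j) \<le> w (xs ! i)" if "i \<le> j" "j < N" for i j
  proof -
    have "sorted (map (\<lambda>i. - w i) xs)" by (simp add: xs_def)
    then have "map (\<lambda>i. - w i) xs ! i \<le> map (\<lambda>i. - w i) xs ! j" by (rule sorted_nth_mono) (use that xs in auto)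
    then show ?thesis using that xs by simp
  qed
  define P :: "'a mat" where "P = mat N N (\<lambda>(i,j). if j = xs ! i then 1 else 0)"
  have Pc: "P \<in> carrier_mat N N" "transpose_mat P \<in> carrier_mat N N" by (simp_all add: P_def)
  have Pl: "(P * A) $$ (i,j) = A $$ (xs ! i, j)" if "A \<in> carrier_mat N N" "i < N" "j < N" for A i j
  proof -
    have "(P * A) $$ (i,j) = (\<Sum>k<N. if k = xs ! i then A $$ (xs ! i, j) else 0)"
      unfolding mat_mult_index[OF Pc(1) that] using that by (intro sum.cong) (auto simp: P_def)
    then show ?thesis using xl[OF that(2)] by simp
  qed
  have Pr: "(A * transpose_mat P) $$ (i,j) = A $$ (i, xs ! j)" if "A \<in> carrier_mat N N" "i < N" "j < N" for A i j
  proof -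
    have "(A * transpose_mat P) $$ (i,j) = (\<Sum>k<N. if k = xs ! j then A $$ (i, xs ! j) else 0)"
      unfolding mat_mult_index[OF that(1) Pc(2) that(2,3)] using that by (intro sum.cong) (auto simp: P_def)
    then show ?thesis using xl[OF that(3)] by simp
  qed
  have PP: "P * transpose_mat P = 1\<^sub>m N"
  proof (rule eq_matI)
    fix i j assume "i < dim_row (1\<^sub>m N :: 'a mat)" "j < dim_col (1\<^sub>m N :: 'a mat)"
    then have ij: "i < N" "j < N" by auto
    have "(P * transpose_mat P) $$ (i,j) = P $$ (i, xs ! j)" by (rule Pr[OF Pc(1) ij])
    also have "\<dots> = 1\<^sub>m N $$ (i,j)" using ij xl[OF ij(2)] nth_eq_iff_index_eq[OF xs(3), of i j] xs(1) by (auto simp: P_def)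
    finally show "(P * transpose_mat P) $$ (i,j) = 1\<^sub>m N $$ (i,j)" .
  qed (use Pc in auto)
  have PP': "transpose_mat P * P = 1\<^sub>m N" by (rule mat_mult_left_right_inverse[OF Pc PP])
  let ?B = "P * v * transpose_mat P"
  have Pv: "P * v \<in> carrier_mat N N" using Pc vc by auto
  have Bc: "?B \<in> carrier_mat N N" using Pc vc by auto
  have "similar_mat_wit ?B v P (transpose_mat P)" using Pc vc PP PP' Bc by (simp add: similar_mat_wit_def Let_def)
  then have sim: "similar_mat v ?B" using similar_mat_sym unfolding similar_mat_def by blast
  have "upper_triangular ?B"
  proof (rule upper_triangularI)
    fix i j assume ij: "j < i" "i < dim_row ?B"
    then have N: "i < N" "j < N" using Pc by auto
    have "?B $$ (i,j) = v $$ (xs ! i, xs ! j)" unfolding Pr[OF Pv N] by (rule Pl[OF vc N(1) xl[OF N(2)]])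
    moreover have "xs ! i \<noteq> xs ! j" using nth_eq_iff_index_eq[OF xs(3), of i j] xs(1) N ij by auto
    ultimately show "?B $$ (i,j) = 0" using v le[of j i] xl N ij unfolding wunip_def by simp
  qed
  from triangular_to_jnf_vector[OF Bc this] have "jordan_nf ?B (triangular_to_jnf_vector ?B)" .
  then have "jordan_nf v (triangular_to_jnf_vector ?B)"
    using similar_mat_trans[OF sim] unfolding jordan_nf_def by blast
  then show thesis by (rule that)
qed

text \<open>For \<open>i \<ge> 1\<close> these numbers are the parts of the conjugate
  partition.\<close>

definition geq :: "nat multiset \<Rightarrow> nat \<Rightarrow> nat" where
  "geq M i = size (filter_mset (\<lambda>x. i \<le> x) M)"

lemma geq_simps [simp]: "geq {#} i = 0" "geq (M + M') i = geq M i + geq M' i"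
  "geq (add_mset x M) i = (if i \<le> x then 1 else 0) + geq M i"
  by (simp_all add: geq_def)

lemma geq_replicate [simp]: "geq (replicate_mset c x) i = (if i \<le> x then c else 0)"
  by (induction c) auto

lemma geq_sum: "geq (\<Sum>j\<in>X. f j) i = (\<Sum>j\<in>X. geq (f j) i)"
  by (induction X rule: infinite_finite_induct) auto

lemma geq_filter_pos: "1 \<le> i \<Longrightarrow> geq (filter_mset (\<lambda>x. 0 < x) M) i = geq M i"
proof -
  assume "1 \<le> i"
  then have "(\<lambda>x. i \<le> x \<and> 0 < x) = (\<lambda>x. i \<le> x)" by (auto simp: fun_eq_iff)
  then show ?thesis by (simp add: geq_def filter_filter_mset conj_commute)
qed

lemma geq_count: "geq M x = geq M (Suc x) + count M x"
  by (induction M) auto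

lemma sum_min_geq: "(\<Sum>x\<in>#M. min (Suc k) x) = (\<Sum>x\<in>#M. min k x) + geq M (Suc k)"
  by (induction M) (auto simp: min_def)

text \<open>Differences of the sums in \<open>k\<close> are the conjugate parts, and their
  differences are the multiplicities. A part 0 leaves no trace in these sums and has to be
  excluded.\<close>

lemma mset_eqI_min_sums:
  fixes M M' :: "nat multiset"
  assumes "0 \<notin># M" "0 \<notin># M'" "\<And>k. (\<Sum>x\<in>#M. min k x) = (\<Sum>x\<in>#M'. min k x)"
  shows "M = M'"
proof (rule multiset_eqI)
  fix x
  have g: "geq M (Suc k) = geq M' (Suc k)" for k
    using sum_min_geq[of k M] sum_min_geq[of k M'] assms(3)[of k] assms(3)[of "Suc k"] by simp
  show "count M x = count M' x"
  proof (cases x)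
    case 0
    then show ?thesis using assms(1,2) by (simp add: not_in_iff)
  next
    case (Suc y)
    then show ?thesis using geq_count[of M x] geq_count[of M' x] g[of y] g[of x] by simp
  qed
qed

lemma sum_mset_mset: "(\<Sum>x\<in>#mset xs. h x) = sum_list (map h xs)"
  by (induction xs) auto

text \<open>The truncated sum is the corank of the \<open>k\<close>-th power of a nilpotent matrix
  whose Jordan blocks are the dual parts.\<close>

lemma dual_part_min_sum: "(\<Sum>x\<in>#dual_part M. min k x) = (\<Sum>i\<in>{1..sum_mset M}. min k (geq M i))"
proof -
  have f: "(\<Sum>x\<in>#filter_mset (\<lambda>x. 0 < x) X. min k x) = (\<Sum>x\<in>#X. min k x)" for X :: "nat multiset"
    by (induction X) auto
  have "(\<Sum>x\<in>#dual_part M. min k x) = sum_list (map (\<lambda>i. min k (geq M i)) [1..<Suc (sum_mset M)])"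
    unfolding dual_part_def f geq_def[symmetric] sum_mset_mset map_map o_def ..
  also have "\<dots> = (\<Sum>i\<in>{1..sum_mset M}. min k (geq M i))"
    by (simp add: sum_list_distinct_conv_sum_set atLeastLessThanSuc_atLeastAtMost del: upt_Suc)
  finally show ?thesis .
qed

lemma geq_zero: "sum_mset M < i \<Longrightarrow> geq M i = 0"
proof (induction M)
  case (add x M)
  then show ?case by auto
qed simp

lemma dual_part_min_sum':
  assumes "\<And>i. N < i \<Longrightarrow> geq M i = 0"
  shows "(\<Sum>x\<in>#dual_part M. min k x) = (\<Sum>i\<in>{1..N}. min k (geq M i))"
  unfolding dual_part_min_sum
  by (rule sum.mono_neutral_cong[of "{1..N}" "{1..sum_mset M}"]) (use assms geq_zero in \<open>auto simp: not_le\<close>)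

lemma sum_list_filter_split:
  "sum_list (map fst (filter P xs)) + sum_list (map fst (filter (\<lambda>x. \<not> P x) xs)) = (sum_list (map fst xs) :: nat)"
  by (induction xs) auto

lemma sum_list_min_le: "(\<Sum>n\<leftarrow>xs. min K n) \<le> (sum_list xs :: nat)"
  by (induction xs) auto

text \<open>Nilpotency of \<open>u - 1\<close> makes the blocks of eigenvalue 1 exhaust the
  dimension. The coranks of the powers are then the truncated sums of the block sizes, which
  determine them.\<close>

lemma jordan_type_of_ranks:
  fixes u :: "'a::field mat"
  assumes jnf: "jordan_nf u n_as" and u: "u \<in> carrier_mat N N"
    and nil: "(u - 1\<^sub>m N) ^\<^sub>m K = 0\<^sub>m N N"
    and r: "\<And>k. rk N ((u - 1\<^sub>m N) ^\<^sub>m k) + (\<Sum>x\<in>#M. min k x) = N" and M: "0 \<notin># M"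
  shows "jordan_type u M"
proof -
  have cm: "char_matrix u 1 = u - 1\<^sub>m N" unfolding char_matrix_def using u by (intro eq_matI) auto
  have c: "(u - 1\<^sub>m N) ^\<^sub>m k \<in> carrier_mat N N" for k by (rule pow_carrier_mat) (use u in auto)
  let ?E = "\<lambda>x :: nat \<times> 'a. case x of (n, e) \<Rightarrow> e = 1"
  let ?l1 = "filter ?E n_as" and ?l2 = "filter (\<lambda>x. \<not> ?E x) n_as"
  have d: "(\<Sum>n\<leftarrow>map fst ?l1. min k n) = N - rk N ((u - 1\<^sub>m N) ^\<^sub>m k)" for k
    using dim_gen_eigenspace[OF jnf, of 1 k] unfolding dim_gen_eigenspace_def cm kernel_dim_eq_rk[OF c] by simp
  have pos: "0 \<notin> fst ` set n_as" and sim: "similar_mat u (jordan_matrix n_as)" using jnf unfolding jordan_nf_def by auto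
  have "jordan_matrix n_as \<in> carrier_mat N N" by (rule similar_rk_pow(2)[OF sim u])
  from carrier_matD(1)[OF this] have N: "sum_list (map fst n_as) = N" unfolding jordan_matrix_dim .
  have "(\<Sum>n\<leftarrow>map fst ?l1. min K n) = N" unfolding d nil by (simp add: rk_zero)
  then have z: "sum_list (map fst ?l2) = 0"
    using sum_list_filter_split[of ?E n_as] N sum_list_min_le[of K "map fst ?l1"] by linarith
  have "filter (\<lambda>x. \<not> ?E x) n_as = []"
  proof (rule ccontr)
    assume "\<not> ?thesis"
    then obtain x where x: "x \<in> set ?l2" using list.set_sel(1) by blast
    then have "fst x = 0" using z unfolding sum_list_eq_0_iff by auto
    moreover have "x \<in> set n_as" using x by auto
    ultimately show False using pos by (metis image_eqI)
  qed
  then have l1: "?l1 = n_as" unfolding filter_empty_conv by (intro filter_True) simp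
  have "mset (map fst n_as) = M"
  proof (rule mset_eqI_min_sums)
    show "0 \<notin># mset (map fst n_as)" using pos by simp
    show "0 \<notin># M" by (rule M)
    fix k
    have "(\<Sum>x\<in>#mset (map fst n_as). min k x) = (\<Sum>n\<leftarrow>map fst n_as. min k n)"
      by (rule sum_mset_mset)
    also have "\<dots> = N - rk N ((u - 1\<^sub>m N) ^\<^sub>m k)" using d[of k] unfolding l1 .
    also have "\<dots> = (\<Sum>x\<in>#M. min k x)" using r[of k] by simp
    finally show "(\<Sum>x\<in>#mset (map fst n_as). min k x) = (\<Sum>x\<in>#M. min k x)" .
  qed
  then show ?thesis using jnf unfolding jordan_type_def by blast
qed

lemma grp_carrier: "g \<in> grp ty n \<Longrightarrow> g \<in> carrier_mat (dimN ty n) (dimN ty n)"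
  by (cases ty) (auto simp: grp_def orth_group_def Let_def)

lemma grp_inverse:
  assumes g: "g \<in> grp ty n"
  obtains gi where "gi \<in> carrier_mat (dimN ty n) (dimN ty n)" "g * gi = 1\<^sub>m (dimN ty n)" "gi * (g :: 'a::field mat) = 1\<^sub>m (dimN ty n)"
proof -
  let ?N = "dimN ty n"
  have gc: "g \<in> carrier_mat ?N ?N" by (rule grp_carrier[OF g])
  have "\<exists>gi\<in>carrier_mat ?N ?N. gi * g = 1\<^sub>m ?N"
  proof (cases "ty = Spt")
    case False
    then have "det g \<noteq> 0" using g by (cases ty) (auto simp: grp_def orth_group_def Let_def)
    from det_non_zero_imp_unit[OF gc this, of "()"] show ?thesis
      unfolding Units_def ring_mat_def by auto
  next
    case True
    let ?J = "Jsp ?N :: 'a mat" and ?H = "adiag ?N (\<lambda>i. inverse (if ?N - 1 - i < ?N div 2 then 1 else - 1)) :: 'a mat"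
    have HJ: "?H * ?J = 1\<^sub>m ?N" unfolding Jsp_adiag by (rule adiag_mult_inverse(2)) simp
    have e: "transpose_mat g * ?J * g = ?J" using g True by (simp add: grp_def Let_def)
    note [simp] = carrier_matD[OF gc]
    have [simp]: "dim_row ?J = ?N" "dim_col ?J = ?N" by (simp_all add: Jsp_def)
    have "?H * (transpose_mat g * ?J) * g = ?H * (transpose_mat g * ?J * g)" by (simp add: mat_assoc)
    then have "?H * (transpose_mat g * ?J) * g = 1\<^sub>m ?N" unfolding e HJ .
    moreover have "?H * (transpose_mat g * ?J) \<in> carrier_mat ?N ?N" by (rule carrier_matI; simp)
    ultimately show ?thesis by blast
  qed
  then obtain gi where gi: "gi \<in> carrier_mat ?N ?N" "gi * g = 1\<^sub>m ?N" by blast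
  from mat_mult_left_right_inverse[OF gi(1) gc gi(2)] show thesis by (rule that[OF gi(1) _ gi(2)])
qed

lemma one_in_grp: "1\<^sub>m (dimN ty n) \<in> (grp ty n :: 'a::field mat set)"
proof -
  have J: "(Jsp (2 * n) :: 'a mat) \<in> carrier_mat (2 * n) (2 * n)" by (simp add: Jsp_def)
  have e: "1\<^sub>m N - 1\<^sub>m N = (0\<^sub>m N N :: 'a mat)" for N by (rule eq_matI) auto
  have z: "vec_space.rank N (1\<^sub>m N - 1\<^sub>m N :: 'a mat) = 0" for N unfolding e by (simp add: rk_zero)
  show ?thesis
  proof (cases ty)
    case Spt
    then show ?thesis using left_mult_one_mat[OF J] right_mult_one_mat[OF J] by (simp add: grp_def Let_def)
  qed (use z in \<open>auto simp: grp_def orth_group_def Let_def\<close>)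
qed

section \<open>The Levi partition and the block sizes\<close>

text \<open>\<open>f\<close> weakly decreases and stays constant exactly along \<open>J\<close>, so
  the runs of \<open>J\<close> are its level sets; each run is indexed by its first element on one
  side and by its value on the other.\<close>

lemma run_parts:
  fixes f :: "nat \<Rightarrow> nat"
  assumes step: "\<And>k. 1 \<le> k \<Longrightarrow> k < r \<Longrightarrow> f (Suc k) \<le> f k \<and> (f k = f (Suc k) \<longleftrightarrow> k \<in> J)"
  shows "image_mset (\<lambda>s. (LEAST t. s \<le> t \<and> (t = r \<or> t \<notin> J)) - s + 1) (mset_set {s \<in> {1..r}. s = 1 \<or> s - 1 \<notin> J})
    = image_mset (\<lambda>v. card {k \<in> {1..r}. f k = v}) (mset_set (f ` {1..r}))"
proof -
  define e where "e s = (LEAST t. s \<le> t \<and> (t = r \<or> t \<notin> J))" for s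
  define S where "S = {s \<in> {1..r}. s = 1 \<or> s - 1 \<notin> J}"
  have mono: "f b \<le> f a" if "1 \<le> a" "a \<le> b" "b \<le> r" for a b
    using that(2,3)
  proof (induction b rule: dec_induct)
    case (step b)
    then show ?case using assms[of b] that(1) by simp
  qed simp
  have block: "{k \<in> {1..r}. f k = f s} = {s..e s} \<and> s \<le> e s" if s: "s \<in> S" for s
  proof -
    have sr: "1 \<le> s" "s \<le> r" using s by (auto simp: S_def)
    have E: "s \<le> e s \<and> (e s = r \<or> e s \<notin> J)" unfolding e_def by (rule LeastI[of _ r]) (use sr in simp)
    have er: "e s \<le> r" unfolding e_def by (rule Least_le) (use sr in simp)
    have below: "t \<in> J" if "s \<le> t" "t < e s" for t
      using not_less_Least[of t "\<lambda>t. s \<le> t \<and> (t = r \<or> t \<notin> J)"] that unfolding e_def by blast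
    have const: "f t = f s" if "s \<le> t" "t \<le> e s" for t
      using that
    proof (induction t rule: dec_induct)
      case (step t)
      then have "t \<in> J" using below by simp
      then show ?case using assms[of t] step sr er by simp
    qed simp
    have after: "f k < f s" if "e s < k" "k \<le> r" for k
    proof -
      have "e s \<notin> J" using E that by auto
      then have "f (Suc (e s)) < f (e s)" using assms[of "e s"] E sr that by fastforce
      moreover have "f k \<le> f (Suc (e s))" by (rule mono) (use that in auto)
      ultimately show ?thesis using const[of "e s"] E by simp
    qed
    have before: "f s < f k" if "1 \<le> k" "k < s" for k
    proof -
      have s1: "s - 1 \<notin> J" "Suc (s - 1) = s" using s that by (auto simp: S_def)
      then have "f s < f (s - 1)" using assms[of "s - 1"] sr that by fastforce
      moreover have "f (s - 1) \<le> f k" by (rule mono) (use that sr in auto)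
      ultimately show ?thesis by simp
    qed
    have "{k \<in> {1..r}. f k = f s} = {s..e s}"
    proof (intro equalityI subsetI)
      fix k assume k: "k \<in> {k \<in> {1..r}. f k = f s}"
      then have "\<not> e s < k" "\<not> k < s" using after[of k] before[of k] by auto
      then show "k \<in> {s..e s}" by simp
    next
      fix k assume "k \<in> {s..e s}"
      then show "k \<in> {k \<in> {1..r}. f k = f s}" using const[of k] sr er by auto
    qed
    then show ?thesis using E by simp
  qed
  have inj: "inj_on f S"
  proof (rule inj_onI)
    fix s s' assume a: "s \<in> S" "s' \<in> S" "f s = f s'"
    have "s' \<in> {k \<in> {1..r}. f k = f s}" "s \<in> {k \<in> {1..r}. f k = f s'}" using a by (auto simp: S_def)
    then have "s' \<in> {s..e s}" "s \<in> {s'..e s'}" using block[OF a(1)] block[OF a(2)] by auto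
    then show "s = s'" by simp
  qed
  have im: "f ` S = f ` {1..r}"
  proof (intro equalityI subsetI)
    fix v assume "v \<in> f ` {1..r}"
    then obtain k where k: "1 \<le> k" "k \<le> r" "v = f k" by auto
    define s where "s = (LEAST x. 1 \<le> x \<and> f x = f k)"
    have s: "1 \<le> s \<and> f s = f k" unfolding s_def by (rule LeastI[of _ k]) (use k in simp)
    have sk: "s \<le> k" unfolding s_def by (rule Least_le) (use k in simp)
    have "s = 1 \<or> s - 1 \<notin> J"
    proof (rule ccontr)
      assume n: "\<not> ?thesis"
      then have "f (s - 1) = f (Suc (s - 1))" using assms[of "s - 1"] s sk k by auto
      then have "1 \<le> s - 1 \<and> f (s - 1) = f k" using s n by auto
      then have "s \<le> s - 1" unfolding s_def by (rule Least_le)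
      then show False using s by linarith
    qed
    then show "v \<in> f ` S" using s sk k by (auto simp: S_def intro!: image_eqI[of _ _ s])
  qed (auto simp: S_def)
  have "image_mset (\<lambda>v. card {k \<in> {1..r}. f k = v}) (mset_set (f ` {1..r})) = image_mset (\<lambda>s. card {k \<in> {1..r}. f k = f s}) (mset_set S)"
    unfolding im[symmetric] image_mset_mset_set[OF inj, symmetric] multiset.map_comp o_def ..
  also have "\<dots> = image_mset (\<lambda>s. e s - s + 1) (mset_set S)"
  proof (rule image_mset_cong)
    fix s assume "s \<in># mset_set S"
    then have "s \<in> S" by (simp add: S_def)
    then show "card {k \<in> {1..r}. f k = f s} = e s - s + 1" using block[of s] by (simp add: Suc_diff_le)
  qed
  finally show ?thesis unfolding e_def S_def ..
qed

lemma geq_image_mset_set: "finite S \<Longrightarrow> geq (image_mset h (mset_set S)) i = card {v \<in> S. i \<le> h v}"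
  by (simp add: geq_def filter_mset_image_mset filter_mset_mset_set)

text \<open>In type D the last coordinate of the cocharacter can be \<open>- 1\<close>. The absolute
  value forgets which of the last two roots lies in \<open>J\<close>, just as \<open>normJ\<close>
  does.\<close>

definition coch_abs :: "cgroup \<Rightarrow> nat \<Rightarrow> nat set \<Rightarrow> nat \<Rightarrow> nat" where
  "coch_abs ty n J k = nat \<bar>coch_a ty n J k\<bar>"

text \<open>For groups with a form weights count up to sign, and the zero block is left to the
  classical factor.\<close>

definition block_sizes :: "cgroup \<Rightarrow> nat \<Rightarrow> nat set \<Rightarrow> nat multiset" where
  "block_sizes ty n J = image_mset (\<lambda>v. card {k \<in> {1..n}. coch_abs ty n J k = v})
    (mset_set {v \<in> coch_abs ty n J ` {1..n}. ty = GLt \<or> 0 < v})"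

lemma block_sizes_pos: "0 \<notin># block_sizes ty n J"
  by (auto simp: block_sizes_def card_eq_0_iff)

lemma dim_bounds: "ty \<noteq> GLt \<Longrightarrow> dimN ty n = 2 * n + (if ty = SOodd then 1 else 0)"
  by (cases ty) auto

lemma sym_wt: 
  assumes "ty \<noteq> GLt"
  shows "sym_wt (dimN ty n) (wt ty n J)"
proof -
  let ?N = "dimN ty n"
  have N: "2 * n \<le> ?N" "?N \<le> 2 * n + 1" using dim_bounds[OF assms, of n] by auto
  have "wt ty n J (?N - 1 - i) = - wt ty n J i" if i: "i < ?N" for i
  proof -
    consider "i < n" | "?N - n \<le> i" | "n \<le> i" "i < ?N - n" by linarith
    then show ?thesis
    proof cases
      case 1
      then have "\<not> ?N - 1 - i < n" "?N - n \<le> ?N - 1 - i" "?N - (?N - 1 - i) = i + 1" using N i by linarith+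
      then show ?thesis unfolding wt_def using assms 1 by (simp only: if_False if_True)
    next
      case 2
      then have "?N - 1 - i < n" "\<not> i < n" "?N - 1 - i + 1 = ?N - i" using N i by linarith+
      then show ?thesis unfolding wt_def using assms 2 by (simp only: if_False if_True minus_minus)
    next
      case 3
      then have "\<not> ?N - 1 - i < n" "\<not> ?N - n \<le> ?N - 1 - i" "\<not> i < n" "\<not> ?N - n \<le> i" using N i by linarith+
      then show ?thesis unfolding wt_def using assms by (simp only: if_False minus_zero)
    qed
  qed
  then show ?thesis unfolding sym_wt_def by blast
qed

text \<open>Of the two dual positions belonging to such a \<open>k\<close> exactly one has weight
  \<open>v\<close>; the sign of the cocharacter at \<open>k\<close> decides which.\<close>

lemma dW_pos_weight:
  assumes "ty \<noteq> GLt" "0 < v"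
  shows "dW (dimN ty n) (wt ty n J) (int v) = card {k \<in> {1..n}. coch_abs ty n J k = v}"
proof -
  let ?N = "dimN ty n" and ?c = "coch_a ty n J"
  have N: "2 * n \<le> ?N" using dim_bounds[OF assms(1), of n] by auto
  have w: "wt ty n J i = (if i < n then ?c (i + 1) else if ?N - n \<le> i then - ?c (?N - i) else 0)" for i
    unfolding wt_def using assms(1) by simp
  show ?thesis unfolding dW_def
  proof (rule bij_betw_same_card[of "\<lambda>i. if i < n then i + 1 else ?N - i"],
      rule bij_betwI[where g = "\<lambda>k. if ?c k = int v then k - 1 else ?N - k"])
    show "(\<lambda>i. if i < n then i + 1 else ?N - i) \<in> {i. i < ?N \<and> wt ty n J i = int v} \<rightarrow> {k \<in> {1..n}. coch_abs ty n J k = v}"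
      using assms(2) N by (auto simp: w coch_abs_def split: if_splits)
    show "(\<lambda>k. if ?c k = int v then k - 1 else ?N - k) \<in> {k \<in> {1..n}. coch_abs ty n J k = v} \<rightarrow> {i. i < ?N \<and> wt ty n J i = int v}"
    proof
      fix k assume k: "k \<in> {k \<in> {1..n}. coch_abs ty n J k = v}"
      then have kn: "1 \<le> k" "k \<le> n" and c: "?c k = int v \<or> ?c k = - int v" by (auto simp: coch_abs_def)
      show "(if ?c k = int v then k - 1 else ?N - k) \<in> {i. i < ?N \<and> wt ty n J i = int v}"
      proof (cases "?c k = int v")
        case True
        then have "wt ty n J (k - 1) = int v" "k - 1 < ?N" using w[of "k - 1"] kn N by auto
        then show ?thesis using True by simp
      next
        case False
        have "\<not> ?N - k < n \<or> ?N - k < n \<and> False" using kn N by linarith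
        then have "wt ty n J (?N - k) = - ?c (?N - (?N - k))" using w[of "?N - k"] kn N by auto
        moreover have "?N - (?N - k) = k" "?N - k < ?N" using kn N by auto
        ultimately show ?thesis using False c by simp
      qed
    qed
    show "(if ?c (if i < n then i + 1 else ?N - i) = int v then (if i < n then i + 1 else ?N - i) - 1 else ?N - (if i < n then i + 1 else ?N - i)) = i"
      if "i \<in> {i. i < ?N \<and> wt ty n J i = int v}" for i
      using that assms(2) by (auto simp: w split: if_splits)
    show "(if (if ?c k = int v then k - 1 else ?N - k) < n then (if ?c k = int v then k - 1 else ?N - k) + 1 else ?N - (if ?c k = int v then k - 1 else ?N - k)) = k"
      if "k \<in> {k \<in> {1..n}. coch_abs ty n J k = v}" for k
    proof (cases "?c k = int v")
      case False
      have "\<not> ?N - k < n" "?N - (?N - k) = k" using that N by auto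
      then show ?thesis using False by simp
    qed (use that in auto)
  qed
qed

lemma dW_zero_weight:
  assumes "ty \<noteq> GLt"
  shows "dW (dimN ty n) (wt ty n J) 0 = 2 * card {k \<in> {1..n}. coch_abs ty n J k = 0} + (if ty = SOodd then 1 else 0)"
proof -
  let ?N = "dimN ty n" and ?c = "coch_a ty n J"
  have N: "?N = 2 * n + (if ty = SOodd then 1 else 0)" by (rule dim_bounds[OF assms])
  have N2: "2 * n \<le> ?N" "?N - n - n = (if ty = SOodd then 1 else 0)" using N by auto
  have w: "wt ty n J i = (if i < n then ?c (i + 1) else if ?N - n \<le> i then - ?c (?N - i) else 0)" for i
    unfolding wt_def using assms by simp
  let ?A = "{i. i < n \<and> ?c (i + 1) = 0}" and ?B = "{i. ?N - n \<le> i \<and> i < ?N \<and> ?c (?N - i) = 0}" and ?C = "{n..<?N - n}"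
  let ?Z = "{k \<in> {1..n}. coch_abs ty n J k = 0}"
  have cA: "card ?A = card ?Z"
    by (rule bij_betw_same_card[of "\<lambda>i. i + 1"], rule bij_betwI[where g = "\<lambda>k. k - 1"]) (auto simp: coch_abs_def)
  have cB: "card ?B = card ?Z"
    by (rule bij_betw_same_card[of "\<lambda>i. ?N - i"], rule bij_betwI[where g = "\<lambda>k. ?N - k"]) (use N2 in \<open>auto simp: coch_abs_def\<close>)
  have "{i. i < ?N \<and> wt ty n J i = 0} = ?A \<union> ?B \<union> ?C"
  proof (intro equalityI subsetI)
    fix i assume "i \<in> {i. i < ?N \<and> wt ty n J i = 0}"
    then show "i \<in> ?A \<union> ?B \<union> ?C" using w[of i] by (auto split: if_splits)
  next
    fix i assume "i \<in> ?A \<union> ?B \<union> ?C"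
    then show "i \<in> {i. i < ?N \<and> wt ty n J i = 0}" using w[of i] N2 by auto
  qed
  moreover have "card (?A \<union> ?B \<union> ?C) = card (?A \<union> ?B) + card ?C" by (rule card_Un_disjoint) (use N2 in auto)
  moreover have "card (?A \<union> ?B) = card ?A + card ?B" by (rule card_Un_disjoint) (use N2 in auto)
  moreover have "card ?C = (if ty = SOodd then 1 else 0)" using N2 by simp
  ultimately show ?thesis unfolding dW_def cA cB by simp
qed

lemma cW_block_sizes:
  fixes ty :: cgroup and n :: nat and J :: "nat set"
  assumes i: "1 \<le> i"
  defines "N \<equiv> dimN ty n" and "w \<equiv> wt ty n J"
  shows "ty \<noteq> GLt \<Longrightarrow> cW N w i = 2 * geq (block_sizes ty n J) i + (if i \<le> dW N w 0 then 1 else 0)"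
    and "ty = GLt \<Longrightarrow> cW N w i = geq (block_sizes ty n J) i"
proof -
  let ?f = "coch_abs ty n J"
  let ?h = "\<lambda>v. card {k \<in> {1..n}. ?f k = v}"
  have fin: "finite {v \<in> ?f ` {1..n}. ty = GLt \<or> 0 < v}" by simp
  have hpos: "v \<in> ?f ` {1..n} \<longleftrightarrow> 0 < ?h v" for v by (subst card_gt_0_iff) auto
  show "cW N w i = 2 * geq (block_sizes ty n J) i + (if i \<le> dW N w 0 then 1 else 0)" if ty: "ty \<noteq> GLt"
  proof -
    note s = sym_wt[OF ty, of n J, folded N_def w_def]
    have d: "0 < v \<Longrightarrow> dW N w (int v) = ?h v" for v unfolding N_def w_def by (rule dW_pos_weight[OF ty])
    have "{t \<in> w ` {..<N}. t < 0 \<and> i \<le> dW N w t} = (\<lambda>v. - int v) ` {v \<in> {v \<in> ?f ` {1..n}. ty = GLt \<or> 0 < v}. i \<le> ?h v}"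
    proof (intro equalityI subsetI)
      fix t assume "t \<in> {t \<in> w ` {..<N}. t < 0 \<and> i \<le> dW N w t}"
      then have t: "t < 0" "i \<le> dW N w t" by auto
      define v where "v = nat (- t)"
      have v: "t = - int v" "0 < v" using t by (auto simp: v_def)
      then have "i \<le> ?h v" using t(2) d dW_uminus[OF s, of "int v"] by simp
      then have "v \<in> {v \<in> {v \<in> ?f ` {1..n}. ty = GLt \<or> 0 < v}. i \<le> ?h v}" using i v hpos[of v] by simp
      then show "t \<in> (\<lambda>v. - int v) ` {v \<in> {v \<in> ?f ` {1..n}. ty = GLt \<or> 0 < v}. i \<le> ?h v}" using v(1) by blast
    next
      fix t assume "t \<in> (\<lambda>v. - int v) ` {v \<in> {v \<in> ?f ` {1..n}. ty = GLt \<or> 0 < v}. i \<le> ?h v}"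
      then obtain v where v: "t = - int v" "0 < v" "i \<le> ?h v" using ty by auto
      then have "i \<le> dW N w t" using d dW_uminus[OF s, of "int v"] by simp
      then show "t \<in> {t \<in> w ` {..<N}. t < 0 \<and> i \<le> dW N w t}" using v i dW_pos[of t w N] by simp
    qed
    then have "card {t \<in> w ` {..<N}. t < 0 \<and> i \<le> dW N w t} = card {v \<in> {v \<in> ?f ` {1..n}. ty = GLt \<or> 0 < v}. i \<le> ?h v}"
      by (simp only:) (rule card_image, simp add: inj_on_def)
    then show ?thesis
      unfolding cW_split_zero[OF i, of N w] card_nonzero_weights[OF s] block_sizes_def geq_image_mset_set[OF fin] by simp
  qed
  show "cW N w i = geq (block_sizes ty n J) i" if ty: "ty = GLt"
  proof -
    have wf: "w j = int (?f (j + 1))" for j unfolding w_def wt_def coch_abs_def using ty by (simp add: coch_a_def)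
    have d: "dW N w (int v) = ?h v" for v unfolding dW_def
      by (rule bij_betw_same_card[of "\<lambda>i. i + 1"], rule bij_betwI[where g = "\<lambda>k. k - 1"]) (auto simp: wf N_def ty)
    have "w ` {..<N} = int ` ?f ` {1..n}"
    proof -
      have "{1..n} = Suc ` {..<N}" using ty by (simp add: N_def image_Suc_lessThan)
      then show ?thesis by (simp add: image_image wf)
    qed
    then have "{t \<in> w ` {..<N}. i \<le> dW N w t} = int ` {v \<in> {v \<in> ?f ` {1..n}. ty = GLt \<or> 0 < v}. i \<le> ?h v}"
      using ty d by auto
    then have "cW N w i = card {v \<in> {v \<in> ?f ` {1..n}. ty = GLt \<or> 0 < v}. i \<le> ?h v}"
      unfolding cW_def by (simp only:) (rule card_image, simp)
    then show ?thesis unfolding block_sizes_def geq_image_mset_set[OF fin] .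
  qed
qed

lemma card_tail: "finite S \<Longrightarrow> card {j \<in> S. k \<le> j} = card {j \<in> S. Suc k \<le> j} + (if k \<in> S then 1 else 0)"
proof -
  assume S: "finite S"
  have "{j \<in> S. k \<le> j} = {j \<in> S. Suc k \<le> j} \<union> (if k \<in> S then {k} else {})" by (auto simp: Suc_le_eq le_less)
  moreover have "card ({j \<in> S. Suc k \<le> j} \<union> (if k \<in> S then {k} else {})) = card {j \<in> S. Suc k \<le> j} + card (if k \<in> S then {k} else {})"
    by (rule card_Un_disjoint) (use S in auto)
  ultimately show ?thesis by simp
qed

text \<open>The case where the cocharacter is \<open>1 - 1 = 0\<close> at \<open>n\<close>: the zero
  block has size 2 although \<open>m = 0\<close>.\<close>

definition split_end :: "cgroup \<Rightarrow> nat \<Rightarrow> nat set \<Rightarrow> bool" where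
  "split_end ty n J \<longleftrightarrow> ty = SOeven \<and> n \<notin> J \<and> n - 1 \<notin> J"

text \<open>The delicate step is the last one in type D, from \<open>x + y\<close> to the absolute
  value of \<open>y - x\<close>. These differ only if \<open>x = y = 1\<close>, which matches the
  membership of \<open>n - 1\<close> in \<open>normJ\<close>.\<close>

lemma coch_abs_step:
  assumes r: "valid_rank ty n" and k: "1 \<le> k" "k < n"
  shows "coch_abs ty n J (Suc k) \<le> coch_abs ty n J k \<and> (coch_abs ty n J k = coch_abs ty n J (Suc k) \<longleftrightarrow> k \<in> normJ ty n J)"
proof (cases "ty = SOeven")
  case False
  have e: "coch_abs ty n J k = card {j \<in> simple_roots ty n - J. k \<le> j}" for k
    using False by (cases ty) (auto simp: coch_abs_def coch_a_def)
  have s: "k \<in> simple_roots ty n" and fin: "finite (simple_roots ty n - J)" using k by (cases ty; simp)+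
  show ?thesis unfolding e card_tail[OF fin, of k] using False s by (simp add: normJ_def)
next
  case True
  then have n: "2 \<le> n" using r by simp
  let ?S = "{1..n - 2} - J"
  let ?x = "if n - 1 \<notin> J then 1 else 0 :: nat" and ?y = "if n \<notin> J then 1 else 0 :: nat"
  have e: "coch_abs ty n J k = ?x + ?y + card {j \<in> ?S. k \<le> j}" if "k \<noteq> n" for k
    using True that unfolding coch_abs_def coch_a_def by (simp add: Let_def nat_add_distrib)
  have en: "coch_abs ty n J n = (if n - 1 \<in> J \<longleftrightarrow> n \<in> J then 0 else 1)"
    using True unfolding coch_abs_def coch_a_def by (simp add: Let_def)
  show ?thesis
  proof (cases "k = n - 1")
    case False
    then have k': "k \<in> {1..n - 2}" "Suc k \<noteq> n" "k \<noteq> n" "k \<noteq> n - 1" using k by auto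
    then have "k \<in> normJ ty n J \<longleftrightarrow> k \<in> J" by (auto simp: normJ_def)
    then show ?thesis unfolding e[OF k'(2)] e[OF k'(3)] card_tail[of ?S k, OF finite_Diff[OF finite_atLeastAtMost]] using k'(1) by simp
  next
    case kn: True
    have "{j \<in> ?S. n - 1 \<le> j} = {}" using n by auto
    then have c: "coch_abs ty n J (n - 1) = ?x + ?y" using e[of "n - 1"] n by simp
    have "Suc k = n" using kn n by simp
    then show ?thesis unfolding kn c using en c True n by (auto simp: normJ_def)
  qed
qed

lemma coch_abs_end:
  assumes r: "valid_rank ty n" and ty: "ty \<noteq> GLt"
  shows "\<not> split_end ty n J \<Longrightarrow> coch_abs ty n J n = 0 \<longleftrightarrow> n \<in> normJ ty n J"
    and "split_end ty n J \<Longrightarrow> coch_abs ty n J n = 0"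
proof -
  have en: "coch_abs ty n J n = (if n - 1 \<in> J \<longleftrightarrow> n \<in> J then 0 else 1)" if "ty = SOeven"
    using that unfolding coch_abs_def coch_a_def by (simp add: Let_def)
  show "coch_abs ty n J n = 0" if "split_end ty n J" using that en by (auto simp: split_end_def)
  show "coch_abs ty n J n = 0 \<longleftrightarrow> n \<in> normJ ty n J" if ns: "\<not> split_end ty n J"
  proof (cases "ty = SOeven")
    case True
    then have "2 \<le> n" using r by simp
    then show ?thesis using en[OF True] ns True by (auto simp: normJ_def split_end_def)
  next
    case False
    have n: "1 \<le> n" using r False by (cases ty) auto
    have "coch_abs ty n J n = card {j \<in> {1..n} - J. n \<le> j}"
      using False ty by (cases ty) (auto simp: coch_abs_def coch_a_def)
    also have "{j \<in> {1..n} - J. n \<le> j} = (if n \<in> J then {} else {n})" using n by auto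
    finally show ?thesis using False by (simp add: normJ_def)
  qed
qed

lemma levi_parts_run:
  assumes r: "valid_rank ty n"
  shows "levi_gl_parts ty n J = image_mset (\<lambda>v. card {k \<in> {1..n - levi_m ty n J}. coch_abs ty n J k = v})
    (mset_set (coch_abs ty n J ` {1..n - levi_m ty n J}))"
  unfolding levi_gl_parts_def Let_def
  by (rule run_parts, rule coch_abs_step[OF r]) auto

text \<open>The values weakly decrease, so their zeros form a final segment, namely the longest one
  contained in \<open>normJ\<close>.\<close>

lemma coch_abs_zero_iff:
  assumes r: "valid_rank ty n" and ty: "ty \<noteq> GLt" and ns: "\<not> split_end ty n J" and k: "1 \<le> k" "k \<le> n"
  shows "coch_abs ty n J k = 0 \<longleftrightarrow> n - levi_m ty n J < k" "levi_m ty n J \<le> n"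
proof -
  let ?J = "normJ ty n J" and ?m = "levi_m ty n J"
  have z: "coch_abs ty n J k = 0 \<longleftrightarrow> {k..n} \<subseteq> ?J"
    using k(2,1)
  proof (induction k rule: inc_induct)
    case base
    then show ?case using coch_abs_end(1)[OF r ty ns] by simp
  next
    case (step k)
    have "{k..n} = insert k {Suc k..n}" using step by auto
    then show ?case using step coch_abs_step[OF r, of k J] by auto
  qed
  have "?m \<le> n \<and> (coch_abs ty n J k = 0 \<longleftrightarrow> n - ?m < k)"
  proof (cases "n \<in> ?J")
    case True
    let ?P = "\<lambda>m. m \<le> n \<and> {n - m + 1..n} \<subseteq> ?J"
    have m: "?m = Greatest ?P" using ty True by (simp add: levi_m_def Let_def)
    have P: "?P ?m" unfolding m by (rule GreatestI_nat[of ?P 0 n]) auto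
    have "{k..n} \<subseteq> ?J \<longleftrightarrow> n - ?m < k"
    proof
      assume "{k..n} \<subseteq> ?J"
      moreover have "n - (n + 1 - k) + 1 = k" using k by simp
      ultimately have "?P (n + 1 - k)" using k by simp
      then have "n + 1 - k \<le> ?m" unfolding m by (rule Greatest_le_nat[of ?P _ n]) auto
      then show "n - ?m < k" using k by linarith
    next
      assume "n - ?m < k"
      then have "{k..n} \<subseteq> {n - ?m + 1..n}" by auto
      then show "{k..n} \<subseteq> ?J" using P by blast
    qed
    then show ?thesis unfolding z using P by blast
  next
    case False
    then have "?m = 0" by (simp add: levi_m_def Let_def)
    moreover have "\<not> {k..n} \<subseteq> ?J" using False k by auto
    ultimately show ?thesis unfolding z using k by simp
  qed
  then show "coch_abs ty n J k = 0 \<longleftrightarrow> n - ?m < k" "?m \<le> n" by blast+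
qed

text \<open>In the split case the last coordinate is a \<open>GL_1\<close> part of the Levi
  partition but belongs to the zero block of the weights.\<close>

lemma levi_blocks:
  assumes r: "valid_rank ty n"
  shows "ty = GLt \<Longrightarrow> levi_gl_parts ty n J = block_sizes ty n J"
    and "ty \<noteq> GLt \<Longrightarrow> \<not> split_end ty n J \<Longrightarrow> levi_gl_parts ty n J = block_sizes ty n J \<and>
      card {k \<in> {1..n}. coch_abs ty n J k = 0} = levi_m ty n J"
    and "split_end ty n J \<Longrightarrow> levi_gl_parts ty n J = add_mset 1 (block_sizes ty n J) \<and>
      card {k \<in> {1..n}. coch_abs ty n J k = 0} = 1 \<and> levi_m ty n J = 0"
proof -
  let ?f = "coch_abs ty n J" and ?m = "levi_m ty n J"
  have n: "1 \<le> n" using r by (cases ty) auto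
  show "levi_gl_parts ty n J = block_sizes ty n J" if "ty = GLt"
  proof -
    have "?m = 0" using that by (simp add: levi_m_def Let_def)
    then show ?thesis unfolding levi_parts_run[OF r] block_sizes_def using that by simp
  qed
  show "levi_gl_parts ty n J = block_sizes ty n J \<and> card {k \<in> {1..n}. ?f k = 0} = ?m" if ty: "ty \<noteq> GLt" "\<not> split_end ty n J"
  proof
    have z: "?f k = 0 \<longleftrightarrow> n - ?m < k" if "k \<in> {1..n}" for k using coch_abs_zero_iff(1)[OF r ty] that by simp
    have m: "?m \<le> n" using coch_abs_zero_iff(2)[OF r ty n] by simp
    have S: "{1..n - ?m} = {k \<in> {1..n}. 0 < ?f k}" using z by fastforce
    have im: "?f ` {1..n - ?m} = {v \<in> ?f ` {1..n}. ty = GLt \<or> 0 < v}" unfolding S using ty by auto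
    show "levi_gl_parts ty n J = block_sizes ty n J" unfolding levi_parts_run[OF r] block_sizes_def im
    proof (rule image_mset_cong)
      fix v assume "v \<in># mset_set {v \<in> ?f ` {1..n}. ty = GLt \<or> 0 < v}"
      then have "0 < v" using ty by simp
      then show "card {k \<in> {1..n - ?m}. ?f k = v} = card {k \<in> {1..n}. ?f k = v}" unfolding S by (intro arg_cong[of _ _ card]) auto
    qed
    have "{k \<in> {1..n}. ?f k = 0} = {n - ?m<..n}" using z by auto
    then show "card {k \<in> {1..n}. ?f k = 0} = ?m" using m by simp
  qed
  show "levi_gl_parts ty n J = add_mset 1 (block_sizes ty n J) \<and> card {k \<in> {1..n}. ?f k = 0} = 1 \<and> ?m = 0" if s: "split_end ty n J"
  proof -
    have ty: "ty = SOeven" "n \<notin> J" "n - 1 \<notin> J" and n2: "2 \<le> n" using s r by (auto simp: split_end_def)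
    have nJ: "normJ ty n J = J" using ty by (simp add: normJ_def)
    have m: "?m = 0" using ty nJ by (simp add: levi_m_def Let_def)
    have fn: "?f n = 0" using coch_abs_end(2)[OF r _ s] ty by simp
    have pos: "0 < ?f k" if "1 \<le> k" "k \<le> n - 1" for k
      using that(2,1)
    proof (induction k rule: inc_induct)
      case base
      have "?f (n - 1) \<noteq> ?f (Suc (n - 1))" using coch_abs_step[OF r, of "n - 1" J] n2 ty nJ by auto
      then show ?case using fn n2 by simp
    next
      case (step k)
      then have "k < n" "1 \<le> k" "0 < ?f (Suc k)" by auto
      then show ?case using coch_abs_step[OF r, of k J] by (simp add: less_le_trans)
    qed
    have Z: "{k \<in> {1..n}. ?f k = 0} = {n}"
    proof (intro equalityI subsetI)
      fix k assume k: "k \<in> {k \<in> {1..n}. ?f k = 0}"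
      show "k \<in> {n}"
      proof (rule ccontr)
        assume "k \<notin> {n}"
        then have "1 \<le> k" "k \<le> n - 1" using k by auto
        then show False using pos[of k] k by simp
      qed
    qed (use fn n in auto)
    have "?f ` {1..n} = insert 0 {v \<in> ?f ` {1..n}. ty = GLt \<or> 0 < v}"
    proof (intro equalityI subsetI)
      fix v assume "v \<in> insert 0 {v \<in> ?f ` {1..n}. ty = GLt \<or> 0 < v}"
      moreover have "0 \<in> ?f ` {1..n}" using fn n by (intro image_eqI[of _ _ n]) auto
      ultimately show "v \<in> ?f ` {1..n}" by auto
    qed auto
    then have "mset_set (?f ` {1..n}) = mset_set (insert 0 {v \<in> ?f ` {1..n}. ty = GLt \<or> 0 < v})" by (rule arg_cong)
    also have "\<dots> = add_mset 0 (mset_set {v \<in> ?f ` {1..n}. ty = GLt \<or> 0 < v})"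
      by (rule mset_set.insert) (use ty in auto)
    finally have ms: "mset_set (?f ` {1..n}) = add_mset 0 (mset_set {v \<in> ?f ` {1..n}. ty = GLt \<or> 0 < v})" .
    have c1: "card {k \<in> {1..n}. ?f k = 0} = 1" unfolding Z by simp
    have "levi_gl_parts ty n J = image_mset (\<lambda>v. card {k \<in> {1..n}. ?f k = v}) (mset_set (?f ` {1..n}))"
      using levi_parts_run[OF r, of J] unfolding m diff_zero .
    also have "\<dots> = add_mset 1 (block_sizes ty n J)" unfolding ms block_sizes_def image_mset_add_mset c1 ..
    finally show ?thesis using c1 m by simp
  qed
qed

section \<open>Counting the parts of \<open>\<psi>(\<Lambda>)\<close>\<close>

text \<open>All cases of \<open>psi_j\<close> follow one rule:
  \<open>min (collapse ty p d j) c\<close> parts move from \<open>j\<close> up to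
  \<open>j + 1\<close>, and as many down to \<open>j - 1\<close>. The minimum covers the separate
  case of multiplicity 1 in characteristic 2.\<close>

lemma psi_j_geq:
  assumes ty: "ty \<noteq> GLt" and j: "1 \<le> j" and c: "1 \<le> c" and i: "1 \<le> i"
    and d: "d = 2 * m + (if ty = SOodd then 1 else 0)"
  shows "geq (psi_j ty p m j c) i + (if i = j then min (collapse ty p d j) c else 0)
    = (if i \<le> j then 2 * c else 0) + (if i = Suc j then min (collapse ty p d j) c else 0)"
proof -
  have hook: "geq (hook j c) i + (if i = j then 1 else 0) = (if i \<le> j then 2 * c else 0) + (if i = Suc j then 1 else 0)"
    using j c i by (auto simp: hook_def)
  have rep: "geq (replicate_mset (2 * c) j) i = (if i \<le> j then 2 * c else 0)" by simp
  have two: "geq (replicate_mset 2 (j+1) + replicate_mset (2*c - 4) j + replicate_mset 2 (j-1)) i + (if i = j then 2 else 0)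
    = (if i \<le> j then 2 * c else 0) + (if i = Suc j then 2 else 0)" if "2 \<le> c"
    using j that i by auto
  have hook1: "{#j+1, j-1#} = hook j c" if "c = 1" using that by (simp add: hook_def)
  have min1: "min 1 c = 1" using c by simp
  have plain: "geq (psi_j ty p m j c) i + (if i = j then min (collapse ty p d j) c else 0)
    = (if i \<le> j then 2 * c else 0) + (if i = Suc j then min (collapse ty p d j) c else 0)"
    if "psi_j ty p m j c = replicate_mset (2 * c) j" "collapse ty p d j = 0"
    unfolding that using rep by simp
  have one: "geq (psi_j ty p m j c) i + (if i = j then min (collapse ty p d j) c else 0)
    = (if i \<le> j then 2 * c else 0) + (if i = Suc j then min (collapse ty p d j) c else 0)"
    if "psi_j ty p m j c = hook j c" "min (collapse ty p d j) c = 1"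
    unfolding that by (rule hook)
  show ?thesis
  proof (cases ty)
    case GLt
    then show ?thesis using ty by simp
  next
    case SOodd
    show ?thesis
    proof (cases "odd j \<or> j \<le> 2 * m + 1")
      case True
      then show ?thesis using SOodd d by (intro plain) (auto simp: psi_j_def collapse_def)
    next
      case False
      then show ?thesis using SOodd d min1 by (intro one) (auto simp: psi_j_def collapse_def)
    qed
  next
    case Spt
    show ?thesis
    proof (cases "even j \<or> 2 * m \<le> j")
      case True
      then show ?thesis using Spt d by (intro plain) (auto simp: psi_j_def collapse_def)
    next
      case False
      then show ?thesis using Spt d min1 by (intro one) (auto simp: psi_j_def collapse_def)
    qed
  next
    case SOeven
    have jd: "odd j \<Longrightarrow> j < d \<longleftrightarrow> j \<le> 2 * m" using d SOeven by (auto simp: le_less)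
    show ?thesis
    proof (cases "even j")
      case True
      then show ?thesis using SOeven d by (intro plain) (auto simp: psi_j_def collapse_def)
    next
      case odd: False
      show ?thesis
      proof (cases "p = 2")
        case False
        show ?thesis
        proof (cases "j \<le> 2 * m")
          case True
          then show ?thesis using SOeven d False by (intro plain) (auto simp: psi_j_def collapse_def)
        next
          case nle: False
          then show ?thesis using SOeven d False odd min1 by (intro one) (auto simp: psi_j_def collapse_def)
        qed
      next
        case p2: True
        show ?thesis
        proof (cases "j \<le> 2 * m")
          case True
          have "psi_j ty p m j c = hook j c" using SOeven p2 odd True by (simp add: psi_j_def)
          moreover have "collapse ty p d j = 1" using SOeven p2 odd True jd by (simp add: collapse_def)
          ultimately show ?thesis using min1 by (intro one) simp_all
        next
          case nle: False
          have cl: "collapse ty p d j = 2" using SOeven p2 odd nle jd by (simp add: collapse_def)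
          show ?thesis
          proof (cases "c = 1")
            case True
            have "psi_j ty p m j c = {#j+1, j-1#}" using SOeven p2 odd nle True by (simp add: psi_j_def)
            then show ?thesis using hook1[OF True] cl True by (intro one) simp_all
          next
            case False
            then have c2: "2 \<le> c" using c by simp
            have "psi_j ty p m j c = replicate_mset 2 (j+1) + replicate_mset (2*c - 4) j + replicate_mset 2 (j-1)"
              using SOeven p2 odd nle False by (simp add: psi_j_def)
            moreover have "min (collapse ty p d j) c = 2" using cl c2 by simp
            ultimately show ?thesis using two[OF c2] by (simp only:)
          qed
        qed
      qed
    qed
  qed
qed

lemma geq_sum_count: "geq D i = (\<Sum>j\<in>set_mset D. if i \<le> j then count D j else 0)"
proof -
  have "geq D i = (\<Sum>j\<in>set_mset (filter_mset (\<lambda>x. i \<le> x) D). count (filter_mset (\<lambda>x. i \<le> x) D) j)"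
    unfolding geq_def by (rule size_multiset_overloaded_eq)
  also have "\<dots> = (\<Sum>j\<in>{j \<in> set_mset D. i \<le> j}. count D j)" by (rule sum.cong) auto
  also have "\<dots> = (\<Sum>j\<in>set_mset D. if i \<le> j then count D j else 0)" by (rule sum.inter_filter) simp
  finally show ?thesis .
qed

lemma psi_geq:
  assumes ty: "ty \<noteq> GLt" and D: "0 \<notin># D" and i: "1 \<le> i" and d: "d = 2 * m + (if ty = SOodd then 1 else 0)"
  shows "geq (psi ty p m D) i + min (collapse ty p d i) (count D i)
    = 2 * geq D i + (if i \<le> d then 1 else 0) + min (collapse ty p d (i - 1)) (count D (i - 1))"
proof -
  let ?a = "\<lambda>j. min (collapse ty p d j) (count D j)"
  have pm: "geq (psi_m ty m) i = (if i \<le> d then 1 else 0)" using ty d by (cases ty) (auto simp: psi_m_def)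
  have out: "?a j = 0" if "j \<notin># D" for j using that by (simp add: not_in_iff)
  have "(\<Sum>j\<in>set_mset D. geq (psi_j ty p m j (count D j)) i) + (\<Sum>j\<in>set_mset D. if i = j then ?a j else 0)
    = (\<Sum>j\<in>set_mset D. if i \<le> j then 2 * count D j else 0) + (\<Sum>j\<in>set_mset D. if i = Suc j then ?a j else 0)"
    unfolding sum.distrib[symmetric]
  proof (rule sum.cong[OF refl])
    fix j assume j: "j \<in># D"
    have "1 \<le> j" using j D by (cases j) auto
    moreover have "1 \<le> count D j" using j by (simp add: Suc_le_eq)
    ultimately show "geq (psi_j ty p m j (count D j)) i + (if i = j then ?a j else 0) =
      (if i \<le> j then 2 * count D j else 0) + (if i = Suc j then ?a j else 0)"
      by (rule psi_j_geq[OF ty _ _ i d])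
  qed
  moreover have "(\<Sum>j\<in>set_mset D. if i = j then ?a j else 0) = ?a i"
    using out[of i] by (simp add: sum.delta')
  moreover have "(\<Sum>j\<in>set_mset D. if i = Suc j then ?a j else 0) = ?a (i - 1)"
  proof -
    have "(\<Sum>j\<in>set_mset D. if i = Suc j then ?a j else 0) = (\<Sum>j\<in>set_mset D. if i - 1 = j then ?a j else 0)"
      by (rule sum.cong) (use i in auto)
    then show ?thesis using out[of "i - 1"] by (simp add: sum.delta')
  qed
  moreover have "(\<Sum>j\<in>set_mset D. if i \<le> j then 2 * count D j else 0) = 2 * geq D i"
    unfolding geq_sum_count sum_distrib_left by (rule sum.cong) auto
  ultimately show ?thesis unfolding psi_def geq_filter_pos[OF i] geq_simps geq_sum pm by linarith
qed

lemma psi_geq_gl: "1 \<le> i \<Longrightarrow> geq (psi GLt p m D) i = geq D i"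
  unfolding psi_def by (simp only: geq_filter_pos geq_simps geq_sum geq_sum_count[of D]) (simp add: psi_m_def psi_j_def)

text \<open>\<open>GL_1\<close> and \<open>SO_2\<close> agree: with \<open>m = 0\<close> the
  additional part 1 is collapsed to 2 and 0, and this 2 is the contribution of the classical factor
  for \<open>m = 1\<close>.\<close>

lemma psi_split_end: "psi SOeven p 0 (add_mset 1 D) = psi SOeven p 1 D"
proof -
  let ?F = "filter_mset (\<lambda>x. 0 < x) :: nat multiset \<Rightarrow> nat multiset"
  let ?X = "set_mset D - {1}"
  have set: "set_mset (add_mset 1 D) = insert 1 ?X" by auto
  have rest: "(\<Sum>j\<in>?X. psi_j SOeven p 0 j (count (add_mset 1 D) j)) = (\<Sum>j\<in>?X. psi_j SOeven p 1 j (count D j))"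
  proof (rule sum.cong[OF refl])
    fix j assume j: "j \<in> ?X"
    have "j \<le> 2 * 0 \<longleftrightarrow> j \<le> 2 * 1" if "odd j"
    proof -
      have "j \<noteq> 0" "j \<noteq> 2" by (rule notI; use that in simp)+
      moreover have "j \<noteq> 1" using j by simp
      ultimately show ?thesis by linarith
    qed
    moreover have "count (add_mset 1 D) j = count D j" using j by simp
    ultimately show "psi_j SOeven p 0 j (count (add_mset 1 D) j) = psi_j SOeven p 1 j (count D j)"
      unfolding psi_j_def by (cases "even j") simp_all
  qed
  have D: "(\<Sum>j\<in>set_mset D. psi_j SOeven p 1 j (count D j)) =
    (if 1 \<in># D then psi_j SOeven p 1 1 (count D 1) else {#}) + (\<Sum>j\<in>?X. psi_j SOeven p 1 j (count D j))"
  proof (cases "1 \<in># D")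
    case True
    then show ?thesis using sum.remove[of "set_mset D" 1 "\<lambda>j. psi_j SOeven p 1 j (count D j)"] by simp
  qed simp
  have one: "?F (psi_m SOeven 0 + psi_j SOeven p 0 1 (Suc (count D 1))) =
    ?F (psi_m SOeven 1 + (if 1 \<in># D then psi_j SOeven p 1 1 (count D 1) else {#}))"
  proof (cases "count D 1")
    case 0
    then have "1 \<notin># D" by (simp add: not_in_iff)
    then show ?thesis using 0 by (simp add: psi_m_def psi_j_def hook_def)
  next
    case (Suc c)
    then have "1 \<in># D" by (simp add: count_greater_zero_iff[symmetric] del: count_greater_zero_iff)
    then show ?thesis using Suc by (simp add: psi_m_def psi_j_def hook_def numeral_2_eq_2)
  qed
  let ?G = "\<lambda>j. psi_j SOeven p 0 j (count (add_mset 1 D) j)"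
  have "sum ?G (insert 1 ?X) = ?G 1 + sum ?G ?X" by (rule sum.insert) auto
  then have "sum ?G (set_mset (add_mset 1 D)) = psi_j SOeven p 0 1 (Suc (count D 1)) + (\<Sum>j\<in>?X. psi_j SOeven p 1 j (count D j))"
    unfolding set rest by simp
  then have "psi SOeven p 0 (add_mset 1 D) = ?F (psi_m SOeven 0 + psi_j SOeven p 0 1 (Suc (count D 1))) + ?F (\<Sum>j\<in>?X. psi_j SOeven p 1 j (count D j))"
    unfolding psi_def by (simp only: filter_union_mset add.assoc)
  also have "\<dots> = psi SOeven p 1 D" unfolding one psi_def D by (simp only: filter_union_mset add.assoc)
  finally show ?thesis .
qed

text \<open>The multiplicity of \<open>j\<close> is half the drop of the block counts from
  \<open>j\<close> to \<open>j + 1\<close>, rounded down for the middle block. So \<open>psi\<close>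
  is expressed by the weights alone, also in the split case.\<close>

lemma psi_levi:
  fixes ty :: cgroup and n p :: nat and J :: "nat set"
  assumes r: "valid_rank ty n"
  defines "N \<equiv> dimN ty n" and "w \<equiv> wt ty n J" and "M \<equiv> psi ty p (levi_m ty n J) (levi_gl_parts ty n J)"
  assumes i: "1 \<le> i"
  shows "geq M i + min (collapse ty p (dW N w 0) i) ((cW N w i - cW N w (Suc i)) div 2)
    = cW N w i + min (collapse ty p (dW N w 0) (i - 1)) ((cW N w (i - 1) - cW N w (Suc (i - 1))) div 2)"
proof (cases "ty = GLt")
  case True
  then have "collapse ty p d j = 0" for d j by (simp add: collapse_def)
  moreover have "geq M i = cW N w i"
    unfolding M_def N_def w_def cW_block_sizes(2)[OF i True] levi_blocks(1)[OF r True] using psi_geq_gl[OF i] True by simp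
  ultimately show ?thesis by simp
next
  case ty: False
  let ?D = "block_sizes ty n J" and ?d = "dW N w 0"
  define m where "m = card {k \<in> {1..n}. coch_abs ty n J k = 0}"
  have d: "?d = 2 * m + (if ty = SOodd then 1 else 0)" unfolding N_def w_def m_def by (rule dW_zero_weight[OF ty])
  have M: "M = psi ty p m ?D"
  proof (cases "split_end ty n J")
    case True
    then have "ty = SOeven" by (simp add: split_end_def)
    then show ?thesis unfolding M_def using levi_blocks(3)[OF r True] psi_split_end by (simp add: m_def)
  next
    case False
    then show ?thesis unfolding M_def using levi_blocks(2)[OF r ty False] by (simp add: m_def)
  qed
  have c: "cW N w j = 2 * geq ?D j + (if j \<le> ?d then 1 else 0)" if "1 \<le> j" for j
    unfolding N_def w_def by (rule cW_block_sizes(1)[OF that ty])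
  have A: "min (collapse ty p ?d j) ((cW N w j - cW N w (Suc j)) div 2) = min (collapse ty p ?d j) (count ?D j)" for j
  proof (cases "j = 0")
    case True
    have "collapse ty p ?d 0 = 0" by (cases ty) (auto simp: collapse_def)
    then show ?thesis using True by simp
  next
    case False
    then have "(cW N w j - cW N w (Suc j)) div 2 = count ?D j"
      using c[of j] c[of "Suc j"] geq_count[of ?D j] by (auto split: if_splits)
    then show ?thesis by simp
  qed
  show ?thesis unfolding A M unfolding c[OF i] by (rule psi_geq[OF ty block_sizes_pos i d])
qed

section \<open>The Richardson class\<close>

lemma cW_large: "N < i \<Longrightarrow> cW N w i = 0"
proof -
  assume "N < i"
  then have "{t \<in> w ` {..<N}. i \<le> dW N w t} = {}" using dW_le[of N w] by (auto simp: not_le intro: le_less_trans)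
  then show ?thesis by (simp add: cW_def)
qed

text \<open>The counts decrease and add up to \<open>N\<close>, so the \<open>N\<close>-th of them
  is at most 1; hence nothing is moved beyond size \<open>N\<close>.\<close>

lemma cW_dim_le_1:
  assumes "1 \<le> N"
  shows "cW N w N \<le> 1"
proof -
  have "card {0<..N} * cW N w N \<le> (\<Sum>i\<in>{0<..N}. cW N w i)"
    using sum_bounded_below[of "{0<..N}" "cW N w N" "cW N w"] cW_anti[of _ N N w] by simp
  then have "N * cW N w N \<le> N * 1" unfolding sum_cW by simp
  then show ?thesis using assms by simp
qed

lemma ex_critical_index:
  fixes c :: "nat \<Rightarrow> nat"
  assumes "k < c 1" "c N \<le> k" "1 \<le> N"
  shows "\<exists>j. 1 \<le> j \<and> j < N \<and> c (Suc j) \<le> k \<and> k \<le> c j"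
proof (rule ccontr)
  assume n: "\<not> ?thesis"
  have "k < c j" if "1 \<le> j" "j \<le> N" for j
    using that
  proof (induction j rule: dec_induct)
    case base
    then show ?case using assms by simp
  next
    case (step j)
    then have "k < c j" "j < N" by simp_all
    then show ?case using n step.hyps(1) by (meson less_imp_le not_le)
  qed
  then show False using assms(2,3) by (meson le_refl not_less)
qed

locale block_profile =
  fixes ty :: cgroup and n N p :: nat and w :: "nat \<Rightarrow> int" and M :: "nat multiset"
  assumes N: "N = dimN ty n" "1 \<le> N" and s: "ty \<noteq> GLt \<Longrightarrow> sym_wt N w"
    and M: "\<And>i. 1 \<le> i \<Longrightarrow> geq M i + min (collapse ty p (dW N w 0) i) ((cW N w i - cW N w (Suc i)) div 2)
      = cW N w i + min (collapse ty p (dW N w 0) (i - 1)) ((cW N w (i - 1) - cW N w (Suc (i - 1))) div 2)"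
begin

abbreviation c where "c \<equiv> cW N w"
definition A where "A j = min (collapse ty p (dW N w 0) j) ((c j - c (Suc j)) div 2)"

text \<open>For fixed type and middle block \<open>collapse\<close> is nonzero for one parity of
  \<open>j\<close> only, so neighbouring sizes never move simultaneously.\<close>

lemma A_props: "A 0 = 0" "A N = 0" "c (Suc j) + 2 * A j \<le> c j" "0 < A j \<Longrightarrow> A (j - 1) = 0 \<and> A (Suc j) = 0"
proof -
  have c0: "collapse ty p d 0 = 0" for d by (cases ty) (auto simp: collapse_def)
  then show "A 0 = 0" by (simp add: A_def)
  show "A N = 0" using cW_large[of N "Suc N" w] cW_dim_le_1[OF N(2), of w] by (simp add: A_def)
  have "c (Suc j) \<le> c j" by (rule cW_anti) simp
  moreover have "2 * A j \<le> c j - c (Suc j)" by (simp add: A_def)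
  ultimately show "c (Suc j) + 2 * A j \<le> c j" by linarith
  assume "0 < A j"
  then have nz: "collapse ty p (dW N w 0) j \<noteq> 0" by (auto simp: A_def)
  then have "j \<noteq> 0" using c0 by (metis)
  then have "collapse ty p (dW N w 0) (j - 1) = 0 \<and> collapse ty p (dW N w 0) (Suc j) = 0"
    using nz by (cases ty) (auto simp: collapse_def split: if_splits)
  then show "A (j - 1) = 0 \<and> A (Suc j) = 0" by (simp add: A_def)
qed

lemma geq_M: "1 \<le> i \<Longrightarrow> geq M i + A i = c i + A (i - 1)"
  unfolding A_def by (rule M)

lemma geq_M_large: "N < i \<Longrightarrow> geq M i = 0"
proof -
  assume i: "N < i"
  have "A (i - 1) = 0"
  proof (cases "i - 1 = N")
    case True
    then show ?thesis using A_props(2) by simp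
  next
    case False
    then have "N < i - 1" using i by simp
    then show ?thesis using cW_large[of N "i - 1" w] by (simp add: A_def)
  qed
  then show ?thesis using geq_M[of i] cW_large[OF i] i N by simp
qed

text \<open>The corank of \<open>x^k\<close> predicted by the dual of \<open>M\<close>.\<close>

definition total where "total k = (\<Sum>i\<in>{1..N}. min k (geq M i))"

lemma total_large: "c 1 \<le> k \<Longrightarrow> total k = topF c N 0 k"
  unfolding total_def
  by (rule sum_min_collapse_0[where A = A]) (use geq_M A_props cW_anti in auto)

lemma total_critical:
  assumes j: "1 \<le> j" "j < N" and k: "c (Suc j) \<le> k" "k \<le> c j"
  shows "total k = topF c N j k + min (collapse ty p (dW N w 0) j) (min (k - c (Suc j)) (c j - k))"
proof -
  have "total k = topF c N j k + min (A j) (min (k - c (Suc j)) (c j - k))"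
    unfolding total_def by (rule sum_min_collapse[where A = A]) (use geq_M A_props cW_anti j k in auto)
  \<comment> \<open>The nearer end of the interval is at most half its length away, so the bound by
    the multiplicity inside \<open>A\<close> is absorbed.\<close>
  moreover have "min (k - c (Suc j)) (c j - k) \<le> (c j - c (Suc j)) div 2" using k by linarith
  then have "min (A j) (min (k - c (Suc j)) (c j - k)) = min (collapse ty p (dW N w 0) j) (min (k - c (Suc j)) (c j - k))"
    unfolding A_def min.assoc by (simp only: min.absorb2)
  ultimately show ?thesis by simp
qed

lemma total_cases:
  obtains "k = 0" | "c 1 \<le> k" | j where "1 \<le> j" "j < N" "c (Suc j) \<le> k" "k \<le> c j" "1 \<le> k"
proof (cases "k = 0 \<or> c 1 \<le> k")
  case False
  then have "c N \<le> k" using cW_dim_le_1[OF N(2), of w] by linarith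
  moreover have k: "k < c 1" "1 \<le> k" using False by auto
  ultimately obtain j where "1 \<le> j" "j < N" "c (Suc j) \<le> k" "k \<le> c j" using ex_critical_index[of k c N] N(2) by blast
  then show ?thesis using that(3)[of j] k(2) by simp
qed (use that in blast)

lemma upper:
  fixes v :: "'a::field mat"
  assumes p: "p = CHAR('a)" and odd2: "\<not> (ty = SOodd \<and> p = 2)" and v: "v \<in> grp ty n" "wunip N w v"
  shows "rk N ((v - 1\<^sub>m N) ^\<^sub>m k) + total k \<le> N"
proof (cases rule: total_cases[of k])
  case 1
  have "v - 1\<^sub>m N \<in> carrier_mat N N" using v(2) by (auto simp: wunip_def)
  then have "rk N ((v - 1\<^sub>m N) ^\<^sub>m k) \<le> N" by (rule rk_le_nr[OF pow_carrier_mat])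
  then show ?thesis using 1 by (simp add: total_def)
next
  case 2
  have "raises N w (v - 1\<^sub>m N)" using v(2) wunip_iff[of v N w] by (simp add: wunip_def)
  from rk_raises_topF_0[OF this 2] show ?thesis using total_large[OF 2] by simp
next
  case (3 j)
  show ?thesis unfolding total_critical[OF 3(1-4)]
    using rk_upper_bound[OF v(1) N(1) v(2) s _ 3(1) _ 3(3,4)] 3(2) odd2 p by (simp add: add.assoc)
qed

lemma lower:
  assumes p: "p = CHAR('a)" and odd2: "\<not> (ty = SOodd \<and> p = 2)"
  obtains v :: "'a::field mat" where "v \<in> grp ty n" "wunip N w v" "N \<le> rk N ((v - 1\<^sub>m N) ^\<^sub>m k) + total k"
proof -
  \<comment> \<open>The identity is a sufficient witness for \<open>k = 0\<close> and when the
    predicted rank is 0.\<close>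
  have one: "1\<^sub>m N \<in> (grp ty n :: 'a mat set)" "wunip N w (1\<^sub>m N :: 'a mat)"
    using one_in_grp[of ty n] N(1) by (auto simp: wunip_def)
  show thesis
  proof (cases rule: total_cases[of k])
    case 1
    have "(1\<^sub>m N - 1\<^sub>m N) ^\<^sub>m k = (1\<^sub>m N :: 'a mat)" using 1 by simp
    then show ?thesis using that[OF one] by (simp add: rk_one)
  next
    case 2
    have "topF c N 0 k = N" using sum_cW[of N w] by (simp add: topF_def)
    then show ?thesis using that[OF one] total_large[OF 2] by simp
  next
    case (3 j)
    have "\<exists>v::'a mat. v \<in> grp ty n \<and> wunip N w v \<and> N \<le> rk N ((v - 1\<^sub>m N) ^\<^sub>m k) + topF (cW N w) N j k
      + min (collapse ty CHAR('a) (dW N w 0) j) (min (k - cW N w (Suc j)) (cW N w j - k))"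
    proof (rule rk_lower_bound[OF N(1) _ _ 3])
      show "sym_wt N w" if "ty \<noteq> GLt" using s that .
      show "\<not> (ty = SOodd \<and> CHAR('a) = 2)" using odd2 unfolding p .
    qed
    then obtain v :: "'a mat" where v: "v \<in> grp ty n" "wunip N w v" "N \<le> rk N ((v - 1\<^sub>m N) ^\<^sub>m k) + topF (cW N w) N j k
      + min (collapse ty CHAR('a) (dW N w 0) j) (min (k - cW N w (Suc j)) (cW N w j - k))" by blast
    show ?thesis by (rule that[OF v(1,2)]) (use v(3) in \<open>simp only: total_critical[OF 3(1-4)] p add.assoc\<close>)
  qed
qed

end

lemma dual_part_pos: "0 \<notin># dual_part X"
  unfolding dual_part_def by (simp only: set_mset_filter mem_Collect_eq less_irrefl simp_thms not_False_eq_True)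

lemma std_unip_radical_wunip: "std_unip_radical ty n J = {v \<in> grp ty n. wunip (dimN ty n) (wt ty n J) v}"
  unfolding std_unip_radical_def wunip_def using grp_carrier[of _ ty n] by auto

lemma gclass_similar:
  fixes u :: "'a::field mat"
  assumes u: "u \<in> grp ty n" and x: "x \<in> gclass ty n u"
  shows "similar_mat x u" "x \<in> carrier_mat (dimN ty n) (dimN ty n)"
proof -
  obtain h where h: "h \<in> grp ty n" "h * u = x * h" and xc: "x \<in> carrier_mat (dimN ty n) (dimN ty n)"
    using x by (auto simp: gclass_def)
  obtain hi where "hi \<in> carrier_mat (dimN ty n) (dimN ty n)" "h * hi = 1\<^sub>m (dimN ty n)" "hi * h = 1\<^sub>m (dimN ty n)"
    by (rule grp_inverse[OF h(1)])
  then show "similar_mat x u" by (rule intertwine_similar[OF grp_carrier[OF h(1)] _ _ _ grp_carrier[OF u] xc h(2)])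
  show "x \<in> carrier_mat (dimN ty n) (dimN ty n)" by (rule xc)
qed

lemma conj_set_similar:
  fixes g :: "'a::field mat"
  assumes g: "g \<in> grp ty n" and Q: "Q \<subseteq> carrier_mat (dimN ty n) (dimN ty n)"
  shows "x \<in> conj_set g Q \<Longrightarrow> \<exists>v\<in>Q. similar_mat x v" "v \<in> Q \<Longrightarrow> \<exists>x\<in>conj_set g Q. similar_mat x v"
    "conj_set g Q \<subseteq> carrier_mat (dimN ty n) (dimN ty n)"
proof -
  let ?N = "dimN ty n"
  have gc: "g \<in> carrier_mat ?N ?N" by (rule grp_carrier[OF g])
  obtain gi where gi: "gi \<in> carrier_mat ?N ?N" "g * gi = 1\<^sub>m ?N" "gi * g = 1\<^sub>m ?N" by (rule grp_inverse[OF g])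
  show sub: "conj_set g Q \<subseteq> carrier_mat ?N ?N" using gc by (auto simp: conj_set_def)
  have sim: "similar_mat x v" if "x \<in> carrier_mat ?N ?N" "v \<in> Q" "x * g = g * v" for x v
    by (rule intertwine_similar[OF gc gi _ that(1) that(3)[symmetric]]) (use that(2) Q in blast)
  show "\<exists>v\<in>Q. similar_mat x v" if x: "x \<in> conj_set g Q"
  proof -
    obtain v where "v \<in> Q" "x * g = g * v" using x by (auto simp: conj_set_def)
    then show ?thesis using sim x sub by blast
  qed
  show "\<exists>x\<in>conj_set g Q. similar_mat x v" if v: "v \<in> Q"
  proof
    have vc: "v \<in> carrier_mat ?N ?N" using v Q by blast
    note [simp] = carrier_matD[OF gc] carrier_matD[OF gi(1)] carrier_matD[OF vc]
    have c: "g * v * gi \<in> carrier_mat ?N ?N" by (rule carrier_matI; simp)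
    have "g * v * gi * g = g * (v * (gi * g))" by (simp add: mat_assoc)
    then have e: "g * v * gi * g = g * v" unfolding gi(3) by (simp add: mat_mult_one)
    then show "similar_mat (g * v * gi) v" by (rule sim[OF c v])
    show "g * v * gi \<in> conj_set g Q" using c e v gc by (auto simp: conj_set_def)
  qed
qed

theorem mainTheorem1:
  fixes ty :: cgroup and n :: nat and J :: "nat set"
    and g :: "'a::field mat" and C :: "'a mat set" and u :: "'a mat"
  assumes alg_closed: "\<forall>q :: 'a poly. 0 < degree q \<longrightarrow> (\<exists>x. poly q x = 0)"
    and rank: "valid_rank ty n"
    and not_B_char2: "\<not> (ty = SOodd \<and> CHAR('a) = 2)"
    and J: "J \<subseteq> simple_roots ty n"
    and g: "g \<in> grp ty n"
    and rich: "richardson_class ty n (conj_set g (std_unip_radical ty n J)) C"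
    and u: "u \<in> C"
  shows "jordan_type u (dual_part (psi ty CHAR('a) (levi_m ty n J) (levi_gl_parts ty n J)))"
proof -
  let ?N = "dimN ty n" and ?w = "wt ty n J" and ?Q = "std_unip_radical ty n J :: 'a mat set"
  let ?M = "psi ty CHAR('a) (levi_m ty n J) (levi_gl_parts ty n J)"
  interpret P: block_profile ty n ?N "CHAR('a)" ?w ?M
  proof
    show "1 \<le> ?N" using rank by (cases ty) auto
    show "geq ?M i + min (collapse ty CHAR('a) (dW ?N ?w 0) i) ((cW ?N ?w i - cW ?N ?w (Suc i)) div 2)
      = cW ?N ?w i + min (collapse ty CHAR('a) (dW ?N ?w 0) (i - 1)) ((cW ?N ?w (i - 1) - cW ?N ?w (Suc (i - 1))) div 2)"
      if "1 \<le> i" for i by (rule psi_levi[OF rank that])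
  qed (use sym_wt in auto)
  have Q: "?Q = {v \<in> grp ty n. wunip ?N ?w v}" by (rule std_unip_radical_wunip)
  have Qc: "?Q \<subseteq> carrier_mat ?N ?N" unfolding Q using grp_carrier by blast
  note conj = conj_set_similar[OF g Qc]
  obtain u0 where u0: "u0 \<in> grp ty n" "C = gclass ty n u0" using rich unfolding richardson_class_def by blast
  have dense: "zdense_in ?N (conj_set g ?Q) (C \<inter> conj_set g ?Q)" using rich unfolding richardson_class_def by blast
  have C: "similar_mat x u0" "x \<in> carrier_mat ?N ?N" if "x \<in> C" for x
    using gclass_similar[OF u0(1)] that u0(2) by auto
  \<comment> \<open>The radical is nonempty, so by density the class meets its conjugate; the
    element \<open>x1\<close> found there transports unipotency and the upper bounds to
    \<open>u\<close>.\<close>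
  obtain v0 :: "'a mat" where "v0 \<in> grp ty n" "wunip ?N ?w v0" by (rule P.lower[OF refl not_B_char2])
  then have "conj_set g ?Q \<noteq> {}" using conj(2)[of v0] Q by blast
  then obtain x1 where x1: "x1 \<in> C" "x1 \<in> conj_set g ?Q" using zdense_nonempty[OF dense] by blast
  then obtain v1 where v1: "v1 \<in> ?Q" "similar_mat x1 v1" using conj(1) by blast
  have uv: "similar_mat u v1"
    using similar_mat_trans[OF C(1)[OF u] similar_mat_trans[OF similar_mat_sym[OF C(1)[OF x1(1)]] v1(2)]] .
  note uc = C(2)[OF u]
  have v1': "v1 \<in> grp ty n" "wunip ?N ?w v1" using v1(1) Q by auto
  obtain n_as where "jordan_nf v1 n_as" by (rule wunip_jordan_nf[OF v1'(2)])
  then have jnf: "jordan_nf u n_as" using similar_mat_trans[OF uv] unfolding jordan_nf_def by blast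
  have rk: "rk ?N ((x - 1\<^sub>m ?N) ^\<^sub>m k) = rk ?N ((u - 1\<^sub>m ?N) ^\<^sub>m k)" if "x \<in> C" for x k
    using similar_rk_pow(1)[OF C[OF that]] similar_rk_pow(1)[OF C[OF u]] by simp
  \<comment> \<open>The upper bound comes from an element of the radical similar to
    \<open>u\<close>, the lower bound by density from a witness chosen for this
    \<open>k\<close>.\<close>
  have ranks: "rk ?N ((u - 1\<^sub>m ?N) ^\<^sub>m k) + P.total k = ?N" for k
  proof (rule antisym)
    show "rk ?N ((u - 1\<^sub>m ?N) ^\<^sub>m k) + P.total k \<le> ?N"
      unfolding similar_rk_pow(1)[OF uv uc] by (rule P.upper[OF refl not_B_char2 v1'])
    obtain v :: "'a mat" where v: "v \<in> grp ty n" "wunip ?N ?w v" "?N \<le> rk ?N ((v - 1\<^sub>m ?N) ^\<^sub>m k) + P.total k"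
      by (rule P.lower[OF refl not_B_char2])
    then obtain x where x: "x \<in> conj_set g ?Q" "similar_mat x v" using conj(2)[of v] Q by blast
    have "rk ?N ((x - 1\<^sub>m ?N) ^\<^sub>m k) \<le> rk ?N ((u - 1\<^sub>m ?N) ^\<^sub>m k)"
      by (rule zdense_rank_bound[OF dense conj(3) x(1)]) (use rk in blast)
    moreover have "rk ?N ((x - 1\<^sub>m ?N) ^\<^sub>m k) = rk ?N ((v - 1\<^sub>m ?N) ^\<^sub>m k)"
      by (rule similar_rk_pow(1)[OF x(2)]) (use conj(3) x(1) in blast)
    ultimately show "?N \<le> rk ?N ((u - 1\<^sub>m ?N) ^\<^sub>m k) + P.total k" using v(3) by linarith
  qed
  have "raises ?N ?w (v1 - 1\<^sub>m ?N)" using v1'(2) wunip_iff[of v1 ?N ?w] by (simp add: wunip_def)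
  then obtain K where "(v1 - 1\<^sub>m ?N) ^\<^sub>m K = 0\<^sub>m ?N ?N" by (rule raises_nilpotent)
  then have "rk ?N ((u - 1\<^sub>m ?N) ^\<^sub>m K) = 0" unfolding similar_rk_pow(1)[OF uv uc] by (simp add: rk_zero)
  moreover have "(u - 1\<^sub>m ?N) ^\<^sub>m K \<in> carrier_mat ?N ?N" by (rule pow_carrier_mat) (use uc in auto)
  ultimately have nil: "(u - 1\<^sub>m ?N) ^\<^sub>m K = 0\<^sub>m ?N ?N" by (intro rk_eq_0)
  show ?thesis
  proof (rule jordan_type_of_ranks[OF jnf uc nil])
    show "rk ?N ((u - 1\<^sub>m ?N) ^\<^sub>m k) + (\<Sum>x\<in>#dual_part ?M. min k x) = ?N" for k
    proof -
      have "(\<Sum>x\<in>#dual_part ?M. min k x) = P.total k"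
        unfolding P.total_def by (rule dual_part_min_sum'[OF P.geq_M_large])
      then show ?thesis using ranks[of k] by simp
    qed
    show "0 \<notin># dual_part ?M" by (rule dual_part_pos)
  qed
qed

end
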